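(* Let $k$ be a field and $p,q\in k^*$. The algebra $\mathcal{O}_{p,q}(\mathrm{SL}_2(k))$ is twisted Calabi-Yau of dimension $3$, with Nakayama automorphism $\mu$ defined by $$\mu(a)=(pq)^{-1}a,\quad \mu(b)=b,\quad \mu(c)=c,\quad \mu(d)=(pq)d.$$
   Context: For $p,q\in k^*$, $\mathcal{O}_{p,q}(\mathrm{SL}_2(k))$ is the $k$-algebra presented by generators $a,b,c,d$ and relations $ba=qab$, $ca=pac$, $db=qbd$, $dc=pcd$, $bc=cb$, $ad-p^{-1}bc=1=da-qbc$. An algebra $A$ is smooth if $A$ has, as an $A$-bimodule, a finite-length resolution by finitely generated projective $A$-bimodules. $A$ is twisted Calabi-Yau of dimension $n\ge 0$ with Nakayama automorphism $\mu\in\operatorname{Aut}(A)$ if $A$ is smooth and, as $A$-bimodules, the Hochschild cohomology satisfies $H^i(A,{}_AA\otimes A_A)=\{0\}$ for $i\neq n$ and $H^n(A,{}_AA\otimes A_A)\simeq A_\mu$. Here $H^*(A,{}_AA\otimes A_A)=\operatorname{Ext}^*_{A^e}(A,A^e)$, with $A^e=A\otimes A^{\rm op}$, is a right $A^e$-module, hence an $A$-bimodule (via $y\cdot m\cdot x=m\cdot(x\otimes y)$), by right multiplication in $A^e$, and $A_\mu$ is $A$ with bimodule structure $y\cdot m\cdot x=ym\mu(x)$. *)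

theory Defs
  imports "HOL-Algebra.QuotRing" "HOL-Algebra.Module"
begin

section \<open>Algebras over a field\<close>

text \<open>An associative unital algebra over a commutative ring is a \<^typ>\<open>('k, 'a) module\<close>
  record whose multiplicative fields are used. (\<^locale>\<open>algebra\<close> of the library is for
  commutative algebras only.)\<close>

locale assoc_algebra = module K A + ring A for K (structure) and A (structure) +
  assumes smult_mult_left:
      "\<lbrakk>c \<in> carrier K; x \<in> carrier A; y \<in> carrier A\<rbrakk>
        \<Longrightarrow> c \<odot>\<^bsub>A\<^esub> (x \<otimes>\<^bsub>A\<^esub> y) = (c \<odot>\<^bsub>A\<^esub> x) \<otimes>\<^bsub>A\<^esub> y"
    and smult_mult_right:
      "\<lbrakk>c \<in> carrier K; x \<in> carrier A; y \<in> carrier A\<rbrakk>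
        \<Longrightarrow> c \<odot>\<^bsub>A\<^esub> (x \<otimes>\<^bsub>A\<^esub> y) = x \<otimes>\<^bsub>A\<^esub> (c \<odot>\<^bsub>A\<^esub> y)"

text \<open>Automorphisms are extensional functions, so that equality is equality on \<open>A\<close>.\<close>

definition alg_auto :: "('k, 'x) ring_scheme \<Rightarrow> ('k, 'a) module \<Rightarrow> ('a \<Rightarrow> 'a) set" where
  "alg_auto K A =
    {f \<in> ring_iso A A \<inter> extensional (carrier A).
      \<forall>c\<in>carrier K. \<forall>x\<in>carrier A. f (c \<odot>\<^bsub>A\<^esub> x) = c \<odot>\<^bsub>A\<^esub> f x}"

definition op_alg :: "('k, 'a) module \<Rightarrow> ('k, 'a) module" where
  "op_alg A = A\<lparr>mult := \<lambda>x y. y \<otimes>\<^bsub>A\<^esub> x\<rparr>"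

text \<open>The quotient by a submodule; if \<open>M\<close> is an algebra and \<open>I\<close> an ideal, the quotient algebra,
  with underlying ring \<open>M Quot I\<close>.\<close>

definition quot_mod :: "('k, 'a) module \<Rightarrow> 'a set \<Rightarrow> ('k, 'a set) module" where
  "quot_mod M I =
    \<lparr>carrier = carrier (M Quot I), mult = mult (M Quot I), one = one (M Quot I),
     zero = zero (M Quot I), add = add (M Quot I),
     smult = (\<lambda>c X. (\<Union>x\<in>X. I +>\<^bsub>M\<^esub> (c \<odot>\<^bsub>M\<^esub> x)))\<rparr>"

definition delta :: "('k, 'x) ring_scheme \<Rightarrow> 'g \<Rightarrow> 'g \<Rightarrow> 'k" where
  "delta K g = (\<lambda>h. if h = g then \<one>\<^bsub>K\<^esub> else \<zero>\<^bsub>K\<^esub>)"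

text \<open>The monoid algebra $K[G]$: finitely supported functions with the convolution product.\<close>

definition monoid_algebra ::
  "('k, 'x) ring_scheme \<Rightarrow> ('g, 'y) monoid_scheme \<Rightarrow> ('k, 'g \<Rightarrow> 'k) module" where
  "monoid_algebra K G =
    \<lparr>carrier = {f. (\<forall>g. f g \<in> carrier K) \<and> (\<forall>g. g \<notin> carrier G \<longrightarrow> f g = \<zero>\<^bsub>K\<^esub>)
                   \<and> finite {g. f g \<noteq> \<zero>\<^bsub>K\<^esub>}},
     mult = (\<lambda>f f'. \<lambda>g. \<Oplus>\<^bsub>K\<^esub>z \<in> {(u, v). f u \<noteq> \<zero>\<^bsub>K\<^esub> \<and> f' v \<noteq> \<zero>\<^bsub>K\<^esub> \<and> u \<otimes>\<^bsub>G\<^esub> v = g}.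
                      f (fst z) \<otimes>\<^bsub>K\<^esub> f' (snd z)),
     one = delta K \<one>\<^bsub>G\<^esub>,
     zero = (\<lambda>g. \<zero>\<^bsub>K\<^esub>),
     add = (\<lambda>f f'. \<lambda>g. f g \<oplus>\<^bsub>K\<^esub> f' g),
     smult = (\<lambda>c f. \<lambda>g. c \<otimes>\<^bsub>K\<^esub> f g)\<rparr>"

definition word_monoid :: "'g list monoid" where
  "word_monoid = \<lparr>carrier = UNIV, mult = (@), one = []\<rparr>"

definition free_algebra :: "('k, 'x) ring_scheme \<Rightarrow> ('k, 'g list \<Rightarrow> 'k) module" where
  "free_algebra K = monoid_algebra K word_monoid"


section \<open>Tensor products of algebras and the enveloping algebra\<close>

text \<open>The $K$-module underlying \<^term>\<open>monoid_algebra K (A \<times>\<times> B)\<close> is free on the pairs of elements.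
  The span of the bilinearity relations is stable under multiplication by pairs on either side, so
  that it coincides with the ideal generated by them, and the quotient below is the usual
  $A \otimes_K B$ with its componentwise product.\<close>

definition bilinear_rels ::
  "('k, 'x) ring_scheme \<Rightarrow> ('k, 'a) module \<Rightarrow> ('k, 'b) module \<Rightarrow> ('a \<times> 'b \<Rightarrow> 'k) set" where
  "bilinear_rels K A B = (let F = monoid_algebra K (A \<times>\<times> B) in
      {delta K (x \<oplus>\<^bsub>A\<^esub> x', y) \<ominus>\<^bsub>F\<^esub> (delta K (x, y) \<oplus>\<^bsub>F\<^esub> delta K (x', y)) | x x' y.
         x \<in> carrier A \<and> x' \<in> carrier A \<and> y \<in> carrier B}
    \<union> {delta K (x, y \<oplus>\<^bsub>B\<^esub> y') \<ominus>\<^bsub>F\<^esub> (delta K (x, y) \<oplus>\<^bsub>F\<^esub> delta K (x, y')) | x y y'.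
         x \<in> carrier A \<and> y \<in> carrier B \<and> y' \<in> carrier B}
    \<union> {delta K (c \<odot>\<^bsub>A\<^esub> x, y) \<ominus>\<^bsub>F\<^esub> (c \<odot>\<^bsub>F\<^esub> delta K (x, y)) | c x y.
         c \<in> carrier K \<and> x \<in> carrier A \<and> y \<in> carrier B}
    \<union> {delta K (x, c \<odot>\<^bsub>B\<^esub> y) \<ominus>\<^bsub>F\<^esub> (c \<odot>\<^bsub>F\<^esub> delta K (x, y)) | c x y.
         c \<in> carrier K \<and> x \<in> carrier A \<and> y \<in> carrier B})"

definition tensor_ideal ::
  "('k, 'x) ring_scheme \<Rightarrow> ('k, 'a) module \<Rightarrow> ('k, 'b) module \<Rightarrow> ('a \<times> 'b \<Rightarrow> 'k) set" where
  "tensor_ideal K A B = Idl\<^bsub>monoid_algebra K (A \<times>\<times> B)\<^esub> (bilinear_rels K A B)"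

definition tensor_alg ::
  "('k, 'x) ring_scheme \<Rightarrow> ('k, 'a) module \<Rightarrow> ('k, 'b) module
    \<Rightarrow> ('k, ('a \<times> 'b \<Rightarrow> 'k) set) module" where
  "tensor_alg K A B = quot_mod (monoid_algebra K (A \<times>\<times> B)) (tensor_ideal K A B)"

definition pure_tensor ::
  "('k, 'x) ring_scheme \<Rightarrow> ('k, 'a) module \<Rightarrow> ('k, 'b) module
    \<Rightarrow> 'a \<Rightarrow> 'b \<Rightarrow> ('a \<times> 'b \<Rightarrow> 'k) set" where
  "pure_tensor K A B x y = tensor_ideal K A B +>\<^bsub>monoid_algebra K (A \<times>\<times> B)\<^esub> delta K (x, y)"

type_synonym ('k, 'a) env = "('a \<times> 'a \<Rightarrow> 'k) set"

definition env_alg ::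
  "('k, 'x) ring_scheme \<Rightarrow> ('k, 'a) module \<Rightarrow> ('k, ('k, 'a) env) module" where
  "env_alg K A = tensor_alg K A (op_alg A)"

definition env_tensor ::
  "('k, 'x) ring_scheme \<Rightarrow> ('k, 'a) module \<Rightarrow> 'a \<Rightarrow> 'a \<Rightarrow> ('k, 'a) env" where
  "env_tensor K A = pure_tensor K A (op_alg A)"

text \<open>\<open>A\<close> as a left $A^e$-module, $(x \otimes y) \cdot m = x m y$, extended linearly; all
  representatives of a tensor give the same value, which \<^const>\<open>the_elem\<close> extracts.\<close>

definition env_action ::
  "('k, 'x) ring_scheme \<Rightarrow> ('k, 'a) module \<Rightarrow> ('k, 'a) env \<Rightarrow> 'a \<Rightarrow> 'a" where
  "env_action K A t m =
    the_elem ((\<lambda>f. \<Oplus>\<^bsub>A\<^esub>z \<in> {z. f z \<noteq> \<zero>\<^bsub>K\<^esub>}.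
                f z \<odot>\<^bsub>A\<^esub> (fst z \<otimes>\<^bsub>A\<^esub> m \<otimes>\<^bsub>A\<^esub> snd z)) ` t)"

definition env_module ::
  "('k, 'x) ring_scheme \<Rightarrow> ('k, 'a) module \<Rightarrow> (('k, 'a) env, 'a) module" where
  "env_module K A =
    \<lparr>carrier = carrier A, mult = mult A, one = one A, zero = zero A, add = add A,
     smult = env_action K A\<rparr>"


section \<open>Modules over noncommutative rings\<close>

text \<open>One-sided modules are carried by the library's \<^typ>\<open>('r, 'm) module\<close> records, whose fields
  \<^const>\<open>mult\<close> and \<^const>\<open>one\<close> are then irrelevant. For a right module,
  \<open>r \<odot>\<^bsub>M\<^esub> m\<close> stands for $m \cdot r$.\<close>

locale left_module = R?: ring R + M?: abelian_group M for R (structure) and M (structure) +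
  assumes smult_closed:
      "\<lbrakk>r \<in> carrier R; m \<in> carrier M\<rbrakk> \<Longrightarrow> r \<odot>\<^bsub>M\<^esub> m \<in> carrier M"
    and smult_l_distr:
      "\<lbrakk>r \<in> carrier R; s \<in> carrier R; m \<in> carrier M\<rbrakk>
        \<Longrightarrow> (r \<oplus>\<^bsub>R\<^esub> s) \<odot>\<^bsub>M\<^esub> m = r \<odot>\<^bsub>M\<^esub> m \<oplus>\<^bsub>M\<^esub> s \<odot>\<^bsub>M\<^esub> m"
    and smult_r_distr:
      "\<lbrakk>r \<in> carrier R; m \<in> carrier M; m' \<in> carrier M\<rbrakk>
        \<Longrightarrow> r \<odot>\<^bsub>M\<^esub> (m \<oplus>\<^bsub>M\<^esub> m') = r \<odot>\<^bsub>M\<^esub> m \<oplus>\<^bsub>M\<^esub> r \<odot>\<^bsub>M\<^esub> m'"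
    and smult_assoc:
      "\<lbrakk>r \<in> carrier R; s \<in> carrier R; m \<in> carrier M\<rbrakk>
        \<Longrightarrow> (r \<otimes>\<^bsub>R\<^esub> s) \<odot>\<^bsub>M\<^esub> m = r \<odot>\<^bsub>M\<^esub> (s \<odot>\<^bsub>M\<^esub> m)"
    and smult_one:
      "m \<in> carrier M \<Longrightarrow> \<one>\<^bsub>R\<^esub> \<odot>\<^bsub>M\<^esub> m = m"

definition mod_hom ::
  "('r, 'x) ring_scheme \<Rightarrow> ('r, 'm) module \<Rightarrow> ('r, 'n) module \<Rightarrow> ('m \<Rightarrow> 'n) set" where
  "mod_hom R M N =
    {f \<in> hom (add_monoid M) (add_monoid N).
      \<forall>r\<in>carrier R. \<forall>m\<in>carrier M. f (r \<odot>\<^bsub>M\<^esub> m) = r \<odot>\<^bsub>N\<^esub> f m}"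

definition regular_module :: "('r, 'x) ring_scheme \<Rightarrow> ('r, 'r) module" where
  "regular_module R =
    \<lparr>carrier = carrier R, mult = mult R, one = one R, zero = zero R, add = add R,
     smult = mult R\<rparr>"

definition free_module :: "('r, 'x) ring_scheme \<Rightarrow> 'i set \<Rightarrow> ('r, 'i \<Rightarrow> 'r) module" where
  "free_module R X =
    \<lparr>carrier = {f. (\<forall>i. f i \<in> carrier R) \<and> (\<forall>i. i \<notin> X \<longrightarrow> f i = \<zero>\<^bsub>R\<^esub>)
                   \<and> finite {i. f i \<noteq> \<zero>\<^bsub>R\<^esub>}},
     mult = undefined, one = undefined,
     zero = (\<lambda>i. \<zero>\<^bsub>R\<^esub>),
     add = (\<lambda>f f'. \<lambda>i. f i \<oplus>\<^bsub>R\<^esub> f' i),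
     smult = (\<lambda>r f. \<lambda>i. r \<otimes>\<^bsub>R\<^esub> f i)\<rparr>"

text \<open>Projective: a direct summand of a free module. The basis may be taken inside the type of
  the elements of \<open>P\<close> because a projective module is a summand of the free module on its
  underlying set.\<close>

definition projective_module :: "('r, 'x) ring_scheme \<Rightarrow> ('r, 'm) module \<Rightarrow> bool" where
  "projective_module R P \<longleftrightarrow> left_module R P \<and>
    (\<exists>X :: 'm set. \<exists>s \<in> mod_hom R P (free_module R X). \<exists>t \<in> mod_hom R (free_module R X) P.
      \<forall>m\<in>carrier P. t (s m) = m)"

definition fg_module :: "('r, 'x) ring_scheme \<Rightarrow> ('r, 'm) module \<Rightarrow> bool" where
  "fg_module R M \<longleftrightarrow>
    (\<exists>S. finite S \<and> S \<subseteq> carrier M \<and>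
      (\<forall>m\<in>carrier M. \<exists>c \<in> S \<rightarrow> carrier R. m = (\<Oplus>\<^bsub>M\<^esub>s\<in>S. c s \<odot>\<^bsub>M\<^esub> s)))"


section \<open>Projective resolutions and Ext\<close>

text \<open>A resolution
  $\cdots \to P_2 \stackrel{d_1}{\to} P_1 \stackrel{d_0}{\to} P_0 \stackrel{e}{\to} M \to 0$
  is a triple \<open>(P, d, e)\<close>, with \<open>d i\<close> mapping \<open>P (Suc i)\<close> to \<open>P i\<close>.\<close>

type_synonym ('r, 'm, 'p) resolution = "(nat \<Rightarrow> ('r, 'p) module) \<times> (nat \<Rightarrow> 'p \<Rightarrow> 'p) \<times> ('p \<Rightarrow> 'm)"

definition projective_resolution ::
  "('r, 'x) ring_scheme \<Rightarrow> ('r, 'm) module \<Rightarrow> ('r, 'm, 'p) resolution \<Rightarrow> bool" where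
  "projective_resolution R M = (\<lambda>(P, d, e).
    (\<forall>i. projective_module R (P i)) \<and>
    (\<forall>i. d i \<in> mod_hom R (P (Suc i)) (P i)) \<and>
    e \<in> mod_hom R (P 0) M \<and>
    e ` carrier (P 0) = carrier M \<and>
    d 0 ` carrier (P 1) = {x \<in> carrier (P 0). e x = \<zero>\<^bsub>M\<^esub>} \<and>
    (\<forall>i. d (Suc i) ` carrier (P (Suc (Suc i))) = {x \<in> carrier (P (Suc i)). d i x = \<zero>\<^bsub>P i\<^esub>}))"

text \<open>$\mathrm{Hom}_R(P, R)$ for a left module \<open>P\<close>, as a right $R$-module: $(f \cdot r)(x) = f(x) r$.
  Homomorphisms are made extensional so that equality is equality on \<open>P\<close>.\<close>

definition dual_module ::
  "('r, 'x) ring_scheme \<Rightarrow> ('r, 'm) module \<Rightarrow> ('r, 'm \<Rightarrow> 'r) module" where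
  "dual_module R P =
    \<lparr>carrier = mod_hom R P (regular_module R) \<inter> extensional (carrier P),
     mult = undefined, one = undefined,
     zero = (\<lambda>x\<in>carrier P. \<zero>\<^bsub>R\<^esub>),
     add = (\<lambda>f g. \<lambda>x\<in>carrier P. f x \<oplus>\<^bsub>R\<^esub> g x),
     smult = (\<lambda>r f. \<lambda>x\<in>carrier P. f x \<otimes>\<^bsub>R\<^esub> r)\<rparr>"

definition dual_cocycles ::
  "('r, 'x) ring_scheme \<Rightarrow> ('r, 'm, 'p) resolution \<Rightarrow> nat \<Rightarrow> ('p \<Rightarrow> 'r) set" where
  "dual_cocycles R = (\<lambda>(P, d, e) i.
    {f \<in> carrier (dual_module R (P i)).
      compose (carrier (P (Suc i))) f (d i) = \<zero>\<^bsub>dual_module R (P (Suc i))\<^esub>})"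

definition dual_coboundaries ::
  "('r, 'x) ring_scheme \<Rightarrow> ('r, 'm, 'p) resolution \<Rightarrow> nat \<Rightarrow> ('p \<Rightarrow> 'r) set" where
  "dual_coboundaries R = (\<lambda>(P, d, e) i.
    (case i of
      0 \<Rightarrow> {\<zero>\<^bsub>dual_module R (P 0)\<^esub>}
    | Suc j \<Rightarrow> (\<lambda>g. compose (carrier (P (Suc j))) g (d j)) ` carrier (dual_module R (P j))))"

text \<open>The right $R$-module $H^i(\mathrm{Hom}_R(P_\bullet, R))$.\<close>

definition dual_cohomology ::
  "('r, 'x) ring_scheme \<Rightarrow> ('r, 'm, 'p) resolution \<Rightarrow> nat \<Rightarrow> ('r, ('p \<Rightarrow> 'r) set) module" where
  "dual_cohomology R Q i =
    quot_mod ((dual_module R (fst Q i))\<lparr>carrier := dual_cocycles R Q i\<rparr>)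
      (dual_coboundaries R Q i)"

text \<open>A single type has to be fixed for the members of the resolutions of \<open>M\<close>. As
  \<open>('m \<times> 'r) list\<close> is infinite and at least as large as \<open>'m\<close> and \<open>'r\<close>, every left module \<open>M\<close>
  has a resolution by free modules \<open>free_module R X\<close> with \<open>X\<close> a set of such lists, and every
  finitely generated projective module has an isomorphic copy inside such a free module.\<close>

type_synonym ('m, 'r) res_carrier = "('m \<times> 'r) list \<Rightarrow> 'r"

text \<open>$\mathrm{Ext}^i_R(M, R)$ as a right $R$-module, computed from a chosen projective
  resolution of \<open>M\<close>.\<close>

definition Ext_ring ::
  "('r, 'x) ring_scheme \<Rightarrow> ('r, 'm) module \<Rightarrow> nat
    \<Rightarrow> ('r, (('m, 'r) res_carrier \<Rightarrow> 'r) set) module" where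
  "Ext_ring R M i =
    dual_cohomology R
      (SOME Q :: ('r, 'm, ('m, 'r) res_carrier) resolution. projective_resolution R M Q) i"


section \<open>Smooth and twisted Calabi-Yau algebras\<close>

text \<open>$A$-bimodules with central action of $K$ are the same as left $A^e$-modules.\<close>

definition smooth_algebra :: "('k, 'x) ring_scheme \<Rightarrow> ('k, 'a) module \<Rightarrow> bool" where
  "smooth_algebra K A \<longleftrightarrow>
    (\<exists>(P :: nat \<Rightarrow> (('k, 'a) env, ('a, ('k, 'a) env) res_carrier) module) d e.
      projective_resolution (env_alg K A) (env_module K A) (P, d, e) \<and>
      (\<forall>i. fg_module (env_alg K A) (P i)) \<and>
      (\<exists>l. \<forall>i>l. carrier (P i) = {\<zero>\<^bsub>P i\<^esub>}))"

record ('a, 'm) bimodule = "'m ring" +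
  lact :: "'a \<Rightarrow> 'm \<Rightarrow> 'm"
  ract :: "'m \<Rightarrow> 'a \<Rightarrow> 'm"

text \<open>A right $A^e$-module as a bimodule: $y \cdot m \cdot x = m \cdot (x \otimes y)$.\<close>

definition bimodule_of_right_env ::
  "('k, 'x) ring_scheme \<Rightarrow> ('k, 'a) module \<Rightarrow> (('k, 'a) env, 'm) module \<Rightarrow> ('a, 'm) bimodule" where
  "bimodule_of_right_env K A M =
    \<lparr>carrier = carrier M, mult = mult M, one = one M, zero = zero M, add = add M,
     lact = (\<lambda>y m. env_tensor K A \<one>\<^bsub>A\<^esub> y \<odot>\<^bsub>M\<^esub> m),
     ract = (\<lambda>m x. env_tensor K A x \<one>\<^bsub>A\<^esub> \<odot>\<^bsub>M\<^esub> m)\<rparr>"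

text \<open>$A_\mu$: $y \cdot m \cdot x = y m \mu(x)$.\<close>

definition twisted_bimodule :: "('k, 'a) module \<Rightarrow> ('a \<Rightarrow> 'a) \<Rightarrow> ('a, 'a) bimodule" where
  "twisted_bimodule A \<mu> =
    \<lparr>carrier = carrier A, mult = mult A, one = one A, zero = zero A, add = add A,
     lact = (\<lambda>y m. y \<otimes>\<^bsub>A\<^esub> m),
     ract = (\<lambda>m x. m \<otimes>\<^bsub>A\<^esub> \<mu> x)\<rparr>"

definition bimodule_iso ::
  "('k, 'a) module \<Rightarrow> ('a, 'm) bimodule \<Rightarrow> ('a, 'n) bimodule \<Rightarrow> ('m \<Rightarrow> 'n) set" where
  "bimodule_iso A M N =
    {f \<in> iso (add_monoid M) (add_monoid N).
      \<forall>x\<in>carrier A. \<forall>m\<in>carrier M.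
        f (lact M x m) = lact N x (f m) \<and> f (ract M m x) = ract N (f m) x}"

text \<open>The Hochschild cohomology $H^i(A, {}_AA \otimes A_A) = \mathrm{Ext}^i_{A^e}(A, A^e)$.\<close>

definition hochschild_env where
  "hochschild_env K A i =
    bimodule_of_right_env K A (Ext_ring (env_alg K A) (env_module K A) i)"

definition twisted_calabi_yau ::
  "('k, 'x) ring_scheme \<Rightarrow> ('k, 'a) module \<Rightarrow> nat \<Rightarrow> ('a \<Rightarrow> 'a) \<Rightarrow> bool" where
  "twisted_calabi_yau K A n \<mu> \<longleftrightarrow>
    assoc_algebra K A \<and> \<mu> \<in> alg_auto K A \<and> smooth_algebra K A \<and>
    (\<forall>i. i \<noteq> n \<longrightarrow> carrier (hochschild_env K A i) = {\<zero>\<^bsub>hochschild_env K A i\<^esub>}) \<and>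
    bimodule_iso A (hochschild_env K A n) (twisted_bimodule A \<mu>) \<noteq> {}"


section \<open>The two-parameter quantum special linear group\<close>

datatype sl2_gen = Ga | Gb | Gc | Gd

definition sl2_rels ::
  "('k, 'x) ring_scheme \<Rightarrow> 'k \<Rightarrow> 'k \<Rightarrow> (sl2_gen list \<Rightarrow> 'k) set" where
  "sl2_rels K p q = (let F = free_algebra K; w = delta K in
    {w [Gb, Ga] \<ominus>\<^bsub>F\<^esub> q \<odot>\<^bsub>F\<^esub> w [Ga, Gb],
     w [Gc, Ga] \<ominus>\<^bsub>F\<^esub> p \<odot>\<^bsub>F\<^esub> w [Ga, Gc],
     w [Gd, Gb] \<ominus>\<^bsub>F\<^esub> q \<odot>\<^bsub>F\<^esub> w [Gb, Gd],
     w [Gd, Gc] \<ominus>\<^bsub>F\<^esub> p \<odot>\<^bsub>F\<^esub> w [Gc, Gd],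
     w [Gb, Gc] \<ominus>\<^bsub>F\<^esub> w [Gc, Gb],
     w [Ga, Gd] \<ominus>\<^bsub>F\<^esub> (inv\<^bsub>K\<^esub> p) \<odot>\<^bsub>F\<^esub> w [Gb, Gc] \<ominus>\<^bsub>F\<^esub> \<one>\<^bsub>F\<^esub>,
     w [Gd, Ga] \<ominus>\<^bsub>F\<^esub> q \<odot>\<^bsub>F\<^esub> w [Gb, Gc] \<ominus>\<^bsub>F\<^esub> \<one>\<^bsub>F\<^esub>})"

definition sl2_ideal ::
  "('k, 'x) ring_scheme \<Rightarrow> 'k \<Rightarrow> 'k \<Rightarrow> (sl2_gen list \<Rightarrow> 'k) set" where
  "sl2_ideal K p q = Idl\<^bsub>free_algebra K\<^esub> (sl2_rels K p q)"

definition O_SL2 ::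
  "('k, 'x) ring_scheme \<Rightarrow> 'k \<Rightarrow> 'k \<Rightarrow> ('k, (sl2_gen list \<Rightarrow> 'k) set) module" where
  "O_SL2 K p q = quot_mod (free_algebra K) (sl2_ideal K p q)"

definition O_SL2_gen ::
  "('k, 'x) ring_scheme \<Rightarrow> 'k \<Rightarrow> 'k \<Rightarrow> sl2_gen \<Rightarrow> (sl2_gen list \<Rightarrow> 'k) set" where
  "O_SL2_gen K p q g = sl2_ideal K p q +>\<^bsub>free_algebra K\<^esub> delta K [g]"

end

theory Submission
  imports Defs
begin

text \<open>In $R = A^e$ let $X = a \otimes d - p^{-1} b \otimes c$, $Y = b \otimes a - q\, a \otimes b$,
  $Z = c \otimes d - p^{-1} d \otimes c$ and $W = d \otimes a - q\, c \otimes b$. Then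
  $a \otimes 1 = (1 \otimes a) X + (1 \otimes c) Y$ and similarly for $b, c, d$, so that $X - 1$, $Y$ and $Z$
  generate the annihilator of $1 \in A$. There are automorphisms
  $\phi$, $\psi$ of $R$ scaling the generators in the left factor such that $Y u = \phi(u) Y$ and
  $Z u = \psi(u) Z$ for $u = X, W$, and $Y$ and $Z$ satisfy a similar commutation rule. A normal form for $R$, whose linear
  independence comes from a representation by weighted shifts on functions on
  $\mathbb{Z} \times \mathbb{N} \times \mathbb{N}$, shows that $Y, Z, X - 1$ is a regular sequence in a
  twisted sense, and a twisted Koszul complex $0 \to R \to R^3 \to R^3 \to R \to A \to 0$ is exact.
  Exchanging $a$ with $d$ and $b$ with $c$ gives an anti-isomorphism of $R$ with the enveloping
  algebra for the parameters $q^{-1}, p^{-1}$, which carries the dual complex to a complex of the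
  same kind. Hence the dual complex is exact except at the end, where its cohomology is $A$, twisted
  by the discrepancy between the two factors of the anti-isomorphism. The comparison theorem for
  projective resolutions transfers this to an arbitrary resolution.\<close>

section \<open>Homomorphisms and linear endomorphisms\<close>

text \<open>Let T be the matrix with rows (a, b), (c, d). The relations say that T is invertible,
  with inverse rows (d, -q b), (-p^{-1} c, a). The matrix M with rows (X, Y), (Z, W) is the product
  of T in the left tensor factor and T^{-1} in the right one. This is the origin of the coefficients
  and of the formula for a \<otimes> 1, and it shows why X - 1, Y, Z and W - 1 annihilate 1; W - 1
  lies in the left ideal of the others because W X - 1 is a left multiple of Z. The obstacle is that
  Y and Z pass across X, and across each other, only after the left letters are rescaled. The
  scalars inside change each time, so the Koszul cube needs four versions of X - 1 and two each of Y
  and Z. That such factors can be cancelled is not visible from the relations; the faithful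
  representation supplies it. At the last corner of the cube the coefficient of a \<otimes> d has
  grown from 1 to p q. After the tensor factors are exchanged it has to return to 1; the torus
  element that compensates it is, up to inversion, the Nakayama automorphism.\<close>

definition alg_hom ::
  "('k, 'x) ring_scheme \<Rightarrow> ('k, 'a) module \<Rightarrow> ('k, 'b) module \<Rightarrow> ('a \<Rightarrow> 'b) set" where
  "alg_hom K A B = {h \<in> ring_hom A B.
    \<forall>c\<in>carrier K. \<forall>x\<in>carrier A. h (c \<odot>\<^bsub>A\<^esub> x) = c \<odot>\<^bsub>B\<^esub> h x}"

lemma alg_homI:
  assumes "\<And>x. x \<in> carrier A \<Longrightarrow> h x \<in> carrier B"
    and "\<And>x y. x \<in> carrier A \<Longrightarrow> y \<in> carrier A \<Longrightarrow> h (x \<otimes>\<^bsub>A\<^esub> y) = h x \<otimes>\<^bsub>B\<^esub> h y"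
    and "\<And>x y. x \<in> carrier A \<Longrightarrow> y \<in> carrier A \<Longrightarrow> h (x \<oplus>\<^bsub>A\<^esub> y) = h x \<oplus>\<^bsub>B\<^esub> h y"
    and "h \<one>\<^bsub>A\<^esub> = \<one>\<^bsub>B\<^esub>"
    and "\<And>c x. c \<in> carrier K \<Longrightarrow> x \<in> carrier A \<Longrightarrow> h (c \<odot>\<^bsub>A\<^esub> x) = c \<odot>\<^bsub>B\<^esub> h x"
  shows "h \<in> alg_hom K A B"
  using assms by (auto simp: alg_hom_def ring_hom_def)

lemma alg_homD:
  assumes "h \<in> alg_hom K A B"
  shows "\<And>x. x \<in> carrier A \<Longrightarrow> h x \<in> carrier B"
    and "\<And>x y. x \<in> carrier A \<Longrightarrow> y \<in> carrier A \<Longrightarrow> h (x \<otimes>\<^bsub>A\<^esub> y) = h x \<otimes>\<^bsub>B\<^esub> h y"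
    and "\<And>x y. x \<in> carrier A \<Longrightarrow> y \<in> carrier A \<Longrightarrow> h (x \<oplus>\<^bsub>A\<^esub> y) = h x \<oplus>\<^bsub>B\<^esub> h y"
    and "h \<one>\<^bsub>A\<^esub> = \<one>\<^bsub>B\<^esub>"
    and "\<And>c x. c \<in> carrier K \<Longrightarrow> x \<in> carrier A \<Longrightarrow> h (c \<odot>\<^bsub>A\<^esub> x) = c \<odot>\<^bsub>B\<^esub> h x"
  using assms by (auto simp: alg_hom_def ring_hom_def)

lemma assoc_algebraI:
  fixes K (structure) and A (structure)
  assumes "cring K" "abelian_group A"
    and "\<And>x y. \<lbrakk>x \<in> carrier A; y \<in> carrier A\<rbrakk> \<Longrightarrow> x \<otimes>\<^bsub>A\<^esub> y \<in> carrier A"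
    and "\<And>x y z. \<lbrakk>x \<in> carrier A; y \<in> carrier A; z \<in> carrier A\<rbrakk>
      \<Longrightarrow> (x \<otimes>\<^bsub>A\<^esub> y) \<otimes>\<^bsub>A\<^esub> z = x \<otimes>\<^bsub>A\<^esub> (y \<otimes>\<^bsub>A\<^esub> z)"
    and "\<one>\<^bsub>A\<^esub> \<in> carrier A"
    and "\<And>x. x \<in> carrier A \<Longrightarrow> \<one>\<^bsub>A\<^esub> \<otimes>\<^bsub>A\<^esub> x = x"
    and "\<And>x. x \<in> carrier A \<Longrightarrow> x \<otimes>\<^bsub>A\<^esub> \<one>\<^bsub>A\<^esub> = x"
    and "\<And>x y z. \<lbrakk>x \<in> carrier A; y \<in> carrier A; z \<in> carrier A\<rbrakk>
      \<Longrightarrow> (x \<oplus>\<^bsub>A\<^esub> y) \<otimes>\<^bsub>A\<^esub> z = x \<otimes>\<^bsub>A\<^esub> z \<oplus>\<^bsub>A\<^esub> y \<otimes>\<^bsub>A\<^esub> z"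
    and "\<And>x y z. \<lbrakk>x \<in> carrier A; y \<in> carrier A; z \<in> carrier A\<rbrakk>
      \<Longrightarrow> z \<otimes>\<^bsub>A\<^esub> (x \<oplus>\<^bsub>A\<^esub> y) = z \<otimes>\<^bsub>A\<^esub> x \<oplus>\<^bsub>A\<^esub> z \<otimes>\<^bsub>A\<^esub> y"
    and "\<And>c x. \<lbrakk>c \<in> carrier K; x \<in> carrier A\<rbrakk> \<Longrightarrow> c \<odot>\<^bsub>A\<^esub> x \<in> carrier A"
    and "\<And>c d x. \<lbrakk>c \<in> carrier K; d \<in> carrier K; x \<in> carrier A\<rbrakk>
      \<Longrightarrow> (c \<oplus>\<^bsub>K\<^esub> d) \<odot>\<^bsub>A\<^esub> x = c \<odot>\<^bsub>A\<^esub> x \<oplus>\<^bsub>A\<^esub> d \<odot>\<^bsub>A\<^esub> x"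
    and "\<And>c x y. \<lbrakk>c \<in> carrier K; x \<in> carrier A; y \<in> carrier A\<rbrakk>
      \<Longrightarrow> c \<odot>\<^bsub>A\<^esub> (x \<oplus>\<^bsub>A\<^esub> y) = c \<odot>\<^bsub>A\<^esub> x \<oplus>\<^bsub>A\<^esub> c \<odot>\<^bsub>A\<^esub> y"
    and "\<And>c d x. \<lbrakk>c \<in> carrier K; d \<in> carrier K; x \<in> carrier A\<rbrakk>
      \<Longrightarrow> (c \<otimes>\<^bsub>K\<^esub> d) \<odot>\<^bsub>A\<^esub> x = c \<odot>\<^bsub>A\<^esub> (d \<odot>\<^bsub>A\<^esub> x)"
    and "\<And>x. x \<in> carrier A \<Longrightarrow> \<one>\<^bsub>K\<^esub> \<odot>\<^bsub>A\<^esub> x = x"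
    and "\<And>c x y. \<lbrakk>c \<in> carrier K; x \<in> carrier A; y \<in> carrier A\<rbrakk>
      \<Longrightarrow> (c \<odot>\<^bsub>A\<^esub> x) \<otimes>\<^bsub>A\<^esub> y = c \<odot>\<^bsub>A\<^esub> (x \<otimes>\<^bsub>A\<^esub> y)"
    and "\<And>c x y. \<lbrakk>c \<in> carrier K; x \<in> carrier A; y \<in> carrier A\<rbrakk>
      \<Longrightarrow> x \<otimes>\<^bsub>A\<^esub> (c \<odot>\<^bsub>A\<^esub> y) = c \<odot>\<^bsub>A\<^esub> (x \<otimes>\<^bsub>A\<^esub> y)"
  shows "assoc_algebra K A"
proof -
  have "module K A" by (rule moduleI) (use assms in auto)
  moreover have "ring A"
    by (rule ringI) (use assms in \<open>auto intro!: Group.monoidI\<close>)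
  ultimately show ?thesis
    by (simp add: assoc_algebra_def assoc_algebra_axioms_def assms)
qed

context assoc_algebra
begin

lemma ring_A: "ring A" by unfold_locales
lemma module_A: "module K A" by unfold_locales
lemma cring_K: "cring K" by unfold_locales

end

lemma alg_hom_zero:
  assumes "ring A" "ring B" "h \<in> alg_hom K A B"
  shows "h \<zero>\<^bsub>A\<^esub> = \<zero>\<^bsub>B\<^esub>"
  using assms ring_hom_zero by (auto simp: alg_hom_def)

lemma alg_hom_diff:
  assumes "ring A" "ring B" "h \<in> alg_hom K A B" "x \<in> carrier A" "y \<in> carrier A"
  shows "h (x \<ominus>\<^bsub>A\<^esub> y) = h x \<ominus>\<^bsub>B\<^esub> h y"
proof -
  interpret ring_hom_ring A B h
    using assms by (auto simp: alg_hom_def intro: ring_hom_ringI2)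
  show ?thesis using assms(4,5) by (simp add: a_minus_def)
qed

lemma alg_hom_comp:
  assumes "h \<in> alg_hom K A B" "g \<in> alg_hom K B C"
  shows "(\<lambda>x. g (h x)) \<in> alg_hom K A C"
  by (rule alg_homI) (simp_all add: alg_homD[OF assms(1)] alg_homD[OF assms(2)])

lemma alg_hom_id: "(\<lambda>x. x) \<in> alg_hom K A A"
  by (rule alg_homI) auto

text \<open>Operators are extensional on \<open>V\<close>, so that operators agreeing on
  \<open>V\<close> are equal and relations between them can be checked pointwise.\<close>

definition end_alg :: "('k, 'x) ring_scheme \<Rightarrow> ('k, 'v) module \<Rightarrow> ('k, 'v \<Rightarrow> 'v) module" where
  "end_alg K V =
    \<lparr>carrier = {f \<in> extensional (carrier V). f \<in> carrier V \<rightarrow> carrier V \<and>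
       (\<forall>x\<in>carrier V. \<forall>y\<in>carrier V. f (x \<oplus>\<^bsub>V\<^esub> y) = f x \<oplus>\<^bsub>V\<^esub> f y) \<and>
       (\<forall>c\<in>carrier K. \<forall>x\<in>carrier V. f (c \<odot>\<^bsub>V\<^esub> x) = c \<odot>\<^bsub>V\<^esub> f x)},
     mult = (\<lambda>f g. compose (carrier V) f g), one = (\<lambda>x\<in>carrier V. x),
     zero = (\<lambda>x\<in>carrier V. \<zero>\<^bsub>V\<^esub>), add = (\<lambda>f g. \<lambda>x\<in>carrier V. f x \<oplus>\<^bsub>V\<^esub> g x),
     smult = (\<lambda>c f. \<lambda>x\<in>carrier V. c \<odot>\<^bsub>V\<^esub> f x)\<rparr>"

lemma end_algD:
  assumes "f \<in> carrier (end_alg K V)"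
  shows "\<And>x. x \<in> carrier V \<Longrightarrow> f x \<in> carrier V"
    and "\<And>x y. x \<in> carrier V \<Longrightarrow> y \<in> carrier V \<Longrightarrow> f (x \<oplus>\<^bsub>V\<^esub> y) = f x \<oplus>\<^bsub>V\<^esub> f y"
    and "\<And>c x. c \<in> carrier K \<Longrightarrow> x \<in> carrier V \<Longrightarrow> f (c \<odot>\<^bsub>V\<^esub> x) = c \<odot>\<^bsub>V\<^esub> f x"
  using assms by (auto simp: end_alg_def)

lemma end_alg_eqI:
  assumes "f \<in> carrier (end_alg K V)" "g \<in> carrier (end_alg K V)"
    and "\<And>x. x \<in> carrier V \<Longrightarrow> f x = g x"
  shows "f = g"
  using assms by (auto simp: end_alg_def intro: extensionalityI)

lemma end_alg_apply:
  assumes "x \<in> carrier V"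
  shows "(f \<otimes>\<^bsub>end_alg K V\<^esub> g) x = f (g x)" "\<one>\<^bsub>end_alg K V\<^esub> x = x"
    "\<zero>\<^bsub>end_alg K V\<^esub> x = \<zero>\<^bsub>V\<^esub>" "(f \<oplus>\<^bsub>end_alg K V\<^esub> g) x = f x \<oplus>\<^bsub>V\<^esub> g x"
    "(c \<odot>\<^bsub>end_alg K V\<^esub> f) x = c \<odot>\<^bsub>V\<^esub> f x"
  using assms by (auto simp: end_alg_def compose_def)

lemma end_algI:
  assumes "\<And>x. x \<in> carrier V \<Longrightarrow> f x \<in> carrier V"
    and "\<And>x y. x \<in> carrier V \<Longrightarrow> y \<in> carrier V \<Longrightarrow> f (x \<oplus>\<^bsub>V\<^esub> y) = f x \<oplus>\<^bsub>V\<^esub> f y"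
    and "\<And>c x. c \<in> carrier K \<Longrightarrow> x \<in> carrier V \<Longrightarrow> f (c \<odot>\<^bsub>V\<^esub> x) = c \<odot>\<^bsub>V\<^esub> f x"
  assumes "module K V"
  shows "(\<lambda>x\<in>carrier V. f x) \<in> carrier (end_alg K V)"
proof -
  interpret module K V by fact
  show ?thesis using assms by (auto simp: end_alg_def)
qed

lemma assoc_algebra_end_alg:
  assumes "module K V"
  shows "assoc_algebra K (end_alg K V)"
proof -
  interpret module K V by fact
  let ?E = "end_alg K V"
  note D = end_algD[where K=K and V=V]
  have ag: "abelian_group ?E"
  proof (rule abelian_groupI)
    show "x \<oplus>\<^bsub>?E\<^esub> y \<in> carrier ?E" if "x \<in> carrier ?E" "y \<in> carrier ?E" for x y
      using that D[OF that(1)] D[OF that(2)]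
      by (auto simp: end_alg_def smult_r_distr M.a_ac)
    show "\<zero>\<^bsub>?E\<^esub> \<in> carrier ?E" by (auto simp: end_alg_def)
    show "x \<oplus>\<^bsub>?E\<^esub> y \<oplus>\<^bsub>?E\<^esub> z = x \<oplus>\<^bsub>?E\<^esub> (y \<oplus>\<^bsub>?E\<^esub> z)"
      if "x \<in> carrier ?E" "y \<in> carrier ?E" "z \<in> carrier ?E" for x y z
      using D[OF that(1)] D[OF that(2)] D[OF that(3)]
      by (auto simp: end_alg_def M.a_assoc intro!: restrict_ext)
    show "x \<oplus>\<^bsub>?E\<^esub> y = y \<oplus>\<^bsub>?E\<^esub> x" if "x \<in> carrier ?E" "y \<in> carrier ?E" for x y
      using D[OF that(1)] D[OF that(2)] by (auto simp: end_alg_def M.a_comm intro!: restrict_ext)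
    show "\<zero>\<^bsub>?E\<^esub> \<oplus>\<^bsub>?E\<^esub> x = x" if "x \<in> carrier ?E" for x
      using that D[OF that(1)] by (auto simp: end_alg_def intro!: extensionalityI[of _ "carrier V"])
    show "\<exists>y\<in>carrier ?E. y \<oplus>\<^bsub>?E\<^esub> x = \<zero>\<^bsub>?E\<^esub>" if "x \<in> carrier ?E" for x
      using that D[OF that(1)]
      by (intro bexI[of _ "\<lambda>v\<in>carrier V. \<ominus>\<^bsub>V\<^esub> x v"])
        (auto simp: end_alg_def M.l_neg M.minus_add smult_r_minus intro!: restrict_ext)
  qed
  show ?thesis
  proof (rule assoc_algebraI)
    show "cring K" by unfold_locales
    show "abelian_group ?E" by (rule ag)
    fix x y z c d
    show "c \<odot>\<^bsub>?E\<^esub> x \<in> carrier ?E" if "x \<in> carrier ?E" "c \<in> carrier K"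
      using D[OF that(1)] that by (auto simp: end_alg_def smult_r_distr smult_assoc1[symmetric] m_comm)
    assume x: "x \<in> carrier ?E"
    show "\<one>\<^bsub>?E\<^esub> \<otimes>\<^bsub>?E\<^esub> x = x" "x \<otimes>\<^bsub>?E\<^esub> \<one>\<^bsub>?E\<^esub> = x" "\<one>\<^bsub>K\<^esub> \<odot>\<^bsub>?E\<^esub> x = x"
      using x D[OF x]
      by (auto simp: end_alg_def compose_def intro!: extensionalityI[of _ "carrier V"])
    assume y: "y \<in> carrier ?E"
    show "x \<otimes>\<^bsub>?E\<^esub> y \<in> carrier ?E"
      using x y D[OF x] D[OF y] by (auto simp: end_alg_def compose_def)
    assume z: "z \<in> carrier ?E"
    show "x \<otimes>\<^bsub>?E\<^esub> y \<otimes>\<^bsub>?E\<^esub> z = x \<otimes>\<^bsub>?E\<^esub> (y \<otimes>\<^bsub>?E\<^esub> z)"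
      using D[OF z] by (auto simp: end_alg_def compose_def intro!: restrict_ext)
    show "(x \<oplus>\<^bsub>?E\<^esub> y) \<otimes>\<^bsub>?E\<^esub> z = x \<otimes>\<^bsub>?E\<^esub> z \<oplus>\<^bsub>?E\<^esub> y \<otimes>\<^bsub>?E\<^esub> z"
      "z \<otimes>\<^bsub>?E\<^esub> (x \<oplus>\<^bsub>?E\<^esub> y) = z \<otimes>\<^bsub>?E\<^esub> x \<oplus>\<^bsub>?E\<^esub> z \<otimes>\<^bsub>?E\<^esub> y"
      using D[OF x] D[OF y] D[OF z] by (auto simp: end_alg_def compose_def intro!: restrict_ext)
  next
    show "\<one>\<^bsub>?E\<^esub> \<in> carrier ?E" by (auto simp: end_alg_def)
  next
    fix x y c d assume c: "c \<in> carrier K" and x: "x \<in> carrier ?E"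
    show "(c \<oplus>\<^bsub>K\<^esub> d) \<odot>\<^bsub>?E\<^esub> x = c \<odot>\<^bsub>?E\<^esub> x \<oplus>\<^bsub>?E\<^esub> d \<odot>\<^bsub>?E\<^esub> x" if "d \<in> carrier K"
      using D[OF x] c that by (auto simp: end_alg_def smult_l_distr intro!: restrict_ext)
    show "(c \<otimes>\<^bsub>K\<^esub> d) \<odot>\<^bsub>?E\<^esub> x = c \<odot>\<^bsub>?E\<^esub> (d \<odot>\<^bsub>?E\<^esub> x)" if "d \<in> carrier K"
      using D[OF x] c that by (auto simp: end_alg_def smult_assoc1 intro!: restrict_ext)
    assume y: "y \<in> carrier ?E"
    show "c \<odot>\<^bsub>?E\<^esub> (x \<oplus>\<^bsub>?E\<^esub> y) = c \<odot>\<^bsub>?E\<^esub> x \<oplus>\<^bsub>?E\<^esub> c \<odot>\<^bsub>?E\<^esub> y"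
      "(c \<odot>\<^bsub>?E\<^esub> x) \<otimes>\<^bsub>?E\<^esub> y = c \<odot>\<^bsub>?E\<^esub> (x \<otimes>\<^bsub>?E\<^esub> y)"
      "x \<otimes>\<^bsub>?E\<^esub> (c \<odot>\<^bsub>?E\<^esub> y) = c \<odot>\<^bsub>?E\<^esub> (x \<otimes>\<^bsub>?E\<^esub> y)"
      using D[OF x] D[OF y] c
      by (auto simp: end_alg_def compose_def smult_r_distr intro!: restrict_ext)
  qed
qed

section \<open>Quotient algebras\<close>

lemma quot_mod_simps:
  "carrier (quot_mod M I) = carrier (M Quot I)" "mult (quot_mod M I) = mult (M Quot I)"
  "one (quot_mod M I) = one (M Quot I)" "zero (quot_mod M I) = zero (M Quot I)"
  "add (quot_mod M I) = add (M Quot I)"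
  by (auto simp: quot_mod_def)

locale k_algebra = assoc_algebra K A
  for K :: "('k, 'x) ring_scheme" (structure) and A :: "('k, 'a) module" (structure)

context k_algebra
begin

lemma smult_eq_mult: "c \<in> carrier K \<Longrightarrow> x \<in> carrier A \<Longrightarrow> c \<odot>\<^bsub>A\<^esub> x = (c \<odot>\<^bsub>A\<^esub> \<one>\<^bsub>A\<^esub>) \<otimes>\<^bsub>A\<^esub> x"
  using smult_mult_left[of c "\<one>\<^bsub>A\<^esub>" x] by simp

text \<open>\<open>quot_mod\<close> multiplies by c through the union of the cosets of c y over all
  representatives y. Since c acts as multiplication by c 1, it preserves the ideal and all these
  cosets coincide.\<close>

lemma coset_smult:
  assumes "ideal I A" "c \<in> carrier K" "x \<in> carrier A"
  shows "c \<odot>\<^bsub>quot_mod A I\<^esub> (I +>\<^bsub>A\<^esub> x) = I +>\<^bsub>A\<^esub> (c \<odot>\<^bsub>A\<^esub> x)"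
proof -
  interpret I: ideal I A by fact
  have "I +>\<^bsub>A\<^esub> (c \<odot>\<^bsub>A\<^esub> y) = I +>\<^bsub>A\<^esub> (c \<odot>\<^bsub>A\<^esub> x)" if "y \<in> I +>\<^bsub>A\<^esub> x" for y
  proof -
    obtain i where i: "i \<in> I" "y = i \<oplus>\<^bsub>A\<^esub> x"
      using \<open>y \<in> _\<close> by (auto simp: a_r_coset_def')
    have "c \<odot>\<^bsub>A\<^esub> i \<in> I"
      using i assms by (subst smult_eq_mult) (auto intro: I.I_l_closed)
    moreover have "c \<odot>\<^bsub>A\<^esub> y = c \<odot>\<^bsub>A\<^esub> i \<oplus>\<^bsub>A\<^esub> c \<odot>\<^bsub>A\<^esub> x"
      using i assms by (simp add: smult_r_distr)
    ultimately show ?thesis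
      using assms a_coset_add_assoc[OF I.a_subset, of "c \<odot>\<^bsub>A\<^esub> i" "c \<odot>\<^bsub>A\<^esub> x"] I.a_rcos_const
        I.a_Hcarr[OF i(1)] by simp
  qed
  then have "(\<Union>y\<in>I +>\<^bsub>A\<^esub> x. I +>\<^bsub>A\<^esub> (c \<odot>\<^bsub>A\<^esub> y)) = I +>\<^bsub>A\<^esub> (c \<odot>\<^bsub>A\<^esub> x)"
    using I.a_rcos_self[OF assms(3)] by blast
  then show ?thesis by (simp only: quot_mod_def module.simps)
qed

lemma coset_hom:
  assumes "ideal I A"
  shows "(\<lambda>x. I +>\<^bsub>A\<^esub> x) \<in> alg_hom K A (quot_mod A I)"
  using ideal.rcos_ring_hom[OF assms] coset_smult[OF assms]
  by (auto simp: alg_hom_def ring_hom_def quot_mod_simps)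

lemma quot_carrierE:
  assumes "X \<in> carrier (quot_mod A I)"
  obtains x where "x \<in> carrier A" "X = I +>\<^bsub>A\<^esub> x"
  using assms by (auto simp: quot_mod_simps FactRing_def A_RCOSETS_def')

lemma assoc_algebra_quot:
  assumes "ideal I A"
  shows "assoc_algebra K (quot_mod A I)"
proof -
  let ?Q = "quot_mod A I"
  have "ring (A Quot I)" using ideal.quotient_is_ring[OF assms] .
  then interpret q: ring "A Quot I" .
  note h = alg_homD(2-5)[OF coset_hom[OF assms], symmetric]
  have ag: "abelian_group ?Q"
  proof (rule abelian_groupI)
    show "\<exists>y\<in>carrier ?Q. y \<oplus>\<^bsub>?Q\<^esub> x = \<zero>\<^bsub>?Q\<^esub>" if "x \<in> carrier ?Q" for x
      using that by (intro bexI[of _ "\<ominus>\<^bsub>A Quot I\<^esub> x"]) (simp_all add: quot_mod_simps q.l_neg)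
  qed (auto simp: quot_mod_simps q.a_ac)
  show ?thesis
  proof (rule assoc_algebraI)
    show "cring K" by (rule cring_K)
    show "abelian_group ?Q" by (rule ag)
    fix x y z c d
    show "\<one>\<^bsub>?Q\<^esub> \<in> carrier ?Q" by (simp add: quot_mod_simps)
    assume x: "x \<in> carrier ?Q"
    then obtain x' where x': "x' \<in> carrier A" "x = I +>\<^bsub>A\<^esub> x'" by (rule quot_carrierE)
    show "\<one>\<^bsub>?Q\<^esub> \<otimes>\<^bsub>?Q\<^esub> x = x" "x \<otimes>\<^bsub>?Q\<^esub> \<one>\<^bsub>?Q\<^esub> = x"
      using x by (simp_all add: quot_mod_simps)
    show "\<one>\<^bsub>K\<^esub> \<odot>\<^bsub>?Q\<^esub> x = x" using x' by (simp add: h)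
    {
      assume y: "y \<in> carrier ?Q"
      show "x \<otimes>\<^bsub>?Q\<^esub> y \<in> carrier ?Q" using x y by (simp add: quot_mod_simps)
      assume z: "z \<in> carrier ?Q"
      show "x \<otimes>\<^bsub>?Q\<^esub> y \<otimes>\<^bsub>?Q\<^esub> z = x \<otimes>\<^bsub>?Q\<^esub> (y \<otimes>\<^bsub>?Q\<^esub> z)"
        "(x \<oplus>\<^bsub>?Q\<^esub> y) \<otimes>\<^bsub>?Q\<^esub> z = x \<otimes>\<^bsub>?Q\<^esub> z \<oplus>\<^bsub>?Q\<^esub> y \<otimes>\<^bsub>?Q\<^esub> z"
        "z \<otimes>\<^bsub>?Q\<^esub> (x \<oplus>\<^bsub>?Q\<^esub> y) = z \<otimes>\<^bsub>?Q\<^esub> x \<oplus>\<^bsub>?Q\<^esub> z \<otimes>\<^bsub>?Q\<^esub> y"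
        using x y z by (simp_all add: quot_mod_simps q.m_assoc q.l_distr q.r_distr)
    }
    assume c: "c \<in> carrier K"
    show "c \<odot>\<^bsub>?Q\<^esub> x \<in> carrier ?Q" using c x' by (simp add: h alg_homD(1)[OF coset_hom[OF assms]])
    {
      assume d: "d \<in> carrier K"
      show "(c \<oplus>\<^bsub>K\<^esub> d) \<odot>\<^bsub>?Q\<^esub> x = c \<odot>\<^bsub>?Q\<^esub> x \<oplus>\<^bsub>?Q\<^esub> d \<odot>\<^bsub>?Q\<^esub> x"
        "(c \<otimes>\<^bsub>K\<^esub> d) \<odot>\<^bsub>?Q\<^esub> x = c \<odot>\<^bsub>?Q\<^esub> (d \<odot>\<^bsub>?Q\<^esub> x)"
        using c d x' by (simp_all add: h smult_l_distr smult_assoc1)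
    }
    assume y: "y \<in> carrier ?Q"
    then obtain y' where y': "y' \<in> carrier A" "y = I +>\<^bsub>A\<^esub> y'" by (rule quot_carrierE)
    show "c \<odot>\<^bsub>?Q\<^esub> (x \<oplus>\<^bsub>?Q\<^esub> y) = c \<odot>\<^bsub>?Q\<^esub> x \<oplus>\<^bsub>?Q\<^esub> c \<odot>\<^bsub>?Q\<^esub> y"
      using c x' y' by (simp add: h smult_r_distr)
    show "(c \<odot>\<^bsub>?Q\<^esub> x) \<otimes>\<^bsub>?Q\<^esub> y = c \<odot>\<^bsub>?Q\<^esub> (x \<otimes>\<^bsub>?Q\<^esub> y)"
      using c x' y' by (simp add: h smult_mult_left[symmetric])
    show "x \<otimes>\<^bsub>?Q\<^esub> (c \<odot>\<^bsub>?Q\<^esub> y) = c \<odot>\<^bsub>?Q\<^esub> (x \<otimes>\<^bsub>?Q\<^esub> y)"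
      using c x' y' by (simp add: h smult_mult_right[symmetric])
  qed
qed

text \<open>Two representatives of a coset differ by an element of \<open>I\<close>, which
  \<open>h\<close> kills, so evaluating \<open>h\<close> at a chosen representative is well defined
  and multiplicative.\<close>

lemma quot_lift:
  assumes "ideal I A" "assoc_algebra K B" "h \<in> alg_hom K A B" "\<And>x. x \<in> I \<Longrightarrow> h x = \<zero>\<^bsub>B\<^esub>"
  shows "\<exists>h'\<in>alg_hom K (quot_mod A I) B. \<forall>x\<in>carrier A. h' (I +>\<^bsub>A\<^esub> x) = h x"
proof -
  interpret I: ideal I A by fact
  interpret B: assoc_algebra K B by fact
  note h = alg_homD[OF assms(3)]
  let ?Q = "quot_mod A I"
  define h' where "h' X = h (SOME x. x \<in> carrier A \<and> X = I +>\<^bsub>A\<^esub> x)" for X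
  have h': "h' (I +>\<^bsub>A\<^esub> x) = h x" if x: "x \<in> carrier A" for x
  proof -
    define y where "y = (SOME y. y \<in> carrier A \<and> I +>\<^bsub>A\<^esub> x = I +>\<^bsub>A\<^esub> y)"
    have y: "y \<in> carrier A \<and> I +>\<^bsub>A\<^esub> x = I +>\<^bsub>A\<^esub> y"
      unfolding y_def by (rule someI[of _ x]) (simp add: x)
    have "x \<in> I +>\<^bsub>A\<^esub> y" using y I.a_rcos_self x by auto
    then obtain i where "i \<in> I" "x = i \<oplus>\<^bsub>A\<^esub> y" by (auto simp: a_r_coset_def')
    then have "h x = h y" using y h assms(4) by (simp add: I.a_Hcarr)
    then show ?thesis by (simp add: h'_def y_def)
  qed
  note c = alg_homD(2-5)[OF coset_hom[OF assms(1)], symmetric]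
  have "h' \<in> alg_hom K ?Q B"
    using quot_carrierE by (intro alg_homI) (force elim!: quot_carrierE simp: c h' h)+
  with h' show ?thesis by blast
qed

end

lemma quot_mod_coset_eq:
  assumes "ideal I A" "x \<in> carrier A" "y \<in> carrier A" "x \<ominus>\<^bsub>A\<^esub> y \<in> I"
  shows "I +>\<^bsub>A\<^esub> x = I +>\<^bsub>A\<^esub> y"
proof -
  interpret I: ideal I A by fact
  have "x \<in> I +>\<^bsub>A\<^esub> y"
    by (rule iffD2[OF I.a_rcos_module_minus[OF I.ring_axioms assms(3,2)] assms(4)])
  from I.a_repr_independence'[OF this assms(3)] show ?thesis by (rule sym)
qed

text \<open>The kernel of \<open>h\<close> is an ideal containing \<open>S\<close>. This is how a
  map that respects finitely many relations descends to a presented algebra.\<close>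

lemma alg_hom_genideal:
  assumes "assoc_algebra K A" "assoc_algebra K B" "h \<in> alg_hom K A B" "S \<subseteq> carrier A"
    and "\<And>x. x \<in> S \<Longrightarrow> h x = \<zero>\<^bsub>B\<^esub>" "x \<in> Idl\<^bsub>A\<^esub> S"
  shows "h x = \<zero>\<^bsub>B\<^esub>"
proof -
  interpret A: assoc_algebra K A by fact
  interpret B: assoc_algebra K B by fact
  interpret ring_hom_ring A B h
    using assms by (auto simp: alg_hom_def intro: ring_hom_ringI2 A.ring_A B.ring_A)
  have "Idl\<^bsub>A\<^esub> S \<subseteq> a_kernel A B h"
  proof (rule A.genideal_minimal[OF kernel_is_ideal])
    show "S \<subseteq> a_kernel A B h" unfolding a_kernel_def' using assms(4,5) by blast
  qed
  then show ?thesis using assms(6) unfolding a_kernel_def' by blast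
qed

section \<open>Monoid algebras\<close>

context abelian_monoid
begin

lemma finsum_swap:
  assumes "finite S" "finite T" "\<And>x y. x \<in> S \<Longrightarrow> y \<in> T \<Longrightarrow> f x y \<in> carrier G"
  shows "(\<Oplus>x\<in>S. \<Oplus>y\<in>T. f x y) = (\<Oplus>y\<in>T. \<Oplus>x\<in>S. f x y)"
  using assms
proof (induction S rule: finite_induct)
  case empty
  then show ?case by simp
next
  case (insert a S)
  then have "(\<Oplus>y\<in>T. \<Oplus>x\<in>insert a S. f x y) = (\<Oplus>y\<in>T. f a y \<oplus> (\<Oplus>x\<in>S. f x y))"
    by (intro finsum_cong') (auto simp: finsum_insert)
  also have "\<dots> = (\<Oplus>y\<in>T. f a y) \<oplus> (\<Oplus>y\<in>T. \<Oplus>x\<in>S. f x y)"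
    using insert by (intro finsum_addf) auto
  finally show ?case using insert by (simp add: finsum_insert Pi_def)
qed

lemma finsum_Times:
  assumes "finite S" "finite T" "\<And>x y. x \<in> S \<Longrightarrow> y \<in> T \<Longrightarrow> f x y \<in> carrier G"
  shows "(\<Oplus>z\<in>S \<times> T. f (fst z) (snd z)) = (\<Oplus>x\<in>S. \<Oplus>y\<in>T. f x y)"
  using assms
proof (induction S rule: finite_induct)
  case empty
  then show ?case by simp
next
  case (insert a S)
  have e: "insert a S \<times> T = Pair a ` T \<union> S \<times> T" by auto
  have "(\<Oplus>z\<in>insert a S \<times> T. f (fst z) (snd z))
      = (\<Oplus>z\<in>Pair a ` T. f (fst z) (snd z)) \<oplus> (\<Oplus>z\<in>S \<times> T. f (fst z) (snd z))"
    unfolding e using insert by (intro finsum_Un_disjoint) auto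
  also have "(\<Oplus>z\<in>Pair a ` T. f (fst z) (snd z)) = (\<Oplus>y\<in>T. f a y)"
    using insert by (subst finsum_reindex) (auto simp: inj_on_def)
  finally show ?case using insert by (simp add: finsum_insert Pi_def)
qed

lemma finsum_superset:
  assumes "finite T" "S \<subseteq> T" "\<And>x. x \<in> T \<Longrightarrow> f x \<in> carrier G"
    "\<And>x. x \<in> T \<Longrightarrow> x \<notin> S \<Longrightarrow> f x = \<zero>"
  shows "finsum G f S = finsum G f T"
  unfolding finsum_def
  by (rule a_comm_monoid[THEN comm_monoid.finprod_mono_neutral_cong_left]) (use assms in auto)

lemma finsum_delta:
  assumes "finite S" "a \<in> S" "f a \<in> carrier G"
  shows "(\<Oplus>x\<in>S. if x = a then f x else \<zero>) = f a"
proof -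
  have "(\<Oplus>x\<in>{a}. if x = a then f x else \<zero>) = (\<Oplus>x\<in>S. if x = a then f x else \<zero>)"
    using assms by (intro finsum_superset) auto
  also have "(\<Oplus>x\<in>{a}. if x = a then f x else \<zero>) = f a"
    using assms by (subst finsum_insert) auto
  finally show ?thesis by (rule sym)
qed

end

lemma (in module) finsum_smult_rdistr:
  "\<lbrakk> finite S; x \<in> carrier M; f \<in> S \<rightarrow> carrier R \<rbrakk> \<Longrightarrow>
     (\<Oplus>i\<in>S. f i) \<odot>\<^bsub>M\<^esub> x = (\<Oplus>\<^bsub>M\<^esub>i\<in>S. f i \<odot>\<^bsub>M\<^esub> x)"
  by (induction S rule: finite_induct)
    (simp_all add: Pi_iff smult_l_distr R.finsum_insert M.finsum_insert R.finsum_closed)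

lemma abelian_group_regular: "ring R \<Longrightarrow> abelian_group (regular_module R)"
proof -
  assume "ring R"
  then interpret ring R .
  show ?thesis
  proof (rule abelian_groupI)
    show "\<exists>y\<in>carrier (regular_module R). y \<oplus>\<^bsub>regular_module R\<^esub> x = \<zero>\<^bsub>regular_module R\<^esub>"
      if "x \<in> carrier (regular_module R)" for x
      using that by (intro bexI[of _ "\<ominus>\<^bsub>R\<^esub> x"]) (auto simp: regular_module_def l_neg)
  qed (auto simp: regular_module_def a_ac)
qed

lemma module_regular: "cring K \<Longrightarrow> module K (regular_module K)"
proof -
  assume K: "cring K"
  then interpret cring K .
  show ?thesis
    by (rule moduleI[OF K abelian_group_regular[OF ring_axioms]])
      (auto simp: regular_module_def l_distr r_distr m_assoc)
qed

section \<open>Linear extension and the algebra structure of a monoid algebra\<close>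

locale monoid_alg = K: cring K + G: Group.monoid G for K (structure) and G :: "'g monoid"
begin

abbreviation "F \<equiv> monoid_algebra K G"

lemma carrier_F: "f \<in> carrier F \<longleftrightarrow> (\<forall>g. f g \<in> carrier K) \<and> (\<forall>g. g \<notin> carrier G \<longrightarrow> f g = \<zero>)
    \<and> finite {g. f g \<noteq> \<zero>}"
  by (simp add: monoid_algebra_def)

lemma F_simps:
  "\<zero>\<^bsub>F\<^esub> = (\<lambda>g. \<zero>)" "f \<oplus>\<^bsub>F\<^esub> f' = (\<lambda>g. f g \<oplus> f' g)" "c \<odot>\<^bsub>F\<^esub> f = (\<lambda>g. c \<otimes> f g)"
  "\<one>\<^bsub>F\<^esub> = delta K \<one>\<^bsub>G\<^esub>"
  by (simp_all add: monoid_algebra_def)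

lemma closed [simp]: "f \<in> carrier F \<Longrightarrow> f g \<in> carrier K"
  by (simp add: carrier_F)

lemma supp_G: "f \<in> carrier F \<Longrightarrow> {g. f g \<noteq> \<zero>} \<subseteq> carrier G"
  by (auto simp: carrier_F)

lemma finite_supp: "f \<in> carrier F \<Longrightarrow> finite {g. f g \<noteq> \<zero>}"
  by (simp add: carrier_F)

lemma delta_closed [simp]: "g \<in> carrier G \<Longrightarrow> delta K g \<in> carrier F"
  by (auto simp: carrier_F delta_def)

lemma smult_closed [simp]: "c \<in> carrier K \<Longrightarrow> f \<in> carrier F \<Longrightarrow> c \<odot>\<^bsub>F\<^esub> f \<in> carrier F"
  by (auto simp: carrier_F F_simps intro: rev_finite_subset)

lemma add_closed [simp]: "f \<in> carrier F \<Longrightarrow> f' \<in> carrier F \<Longrightarrow> f \<oplus>\<^bsub>F\<^esub> f' \<in> carrier F"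
  by (auto simp: carrier_F F_simps intro: rev_finite_subset[of "{g. f g \<noteq> \<zero>} \<union> {g. f' g \<noteq> \<zero>}"])

text \<open>The linear extension of \<phi> from the basis \<open>G\<close> to the monoid algebra:
  the universal property of a free module.\<close>

definition lin :: "('a, 'c) module \<Rightarrow> ('g \<Rightarrow> 'c) \<Rightarrow> ('g \<Rightarrow> 'a) \<Rightarrow> 'c" where
  "lin M \<phi> f = (\<Oplus>\<^bsub>M\<^esub>g\<in>{g. f g \<noteq> \<zero>}. f g \<odot>\<^bsub>M\<^esub> \<phi> g)"

lemma lin_superset:
  assumes "module K M" "f \<in> carrier F" "\<phi> \<in> carrier G \<rightarrow> carrier M"
    and "finite T" "{g. f g \<noteq> \<zero>} \<subseteq> T" "T \<subseteq> carrier G"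
  shows "lin M \<phi> f = (\<Oplus>\<^bsub>M\<^esub>g\<in>T. f g \<odot>\<^bsub>M\<^esub> \<phi> g)"
proof -
  interpret M: module K M by fact
  show ?thesis unfolding lin_def using assms by (intro M.finsum_superset) (auto simp: Pi_iff subset_iff)
qed

lemma lin_closed:
  assumes "module K M" "f \<in> carrier F" "\<phi> \<in> carrier G \<rightarrow> carrier M"
  shows "lin M \<phi> f \<in> carrier M"
proof -
  interpret M: module K M by fact
  show ?thesis unfolding lin_def using assms supp_G[OF assms(2)]
    by (intro M.finsum_closed) (auto simp: Pi_iff subset_iff)
qed

lemma lin_delta:
  assumes "module K M" "\<phi> \<in> carrier G \<rightarrow> carrier M" "g \<in> carrier G"
  shows "lin M \<phi> (delta K g) = \<phi> g"
proof -
  interpret M: module K M by fact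
  have "lin M \<phi> (delta K g) = (\<Oplus>\<^bsub>M\<^esub>h\<in>{g}. delta K g h \<odot>\<^bsub>M\<^esub> \<phi> h)"
    using assms by (intro lin_superset delta_closed) (auto simp: delta_def)
  moreover have "\<phi> g \<in> carrier M" using assms by auto
  ultimately show ?thesis by (simp add: delta_def M.finsum_insert)
qed

lemma lin_add:
  assumes "module K M" "f \<in> carrier F" "f' \<in> carrier F" "\<phi> \<in> carrier G \<rightarrow> carrier M"
  shows "lin M \<phi> (f \<oplus>\<^bsub>F\<^esub> f') = lin M \<phi> f \<oplus>\<^bsub>M\<^esub> lin M \<phi> f'"
proof -
  interpret M: module K M by fact
  define T where "T = {g. f g \<noteq> \<zero>} \<union> {g. f' g \<noteq> \<zero>}"
  have T: "finite T" "T \<subseteq> carrier G" "{g. f g \<noteq> \<zero>} \<subseteq> T" "{g. f' g \<noteq> \<zero>} \<subseteq> T"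
    "{g. (f \<oplus>\<^bsub>F\<^esub> f') g \<noteq> \<zero>} \<subseteq> T"
    using assms supp_G finite_supp by (auto simp: T_def F_simps)
  have "lin M \<phi> (f \<oplus>\<^bsub>F\<^esub> f') = (\<Oplus>\<^bsub>M\<^esub>g\<in>T. (f \<oplus>\<^bsub>F\<^esub> f') g \<odot>\<^bsub>M\<^esub> \<phi> g)"
    using assms T by (intro lin_superset add_closed) auto
  also have "\<dots> = (\<Oplus>\<^bsub>M\<^esub>g\<in>T. f g \<odot>\<^bsub>M\<^esub> \<phi> g \<oplus>\<^bsub>M\<^esub> f' g \<odot>\<^bsub>M\<^esub> \<phi> g)"
    using assms T
    by (intro M.finsum_cong') (auto simp: F_simps Pi_iff subset_iff M.smult_l_distr)
  also have "\<dots> = (\<Oplus>\<^bsub>M\<^esub>g\<in>T. f g \<odot>\<^bsub>M\<^esub> \<phi> g) \<oplus>\<^bsub>M\<^esub> (\<Oplus>\<^bsub>M\<^esub>g\<in>T. f' g \<odot>\<^bsub>M\<^esub> \<phi> g)"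
    using assms T by (intro M.finsum_addf) (auto simp: Pi_iff subset_iff)
  finally show ?thesis using assms T by (simp add: lin_superset[of _ _ _ T])
qed

lemma lin_smult:
  assumes "module K M" "f \<in> carrier F" "c \<in> carrier K" "\<phi> \<in> carrier G \<rightarrow> carrier M"
  shows "lin M \<phi> (c \<odot>\<^bsub>F\<^esub> f) = c \<odot>\<^bsub>M\<^esub> lin M \<phi> f"
proof -
  interpret M: module K M by fact
  define T where "T = {g. f g \<noteq> \<zero>}"
  have T: "finite T" "T \<subseteq> carrier G" "{g. f g \<noteq> \<zero>} \<subseteq> T" "{g. (c \<odot>\<^bsub>F\<^esub> f) g \<noteq> \<zero>} \<subseteq> T"
    using assms supp_G finite_supp by (auto simp: T_def F_simps)
  have "lin M \<phi> (c \<odot>\<^bsub>F\<^esub> f) = (\<Oplus>\<^bsub>M\<^esub>g\<in>T. (c \<odot>\<^bsub>F\<^esub> f) g \<odot>\<^bsub>M\<^esub> \<phi> g)"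
    using assms T by (intro lin_superset smult_closed) auto
  also have "\<dots> = (\<Oplus>\<^bsub>M\<^esub>g\<in>T. c \<odot>\<^bsub>M\<^esub> (f g \<odot>\<^bsub>M\<^esub> \<phi> g))"
    using assms T
    by (intro M.finsum_cong') (auto simp: F_simps Pi_iff subset_iff M.smult_assoc1)
  also have "\<dots> = c \<odot>\<^bsub>M\<^esub> (\<Oplus>\<^bsub>M\<^esub>g\<in>T. f g \<odot>\<^bsub>M\<^esub> \<phi> g)"
    using assms T by (intro M.finsum_smult_ldistr[symmetric]) (auto simp: Pi_iff subset_iff)
  finally show ?thesis using assms T by (simp add: lin_superset[of _ _ _ T])
qed

lemma mult_apply:
  assumes "f \<in> carrier F" "f' \<in> carrier F"
  shows "(f \<otimes>\<^bsub>F\<^esub> f') g = (\<Oplus>u\<in>{u. f u \<noteq> \<zero>}. \<Oplus>v\<in>{v. f' v \<noteq> \<zero>}.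
    if u \<otimes>\<^bsub>G\<^esub> v = g then f u \<otimes> f' v else \<zero>)"
proof -
  let ?S = "{u. f u \<noteq> \<zero>}" and ?T = "{v. f' v \<noteq> \<zero>}"
  let ?Z = "{(u, v). f u \<noteq> \<zero> \<and> f' v \<noteq> \<zero> \<and> u \<otimes>\<^bsub>G\<^esub> v = g}"
  let ?h = "\<lambda>u v. if u \<otimes>\<^bsub>G\<^esub> v = g then f u \<otimes> f' v else \<zero>"
  have "(f \<otimes>\<^bsub>F\<^esub> f') g = (\<Oplus>z\<in>?Z. f (fst z) \<otimes> f' (snd z))"
    by (simp only: monoid_algebra_def monoid.simps)
  also have "\<dots> = (\<Oplus>z\<in>?Z. ?h (fst z) (snd z))"
    using assms by (intro K.finsum_cong') auto
  also have "\<dots> = (\<Oplus>z\<in>?S \<times> ?T. ?h (fst z) (snd z))"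
    using assms by (intro K.finsum_superset) (auto simp: finite_supp)
  also have "\<dots> = (\<Oplus>u\<in>?S. \<Oplus>v\<in>?T. ?h u v)"
    using assms by (intro K.finsum_Times) (auto simp: finite_supp)
  finally show ?thesis .
qed

lemma supp_mult:
  assumes "f \<in> carrier F" "f' \<in> carrier F"
  shows "{g. (f \<otimes>\<^bsub>F\<^esub> f') g \<noteq> \<zero>} \<subseteq> (\<lambda>(u, v). u \<otimes>\<^bsub>G\<^esub> v) ` ({u. f u \<noteq> \<zero>} \<times> {v. f' v \<noteq> \<zero>})"
proof (rule subsetI, rule ccontr)
  fix g
  assume g: "g \<in> {g. (f \<otimes>\<^bsub>F\<^esub> f') g \<noteq> \<zero>}"
    and "g \<notin> (\<lambda>(u, v). u \<otimes>\<^bsub>G\<^esub> v) ` ({u. f u \<noteq> \<zero>} \<times> {v. f' v \<noteq> \<zero>})"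
  then have "\<And>u v. f u \<noteq> \<zero> \<Longrightarrow> f' v \<noteq> \<zero> \<Longrightarrow> u \<otimes>\<^bsub>G\<^esub> v \<noteq> g" by force
  then have "(f \<otimes>\<^bsub>F\<^esub> f') g = \<zero>"
    unfolding mult_apply[OF assms]
    by (intro K.add.finprod_one_eqI) (auto intro!: K.add.finprod_one_eqI)
  with g show False by simp
qed

lemma mult_closed [simp]:
  assumes "f \<in> carrier F" "f' \<in> carrier F"
  shows "f \<otimes>\<^bsub>F\<^esub> f' \<in> carrier F"
proof -
  have "finite {g. (f \<otimes>\<^bsub>F\<^esub> f') g \<noteq> \<zero>}"
    using assms by (intro finite_subset[OF supp_mult]) (auto simp: finite_supp)
  moreover have "(f \<otimes>\<^bsub>F\<^esub> f') g \<in> carrier K" for g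
    unfolding mult_apply[OF assms] using assms by (intro K.finsum_closed) auto
  moreover have "(f \<otimes>\<^bsub>F\<^esub> f') g = \<zero>" if "g \<notin> carrier G" for g
    using that supp_mult[OF assms] supp_G[OF assms(1)] supp_G[OF assms(2)] by force
  ultimately show ?thesis by (simp add: carrier_F)
qed

text \<open>Both sides are one sum over triples (u, v, w) with w = u v. \<open>W\<close> is a finite
  set containing all products of the two supports; the sum over it is moved innermost, where a
  single term survives.\<close>

lemma lin_mult:
  assumes "module K M" "f \<in> carrier F" "f' \<in> carrier F" "\<phi> \<in> carrier G \<rightarrow> carrier M"
  shows "lin M \<phi> (f \<otimes>\<^bsub>F\<^esub> f') = (\<Oplus>\<^bsub>M\<^esub>u\<in>{u. f u \<noteq> \<zero>}. \<Oplus>\<^bsub>M\<^esub>v\<in>{v. f' v \<noteq> \<zero>}.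
    (f u \<otimes> f' v) \<odot>\<^bsub>M\<^esub> \<phi> (u \<otimes>\<^bsub>G\<^esub> v))"
proof -
  interpret M: module K M by fact
  let ?S = "{u. f u \<noteq> \<zero>}" and ?T = "{v. f' v \<noteq> \<zero>}"
  define W where "W = (\<lambda>(u, v). u \<otimes>\<^bsub>G\<^esub> v) ` (?S \<times> ?T)"
  have fin: "finite ?S" "finite ?T" "finite W" using assms by (auto simp: finite_supp W_def)
  have S: "?S \<subseteq> carrier G" "?T \<subseteq> carrier G" using assms supp_G by auto
  then have W: "W \<subseteq> carrier G" by (auto simp: W_def)
  have \<phi>: "\<phi> w \<in> carrier M" if "w \<in> carrier G" for w using that assms by auto
  have \<phi>2: "\<phi> (u \<otimes>\<^bsub>G\<^esub> v) \<in> carrier M" if "f u \<noteq> \<zero>" "f' v \<noteq> \<zero>" for u v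
    using that S by (intro \<phi>) auto
  let ?h = "\<lambda>w u v. if u \<otimes>\<^bsub>G\<^esub> v = w then f u \<otimes> f' v else \<zero>"
  have "lin M \<phi> (f \<otimes>\<^bsub>F\<^esub> f') = (\<Oplus>\<^bsub>M\<^esub>w\<in>W. (f \<otimes>\<^bsub>F\<^esub> f') w \<odot>\<^bsub>M\<^esub> \<phi> w)"
    using assms fin W supp_mult[OF assms(2,3)] by (intro lin_superset) (auto simp: W_def)
  also have "\<dots> = (\<Oplus>\<^bsub>M\<^esub>w\<in>W. \<Oplus>\<^bsub>M\<^esub>u\<in>?S. \<Oplus>\<^bsub>M\<^esub>v\<in>?T. ?h w u v \<odot>\<^bsub>M\<^esub> \<phi> w)"
  proof (rule M.finsum_cong', goal_cases)
    case (3 w)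
    then have w: "\<phi> w \<in> carrier M" using W \<phi> by auto
    have a: "(\<Oplus>v\<in>?T. ?h w u v) \<odot>\<^bsub>M\<^esub> \<phi> w = (\<Oplus>\<^bsub>M\<^esub>v\<in>?T. ?h w u v \<odot>\<^bsub>M\<^esub> \<phi> w)" for u
      using w fin assms by (intro M.finsum_smult_rdistr) auto
    have "(\<Oplus>u\<in>?S. \<Oplus>v\<in>?T. ?h w u v) \<odot>\<^bsub>M\<^esub> \<phi> w = (\<Oplus>\<^bsub>M\<^esub>u\<in>?S. (\<Oplus>v\<in>?T. ?h w u v) \<odot>\<^bsub>M\<^esub> \<phi> w)"
      using w fin assms by (intro M.finsum_smult_rdistr) (auto intro!: K.finsum_closed)
    then show ?case unfolding mult_apply[OF assms(2,3)] a .
  next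
    case 2 then show ?case using W \<phi> assms by (auto intro!: M.finsum_closed M.smult_closed)
  qed auto
  also have "\<dots> = (\<Oplus>\<^bsub>M\<^esub>u\<in>?S. \<Oplus>\<^bsub>M\<^esub>w\<in>W. \<Oplus>\<^bsub>M\<^esub>v\<in>?T. ?h w u v \<odot>\<^bsub>M\<^esub> \<phi> w)"
    using W \<phi> assms fin by (intro M.finsum_swap) (auto intro!: M.finsum_closed M.smult_closed)
  also have "\<dots> = (\<Oplus>\<^bsub>M\<^esub>u\<in>?S. \<Oplus>\<^bsub>M\<^esub>v\<in>?T. \<Oplus>\<^bsub>M\<^esub>w\<in>W. ?h w u v \<odot>\<^bsub>M\<^esub> \<phi> w)"
    using W \<phi> assms fin
    by (intro M.finsum_cong' M.finsum_swap) (auto intro!: M.finsum_closed M.smult_closed)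
  also have "\<dots> = (\<Oplus>\<^bsub>M\<^esub>u\<in>?S. \<Oplus>\<^bsub>M\<^esub>v\<in>?T. (f u \<otimes> f' v) \<odot>\<^bsub>M\<^esub> \<phi> (u \<otimes>\<^bsub>G\<^esub> v))"
  proof (intro M.finsum_cong', goal_cases)
    case (5 u v)
    then have uv: "u \<otimes>\<^bsub>G\<^esub> v \<in> W" "u \<otimes>\<^bsub>G\<^esub> v \<in> carrier G" using S by (auto simp: W_def)
    have "(\<Oplus>\<^bsub>M\<^esub>w\<in>W. ?h w u v \<odot>\<^bsub>M\<^esub> \<phi> w)
        = (\<Oplus>\<^bsub>M\<^esub>w\<in>W. if w = u \<otimes>\<^bsub>G\<^esub> v then (f u \<otimes> f' v) \<odot>\<^bsub>M\<^esub> \<phi> w else \<zero>\<^bsub>M\<^esub>)"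
      using W \<phi> assms by (intro M.finsum_cong') (auto simp: subset_iff)
    also have "\<dots> = (f u \<otimes> f' v) \<odot>\<^bsub>M\<^esub> \<phi> (u \<otimes>\<^bsub>G\<^esub> v)"
      using uv fin \<phi> assms by (intro M.finsum_delta) auto
    finally show ?case .
  qed (use S \<phi>2 assms in \<open>auto intro!: M.finsum_closed M.smult_closed\<close>)
  finally show ?thesis .
qed

lemma apply_eq_lin:
  assumes "f \<in> carrier F"
  shows "f g = lin (regular_module K) (\<lambda>h. delta K h g) f"
proof -
  interpret M: module K "regular_module K" by (rule module_regular) (rule K.cring_axioms)
  define T where "T = insert g {h. f h \<noteq> \<zero>}"
  have fin: "finite T" using assms by (simp add: T_def finite_supp)
  have sm: "c \<odot>\<^bsub>regular_module K\<^esub> x = c \<otimes> x" "\<zero>\<^bsub>regular_module K\<^esub> = \<zero>"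
    "carrier (regular_module K) = carrier K" for c x
    by (simp_all add: regular_module_def)
  have "lin (regular_module K) (\<lambda>h. delta K h g) f
      = (\<Oplus>\<^bsub>regular_module K\<^esub>h\<in>T. f h \<otimes> delta K h g)"
    unfolding lin_def sm using assms fin
    by (intro M.finsum_superset) (auto simp: T_def sm delta_def)
  also have "\<dots> = (\<Oplus>\<^bsub>regular_module K\<^esub>h\<in>T. if h = g then f h else \<zero>\<^bsub>regular_module K\<^esub>)"
    using assms by (intro M.finsum_cong') (auto simp: sm delta_def)
  also have "\<dots> = f g" using assms fin
    by (intro M.finsum_delta) (auto simp: T_def sm)
  finally show ?thesis by simp
qed

lemma lin_cong:
  assumes "module K M" "f \<in> carrier F" "\<phi> \<in> carrier G \<rightarrow> carrier M"
    "\<And>g. g \<in> carrier G \<Longrightarrow> \<phi> g = \<psi> g"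
  shows "lin M \<phi> f = lin M \<psi> f"
proof -
  interpret M: module K M by fact
  have "\<psi> \<in> carrier G \<rightarrow> carrier M" using assms(3,4) by (metis Pi_cong)
  then show ?thesis unfolding lin_def using assms supp_G[OF assms(2)]
    by (intro M.finsum_cong') (auto simp: Pi_iff subset_iff)
qed

lemma lin_linear:
  assumes "module K M" "module K N" "f \<in> carrier F" "\<phi> \<in> carrier G \<rightarrow> carrier M"
    and T: "\<And>x. x \<in> carrier M \<Longrightarrow> T x \<in> carrier N"
    "\<And>x y. x \<in> carrier M \<Longrightarrow> y \<in> carrier M \<Longrightarrow> T (x \<oplus>\<^bsub>M\<^esub> y) = T x \<oplus>\<^bsub>N\<^esub> T y"
    "\<And>c x. c \<in> carrier K \<Longrightarrow> x \<in> carrier M \<Longrightarrow> T (c \<odot>\<^bsub>M\<^esub> x) = c \<odot>\<^bsub>N\<^esub> T x"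
  shows "T (lin M \<phi> f) = lin N (\<lambda>g. T (\<phi> g)) f"
proof -
  interpret M: module K M by fact
  interpret N: module K N by fact
  have T0: "T \<zero>\<^bsub>M\<^esub> = \<zero>\<^bsub>N\<^esub>"
    using T(1)[of "\<zero>\<^bsub>M\<^esub>"] T(3)[of \<zero> "\<zero>\<^bsub>M\<^esub>"] by simp
  have "T (\<Oplus>\<^bsub>M\<^esub>g\<in>S. f g \<odot>\<^bsub>M\<^esub> \<phi> g) = (\<Oplus>\<^bsub>N\<^esub>g\<in>S. f g \<odot>\<^bsub>N\<^esub> T (\<phi> g))"
    if "finite S" "S \<subseteq> carrier G" for S
    using that
  proof (induction S rule: finite_induct)
    case empty
    then show ?case by (simp add: T0)
  next
    case (insert x S)
    then have m: "\<phi> x \<in> carrier M" "\<And>y. y \<in> S \<Longrightarrow> \<phi> y \<in> carrier M" using assms(4) by auto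
    moreover have "(\<Oplus>\<^bsub>M\<^esub>g\<in>S. f g \<odot>\<^bsub>M\<^esub> \<phi> g) \<in> carrier M"
      using m assms(3) by (intro M.finsum_closed) auto
    ultimately show ?case using insert assms(3)
      by (subst M.finsum_insert, simp_all, subst N.finsum_insert, simp_all add: T Pi_iff)
  qed
  then show ?thesis unfolding lin_def using supp_G[OF assms(3)] finite_supp[OF assms(3)] by simp
qed

lemma lin_fun_add:
  assumes "module K M" "f \<in> carrier F" "\<phi> \<in> carrier G \<rightarrow> carrier M" "\<psi> \<in> carrier G \<rightarrow> carrier M"
  shows "lin M (\<lambda>g. \<phi> g \<oplus>\<^bsub>M\<^esub> \<psi> g) f = lin M \<phi> f \<oplus>\<^bsub>M\<^esub> lin M \<psi> f"
proof -
  interpret M: module K M by fact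
  have m: "\<phi> g \<in> carrier M" "\<psi> g \<in> carrier M" if "f g \<noteq> \<zero>" for g
    using that assms supp_G[OF assms(2)] by auto
  have "lin M (\<lambda>g. \<phi> g \<oplus>\<^bsub>M\<^esub> \<psi> g) f
      = (\<Oplus>\<^bsub>M\<^esub>g\<in>{g. f g \<noteq> \<zero>}. f g \<odot>\<^bsub>M\<^esub> \<phi> g \<oplus>\<^bsub>M\<^esub> f g \<odot>\<^bsub>M\<^esub> \<psi> g)"
    unfolding lin_def using assms m by (intro M.finsum_cong') (auto simp: M.smult_r_distr)
  also have "\<dots> = lin M \<phi> f \<oplus>\<^bsub>M\<^esub> lin M \<psi> f"
    unfolding lin_def using assms m by (intro M.finsum_addf) auto
  finally show ?thesis .
qed

lemma lin_fun_smult: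
  assumes "module K M" "f \<in> carrier F" "\<phi> \<in> carrier G \<rightarrow> carrier M" "c \<in> carrier K"
  shows "lin M (\<lambda>g. c \<odot>\<^bsub>M\<^esub> \<phi> g) f = c \<odot>\<^bsub>M\<^esub> lin M \<phi> f"
proof -
  interpret M: module K M by fact
  show ?thesis
    by (rule lin_linear[OF assms(1,1-3), symmetric])
      (use assms(4) in \<open>auto simp: M.smult_r_distr M.smult_assoc1[symmetric] K.m_comm\<close>)
qed

text \<open>Convolution turns into iterated linear extension, so that associativity of the product
  is reduced to associativity in \<open>G\<close> under three nested extensions.\<close>

lemma lin_mult_nested:
  assumes "module K M" "f \<in> carrier F" "f' \<in> carrier F" "\<phi> \<in> carrier G \<rightarrow> carrier M"
  shows "lin M \<phi> (f \<otimes>\<^bsub>F\<^esub> f') = lin M (\<lambda>u. lin M (\<lambda>v. \<phi> (u \<otimes>\<^bsub>G\<^esub> v)) f') f"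
proof -
  interpret M: module K M by fact
  have \<phi>2: "\<phi> (u \<otimes>\<^bsub>G\<^esub> v) \<in> carrier M" if "f u \<noteq> \<zero>" "f' v \<noteq> \<zero>" for u v
    using that supp_G[OF assms(2)] supp_G[OF assms(3)] assms(4) by (auto simp: Pi_iff subset_iff)
  have "(\<Oplus>\<^bsub>M\<^esub>v\<in>{v. f' v \<noteq> \<zero>}. (f u \<otimes> f' v) \<odot>\<^bsub>M\<^esub> \<phi> (u \<otimes>\<^bsub>G\<^esub> v))
      = f u \<odot>\<^bsub>M\<^esub> lin M (\<lambda>v. \<phi> (u \<otimes>\<^bsub>G\<^esub> v)) f'" if "f u \<noteq> \<zero>" for u
  proof -
    have "f u \<odot>\<^bsub>M\<^esub> lin M (\<lambda>v. \<phi> (u \<otimes>\<^bsub>G\<^esub> v)) f'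
        = (\<Oplus>\<^bsub>M\<^esub>v\<in>{v. f' v \<noteq> \<zero>}. f u \<odot>\<^bsub>M\<^esub> (f' v \<odot>\<^bsub>M\<^esub> \<phi> (u \<otimes>\<^bsub>G\<^esub> v)))"
      unfolding lin_def using that assms \<phi>2 by (intro M.finsum_smult_ldistr) (auto simp: finite_supp)
    also have "\<dots> = (\<Oplus>\<^bsub>M\<^esub>v\<in>{v. f' v \<noteq> \<zero>}. (f u \<otimes> f' v) \<odot>\<^bsub>M\<^esub> \<phi> (u \<otimes>\<^bsub>G\<^esub> v))"
      using that assms \<phi>2 by (intro M.finsum_cong') (auto simp: M.smult_assoc1)
    finally show ?thesis by simp
  qed
  moreover have "(\<Oplus>\<^bsub>M\<^esub>v\<in>{v. f' v \<noteq> \<zero>}. (f u \<otimes> f' v) \<odot>\<^bsub>M\<^esub> \<phi> (u \<otimes>\<^bsub>G\<^esub> v)) \<in> carrier M"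
    if "f u \<noteq> \<zero>" for u
    using that assms \<phi>2 by (intro M.finsum_closed) auto
  ultimately show ?thesis
    unfolding lin_mult[OF assms] lin_def[of M "\<lambda>u. lin M (\<lambda>v. \<phi> (u \<otimes>\<^bsub>G\<^esub> v)) f'" f]
    by (intro M.finsum_cong') auto
qed

text \<open>Coefficient extraction is itself a linear extension by \<open>apply_eq_lin\<close>,
  hence scalar-valued extensions separate elements. The algebra axioms are verified after applying
  such a functional.\<close>

lemma ext_lin:
  assumes "f \<in> carrier F" "f' \<in> carrier F"
    and "\<And>\<phi>. \<phi> \<in> carrier G \<rightarrow> carrier (regular_module K) \<Longrightarrow>
      lin (regular_module K) \<phi> f = lin (regular_module K) \<phi> f'"
  shows "f = f'"
proof
  fix g
  have "(\<lambda>h. delta K h g) \<in> carrier G \<rightarrow> carrier (regular_module K)"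
    by (auto simp: delta_def regular_module_def)
  then show "f g = f' g"
    unfolding apply_eq_lin[OF assms(1), of g] apply_eq_lin[OF assms(2), of g] by (rule assms(3))
qed

lemma abelian_group_F: "abelian_group F"
proof (rule abelian_groupI)
  show "\<exists>y\<in>carrier F. y \<oplus>\<^bsub>F\<^esub> x = \<zero>\<^bsub>F\<^esub>" if "x \<in> carrier F" for x
  proof (intro bexI[of _ "\<lambda>g. \<ominus> x g"])
    show "(\<lambda>g. \<ominus> x g) \<in> carrier F" using that
      by (auto simp: carrier_F intro: rev_finite_subset)
  qed (use that in \<open>auto simp: F_simps K.l_neg\<close>)
  show "\<zero>\<^bsub>F\<^esub> \<in> carrier F" by (simp add: F_simps carrier_F)
  show "x \<oplus>\<^bsub>F\<^esub> y \<in> carrier F" if "x \<in> carrier F" "y \<in> carrier F" for x y using that by simp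
qed (auto simp: F_simps K.a_ac)

lemma module_F: "module K F"
proof (rule moduleI[OF K.cring_axioms abelian_group_F])
  show "a \<odot>\<^bsub>F\<^esub> x \<in> carrier F" if "a \<in> carrier K" "x \<in> carrier F" for a x using that by simp
qed (auto simp: F_simps K.l_distr K.r_distr K.m_assoc)

lemma assoc_algebra_F: "assoc_algebra K F"
proof -
  let ?K = "regular_module K"
  have K: "module K ?K" by (rule module_regular) (rule K.cring_axioms)
  interpret M: module K ?K by (rule K)
  interpret FM: module K F by (rule module_F)
  have nested: "(\<lambda>u. lin ?K (\<lambda>v. \<phi> (u \<otimes>\<^bsub>G\<^esub> v)) f) \<in> carrier G \<rightarrow> carrier ?K"
    if "f \<in> carrier F" "\<phi> \<in> carrier G \<rightarrow> carrier ?K" for f \<phi>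
    using that by (intro Pi_I lin_closed[OF K]) (auto simp: Pi_iff)
  have trans: "(\<lambda>v. \<phi> (u \<otimes>\<^bsub>G\<^esub> v)) \<in> carrier G \<rightarrow> carrier ?K"
    if "\<phi> \<in> carrier G \<rightarrow> carrier ?K" "u \<in> carrier G" for u \<phi>
    using that by (auto simp: Pi_iff)
  show ?thesis
  proof (rule assoc_algebraI[OF K.cring_axioms abelian_group_F])
    fix x y z c assume x: "x \<in> carrier F"
    have one: "\<one>\<^bsub>F\<^esub> = delta K \<one>\<^bsub>G\<^esub>" by (simp add: F_simps)
    show "\<one>\<^bsub>F\<^esub> \<otimes>\<^bsub>F\<^esub> x = x"
    proof (rule ext_lin)
      fix \<phi> assume p: "\<phi> \<in> carrier G \<rightarrow> carrier ?K"
      show "lin ?K \<phi> (\<one>\<^bsub>F\<^esub> \<otimes>\<^bsub>F\<^esub> x) = lin ?K \<phi> x"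
        using x p unfolding one
        by (simp add: lin_mult_nested[OF K] lin_delta[OF K nested])
          (rule lin_cong[OF K x trans], auto)
    qed (use x one in auto)
    show "x \<otimes>\<^bsub>F\<^esub> \<one>\<^bsub>F\<^esub> = x"
    proof (rule ext_lin)
      fix \<phi> assume p: "\<phi> \<in> carrier G \<rightarrow> carrier ?K"
      have "lin ?K \<phi> (x \<otimes>\<^bsub>F\<^esub> \<one>\<^bsub>F\<^esub>) = lin ?K (\<lambda>u. lin ?K (\<lambda>v. \<phi> (u \<otimes>\<^bsub>G\<^esub> v)) \<one>\<^bsub>F\<^esub>) x"
        using x p one by (intro lin_mult_nested[OF K]) auto
      also have "\<dots> = lin ?K \<phi> x"
        using x p one by (intro lin_cong[OF K x nested]) (auto simp: lin_delta[OF K trans])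
      finally show "lin ?K \<phi> (x \<otimes>\<^bsub>F\<^esub> \<one>\<^bsub>F\<^esub>) = lin ?K \<phi> x" .
    qed (use x one in auto)
    {
    assume y: "y \<in> carrier F"
    assume z: "z \<in> carrier F"
    show "x \<otimes>\<^bsub>F\<^esub> y \<otimes>\<^bsub>F\<^esub> z = x \<otimes>\<^bsub>F\<^esub> (y \<otimes>\<^bsub>F\<^esub> z)"
    proof (rule ext_lin)
      fix \<phi> assume p: "\<phi> \<in> carrier G \<rightarrow> carrier ?K"
      have "lin ?K \<phi> (x \<otimes>\<^bsub>F\<^esub> y \<otimes>\<^bsub>F\<^esub> z)
          = lin ?K (\<lambda>u. lin ?K (\<lambda>v. lin ?K (\<lambda>w. \<phi> (u \<otimes>\<^bsub>G\<^esub> v \<otimes>\<^bsub>G\<^esub> w)) z) y) x"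
        using x y z p nested[OF z p] by (simp add: lin_mult_nested[OF K])
      also have "\<dots> = lin ?K (\<lambda>u. lin ?K (\<lambda>v. lin ?K (\<lambda>w. \<phi> (u \<otimes>\<^bsub>G\<^esub> (v \<otimes>\<^bsub>G\<^esub> w))) z) y) x"
      proof (rule lin_cong[OF K x nested[OF y nested[OF z p]]])
        fix u assume u: "u \<in> carrier G"
        show "lin ?K (\<lambda>v. lin ?K (\<lambda>w. \<phi> (u \<otimes>\<^bsub>G\<^esub> v \<otimes>\<^bsub>G\<^esub> w)) z) y
            = lin ?K (\<lambda>v. lin ?K (\<lambda>w. \<phi> (u \<otimes>\<^bsub>G\<^esub> (v \<otimes>\<^bsub>G\<^esub> w))) z) y"
          by (rule lin_cong[OF K y trans[OF nested[OF z p] u]], rule lin_cong[OF K z])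
            (use u p in \<open>auto simp: G.m_assoc Pi_iff\<close>)
      qed
      also have "\<dots> = lin ?K (\<lambda>u. lin ?K (\<lambda>x. \<phi> (u \<otimes>\<^bsub>G\<^esub> x)) (y \<otimes>\<^bsub>F\<^esub> z)) x"
        using x y z p
        by (intro lin_cong[OF K x, symmetric] nested)
          (auto simp: lin_mult_nested[OF K y z trans[OF p]])
      also have "\<dots> = lin ?K \<phi> (x \<otimes>\<^bsub>F\<^esub> (y \<otimes>\<^bsub>F\<^esub> z))"
        using x y z p by (simp add: lin_mult_nested[OF K])
      finally show "lin ?K \<phi> (x \<otimes>\<^bsub>F\<^esub> y \<otimes>\<^bsub>F\<^esub> z) = lin ?K \<phi> (x \<otimes>\<^bsub>F\<^esub> (y \<otimes>\<^bsub>F\<^esub> z))" .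
    qed (use x y z in auto)
    show "(x \<oplus>\<^bsub>F\<^esub> y) \<otimes>\<^bsub>F\<^esub> z = x \<otimes>\<^bsub>F\<^esub> z \<oplus>\<^bsub>F\<^esub> y \<otimes>\<^bsub>F\<^esub> z"
    proof (rule ext_lin)
      fix \<phi> assume p: "\<phi> \<in> carrier G \<rightarrow> carrier ?K"
      show "lin ?K \<phi> ((x \<oplus>\<^bsub>F\<^esub> y) \<otimes>\<^bsub>F\<^esub> z) = lin ?K \<phi> (x \<otimes>\<^bsub>F\<^esub> z \<oplus>\<^bsub>F\<^esub> y \<otimes>\<^bsub>F\<^esub> z)"
        using x y z p nested[OF z p] by (simp add: lin_mult_nested[OF K] lin_add[OF K])
    qed (use x y z in auto)
    show "z \<otimes>\<^bsub>F\<^esub> (x \<oplus>\<^bsub>F\<^esub> y) = z \<otimes>\<^bsub>F\<^esub> x \<oplus>\<^bsub>F\<^esub> z \<otimes>\<^bsub>F\<^esub> y"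
    proof (rule ext_lin)
      fix \<phi> assume p: "\<phi> \<in> carrier G \<rightarrow> carrier ?K"
      have "lin ?K \<phi> (z \<otimes>\<^bsub>F\<^esub> (x \<oplus>\<^bsub>F\<^esub> y))
          = lin ?K (\<lambda>u. lin ?K (\<lambda>v. \<phi> (u \<otimes>\<^bsub>G\<^esub> v)) (x \<oplus>\<^bsub>F\<^esub> y)) z"
        using x y z p by (simp add: lin_mult_nested[OF K])
      also have "\<dots> = lin ?K (\<lambda>u. lin ?K (\<lambda>v. \<phi> (u \<otimes>\<^bsub>G\<^esub> v)) x \<oplus>\<^bsub>?K\<^esub> lin ?K (\<lambda>v. \<phi> (u \<otimes>\<^bsub>G\<^esub> v)) y) z"
        using x y z p
        by (intro lin_cong[OF K z nested]) (auto simp: lin_add[OF K x y trans[OF p]])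
      also have "\<dots> = lin ?K \<phi> (z \<otimes>\<^bsub>F\<^esub> x \<oplus>\<^bsub>F\<^esub> z \<otimes>\<^bsub>F\<^esub> y)"
        using x y z p nested[OF x p] nested[OF y p]
        by (simp add: lin_mult_nested[OF K] lin_add[OF K] lin_fun_add[OF K])
      finally show "lin ?K \<phi> (z \<otimes>\<^bsub>F\<^esub> (x \<oplus>\<^bsub>F\<^esub> y)) = lin ?K \<phi> (z \<otimes>\<^bsub>F\<^esub> x \<oplus>\<^bsub>F\<^esub> z \<otimes>\<^bsub>F\<^esub> y)" .
    qed (use x y z in auto)
    }
    assume y: "y \<in> carrier F" and c: "c \<in> carrier K"
    show "(c \<odot>\<^bsub>F\<^esub> x) \<otimes>\<^bsub>F\<^esub> y = c \<odot>\<^bsub>F\<^esub> (x \<otimes>\<^bsub>F\<^esub> y)"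
    proof (rule ext_lin)
      fix \<phi> assume p: "\<phi> \<in> carrier G \<rightarrow> carrier ?K"
      show "lin ?K \<phi> ((c \<odot>\<^bsub>F\<^esub> x) \<otimes>\<^bsub>F\<^esub> y) = lin ?K \<phi> (c \<odot>\<^bsub>F\<^esub> (x \<otimes>\<^bsub>F\<^esub> y))"
        using x y c p nested[OF y p] by (simp add: lin_mult_nested[OF K] lin_smult[OF K])
    qed (use x y c in auto)
    show "x \<otimes>\<^bsub>F\<^esub> (c \<odot>\<^bsub>F\<^esub> y) = c \<odot>\<^bsub>F\<^esub> (x \<otimes>\<^bsub>F\<^esub> y)"
    proof (rule ext_lin)
      fix \<phi> assume p: "\<phi> \<in> carrier G \<rightarrow> carrier ?K"
      have "lin ?K \<phi> (x \<otimes>\<^bsub>F\<^esub> (c \<odot>\<^bsub>F\<^esub> y)) = lin ?K (\<lambda>u. lin ?K (\<lambda>v. \<phi> (u \<otimes>\<^bsub>G\<^esub> v)) (c \<odot>\<^bsub>F\<^esub> y)) x"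
        using x y c p by (simp add: lin_mult_nested[OF K])
      also have "\<dots> = lin ?K (\<lambda>u. c \<odot>\<^bsub>?K\<^esub> lin ?K (\<lambda>v. \<phi> (u \<otimes>\<^bsub>G\<^esub> v)) y) x"
        using x y c p by (intro lin_cong[OF K x nested]) (auto simp: lin_smult[OF K y c trans[OF p]])
      also have "\<dots> = lin ?K \<phi> (c \<odot>\<^bsub>F\<^esub> (x \<otimes>\<^bsub>F\<^esub> y))"
        using x y c p nested[OF y p]
        by (simp add: lin_mult_nested[OF K] lin_smult[OF K] lin_fun_smult[OF K])
      finally show "lin ?K \<phi> (x \<otimes>\<^bsub>F\<^esub> (c \<odot>\<^bsub>F\<^esub> y)) = lin ?K \<phi> (c \<odot>\<^bsub>F\<^esub> (x \<otimes>\<^bsub>F\<^esub> y))" .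
    qed (use x y c in auto)
  qed (auto simp: FM.smult_l_distr FM.smult_r_distr FM.smult_assoc1 F_simps(4))
qed

lemma lin_alg_hom:
  assumes "assoc_algebra K B" "\<And>g. g \<in> carrier G \<Longrightarrow> \<phi> g \<in> carrier B"
    and "\<And>g h. g \<in> carrier G \<Longrightarrow> h \<in> carrier G \<Longrightarrow> \<phi> (g \<otimes>\<^bsub>G\<^esub> h) = \<phi> g \<otimes>\<^bsub>B\<^esub> \<phi> h"
    and "\<phi> \<one>\<^bsub>G\<^esub> = \<one>\<^bsub>B\<^esub>"
  shows "lin B \<phi> \<in> alg_hom K F B"
proof -
  interpret B: assoc_algebra K B by fact
  have M: "module K B" by (rule B.module_A)
  have \<phi>: "\<phi> \<in> carrier G \<rightarrow> carrier B" using assms by auto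
  show ?thesis
  proof (rule alg_homI)
    fix x y assume x: "x \<in> carrier F" and y: "y \<in> carrier F"
    have lx: "lin B \<phi> x \<in> carrier B" "lin B \<phi> y \<in> carrier B"
      using x y by (auto intro: lin_closed[OF M _ \<phi>])
    have "lin B \<phi> (x \<otimes>\<^bsub>F\<^esub> y) = lin B (\<lambda>u. lin B (\<lambda>v. \<phi> (u \<otimes>\<^bsub>G\<^esub> v)) y) x"
      by (rule lin_mult_nested[OF M x y \<phi>])
    also have "\<dots> = lin B (\<lambda>u. \<phi> u \<otimes>\<^bsub>B\<^esub> lin B \<phi> y) x"
    proof (rule lin_cong[OF M x])
      show "(\<lambda>u. lin B (\<lambda>v. \<phi> (u \<otimes>\<^bsub>G\<^esub> v)) y) \<in> carrier G \<rightarrow> carrier B"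
        using \<phi> y by (intro Pi_I lin_closed[OF M]) (auto simp: Pi_iff)
      fix u assume u: "u \<in> carrier G"
      have "\<phi> u \<otimes>\<^bsub>B\<^esub> lin B \<phi> y = lin B (\<lambda>v. \<phi> u \<otimes>\<^bsub>B\<^esub> \<phi> v) y"
        using u assms(2)
        by (intro lin_linear[OF M M y \<phi>]) (auto simp: B.smult_mult_right B.r_distr)
      also have "\<dots> = lin B (\<lambda>v. \<phi> (u \<otimes>\<^bsub>G\<^esub> v)) y"
        using u assms by (intro lin_cong[OF M y]) auto
      finally show "lin B (\<lambda>v. \<phi> (u \<otimes>\<^bsub>G\<^esub> v)) y = \<phi> u \<otimes>\<^bsub>B\<^esub> lin B \<phi> y" by simp
    qed
    also have "\<dots> = lin B \<phi> x \<otimes>\<^bsub>B\<^esub> lin B \<phi> y"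
      by (rule lin_linear[OF M M x \<phi>, symmetric]) (use lx in \<open>auto simp: B.smult_mult_left B.l_distr\<close>)
    finally show "lin B \<phi> (x \<otimes>\<^bsub>F\<^esub> y) = lin B \<phi> x \<otimes>\<^bsub>B\<^esub> lin B \<phi> y" .
  qed (use \<phi> assms in \<open>auto simp: lin_closed[OF M] lin_add[OF M] lin_smult[OF M] F_simps(4) lin_delta[OF M]\<close>)
qed

lemma F_induct [consumes 1, case_names zero step]:
  assumes "f \<in> carrier F" "P \<zero>\<^bsub>F\<^esub>"
    and "\<And>c g f. c \<in> carrier K \<Longrightarrow> g \<in> carrier G \<Longrightarrow> f \<in> carrier F \<Longrightarrow> P f
      \<Longrightarrow> P (c \<odot>\<^bsub>F\<^esub> delta K g \<oplus>\<^bsub>F\<^esub> f)"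
  shows "P f"
proof -
  have "\<And>f. f \<in> carrier F \<Longrightarrow> {g. f g \<noteq> \<zero>} \<subseteq> S \<Longrightarrow> P f" if "finite S" for S
    using that
  proof (induction S rule: finite_induct)
    case empty
    then have "f = \<zero>\<^bsub>F\<^esub>" by (auto simp: F_simps)
    then show ?case using assms(2) by simp
  next
    case (insert g S)
    show ?case
    proof (cases "g \<in> carrier G")
      case False
      then show ?thesis using insert supp_G[of f] by (intro insert.IH) auto
    next
      case True
      define f' where "f' = f(g := \<zero>)"
      have f': "f' \<in> carrier F" using insert.prems(1)
        by (auto simp: carrier_F f'_def intro: rev_finite_subset)
      moreover have "P f'" using insert by (intro insert.IH f') (auto simp: f'_def)
      ultimately have "P (f g \<odot>\<^bsub>F\<^esub> delta K g \<oplus>\<^bsub>F\<^esub> f')" using insert.prems True by (intro assms(3)) auto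
      moreover have "f g \<odot>\<^bsub>F\<^esub> delta K g \<oplus>\<^bsub>F\<^esub> f' = f"
        using insert.prems by (auto simp: F_simps f'_def delta_def)
      ultimately show ?thesis by simp
    qed
  qed
  then show ?thesis using finite_supp[OF assms(1)] assms(1) by blast
qed

lemma delta_mult:
  assumes "g \<in> carrier G" "h \<in> carrier G"
  shows "delta K g \<otimes>\<^bsub>F\<^esub> delta K h = delta K (g \<otimes>\<^bsub>G\<^esub> h)"
proof (rule ext_lin)
  have K: "module K (regular_module K)" by (rule module_regular) (rule K.cring_axioms)
  fix \<phi> assume p: "\<phi> \<in> carrier G \<rightarrow> carrier (regular_module K)"
  have "(\<lambda>u. lin (regular_module K) (\<lambda>v. \<phi> (u \<otimes>\<^bsub>G\<^esub> v)) (delta K h)) \<in> carrier G \<rightarrow> carrier (regular_module K)"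
    using assms p by (intro Pi_I lin_closed[OF K]) (auto simp: Pi_iff)
  moreover have "(\<lambda>v. \<phi> (g \<otimes>\<^bsub>G\<^esub> v)) \<in> carrier G \<rightarrow> carrier (regular_module K)"
    using assms p by (auto simp: Pi_iff)
  ultimately show "lin (regular_module K) \<phi> (delta K g \<otimes>\<^bsub>F\<^esub> delta K h)
      = lin (regular_module K) \<phi> (delta K (g \<otimes>\<^bsub>G\<^esub> h))"
    using assms p by (simp add: lin_mult_nested[OF K] lin_delta[OF K])
qed (use assms in auto)

end

section \<open>The algebra presented by the relations of the quantum group\<close>

text \<open>The seven relations are each solved for one word. Every word on a right-hand side is
  irreducible for the others, so they serve as terminating rewrite rules.\<close>

definition sl2_tuple ::
  "('k, 'x) ring_scheme \<Rightarrow> 'k \<Rightarrow> 'k \<Rightarrow> ('k, 'b) module \<Rightarrow> (sl2_gen \<Rightarrow> 'b) \<Rightarrow> bool" where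
  "sl2_tuple K p q B w \<longleftrightarrow> (\<forall>g. w g \<in> carrier B) \<and>
    w Gb \<otimes>\<^bsub>B\<^esub> w Ga = q \<odot>\<^bsub>B\<^esub> (w Ga \<otimes>\<^bsub>B\<^esub> w Gb) \<and>
    w Gc \<otimes>\<^bsub>B\<^esub> w Ga = p \<odot>\<^bsub>B\<^esub> (w Ga \<otimes>\<^bsub>B\<^esub> w Gc) \<and>
    w Gd \<otimes>\<^bsub>B\<^esub> w Gb = q \<odot>\<^bsub>B\<^esub> (w Gb \<otimes>\<^bsub>B\<^esub> w Gd) \<and>
    w Gd \<otimes>\<^bsub>B\<^esub> w Gc = p \<odot>\<^bsub>B\<^esub> (w Gc \<otimes>\<^bsub>B\<^esub> w Gd) \<and>
    w Gc \<otimes>\<^bsub>B\<^esub> w Gb = w Gb \<otimes>\<^bsub>B\<^esub> w Gc \<and>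
    w Ga \<otimes>\<^bsub>B\<^esub> w Gd = \<one>\<^bsub>B\<^esub> \<oplus>\<^bsub>B\<^esub> inv\<^bsub>K\<^esub> p \<odot>\<^bsub>B\<^esub> (w Gb \<otimes>\<^bsub>B\<^esub> w Gc) \<and>
    w Gd \<otimes>\<^bsub>B\<^esub> w Ga = \<one>\<^bsub>B\<^esub> \<oplus>\<^bsub>B\<^esub> q \<odot>\<^bsub>B\<^esub> (w Gb \<otimes>\<^bsub>B\<^esub> w Gc)"

lemma (in abelian_group) diff_eq_zero_iff:
  assumes "x \<in> carrier G" "y \<in> carrier G"
  shows "x \<ominus> y = \<zero> \<longleftrightarrow> x = y"
  using assms by (metis a_minus_def minus_equality minus_minus r_neg a_inv_closed)

lemma (in abelian_group) diff_diff_eq_zero_iff: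
  assumes "x \<in> carrier G" "y \<in> carrier G" "z \<in> carrier G"
  shows "x \<ominus> y \<ominus> z = \<zero> \<longleftrightarrow> x = z \<oplus> y"
proof -
  have "x \<ominus> y \<ominus> z = x \<ominus> (z \<oplus> y)" using assms by (simp add: a_minus_def minus_add a_ac)
  then show ?thesis using assms by (simp add: diff_eq_zero_iff)
qed

lemma word_monoid_simps [simp]:
  "carrier word_monoid = UNIV" "\<one>\<^bsub>word_monoid\<^esub> = []" "u \<otimes>\<^bsub>word_monoid\<^esub> v = u @ v"
  by (simp_all add: word_monoid_def)

locale quantum_sl2 = K: field K for K :: "('k, 'x) ring_scheme" (structure) +
  fixes p q :: 'k
  assumes p: "p \<in> Units K" and q: "q \<in> Units K"
begin

sublocale W: monoid_alg K "word_monoid :: sl2_gen list monoid"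
  by unfold_locales auto

abbreviation "A \<equiv> O_SL2 K p q"
abbreviation "gen \<equiv> O_SL2_gen K p q"

lemma pq_closed [simp]: "p \<in> carrier K" "q \<in> carrier K" "inv p \<in> carrier K" "inv q \<in> carrier K"
  using p q by auto

lemma pq_inv: "p \<otimes> inv p = \<one>" "q \<otimes> inv q = \<one>" "inv p \<otimes> p = \<one>" "inv q \<otimes> q = \<one>"
  using p q by auto

lemma free: "free_algebra K = W.F" by (simp add: free_algebra_def)

sublocale Fr: k_algebra K W.F by (simp add: k_algebra_def W.assoc_algebra_F)

lemma word_closed [simp]: "delta K (w :: sl2_gen list) \<in> carrier W.F"
  by (rule W.delta_closed) (simp add: word_monoid_def)

lemma word_append: "delta K (v @ w :: sl2_gen list) = delta K v \<otimes>\<^bsub>W.F\<^esub> delta K w"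
  using W.delta_mult[of v w] by simp

lemma rels_closed: "sl2_rels K p q \<subseteq> carrier W.F"
  by (simp add: sl2_rels_def free Let_def)

lemma ideal_sl2: "ideal (sl2_ideal K p q) W.F"
  unfolding sl2_ideal_def free by (rule Fr.genideal_ideal) (rule rels_closed)

lemma A_eq: "A = quot_mod W.F (sl2_ideal K p q)"
  by (simp add: O_SL2_def free)

sublocale A: k_algebra K A
  unfolding k_algebra_def A_eq by (rule Fr.assoc_algebra_quot) (rule ideal_sl2)

lemma gen_eq: "gen g = sl2_ideal K p q +>\<^bsub>W.F\<^esub> delta K [g]"
  by (simp add: O_SL2_gen_def free)

lemma proj: "(\<lambda>x. sl2_ideal K p q +>\<^bsub>W.F\<^esub> x) \<in> alg_hom K W.F A"
  unfolding A_eq by (rule Fr.coset_hom) (rule ideal_sl2)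

lemma gen_closed [simp]: "gen g \<in> carrier A"
  unfolding gen_eq by (rule alg_homD(1)[OF proj]) simp

lemma gen_mult: "gen g \<otimes>\<^bsub>A\<^esub> gen h = sl2_ideal K p q +>\<^bsub>W.F\<^esub> delta K [g, h]"
  unfolding gen_eq using word_append[of "[g]" "[h]"]
  by (simp add: alg_homD(2)[OF proj, symmetric])

lemma sl2_tuple_gen: "sl2_tuple K p q A gen"
proof -
  let ?I = "sl2_ideal K p q"
  have eq: "?I +>\<^bsub>W.F\<^esub> x = ?I +>\<^bsub>W.F\<^esub> y"
    if "x \<in> carrier W.F" "y \<in> carrier W.F" "x \<ominus>\<^bsub>W.F\<^esub> y \<in> sl2_rels K p q" for x y
    using that rels_closed Fr.genideal_self[OF rels_closed]
    by (intro quot_mod_coset_eq[OF ideal_sl2]) (auto simp: sl2_ideal_def free)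
  have eq2: "?I +>\<^bsub>W.F\<^esub> x = ?I +>\<^bsub>W.F\<^esub> (\<one>\<^bsub>W.F\<^esub> \<oplus>\<^bsub>W.F\<^esub> y)"
    if "x \<in> carrier W.F" "y \<in> carrier W.F" "x \<ominus>\<^bsub>W.F\<^esub> y \<ominus>\<^bsub>W.F\<^esub> \<one>\<^bsub>W.F\<^esub> \<in> sl2_rels K p q" for x y
  proof (rule eq)
    have "x \<ominus>\<^bsub>W.F\<^esub> (\<one>\<^bsub>W.F\<^esub> \<oplus>\<^bsub>W.F\<^esub> y) = x \<ominus>\<^bsub>W.F\<^esub> y \<ominus>\<^bsub>W.F\<^esub> \<one>\<^bsub>W.F\<^esub>"
      using that by (simp add: a_minus_def Fr.minus_add Fr.a_ac)
    then show "x \<ominus>\<^bsub>W.F\<^esub> (\<one>\<^bsub>W.F\<^esub> \<oplus>\<^bsub>W.F\<^esub> y) \<in> sl2_rels K p q" using that by simp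
  qed (use that in auto)
  note h = alg_homD(2-5)[OF proj, symmetric]
  have w: "delta K (w :: sl2_gen list) \<in> carrier W.F" for w by simp
  show ?thesis
    unfolding sl2_tuple_def gen_mult
  proof (intro conjI allI)
    have "?I +>\<^bsub>W.F\<^esub> delta K [Gb, Gc] = ?I +>\<^bsub>W.F\<^esub> delta K [Gc, Gb]"
      by (rule eq) (simp_all add: sl2_rels_def free Let_def)
    then show "?I +>\<^bsub>W.F\<^esub> delta K [Gc, Gb] = ?I +>\<^bsub>W.F\<^esub> delta K [Gb, Gc]" by simp
  qed (simp_all add: h(1-3) h(4)[OF _ w] del: W.delta_closed,
    (rule eq eq2; simp add: sl2_rels_def free Let_def)+)
qed

text \<open>The algebra is spanned by the classes of words, and a word grows by a letter on the
  left. This is the induction by which homomorphisms out of the algebra are compared.\<close>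

lemma A_induct [consumes 1, case_names zero one smult add gen]:
  assumes "x \<in> carrier A" "P \<zero>\<^bsub>A\<^esub>" "P \<one>\<^bsub>A\<^esub>"
    and "\<And>c x. c \<in> carrier K \<Longrightarrow> x \<in> carrier A \<Longrightarrow> P x \<Longrightarrow> P (c \<odot>\<^bsub>A\<^esub> x)"
    and "\<And>x y. x \<in> carrier A \<Longrightarrow> y \<in> carrier A \<Longrightarrow> P x \<Longrightarrow> P y \<Longrightarrow> P (x \<oplus>\<^bsub>A\<^esub> y)"
    and "\<And>g x. x \<in> carrier A \<Longrightarrow> P x \<Longrightarrow> P (gen g \<otimes>\<^bsub>A\<^esub> x)"
  shows "P x"
proof -
  let ?\<pi> = "\<lambda>x. sl2_ideal K p q +>\<^bsub>W.F\<^esub> x"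
  note h = alg_homD[OF proj]
  have w: "P (?\<pi> (delta K w))" for w :: "sl2_gen list"
  proof (induction w)
    case Nil
    have "?\<pi> (delta K []) = \<one>\<^bsub>A\<^esub>" using h(4) by (simp add: W.F_simps)
    then show ?case using assms(3) by simp
  next
    case (Cons g w)
    have "?\<pi> (delta K (g # w)) = gen g \<otimes>\<^bsub>A\<^esub> ?\<pi> (delta K w)"
      using word_append[of "[g]" w] by (simp add: h(2)[symmetric] gen_eq)
    then show ?case using Cons assms(6) by (simp add: h(1))
  qed
  obtain f where f: "f \<in> carrier W.F" "x = ?\<pi> f"
    using assms(1) unfolding A_eq by (rule Fr.quot_carrierE)
  have "P (?\<pi> f)" using f(1)
  proof (induction f rule: W.F_induct)
    case zero
    then show ?case using assms(2) alg_hom_zero[OF Fr.ring_A A.ring_A proj] by simp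
  next
    case (step c g f)
    have "?\<pi> (c \<odot>\<^bsub>W.F\<^esub> delta K g \<oplus>\<^bsub>W.F\<^esub> f) = c \<odot>\<^bsub>A\<^esub> ?\<pi> (delta K g) \<oplus>\<^bsub>A\<^esub> ?\<pi> f"
      using step by (simp add: h)
    then show ?case using step w by (simp add: h(1) assms(4,5))
  qed
  with f show ?thesis by simp
qed

text \<open>The universal property of the presentation; the torus automorphisms, the operator
  representation and the exchange maps all come from it.\<close>

lemma A_lift:
  assumes B: "assoc_algebra K B" and t: "sl2_tuple K p q B w"
  shows "\<exists>h\<in>alg_hom K A B. \<forall>g. h (gen g) = w g"
proof -
  interpret B: assoc_algebra K B by (rule B)
  have w [simp]: "w g \<in> carrier B" for g using t by (simp add: sl2_tuple_def)
  define \<phi> where "\<phi> v = foldr (\<lambda>g x. w g \<otimes>\<^bsub>B\<^esub> x) v \<one>\<^bsub>B\<^esub>" for v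
  have \<phi>_closed [simp]: "\<phi> v \<in> carrier B" for v by (induction v) (auto simp: \<phi>_def)
  have \<phi>_append: "\<phi> (u @ v) = \<phi> u \<otimes>\<^bsub>B\<^esub> \<phi> v" for u v
    by (induction u) (use \<phi>_closed in \<open>auto simp: \<phi>_def B.m_assoc\<close>)
  have hom: "W.lin B \<phi> \<in> alg_hom K W.F B"
    by (rule W.lin_alg_hom[OF B]) (simp_all add: \<phi>_append, simp add: \<phi>_def)
  note h = alg_homD[OF hom]
  have ld: "W.lin B \<phi> (delta K v) = \<phi> v" for v
    by (rule W.lin_delta[OF B.module_A]) auto
  have \<phi>1: "\<phi> [g] = w g" "\<phi> [g, g'] = w g \<otimes>\<^bsub>B\<^esub> w g'" for g g' by (simp_all add: \<phi>_def)
  have d: "W.lin B \<phi> (x \<ominus>\<^bsub>W.F\<^esub> y) = W.lin B \<phi> x \<ominus>\<^bsub>B\<^esub> W.lin B \<phi> y"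
    if "x \<in> carrier W.F" "y \<in> carrier W.F" for x y
    by (rule alg_hom_diff[OF Fr.ring_A B.ring_A hom that])
  have t': "w Gb \<otimes>\<^bsub>B\<^esub> w Ga \<ominus>\<^bsub>B\<^esub> q \<odot>\<^bsub>B\<^esub> (w Ga \<otimes>\<^bsub>B\<^esub> w Gb) = \<zero>\<^bsub>B\<^esub>"
    "w Gc \<otimes>\<^bsub>B\<^esub> w Ga \<ominus>\<^bsub>B\<^esub> p \<odot>\<^bsub>B\<^esub> (w Ga \<otimes>\<^bsub>B\<^esub> w Gc) = \<zero>\<^bsub>B\<^esub>"
    "w Gd \<otimes>\<^bsub>B\<^esub> w Gb \<ominus>\<^bsub>B\<^esub> q \<odot>\<^bsub>B\<^esub> (w Gb \<otimes>\<^bsub>B\<^esub> w Gd) = \<zero>\<^bsub>B\<^esub>"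
    "w Gd \<otimes>\<^bsub>B\<^esub> w Gc \<ominus>\<^bsub>B\<^esub> p \<odot>\<^bsub>B\<^esub> (w Gc \<otimes>\<^bsub>B\<^esub> w Gd) = \<zero>\<^bsub>B\<^esub>"
    "w Gb \<otimes>\<^bsub>B\<^esub> w Gc \<ominus>\<^bsub>B\<^esub> w Gc \<otimes>\<^bsub>B\<^esub> w Gb = \<zero>\<^bsub>B\<^esub>"
    "w Ga \<otimes>\<^bsub>B\<^esub> w Gd \<ominus>\<^bsub>B\<^esub> inv p \<odot>\<^bsub>B\<^esub> (w Gb \<otimes>\<^bsub>B\<^esub> w Gc) \<ominus>\<^bsub>B\<^esub> \<one>\<^bsub>B\<^esub> = \<zero>\<^bsub>B\<^esub>"
    "w Gd \<otimes>\<^bsub>B\<^esub> w Ga \<ominus>\<^bsub>B\<^esub> q \<odot>\<^bsub>B\<^esub> (w Gb \<otimes>\<^bsub>B\<^esub> w Gc) \<ominus>\<^bsub>B\<^esub> \<one>\<^bsub>B\<^esub> = \<zero>\<^bsub>B\<^esub>"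
    by (rule iffD2[OF B.diff_eq_zero_iff] iffD2[OF B.diff_diff_eq_zero_iff];
      use t in \<open>simp add: sl2_tuple_def\<close>)+
  have "W.lin B \<phi> x = \<zero>\<^bsub>B\<^esub>" if "x \<in> sl2_rels K p q" for x
    using that unfolding sl2_rels_def Let_def free
    by (elim insertE emptyE; hypsubst; simp add: d h ld \<phi>1 t' del: One_nat_def)
  then have "W.lin B \<phi> x = \<zero>\<^bsub>B\<^esub>" if "x \<in> sl2_ideal K p q" for x
    using that alg_hom_genideal[OF Fr.assoc_algebra_axioms B hom rels_closed]
    by (auto simp: sl2_ideal_def free)
  from Fr.quot_lift[OF ideal_sl2 B hom this] obtain h' where
    "h' \<in> alg_hom K A B" "\<forall>x\<in>carrier W.F. h' (sl2_ideal K p q +>\<^bsub>W.F\<^esub> x) = W.lin B \<phi> x"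
    by (auto simp: A_eq)
  then show ?thesis by (intro bexI[of _ h']) (simp_all add: gen_eq ld \<phi>1)
qed

end

section \<open>Tensor products and the enveloping algebra\<close>

lemma op_alg_simps [simp]:
  "carrier (op_alg A) = carrier A" "one (op_alg A) = one A" "zero (op_alg A) = zero A"
  "add (op_alg A) = add A" "smult (op_alg A) = smult A" "x \<otimes>\<^bsub>op_alg A\<^esub> y = y \<otimes>\<^bsub>A\<^esub> x"
  by (simp_all add: op_alg_def)

lemma assoc_algebra_op:
  assumes "assoc_algebra K A"
  shows "assoc_algebra K (op_alg A)"
proof -
  interpret assoc_algebra K A by fact
  have ag: "abelian_group (op_alg A)"
  proof (rule abelian_groupI)
    show "\<exists>y\<in>carrier (op_alg A). y \<oplus>\<^bsub>op_alg A\<^esub> x = \<zero>\<^bsub>op_alg A\<^esub>" if "x \<in> carrier (op_alg A)" for x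
      using that by (intro bexI[of _ "\<ominus>\<^bsub>A\<^esub> x"]) (auto simp: M.l_neg)
  qed (auto simp: M.a_ac)
  show ?thesis
    by (rule assoc_algebraI[OF cring_K ag])
      (auto simp: m_assoc l_distr r_distr smult_l_distr smult_r_distr smult_assoc1
        smult_mult_left[symmetric] smult_mult_right[symmetric])
qed

locale tensor = A: k_algebra K A + B: k_algebra K B
  for K :: "('k, 'x) ring_scheme" (structure) and A :: "('k, 'a) module" and B :: "('k, 'b) module"
begin

sublocale F: monoid_alg K "A \<times>\<times> B"
proof -
  have "Group.monoid (A \<times>\<times> B)" by (rule DirProd_monoid) unfold_locales
  then show "monoid_alg K (A \<times>\<times> B)" by (simp add: monoid_alg_def A.cring_K)
qed

sublocale FA: k_algebra K F.F by (simp add: k_algebra_def F.assoc_algebra_F)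

abbreviation "T \<equiv> tensor_alg K A B"
abbreviation "pt \<equiv> pure_tensor K A B"
abbreviation "I \<equiv> tensor_ideal K A B"

lemma rels_closed: "bilinear_rels K A B \<subseteq> carrier F.F"
  unfolding bilinear_rels_def Let_def by auto

lemma ideal_I: "ideal I F.F"
  unfolding tensor_ideal_def by (rule FA.genideal_ideal) (rule rels_closed)

sublocale T: k_algebra K T
  unfolding k_algebra_def tensor_alg_def by (rule FA.assoc_algebra_quot) (rule ideal_I)

lemma proj: "(\<lambda>x. I +>\<^bsub>F.F\<^esub> x) \<in> alg_hom K F.F T"
  unfolding tensor_alg_def by (rule FA.coset_hom) (rule ideal_I)

lemma pt_closed [simp]: "x \<in> carrier A \<Longrightarrow> y \<in> carrier B \<Longrightarrow> pt x y \<in> carrier T"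
  unfolding pure_tensor_def by (rule alg_homD(1)[OF proj]) simp

lemma pt_one: "pt \<one>\<^bsub>A\<^esub> \<one>\<^bsub>B\<^esub> = \<one>\<^bsub>T\<^esub>"
  unfolding pure_tensor_def alg_homD(4)[OF proj, symmetric] by (simp add: F.F_simps carrier_DirProd)

lemma pt_mult:
  assumes "x \<in> carrier A" "y \<in> carrier B" "x' \<in> carrier A" "y' \<in> carrier B"
  shows "pt x y \<otimes>\<^bsub>T\<^esub> pt x' y' = pt (x \<otimes>\<^bsub>A\<^esub> x') (y \<otimes>\<^bsub>B\<^esub> y')"
  unfolding pure_tensor_def using assms F.delta_mult[of "(x, y)" "(x', y')"]
  by (simp add: alg_homD(2)[OF proj, symmetric] carrier_DirProd)

lemma rel_eq:
  assumes "x \<in> carrier F.F" "y \<in> carrier F.F" "x \<ominus>\<^bsub>F.F\<^esub> y \<in> bilinear_rels K A B"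
  shows "I +>\<^bsub>F.F\<^esub> x = I +>\<^bsub>F.F\<^esub> y"
  using assms rels_closed FA.genideal_self[OF rels_closed]
  by (intro quot_mod_coset_eq[OF ideal_I]) (auto simp: tensor_ideal_def)

lemma pt_add_left:
  assumes "x \<in> carrier A" "x' \<in> carrier A" "y \<in> carrier B"
  shows "pt (x \<oplus>\<^bsub>A\<^esub> x') y = pt x y \<oplus>\<^bsub>T\<^esub> pt x' y"
proof -
  have "I +>\<^bsub>F.F\<^esub> delta K (x \<oplus>\<^bsub>A\<^esub> x', y) = I +>\<^bsub>F.F\<^esub> (delta K (x, y) \<oplus>\<^bsub>F.F\<^esub> delta K (x', y))"
    by (rule rel_eq) (use assms in \<open>simp_all add: bilinear_rels_def Let_def, blast\<close>)
  then show ?thesis using assms by (simp add: pure_tensor_def alg_homD(3)[OF proj])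
qed

lemma pt_add_right:
  assumes "x \<in> carrier A" "y \<in> carrier B" "y' \<in> carrier B"
  shows "pt x (y \<oplus>\<^bsub>B\<^esub> y') = pt x y \<oplus>\<^bsub>T\<^esub> pt x y'"
proof -
  have "I +>\<^bsub>F.F\<^esub> delta K (x, y \<oplus>\<^bsub>B\<^esub> y') = I +>\<^bsub>F.F\<^esub> (delta K (x, y) \<oplus>\<^bsub>F.F\<^esub> delta K (x, y'))"
    by (rule rel_eq) (use assms in \<open>simp_all add: bilinear_rels_def Let_def, blast\<close>)
  then show ?thesis using assms by (simp add: pure_tensor_def alg_homD(3)[OF proj])
qed

lemma pt_smult:
  assumes "c \<in> carrier K" "x \<in> carrier A" "y \<in> carrier B"
  shows "pt (c \<odot>\<^bsub>A\<^esub> x) y = c \<odot>\<^bsub>T\<^esub> pt x y" "pt x (c \<odot>\<^bsub>B\<^esub> y) = c \<odot>\<^bsub>T\<^esub> pt x y"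
proof -
  have "I +>\<^bsub>F.F\<^esub> delta K (c \<odot>\<^bsub>A\<^esub> x, y) = I +>\<^bsub>F.F\<^esub> (c \<odot>\<^bsub>F.F\<^esub> delta K (x, y))"
    by (rule rel_eq) (use assms in \<open>simp_all add: bilinear_rels_def Let_def, blast\<close>)
  moreover have "I +>\<^bsub>F.F\<^esub> delta K (x, c \<odot>\<^bsub>B\<^esub> y) = I +>\<^bsub>F.F\<^esub> (c \<odot>\<^bsub>F.F\<^esub> delta K (x, y))"
    by (rule rel_eq) (use assms in \<open>simp_all add: bilinear_rels_def Let_def, blast\<close>)
  ultimately show "pt (c \<odot>\<^bsub>A\<^esub> x) y = c \<odot>\<^bsub>T\<^esub> pt x y" "pt x (c \<odot>\<^bsub>B\<^esub> y) = c \<odot>\<^bsub>T\<^esub> pt x y"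
    using assms by (simp_all add: pure_tensor_def alg_homD(5)[OF proj])
qed

lemma T_induct [consumes 1, case_names zero step]:
  assumes "t \<in> carrier T" "P \<zero>\<^bsub>T\<^esub>"
    and "\<And>x y t. x \<in> carrier A \<Longrightarrow> y \<in> carrier B \<Longrightarrow> t \<in> carrier T \<Longrightarrow> P t \<Longrightarrow> P (pt x y \<oplus>\<^bsub>T\<^esub> t)"
  shows "P t"
proof -
  let ?\<pi> = "\<lambda>x. I +>\<^bsub>F.F\<^esub> x"
  note h = alg_homD[OF proj]
  obtain f where f: "f \<in> carrier F.F" "t = ?\<pi> f"
    using assms(1) unfolding tensor_alg_def by (rule FA.quot_carrierE)
  have "P (?\<pi> f)" using f(1)
  proof (induction f rule: F.F_induct)
    case zero
    then show ?case using assms(2) alg_hom_zero[OF FA.ring_A T.ring_A proj] by simp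
  next
    case (step c g f)
    obtain x y where g: "g = (x, y)" "x \<in> carrier A" "y \<in> carrier B"
      using step by (auto simp: carrier_DirProd)
    have "?\<pi> (c \<odot>\<^bsub>F.F\<^esub> delta K g \<oplus>\<^bsub>F.F\<^esub> f) = pt (c \<odot>\<^bsub>A\<^esub> x) y \<oplus>\<^bsub>T\<^esub> ?\<pi> f"
      using step g by (simp add: h pt_smult(1)) (simp add: pure_tensor_def)
    then show ?case using step g by (simp add: h(1) assms(3))
  qed
  with f show ?thesis by simp
qed

text \<open>Two homomorphisms with commuting images induce one on the tensor product. The last
  conclusion gives its value on an arbitrary formal combination of pairs; it is needed to recognise
  \<open>env_action\<close>, which is defined through such representatives.\<close>

lemma T_lift_lin:
  assumes C: "assoc_algebra K C" and f: "f \<in> alg_hom K A C" and g: "g \<in> alg_hom K B C"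
    and comm: "\<And>x y. x \<in> carrier A \<Longrightarrow> y \<in> carrier B \<Longrightarrow> g y \<otimes>\<^bsub>C\<^esub> f x = f x \<otimes>\<^bsub>C\<^esub> g y"
  shows "\<exists>h\<in>alg_hom K T C. (\<forall>x\<in>carrier A. \<forall>y\<in>carrier B. h (pt x y) = f x \<otimes>\<^bsub>C\<^esub> g y)
    \<and> (\<forall>u\<in>carrier F.F. h (I +>\<^bsub>F.F\<^esub> u) = F.lin C (\<lambda>z. f (fst z) \<otimes>\<^bsub>C\<^esub> g (snd z)) u)"
proof -
  interpret C: assoc_algebra K C by (rule C)
  note fh = alg_homD[OF f] and gh = alg_homD[OF g]
  let ?\<phi> = "\<lambda>z. f (fst z) \<otimes>\<^bsub>C\<^esub> g (snd z)"
  have hom: "F.lin C ?\<phi> \<in> alg_hom K F.F C"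
  proof (rule F.lin_alg_hom[OF C])
    fix u v assume "u \<in> carrier (A \<times>\<times> B)" "v \<in> carrier (A \<times>\<times> B)"
    then obtain x y x' y' where uv: "u = (x, y)" "v = (x', y')" "x \<in> carrier A" "y \<in> carrier B"
      "x' \<in> carrier A" "y' \<in> carrier B" by (auto simp: carrier_DirProd)
    have "f x \<otimes>\<^bsub>C\<^esub> (f x' \<otimes>\<^bsub>C\<^esub> (g y \<otimes>\<^bsub>C\<^esub> g y')) = f x \<otimes>\<^bsub>C\<^esub> (g y \<otimes>\<^bsub>C\<^esub> (f x' \<otimes>\<^bsub>C\<^esub> g y'))"
      using uv comm[of x' y] by (simp add: fh(1) gh(1) C.m_assoc[symmetric])
    then show "?\<phi> (u \<otimes>\<^bsub>A \<times>\<times> B\<^esub> v) = ?\<phi> u \<otimes>\<^bsub>C\<^esub> ?\<phi> v"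
      using uv by (simp add: carrier_DirProd fh gh C.m_assoc)
  qed (auto simp: carrier_DirProd fh gh)
  note h = alg_homD[OF hom]
  have ld: "F.lin C ?\<phi> (delta K (x, y)) = f x \<otimes>\<^bsub>C\<^esub> g y" if "x \<in> carrier A" "y \<in> carrier B" for x y
    using that by (subst F.lin_delta[OF C.module_A]) (auto simp: carrier_DirProd fh gh)
  have "F.lin C ?\<phi> x = \<zero>\<^bsub>C\<^esub>" if "x \<in> bilinear_rels K A B" for x
    using that unfolding bilinear_rels_def Let_def
    by (elim UnE CollectE exE conjE)
      (simp_all add: alg_hom_diff[OF FA.ring_A C.ring_A hom] h ld fh gh C.l_distr C.r_distr C.diff_eq_zero_iff
        C.smult_mult_left[symmetric] C.smult_mult_right[symmetric])
  then have "F.lin C ?\<phi> x = \<zero>\<^bsub>C\<^esub>" if "x \<in> I" for x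
    using that alg_hom_genideal[OF FA.assoc_algebra_axioms C hom rels_closed]
    by (auto simp: tensor_ideal_def)
  from FA.quot_lift[OF ideal_I C hom this] obtain h' where
    "h' \<in> alg_hom K T C" "\<forall>x\<in>carrier F.F. h' (I +>\<^bsub>F.F\<^esub> x) = F.lin C ?\<phi> x"
    by (auto simp: tensor_alg_def)
  then show ?thesis by (intro bexI[of _ h']) (simp_all add: pure_tensor_def ld)
qed

end

locale enveloping = k_algebra K A for K :: "('k, 'x) ring_scheme" (structure) and A :: "('k, 'a) module"
begin

lemma op: "k_algebra K (op_alg A)"
  unfolding k_algebra_def by (rule assoc_algebra_op) (rule assoc_algebra_axioms)

sublocale T: tensor K A "op_alg A"
  unfolding tensor_def using op k_algebra_axioms by simp

abbreviation "R \<equiv> env_alg K A"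
abbreviation "et \<equiv> env_tensor K A"

lemma R_eq: "R = T.T" by (simp add: env_alg_def)
lemma et_eq: "et = T.pt" by (simp add: env_tensor_def)

sublocale R: k_algebra K R
  unfolding R_eq by (rule T.T.k_algebra_axioms)

lemma et_closed [simp]: "x \<in> carrier A \<Longrightarrow> y \<in> carrier A \<Longrightarrow> et x y \<in> carrier R"
  unfolding R_eq et_eq by simp

lemma et_one: "et \<one>\<^bsub>A\<^esub> \<one>\<^bsub>A\<^esub> = \<one>\<^bsub>R\<^esub>"
  using T.pt_one unfolding R_eq et_eq by simp

lemma et_mult:
  assumes "x \<in> carrier A" "y \<in> carrier A" "x' \<in> carrier A" "y' \<in> carrier A"
  shows "et x y \<otimes>\<^bsub>R\<^esub> et x' y' = et (x \<otimes>\<^bsub>A\<^esub> x') (y' \<otimes>\<^bsub>A\<^esub> y)"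
  using T.pt_mult[of x y x' y'] assms unfolding R_eq et_eq by simp

lemma et_add:
  assumes "x \<in> carrier A" "y \<in> carrier A" "z \<in> carrier A"
  shows "et (x \<oplus>\<^bsub>A\<^esub> y) z = et x z \<oplus>\<^bsub>R\<^esub> et y z" "et x (y \<oplus>\<^bsub>A\<^esub> z) = et x y \<oplus>\<^bsub>R\<^esub> et x z"
  using T.pt_add_left[of x y z] T.pt_add_right[of x y z] assms unfolding R_eq et_eq by simp_all

lemma et_smult:
  assumes "c \<in> carrier K" "x \<in> carrier A" "y \<in> carrier A"
  shows "et (c \<odot>\<^bsub>A\<^esub> x) y = c \<odot>\<^bsub>R\<^esub> et x y" "et x (c \<odot>\<^bsub>A\<^esub> y) = c \<odot>\<^bsub>R\<^esub> et x y"
  using T.pt_smult[of c x y] assms unfolding R_eq et_eq by simp_all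

lemma R_induct [consumes 1, case_names zero step]:
  assumes "t \<in> carrier R" "P \<zero>\<^bsub>R\<^esub>"
    and "\<And>x y t. x \<in> carrier A \<Longrightarrow> y \<in> carrier A \<Longrightarrow> t \<in> carrier R \<Longrightarrow> P t \<Longrightarrow> P (et x y \<oplus>\<^bsub>R\<^esub> t)"
  shows "P t"
  using T.T_induct[of t P] assms unfolding R_eq et_eq by simp

lemma R_lift:
  assumes "assoc_algebra K C" "f \<in> alg_hom K A C" "g \<in> alg_hom K (op_alg A) C"
    and "\<And>x y. x \<in> carrier A \<Longrightarrow> y \<in> carrier A \<Longrightarrow> g y \<otimes>\<^bsub>C\<^esub> f x = f x \<otimes>\<^bsub>C\<^esub> g y"
  shows "\<exists>h\<in>alg_hom K R C. \<forall>x\<in>carrier A. \<forall>y\<in>carrier A. h (et x y) = f x \<otimes>\<^bsub>C\<^esub> g y"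
  using T.T_lift_lin[of C f g] assms unfolding R_eq et_eq by auto

text \<open>Left and right multiplications on \<open>A\<close> commute, so they combine to a
  representation of A^e. The formula in \<open>env_action\<close> computes this representation on
  any representative, which is what justifies \<open>the_elem\<close> there.\<close>

lemma env_action_hom:
  "\<exists>h\<in>alg_hom K R (end_alg K A). (\<forall>x\<in>carrier A. \<forall>y\<in>carrier A. \<forall>m\<in>carrier A.
      h (et x y) m = x \<otimes>\<^bsub>A\<^esub> m \<otimes>\<^bsub>A\<^esub> y) \<and>
    (\<forall>t\<in>carrier R. \<forall>m\<in>carrier A. env_action K A t m = h t m)"
proof -
  let ?E = "end_alg K A"
  have E: "assoc_algebra K ?E" by (rule assoc_algebra_end_alg) (rule module_A)
  interpret E: assoc_algebra K ?E by (rule E)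
  define f g where "f x = (\<lambda>m\<in>carrier A. x \<otimes>\<^bsub>A\<^esub> m)" and "g y = (\<lambda>m\<in>carrier A. m \<otimes>\<^bsub>A\<^esub> y)" for x y
  have fc: "f x \<in> carrier ?E" if "x \<in> carrier A" for x
    unfolding f_def using that by (intro end_algI) (auto simp: r_distr smult_mult_right[symmetric] module_A)
  have gc: "g x \<in> carrier ?E" if "x \<in> carrier A" for x
    unfolding g_def using that by (intro end_algI) (auto simp: l_distr smult_mult_left[symmetric] module_A)
  have f: "f \<in> alg_hom K A ?E"
    by (rule alg_homI; (intro end_alg_eqI[where K=K and V=A] E.m_closed E.a_closed E.smult_closed E.one_closed)?)
      (auto simp: fc end_alg_apply, auto simp: f_def m_assoc l_distr smult_mult_left[symmetric])
  have g: "g \<in> alg_hom K (op_alg A) ?E"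
    by (rule alg_homI; (intro end_alg_eqI[where K=K and V=A] E.m_closed E.a_closed E.smult_closed E.one_closed)?)
      (auto simp: gc end_alg_apply, auto simp: g_def m_assoc r_distr smult_mult_right[symmetric])
  have comm: "g y \<otimes>\<^bsub>?E\<^esub> f x = f x \<otimes>\<^bsub>?E\<^esub> g y" if "x \<in> carrier A" "y \<in> carrier A" for x y
    by (rule end_alg_eqI[where K=K and V=A])
      (use that in \<open>auto simp: fc gc end_alg_apply\<close>, auto simp: f_def g_def m_assoc that)
  obtain h where h: "h \<in> alg_hom K R ?E"
    "\<And>x y. x \<in> carrier A \<Longrightarrow> y \<in> carrier A \<Longrightarrow> h (et x y) = f x \<otimes>\<^bsub>?E\<^esub> g y"
    "\<And>u. u \<in> carrier T.F.F \<Longrightarrow> h (T.I +>\<^bsub>T.F.F\<^esub> u) = T.F.lin ?E (\<lambda>z. f (fst z) \<otimes>\<^bsub>?E\<^esub> g (snd z)) u"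
    using T.T_lift_lin[OF E f g] comm unfolding R_eq et_eq by auto
  have app: "(f x \<otimes>\<^bsub>?E\<^esub> g y) m = x \<otimes>\<^bsub>A\<^esub> m \<otimes>\<^bsub>A\<^esub> y"
    if "x \<in> carrier A" "y \<in> carrier A" "m \<in> carrier A" for x y m
    using that by (simp add: end_alg_apply) (simp add: f_def g_def m_assoc)
  have "env_action K A t m = h t m" if t: "t \<in> carrier R" and m: "m \<in> carrier A" for t m
  proof -
    let ?L = "\<lambda>u. \<Oplus>\<^bsub>A\<^esub>z\<in>{z. u z \<noteq> \<zero>}. u z \<odot>\<^bsub>A\<^esub> (fst z \<otimes>\<^bsub>A\<^esub> m \<otimes>\<^bsub>A\<^esub> snd z)"
    have L: "?L u = h (T.I +>\<^bsub>T.F.F\<^esub> u) m" if u: "u \<in> carrier T.F.F" for u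
    proof -
      have p: "(\<lambda>z. f (fst z) \<otimes>\<^bsub>?E\<^esub> g (snd z)) \<in> carrier (A \<times>\<times> op_alg A) \<rightarrow> carrier ?E"
        using fc gc by (auto simp: carrier_DirProd)
      have "T.F.lin ?E (\<lambda>z. f (fst z) \<otimes>\<^bsub>?E\<^esub> g (snd z)) u m
          = T.F.lin A (\<lambda>z. (f (fst z) \<otimes>\<^bsub>?E\<^esub> g (snd z)) m) u"
        using m by (intro T.F.lin_linear[OF E.module_A module_A u p])
          (auto simp: end_alg_apply end_algD)
      also have "\<dots> = T.F.lin A (\<lambda>z. fst z \<otimes>\<^bsub>A\<^esub> m \<otimes>\<^bsub>A\<^esub> snd z) u"
        using m end_algD(1)[OF funcset_mem[OF p]]
        by (intro T.F.lin_cong[OF module_A u]) (auto simp: carrier_DirProd app)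
      finally show ?thesis using h(3)[OF u] by (simp add: T.F.lin_def)
    qed
    interpret I: ideal T.I T.F.F by (rule T.ideal_I)
    obtain u where u: "u \<in> carrier T.F.F" "t = T.I +>\<^bsub>T.F.F\<^esub> u"
      using t unfolding R_eq tensor_alg_def by (rule T.FA.quot_carrierE)
    \<comment> \<open>Any other representative of the same coset has the same image under
      \<open>h\<close>, so the set of values inside \<open>the_elem\<close> is a singleton.\<close>
    have "?L v = h t m" if "v \<in> t" for v
      using that u I.a_repr_independence'[of v u] L[of v] I.a_elemrcos_carrier[OF u(1), of v]
        I.is_abelian_subgroup by simp
    then have "?L ` t = (\<lambda>_. h t m) ` t" by (rule image_cong[OF refl])
    also have "u \<in> t" using u I.a_rcos_self by simp
    then have "(\<lambda>_. h t m) ` t = {h t m}" by (rule image_constant)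
    finally have "?L ` t = {h t m}" .
    then show ?thesis by (simp add: env_action_def)
  qed
  with h app show ?thesis by (intro bexI[of _ h]) auto
qed

lemma env_action_closed: "t \<in> carrier R \<Longrightarrow> m \<in> carrier A \<Longrightarrow> env_action K A t m \<in> carrier A"
  using env_action_hom by (metis alg_homD(1) end_algD(1))

lemma env_action_et:
  "x \<in> carrier A \<Longrightarrow> y \<in> carrier A \<Longrightarrow> m \<in> carrier A \<Longrightarrow> env_action K A (et x y) m = x \<otimes>\<^bsub>A\<^esub> m \<otimes>\<^bsub>A\<^esub> y"
  using env_action_hom by (metis et_closed)

lemma left_module_env: "left_module R (env_module K A)"
proof -
  obtain h where h: "h \<in> alg_hom K R (end_alg K A)"
    and a: "\<And>t m. t \<in> carrier R \<Longrightarrow> m \<in> carrier A \<Longrightarrow> env_action K A t m = h t m"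
    using env_action_hom by blast
  note hh = alg_homD[OF h]
  note D = end_algD[OF hh(1)]
  have ag: "abelian_group (env_module K A)"
  proof (rule abelian_groupI)
    show "\<exists>y\<in>carrier (env_module K A). y \<oplus>\<^bsub>env_module K A\<^esub> x = \<zero>\<^bsub>env_module K A\<^esub>"
      if "x \<in> carrier (env_module K A)" for x
      using that by (intro bexI[of _ "\<ominus>\<^bsub>A\<^esub> x"]) (auto simp: env_module_def M.l_neg)
  qed (auto simp: env_module_def M.a_ac)
  show ?thesis
    unfolding left_module_def left_module_axioms_def
    using R.ring_A ag D by (auto simp: env_module_def a hh end_alg_apply)
qed

end

section \<open>Quadratic identities in the enveloping algebra\<close>

context k_algebra
begin

text \<open>Writing both sides of an identity as combinations of one list of elements reduces it to
  identities between scalars, which the simplifier decides.\<close>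

definition comb :: "'a list \<Rightarrow> 'k list \<Rightarrow> 'a" where
  "comb es cs = foldr (\<lambda>(c, e) x. c \<odot>\<^bsub>A\<^esub> e \<oplus>\<^bsub>A\<^esub> x) (zip cs es) \<zero>\<^bsub>A\<^esub>"

lemma comb_simps [simp]: "comb [] [] = \<zero>\<^bsub>A\<^esub>" "comb (e # es) (c # cs) = c \<odot>\<^bsub>A\<^esub> e \<oplus>\<^bsub>A\<^esub> comb es cs"
  by (simp_all add: comb_def)

lemma comb_closed:
  "set es \<subseteq> carrier A \<Longrightarrow> set cs \<subseteq> carrier K \<Longrightarrow> length es = length cs \<Longrightarrow> comb es cs \<in> carrier A"
proof (induction es arbitrary: cs)
  case (Cons e es) then show ?case by (cases cs) auto
qed simp

lemma comb_add:
  "set es \<subseteq> carrier A \<Longrightarrow> set cs \<subseteq> carrier K \<Longrightarrow> set ds \<subseteq> carrier K \<Longrightarrow>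
    length cs = length es \<Longrightarrow> length ds = length es \<Longrightarrow>
    comb es cs \<oplus>\<^bsub>A\<^esub> comb es ds = comb es (map2 (\<oplus>\<^bsub>K\<^esub>) cs ds)"
proof (induction es arbitrary: cs ds)
  case (Cons e es)
  then obtain c cs' d ds' where [simp]: "cs = c # cs'" "ds = d # ds'" by (cases cs; cases ds) auto
  have "c \<odot>\<^bsub>A\<^esub> e \<oplus>\<^bsub>A\<^esub> comb es cs' \<oplus>\<^bsub>A\<^esub> (d \<odot>\<^bsub>A\<^esub> e \<oplus>\<^bsub>A\<^esub> comb es ds')
    = (c \<odot>\<^bsub>A\<^esub> e \<oplus>\<^bsub>A\<^esub> d \<odot>\<^bsub>A\<^esub> e) \<oplus>\<^bsub>A\<^esub> (comb es cs' \<oplus>\<^bsub>A\<^esub> comb es ds')"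
    using Cons.prems comb_closed[of es cs'] comb_closed[of es ds'] by (simp add: M.a_ac)
  then show ?case using Cons by (simp add: smult_l_distr)
next
  case Nil
  then show ?case by simp
qed

lemma comb_smult:
  "set es \<subseteq> carrier A \<Longrightarrow> set cs \<subseteq> carrier K \<Longrightarrow> c \<in> carrier K \<Longrightarrow> length cs = length es \<Longrightarrow>
    c \<odot>\<^bsub>A\<^esub> comb es cs = comb es (map (\<lambda>x. c \<otimes>\<^bsub>K\<^esub> x) cs)"
proof (induction es arbitrary: cs)
  case (Cons e es)
  then obtain d cs' where [simp]: "cs = d # cs'" by (cases cs) auto
  show ?case using Cons comb_closed[of es cs'] by (simp add: smult_r_distr smult_assoc1)
next
  case Nil
  then show ?case by simp
qed

lemma smult_left_commute:
  "i \<in> carrier K \<Longrightarrow> j \<in> carrier K \<Longrightarrow> x \<in> carrier A \<Longrightarrow> i \<odot>\<^bsub>A\<^esub> (j \<odot>\<^bsub>A\<^esub> x) = j \<odot>\<^bsub>A\<^esub> (i \<odot>\<^bsub>A\<^esub> x)"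
  using cring.cring_simprules(14)[OF cring_K, of i j] by (simp add: smult_assoc1[symmetric])

lemma mult_expand:
  assumes "x \<in> carrier A" "y \<in> carrier A" "z \<in> carrier A" "w \<in> carrier A"
    "i \<in> carrier K" "j \<in> carrier K" "k \<in> carrier K" "l \<in> carrier K"
  shows "(i \<odot>\<^bsub>A\<^esub> x \<oplus>\<^bsub>A\<^esub> j \<odot>\<^bsub>A\<^esub> y) \<otimes>\<^bsub>A\<^esub> (k \<odot>\<^bsub>A\<^esub> z \<oplus>\<^bsub>A\<^esub> l \<odot>\<^bsub>A\<^esub> w) =
    ((i \<otimes>\<^bsub>K\<^esub> k) \<odot>\<^bsub>A\<^esub> (x \<otimes>\<^bsub>A\<^esub> z) \<oplus>\<^bsub>A\<^esub> (i \<otimes>\<^bsub>K\<^esub> l) \<odot>\<^bsub>A\<^esub> (x \<otimes>\<^bsub>A\<^esub> w)) \<oplus>\<^bsub>A\<^esub>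
    ((j \<otimes>\<^bsub>K\<^esub> k) \<odot>\<^bsub>A\<^esub> (y \<otimes>\<^bsub>A\<^esub> z) \<oplus>\<^bsub>A\<^esub> (j \<otimes>\<^bsub>K\<^esub> l) \<odot>\<^bsub>A\<^esub> (y \<otimes>\<^bsub>A\<^esub> w))"
  using assms
  by (simp add: l_distr r_distr smult_mult_left[symmetric] smult_mult_right[symmetric] smult_r_distr
      smult_assoc1 M.a_ac smult_left_commute)

lemma mult_expand_right:
  assumes "x \<in> carrier A" "z \<in> carrier A" "w \<in> carrier A" "k \<in> carrier K" "l \<in> carrier K"
  shows "x \<otimes>\<^bsub>A\<^esub> (k \<odot>\<^bsub>A\<^esub> z \<oplus>\<^bsub>A\<^esub> l \<odot>\<^bsub>A\<^esub> w) =
    k \<odot>\<^bsub>A\<^esub> (x \<otimes>\<^bsub>A\<^esub> z) \<oplus>\<^bsub>A\<^esub> l \<odot>\<^bsub>A\<^esub> (x \<otimes>\<^bsub>A\<^esub> w)"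
  using assms by (simp add: r_distr smult_mult_right[symmetric])

end

text \<open>The parameters \<open>k l m n\<close> stand for $p, p^{-1}, q, q^{-1}$. They are kept independent of inverses
  in the field because the same identities are used for the parameters $q^{-1}, p^{-1}$.\<close>

locale sl2_letters = enveloping K A
  for K :: "('k, 'x) ring_scheme" (structure) and A :: "('k, 'a) module" +
  fixes k l m n :: 'k and a b c d :: 'a
  assumes scalars [simp]: "k \<in> carrier K" "l \<in> carrier K" "m \<in> carrier K" "n \<in> carrier K"
    and kl: "k \<otimes> l = \<one>" and mn: "m \<otimes> n = \<one>"
    and letters [simp]: "a \<in> carrier A" "b \<in> carrier A" "c \<in> carrier A" "d \<in> carrier A"
    and rels: "b \<otimes>\<^bsub>A\<^esub> a = m \<odot>\<^bsub>A\<^esub> (a \<otimes>\<^bsub>A\<^esub> b)" "c \<otimes>\<^bsub>A\<^esub> a = k \<odot>\<^bsub>A\<^esub> (a \<otimes>\<^bsub>A\<^esub> c)"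
      "d \<otimes>\<^bsub>A\<^esub> b = m \<odot>\<^bsub>A\<^esub> (b \<otimes>\<^bsub>A\<^esub> d)" "d \<otimes>\<^bsub>A\<^esub> c = k \<odot>\<^bsub>A\<^esub> (c \<otimes>\<^bsub>A\<^esub> d)"
      "c \<otimes>\<^bsub>A\<^esub> b = b \<otimes>\<^bsub>A\<^esub> c"
      "a \<otimes>\<^bsub>A\<^esub> d = \<one>\<^bsub>A\<^esub> \<oplus>\<^bsub>A\<^esub> l \<odot>\<^bsub>A\<^esub> (b \<otimes>\<^bsub>A\<^esub> c)" "d \<otimes>\<^bsub>A\<^esub> a = \<one>\<^bsub>A\<^esub> \<oplus>\<^bsub>A\<^esub> m \<odot>\<^bsub>A\<^esub> (b \<otimes>\<^bsub>A\<^esub> c)"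
begin

lemmas KS = cring.cring_simprules[OF cring_K]

definition "vX s t = s \<odot>\<^bsub>R\<^esub> et a d \<oplus>\<^bsub>R\<^esub> (\<ominus> t) \<odot>\<^bsub>R\<^esub> et b c"
definition "vY t = \<one> \<odot>\<^bsub>R\<^esub> et b a \<oplus>\<^bsub>R\<^esub> (\<ominus> t) \<odot>\<^bsub>R\<^esub> et a b"
definition "vZ t = \<one> \<odot>\<^bsub>R\<^esub> et c d \<oplus>\<^bsub>R\<^esub> (\<ominus> t) \<odot>\<^bsub>R\<^esub> et d c"
definition "vW s t = s \<odot>\<^bsub>R\<^esub> et d a \<oplus>\<^bsub>R\<^esub> (\<ominus> t) \<odot>\<^bsub>R\<^esub> et c b"

lemma v_closed [simp]:
  "s \<in> carrier K \<Longrightarrow> t \<in> carrier K \<Longrightarrow> vX s t \<in> carrier R"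
  "t \<in> carrier K \<Longrightarrow> vY t \<in> carrier R" "t \<in> carrier K \<Longrightarrow> vZ t \<in> carrier R"
  "s \<in> carrier K \<Longrightarrow> t \<in> carrier K \<Longrightarrow> vW s t \<in> carrier R"
  by (simp_all add: vX_def vY_def vZ_def vW_def)

lemma kl_cancel: "x \<in> carrier K \<Longrightarrow> k \<otimes> (l \<otimes> x) = x" "x \<in> carrier K \<Longrightarrow> m \<otimes> (n \<otimes> x) = x"
  using kl mn by (simp_all add: KS(11)[symmetric])

lemmas scalar_simps = kl mn kl_cancel KS

lemmas expand_simps = R.mult_expand R.mult_expand_right one_closed et_closed letters scalars KS(3,5,6)

lemmas et_simps = et_mult rels et_add et_smult

text \<open>The list is delivered existentially so that \<open>comb es\<close> does not unfold: the
  named elements become opaque unit vectors, and an identity in A^e turns into an equality of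
  coefficient lists.\<close>

lemma unit_combs:
  assumes "e1 \<in> carrier R" "e2 \<in> carrier R" "e3 \<in> carrier R" "e4 \<in> carrier R" "e5 \<in> carrier R" "e6 \<in> carrier R"
  shows "\<exists>es. set es \<subseteq> carrier R \<and> length es = 6 \<and>
    e1 = R.comb es [\<one>,\<zero>,\<zero>,\<zero>,\<zero>,\<zero>] \<and> e2 = R.comb es [\<zero>,\<one>,\<zero>,\<zero>,\<zero>,\<zero>] \<and>
    e3 = R.comb es [\<zero>,\<zero>,\<one>,\<zero>,\<zero>,\<zero>] \<and> e4 = R.comb es [\<zero>,\<zero>,\<zero>,\<one>,\<zero>,\<zero>] \<and>
    e5 = R.comb es [\<zero>,\<zero>,\<zero>,\<zero>,\<one>,\<zero>] \<and> e6 = R.comb es [\<zero>,\<zero>,\<zero>,\<zero>,\<zero>,\<one>]"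
  by (intro exI[of _ "[e1,e2,e3,e4,e5,e6]"]) (use assms in simp)

text \<open>\<open>vX m \<one>\<close> is \<phi>(X), the result of rescaling a by m and b by k in
  the left factor. The primed identity is the image of the first under \<psi>, divided by the unit
  m, since \<psi>(Y) is m times \<open>vY k\<close>.\<close>

lemma YX: "vY m \<otimes>\<^bsub>R\<^esub> vX \<one> l = vX m \<one> \<otimes>\<^bsub>R\<^esub> vY m"
  and YX': "vY k \<otimes>\<^bsub>R\<^esub> vX k (m \<otimes> l) = vX (k \<otimes> m) m \<otimes>\<^bsub>R\<^esub> vY k"
proof -
  obtain es where es: "set es \<subseteq> carrier R" "length es = 6"
    and u: "et (a \<otimes>\<^bsub>A\<^esub> b) \<one>\<^bsub>A\<^esub> = R.comb es [\<one>,\<zero>,\<zero>,\<zero>,\<zero>,\<zero>]"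
      "et (a \<otimes>\<^bsub>A\<^esub> b) (b \<otimes>\<^bsub>A\<^esub> c) = R.comb es [\<zero>,\<one>,\<zero>,\<zero>,\<zero>,\<zero>]"
      "et (b \<otimes>\<^bsub>A\<^esub> b) (a \<otimes>\<^bsub>A\<^esub> c) = R.comb es [\<zero>,\<zero>,\<one>,\<zero>,\<zero>,\<zero>]"
      "et (a \<otimes>\<^bsub>A\<^esub> a) (b \<otimes>\<^bsub>A\<^esub> d) = R.comb es [\<zero>,\<zero>,\<zero>,\<one>,\<zero>,\<zero>]"
    using unit_combs[of "et (a \<otimes>\<^bsub>A\<^esub> b) \<one>\<^bsub>A\<^esub>" "et (a \<otimes>\<^bsub>A\<^esub> b) (b \<otimes>\<^bsub>A\<^esub> c)" "et (b \<otimes>\<^bsub>A\<^esub> b) (a \<otimes>\<^bsub>A\<^esub> c)" "et (a \<otimes>\<^bsub>A\<^esub> a) (b \<otimes>\<^bsub>A\<^esub> d)" "\<zero>\<^bsub>R\<^esub>" "\<zero>\<^bsub>R\<^esub>"] by auto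
  show "vY m \<otimes>\<^bsub>R\<^esub> vX \<one> l = vX m \<one> \<otimes>\<^bsub>R\<^esub> vY m"
    unfolding vX_def vY_def vZ_def vW_def et_one[symmetric]
    by (simp only: expand_simps, simp add: et_simps, simp only: u,
      simp add: R.comb_add R.comb_smult es, (simp add: scalar_simps)?)
  show "vY k \<otimes>\<^bsub>R\<^esub> vX k (m \<otimes> l) = vX (k \<otimes> m) m \<otimes>\<^bsub>R\<^esub> vY k"
    unfolding vX_def vY_def vZ_def vW_def et_one[symmetric]
    by (simp only: expand_simps, simp add: et_simps, simp only: u,
      simp add: R.comb_add R.comb_smult es, (simp add: scalar_simps)?)
qed

text \<open>Here \<open>vX k (m \<otimes> l)\<close> is \<psi>(X). The primed identity is the image
  under \<phi>, divided by a unit. Both ways of rescaling X twice end at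
  \<open>vX (k \<otimes> m) m\<close>, because \<phi> and \<psi> commute.\<close>

lemma ZX: "vZ l \<otimes>\<^bsub>R\<^esub> vX \<one> l = vX k (m \<otimes> l) \<otimes>\<^bsub>R\<^esub> vZ l"
  and ZX': "vZ n \<otimes>\<^bsub>R\<^esub> vX m \<one> = vX (k \<otimes> m) m \<otimes>\<^bsub>R\<^esub> vZ n"
proof -
  obtain es where es: "set es \<subseteq> carrier R" "length es = 6"
    and u: "et (a \<otimes>\<^bsub>A\<^esub> c) (d \<otimes>\<^bsub>A\<^esub> d) = R.comb es [\<one>,\<zero>,\<zero>,\<zero>,\<zero>,\<zero>]"
      "et \<one>\<^bsub>A\<^esub> (c \<otimes>\<^bsub>A\<^esub> d) = R.comb es [\<zero>,\<one>,\<zero>,\<zero>,\<zero>,\<zero>]"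
      "et (b \<otimes>\<^bsub>A\<^esub> c) (c \<otimes>\<^bsub>A\<^esub> d) = R.comb es [\<zero>,\<zero>,\<one>,\<zero>,\<zero>,\<zero>]"
      "et (b \<otimes>\<^bsub>A\<^esub> d) (c \<otimes>\<^bsub>A\<^esub> c) = R.comb es [\<zero>,\<zero>,\<zero>,\<one>,\<zero>,\<zero>]"
    using unit_combs[of "et (a \<otimes>\<^bsub>A\<^esub> c) (d \<otimes>\<^bsub>A\<^esub> d)" "et \<one>\<^bsub>A\<^esub> (c \<otimes>\<^bsub>A\<^esub> d)" "et (b \<otimes>\<^bsub>A\<^esub> c) (c \<otimes>\<^bsub>A\<^esub> d)" "et (b \<otimes>\<^bsub>A\<^esub> d) (c \<otimes>\<^bsub>A\<^esub> c)" "\<zero>\<^bsub>R\<^esub>" "\<zero>\<^bsub>R\<^esub>"] by auto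
  show "vZ l \<otimes>\<^bsub>R\<^esub> vX \<one> l = vX k (m \<otimes> l) \<otimes>\<^bsub>R\<^esub> vZ l"
    unfolding vX_def vY_def vZ_def vW_def et_one[symmetric]
    by (simp only: expand_simps, simp add: et_simps, simp only: u,
      simp add: R.comb_add R.comb_smult es, (simp add: scalar_simps)?)
  show "vZ n \<otimes>\<^bsub>R\<^esub> vX m \<one> = vX (k \<otimes> m) m \<otimes>\<^bsub>R\<^esub> vZ n"
    unfolding vX_def vY_def vZ_def vW_def et_one[symmetric]
    by (simp only: expand_simps, simp add: et_simps, simp only: u,
      simp add: R.comb_add R.comb_smult es, (simp add: scalar_simps)?)
qed

text \<open>Up to units this compares \<psi>(Y) Z with \<phi>(Z) Y; it closes the square spanned by
  Y and Z.\<close>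

lemma YZ: "vY k \<otimes>\<^bsub>R\<^esub> vZ l = vZ n \<otimes>\<^bsub>R\<^esub> vY m"
proof -
  obtain es where es: "set es \<subseteq> carrier R" "length es = 6"
    and u: "et (b \<otimes>\<^bsub>A\<^esub> c) \<one>\<^bsub>A\<^esub> = R.comb es [\<one>,\<zero>,\<zero>,\<zero>,\<zero>,\<zero>]"
      "et (b \<otimes>\<^bsub>A\<^esub> d) (a \<otimes>\<^bsub>A\<^esub> c) = R.comb es [\<zero>,\<one>,\<zero>,\<zero>,\<zero>,\<zero>]"
      "et (a \<otimes>\<^bsub>A\<^esub> c) (b \<otimes>\<^bsub>A\<^esub> d) = R.comb es [\<zero>,\<zero>,\<one>,\<zero>,\<zero>,\<zero>]"
      "et \<one>\<^bsub>A\<^esub> (b \<otimes>\<^bsub>A\<^esub> c) = R.comb es [\<zero>,\<zero>,\<zero>,\<one>,\<zero>,\<zero>]"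
      "et (b \<otimes>\<^bsub>A\<^esub> c) (b \<otimes>\<^bsub>A\<^esub> c) = R.comb es [\<zero>,\<zero>,\<zero>,\<zero>,\<one>,\<zero>]"
    using unit_combs[of "et (b \<otimes>\<^bsub>A\<^esub> c) \<one>\<^bsub>A\<^esub>" "et (b \<otimes>\<^bsub>A\<^esub> d) (a \<otimes>\<^bsub>A\<^esub> c)" "et (a \<otimes>\<^bsub>A\<^esub> c) (b \<otimes>\<^bsub>A\<^esub> d)" "et \<one>\<^bsub>A\<^esub> (b \<otimes>\<^bsub>A\<^esub> c)" "et (b \<otimes>\<^bsub>A\<^esub> c) (b \<otimes>\<^bsub>A\<^esub> c)" "\<zero>\<^bsub>R\<^esub>"] by auto
  show "vY k \<otimes>\<^bsub>R\<^esub> vZ l = vZ n \<otimes>\<^bsub>R\<^esub> vY m"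
    unfolding vX_def vY_def vZ_def vW_def et_one[symmetric]
    by (simp only: expand_simps, simp add: et_simps, simp only: u,
      simp add: R.comb_add R.comb_smult es, (simp add: scalar_simps)?)
qed

lemma YW: "vY m \<otimes>\<^bsub>R\<^esub> vW \<one> m = vW n (m \<otimes> l) \<otimes>\<^bsub>R\<^esub> vY m"
proof -
  obtain es where es: "set es \<subseteq> carrier R" "length es = 6"
    and u: "et (b \<otimes>\<^bsub>A\<^esub> d) (a \<otimes>\<^bsub>A\<^esub> a) = R.comb es [\<one>,\<zero>,\<zero>,\<zero>,\<zero>,\<zero>]"
      "et (b \<otimes>\<^bsub>A\<^esub> c) (a \<otimes>\<^bsub>A\<^esub> b) = R.comb es [\<zero>,\<one>,\<zero>,\<zero>,\<zero>,\<zero>]"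
      "et \<one>\<^bsub>A\<^esub> (a \<otimes>\<^bsub>A\<^esub> b) = R.comb es [\<zero>,\<zero>,\<one>,\<zero>,\<zero>,\<zero>]"
      "et (a \<otimes>\<^bsub>A\<^esub> c) (b \<otimes>\<^bsub>A\<^esub> b) = R.comb es [\<zero>,\<zero>,\<zero>,\<one>,\<zero>,\<zero>]"
    using unit_combs[of "et (b \<otimes>\<^bsub>A\<^esub> d) (a \<otimes>\<^bsub>A\<^esub> a)" "et (b \<otimes>\<^bsub>A\<^esub> c) (a \<otimes>\<^bsub>A\<^esub> b)" "et \<one>\<^bsub>A\<^esub> (a \<otimes>\<^bsub>A\<^esub> b)" "et (a \<otimes>\<^bsub>A\<^esub> c) (b \<otimes>\<^bsub>A\<^esub> b)" "\<zero>\<^bsub>R\<^esub>" "\<zero>\<^bsub>R\<^esub>"] by auto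
  show "vY m \<otimes>\<^bsub>R\<^esub> vW \<one> m = vW n (m \<otimes> l) \<otimes>\<^bsub>R\<^esub> vY m"
    unfolding vX_def vY_def vZ_def vW_def et_one[symmetric]
    by (simp only: expand_simps, simp add: et_simps, simp only: u,
      simp add: R.comb_add R.comb_smult es, (simp add: scalar_simps)?)
qed

lemma ZW: "vZ l \<otimes>\<^bsub>R\<^esub> vW \<one> m = vW l \<one> \<otimes>\<^bsub>R\<^esub> vZ l"
proof -
  obtain es where es: "set es \<subseteq> carrier R" "length es = 6"
    and u: "et (c \<otimes>\<^bsub>A\<^esub> d) \<one>\<^bsub>A\<^esub> = R.comb es [\<one>,\<zero>,\<zero>,\<zero>,\<zero>,\<zero>]"
      "et (c \<otimes>\<^bsub>A\<^esub> d) (b \<otimes>\<^bsub>A\<^esub> c) = R.comb es [\<zero>,\<one>,\<zero>,\<zero>,\<zero>,\<zero>]"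
      "et (c \<otimes>\<^bsub>A\<^esub> c) (b \<otimes>\<^bsub>A\<^esub> d) = R.comb es [\<zero>,\<zero>,\<one>,\<zero>,\<zero>,\<zero>]"
      "et (d \<otimes>\<^bsub>A\<^esub> d) (a \<otimes>\<^bsub>A\<^esub> c) = R.comb es [\<zero>,\<zero>,\<zero>,\<one>,\<zero>,\<zero>]"
    using unit_combs[of "et (c \<otimes>\<^bsub>A\<^esub> d) \<one>\<^bsub>A\<^esub>" "et (c \<otimes>\<^bsub>A\<^esub> d) (b \<otimes>\<^bsub>A\<^esub> c)" "et (c \<otimes>\<^bsub>A\<^esub> c) (b \<otimes>\<^bsub>A\<^esub> d)" "et (d \<otimes>\<^bsub>A\<^esub> d) (a \<otimes>\<^bsub>A\<^esub> c)" "\<zero>\<^bsub>R\<^esub>" "\<zero>\<^bsub>R\<^esub>"] by auto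
  show "vZ l \<otimes>\<^bsub>R\<^esub> vW \<one> m = vW l \<one> \<otimes>\<^bsub>R\<^esub> vZ l"
    unfolding vX_def vY_def vZ_def vW_def et_one[symmetric]
    by (simp only: expand_simps, simp add: et_simps, simp only: u,
      simp add: R.comb_add R.comb_smult es, (simp add: scalar_simps)?)
qed

text \<open>The determinant relations of the matrix with rows X, Y and Z, W, in analogy with the two
  relations for a d and d a. They make X and W mutually inverse up to multiples of Y and Z.\<close>

lemma XW: "vX \<one> l \<otimes>\<^bsub>R\<^esub> vW \<one> m = \<one>\<^bsub>R\<^esub> \<oplus>\<^bsub>R\<^esub> l \<odot>\<^bsub>R\<^esub> (vZ n \<otimes>\<^bsub>R\<^esub> vY m)"
  and WX: "vW \<one> m \<otimes>\<^bsub>R\<^esub> vX \<one> l = \<one>\<^bsub>R\<^esub> \<oplus>\<^bsub>R\<^esub> m \<odot>\<^bsub>R\<^esub> (vY k \<otimes>\<^bsub>R\<^esub> vZ l)"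
proof -
  obtain es where es: "set es \<subseteq> carrier R" "length es = 6"
    and u: "et \<one>\<^bsub>A\<^esub> \<one>\<^bsub>A\<^esub> = R.comb es [\<one>,\<zero>,\<zero>,\<zero>,\<zero>,\<zero>]"
      "et (b \<otimes>\<^bsub>A\<^esub> c) \<one>\<^bsub>A\<^esub> = R.comb es [\<zero>,\<one>,\<zero>,\<zero>,\<zero>,\<zero>]"
      "et \<one>\<^bsub>A\<^esub> (b \<otimes>\<^bsub>A\<^esub> c) = R.comb es [\<zero>,\<zero>,\<one>,\<zero>,\<zero>,\<zero>]"
      "et (b \<otimes>\<^bsub>A\<^esub> c) (b \<otimes>\<^bsub>A\<^esub> c) = R.comb es [\<zero>,\<zero>,\<zero>,\<one>,\<zero>,\<zero>]"
      "et (a \<otimes>\<^bsub>A\<^esub> c) (b \<otimes>\<^bsub>A\<^esub> d) = R.comb es [\<zero>,\<zero>,\<zero>,\<zero>,\<one>,\<zero>]"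
      "et (b \<otimes>\<^bsub>A\<^esub> d) (a \<otimes>\<^bsub>A\<^esub> c) = R.comb es [\<zero>,\<zero>,\<zero>,\<zero>,\<zero>,\<one>]"
    using unit_combs[of "et \<one>\<^bsub>A\<^esub> \<one>\<^bsub>A\<^esub>" "et (b \<otimes>\<^bsub>A\<^esub> c) \<one>\<^bsub>A\<^esub>" "et \<one>\<^bsub>A\<^esub> (b \<otimes>\<^bsub>A\<^esub> c)" "et (b \<otimes>\<^bsub>A\<^esub> c) (b \<otimes>\<^bsub>A\<^esub> c)" "et (a \<otimes>\<^bsub>A\<^esub> c) (b \<otimes>\<^bsub>A\<^esub> d)" "et (b \<otimes>\<^bsub>A\<^esub> d) (a \<otimes>\<^bsub>A\<^esub> c)"] by auto
  show "vX \<one> l \<otimes>\<^bsub>R\<^esub> vW \<one> m = \<one>\<^bsub>R\<^esub> \<oplus>\<^bsub>R\<^esub> l \<odot>\<^bsub>R\<^esub> (vZ n \<otimes>\<^bsub>R\<^esub> vY m)"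
    unfolding vX_def vY_def vZ_def vW_def et_one[symmetric]
    by (simp only: expand_simps, simp add: et_simps, simp only: u,
      simp add: R.comb_add R.comb_smult es, (simp add: scalar_simps)?)
  show "vW \<one> m \<otimes>\<^bsub>R\<^esub> vX \<one> l = \<one>\<^bsub>R\<^esub> \<oplus>\<^bsub>R\<^esub> m \<odot>\<^bsub>R\<^esub> (vY k \<otimes>\<^bsub>R\<^esub> vZ l)"
    unfolding vX_def vY_def vZ_def vW_def et_one[symmetric]
    by (simp only: expand_simps, simp add: et_simps, simp only: u,
      simp add: R.comb_add R.comb_smult es, (simp add: scalar_simps)?)
qed

text \<open>With T the matrix of generators and M that of X, Y, Z, W, the next four identities are
  the entries of the equation between T in the left factor and M times T in the right factor. They
  trade every left letter for right letters and entries of M.\<close>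

lemma et_a: "et a \<one>\<^bsub>A\<^esub> = et \<one>\<^bsub>A\<^esub> a \<otimes>\<^bsub>R\<^esub> vX \<one> l \<oplus>\<^bsub>R\<^esub> et \<one>\<^bsub>A\<^esub> c \<otimes>\<^bsub>R\<^esub> vY m"
proof -
  obtain es where es: "set es \<subseteq> carrier R" "length es = 6"
    and u: "et a \<one>\<^bsub>A\<^esub> = R.comb es [\<one>,\<zero>,\<zero>,\<zero>,\<zero>,\<zero>]"
      "et a (b \<otimes>\<^bsub>A\<^esub> c) = R.comb es [\<zero>,\<one>,\<zero>,\<zero>,\<zero>,\<zero>]"
      "et b (a \<otimes>\<^bsub>A\<^esub> c) = R.comb es [\<zero>,\<zero>,\<one>,\<zero>,\<zero>,\<zero>]"
    using unit_combs[of "et a \<one>\<^bsub>A\<^esub>" "et a (b \<otimes>\<^bsub>A\<^esub> c)" "et b (a \<otimes>\<^bsub>A\<^esub> c)" "\<zero>\<^bsub>R\<^esub>" "\<zero>\<^bsub>R\<^esub>" "\<zero>\<^bsub>R\<^esub>"] by auto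
  show "et a \<one>\<^bsub>A\<^esub> = et \<one>\<^bsub>A\<^esub> a \<otimes>\<^bsub>R\<^esub> vX \<one> l \<oplus>\<^bsub>R\<^esub> et \<one>\<^bsub>A\<^esub> c \<otimes>\<^bsub>R\<^esub> vY m"
    unfolding vX_def vY_def vZ_def vW_def et_one[symmetric]
    by (simp only: expand_simps, simp add: et_simps, simp only: u,
      simp add: R.comb_add R.comb_smult es, (simp add: scalar_simps)?)
qed

lemma et_b: "et b \<one>\<^bsub>A\<^esub> = et \<one>\<^bsub>A\<^esub> b \<otimes>\<^bsub>R\<^esub> vX \<one> l \<oplus>\<^bsub>R\<^esub> et \<one>\<^bsub>A\<^esub> d \<otimes>\<^bsub>R\<^esub> vY m"
proof -
  obtain es where es: "set es \<subseteq> carrier R" "length es = 6"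
    and u: "et b \<one>\<^bsub>A\<^esub> = R.comb es [\<one>,\<zero>,\<zero>,\<zero>,\<zero>,\<zero>]"
      "et b (b \<otimes>\<^bsub>A\<^esub> c) = R.comb es [\<zero>,\<one>,\<zero>,\<zero>,\<zero>,\<zero>]"
      "et a (b \<otimes>\<^bsub>A\<^esub> d) = R.comb es [\<zero>,\<zero>,\<one>,\<zero>,\<zero>,\<zero>]"
    using unit_combs[of "et b \<one>\<^bsub>A\<^esub>" "et b (b \<otimes>\<^bsub>A\<^esub> c)" "et a (b \<otimes>\<^bsub>A\<^esub> d)" "\<zero>\<^bsub>R\<^esub>" "\<zero>\<^bsub>R\<^esub>" "\<zero>\<^bsub>R\<^esub>"] by auto
  show "et b \<one>\<^bsub>A\<^esub> = et \<one>\<^bsub>A\<^esub> b \<otimes>\<^bsub>R\<^esub> vX \<one> l \<oplus>\<^bsub>R\<^esub> et \<one>\<^bsub>A\<^esub> d \<otimes>\<^bsub>R\<^esub> vY m"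
    unfolding vX_def vY_def vZ_def vW_def et_one[symmetric]
    by (simp only: expand_simps, simp add: et_simps, simp only: u,
      simp add: R.comb_add R.comb_smult es, (simp add: scalar_simps)?)
qed

lemma et_c: "et c \<one>\<^bsub>A\<^esub> = et \<one>\<^bsub>A\<^esub> a \<otimes>\<^bsub>R\<^esub> vZ l \<oplus>\<^bsub>R\<^esub> et \<one>\<^bsub>A\<^esub> c \<otimes>\<^bsub>R\<^esub> vW \<one> m"
proof -
  obtain es where es: "set es \<subseteq> carrier R" "length es = 6"
    and u: "et c \<one>\<^bsub>A\<^esub> = R.comb es [\<one>,\<zero>,\<zero>,\<zero>,\<zero>,\<zero>]"
      "et c (b \<otimes>\<^bsub>A\<^esub> c) = R.comb es [\<zero>,\<one>,\<zero>,\<zero>,\<zero>,\<zero>]"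
      "et d (a \<otimes>\<^bsub>A\<^esub> c) = R.comb es [\<zero>,\<zero>,\<one>,\<zero>,\<zero>,\<zero>]"
    using unit_combs[of "et c \<one>\<^bsub>A\<^esub>" "et c (b \<otimes>\<^bsub>A\<^esub> c)" "et d (a \<otimes>\<^bsub>A\<^esub> c)" "\<zero>\<^bsub>R\<^esub>" "\<zero>\<^bsub>R\<^esub>" "\<zero>\<^bsub>R\<^esub>"] by auto
  show "et c \<one>\<^bsub>A\<^esub> = et \<one>\<^bsub>A\<^esub> a \<otimes>\<^bsub>R\<^esub> vZ l \<oplus>\<^bsub>R\<^esub> et \<one>\<^bsub>A\<^esub> c \<otimes>\<^bsub>R\<^esub> vW \<one> m"
    unfolding vX_def vY_def vZ_def vW_def et_one[symmetric]
    by (simp only: expand_simps, simp add: et_simps, simp only: u,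
      simp add: R.comb_add R.comb_smult es, (simp add: scalar_simps)?)
qed

lemma et_d: "et d \<one>\<^bsub>A\<^esub> = et \<one>\<^bsub>A\<^esub> b \<otimes>\<^bsub>R\<^esub> vZ l \<oplus>\<^bsub>R\<^esub> et \<one>\<^bsub>A\<^esub> d \<otimes>\<^bsub>R\<^esub> vW \<one> m"
proof -
  obtain es where es: "set es \<subseteq> carrier R" "length es = 6"
    and u: "et d \<one>\<^bsub>A\<^esub> = R.comb es [\<one>,\<zero>,\<zero>,\<zero>,\<zero>,\<zero>]"
      "et d (b \<otimes>\<^bsub>A\<^esub> c) = R.comb es [\<zero>,\<one>,\<zero>,\<zero>,\<zero>,\<zero>]"
      "et c (b \<otimes>\<^bsub>A\<^esub> d) = R.comb es [\<zero>,\<zero>,\<one>,\<zero>,\<zero>,\<zero>]"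
    using unit_combs[of "et d \<one>\<^bsub>A\<^esub>" "et d (b \<otimes>\<^bsub>A\<^esub> c)" "et c (b \<otimes>\<^bsub>A\<^esub> d)" "\<zero>\<^bsub>R\<^esub>" "\<zero>\<^bsub>R\<^esub>" "\<zero>\<^bsub>R\<^esub>"] by auto
  show "et d \<one>\<^bsub>A\<^esub> = et \<one>\<^bsub>A\<^esub> b \<otimes>\<^bsub>R\<^esub> vZ l \<oplus>\<^bsub>R\<^esub> et \<one>\<^bsub>A\<^esub> d \<otimes>\<^bsub>R\<^esub> vW \<one> m"
    unfolding vX_def vY_def vZ_def vW_def et_one[symmetric]
    by (simp only: expand_simps, simp add: et_simps, simp only: u,
      simp add: R.comb_add R.comb_smult es, (simp add: scalar_simps)?)
qed

end

section \<open>Weighted shift operators\<close>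

text \<open>The function \<open>f\<close> at \<open>(u, v, w)\<close> holds the coefficient of the normal form
  $D_Y^v D_Z^w (1 \otimes f(u, v, w)) T^u$ of an element of $A^e$; the operators \<open>opr\<close> below are
  left multiplication by $a \otimes 1, \ldots, d \otimes 1$ in these coordinates. \<open>T^u\<close> is
  $X^u$ for $u \ge 0$ and $W^{-u}$ for $u \le 0$.\<close>

definition grid_module :: "('k, 'a) module \<Rightarrow> ('k, int \<times> nat \<times> nat \<Rightarrow> 'a) module" where
  "grid_module A = \<lparr>carrier = {f. \<forall>i. f i \<in> carrier A}, mult = undefined, one = undefined,
     zero = (\<lambda>i. \<zero>\<^bsub>A\<^esub>), add = (\<lambda>f g i. f i \<oplus>\<^bsub>A\<^esub> g i), smult = (\<lambda>c f i. c \<odot>\<^bsub>A\<^esub> f i)\<rparr>"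

context k_algebra
begin

abbreviation "V \<equiv> grid_module A"
abbreviation "E \<equiv> end_alg K V"

lemma V_simps [simp]: "f \<in> carrier V \<longleftrightarrow> (\<forall>i. f i \<in> carrier A)" "\<zero>\<^bsub>V\<^esub> = (\<lambda>i. \<zero>\<^bsub>A\<^esub>)"
  "f \<oplus>\<^bsub>V\<^esub> g = (\<lambda>i. f i \<oplus>\<^bsub>A\<^esub> g i)" "c \<odot>\<^bsub>V\<^esub> f = (\<lambda>i. c \<odot>\<^bsub>A\<^esub> f i)"
  by (simp_all add: grid_module_def)

lemma module_V: "module K V"
proof -
  have ag: "abelian_group V"
  proof (rule abelian_groupI)
    show "\<exists>y\<in>carrier V. y \<oplus>\<^bsub>V\<^esub> x = \<zero>\<^bsub>V\<^esub>" if "x \<in> carrier V" for x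
      using that by (intro bexI[of _ "\<lambda>i. \<ominus>\<^bsub>A\<^esub> x i"]) (auto simp: M.l_neg)
  qed (auto simp: M.a_ac)
  show ?thesis
    by (rule moduleI[OF cring_K ag]) (auto simp: smult_l_distr smult_r_distr smult_assoc1)
qed

lemma E_algebra: "k_algebra K E"
  unfolding k_algebra_def by (rule assoc_algebra_end_alg) (rule module_V)

text \<open>The exponents of \<alpha> and \<beta> are the v- and w-index at the source of the shift:
  each D_Y and D_Z that a letter has to pass contributes one factor.\<close>

definition N :: "'a \<Rightarrow> int \<Rightarrow> nat \<Rightarrow> nat \<Rightarrow> 'k \<Rightarrow> 'k \<Rightarrow> (int \<times> nat \<times> nat \<Rightarrow> 'a) \<Rightarrow> int \<times> nat \<times> nat \<Rightarrow> 'a" where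
  "N x i j h \<alpha> \<beta> = (\<lambda>f\<in>carrier V. \<lambda>(u, v, w). if j \<le> v \<and> h \<le> w
     then (\<alpha> [^]\<^bsub>K\<^esub> (v - j) \<otimes>\<^bsub>K\<^esub> \<beta> [^]\<^bsub>K\<^esub> (w - h)) \<odot>\<^bsub>A\<^esub> (x \<otimes>\<^bsub>A\<^esub> f (u - i, v - j, w - h)) else \<zero>\<^bsub>A\<^esub>)"

lemma N_apply:
  "f \<in> carrier V \<Longrightarrow> N x i j h \<alpha> \<beta> f (u, v, w) = (if j \<le> v \<and> h \<le> w
     then (\<alpha> [^]\<^bsub>K\<^esub> (v - j) \<otimes>\<^bsub>K\<^esub> \<beta> [^]\<^bsub>K\<^esub> (w - h)) \<odot>\<^bsub>A\<^esub> (x \<otimes>\<^bsub>A\<^esub> f (u - i, v - j, w - h)) else \<zero>\<^bsub>A\<^esub>)"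
  by (simp add: N_def)

lemma N_closed [simp]:
  assumes "x \<in> carrier A" "\<alpha> \<in> carrier K" "\<beta> \<in> carrier K"
  shows "N x i j h \<alpha> \<beta> \<in> carrier E"
  unfolding N_def
  by (rule end_algI[OF _ _ _ module_V])
    (use assms in \<open>auto simp: smult_r_distr r_distr smult_mult_right[symmetric] fun_eq_iff
      smult_left_commute\<close>)

lemma N_eqI:
  assumes "T \<in> carrier E" "T' \<in> carrier E"
    and "\<And>f u v w. f \<in> carrier V \<Longrightarrow> T f (u, v, w) = T' f (u, v, w)"
  shows "T = T'"
  by (rule end_alg_eqI[OF assms(1,2)]) (use assms(3) in \<open>auto simp: fun_eq_iff\<close>)

text \<open>The right-hand operator acts first and raises the source indices seen by the left-hand
  one by j' and h', which produces the scalar in front. Weighted shifts are thus closed under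
  composition up to scalars.\<close>

lemma N_mult:
  assumes "x \<in> carrier A" "x' \<in> carrier A" "\<alpha> \<in> carrier K" "\<beta> \<in> carrier K" "\<alpha>' \<in> carrier K" "\<beta>' \<in> carrier K"
  shows "N x i j h \<alpha> \<beta> \<otimes>\<^bsub>E\<^esub> N x' i' j' h' \<alpha>' \<beta>' = (\<alpha> [^]\<^bsub>K\<^esub> j' \<otimes>\<^bsub>K\<^esub> \<beta> [^]\<^bsub>K\<^esub> h') \<odot>\<^bsub>E\<^esub>
    N (x \<otimes>\<^bsub>A\<^esub> x') (i + i') (j + j') (h + h') (\<alpha> \<otimes>\<^bsub>K\<^esub> \<alpha>') (\<beta> \<otimes>\<^bsub>K\<^esub> \<beta>')"
proof -
  interpret E: k_algebra K E by (rule E_algebra)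
  note KS = cring.cring_simprules[OF cring_K]
  have comm: "\<alpha> [^]\<^bsub>K\<^esub> (s + t) = \<alpha> [^]\<^bsub>K\<^esub> s \<otimes>\<^bsub>K\<^esub> \<alpha> [^]\<^bsub>K\<^esub> t" if "\<alpha> \<in> carrier K" for \<alpha> and s t :: nat
    using that cring_K by (metis cring.axioms(1) monoid.nat_pow_mult ring.is_monoid)
  have distr: "(\<alpha> \<otimes>\<^bsub>K\<^esub> \<alpha>') [^]\<^bsub>K\<^esub> (s::nat) = \<alpha> [^]\<^bsub>K\<^esub> s \<otimes>\<^bsub>K\<^esub> \<alpha>' [^]\<^bsub>K\<^esub> s" if "\<alpha> \<in> carrier K" "\<alpha>' \<in> carrier K" for \<alpha> \<alpha>' s
    using that cring_K by (metis cring.axioms(2) comm_monoid.nat_pow_distrib)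
  show ?thesis
  proof (rule N_eqI)
    fix f u v w assume f: "f \<in> carrier V"
    let ?g = "N x' i' j' h' \<alpha>' \<beta>' f"
    have g: "?g \<in> carrier V" using end_algD(1)[OF N_closed f] assms by simp
    have e: "u - i - i' = u - (i + i')" "v - j - j' = v - (j + j')" "w - h - h' = w - (h + h')" by simp_all
    show "(N x i j h \<alpha> \<beta> \<otimes>\<^bsub>E\<^esub> N x' i' j' h' \<alpha>' \<beta>') f (u, v, w) =
      ((\<alpha> [^]\<^bsub>K\<^esub> j' \<otimes>\<^bsub>K\<^esub> \<beta> [^]\<^bsub>K\<^esub> h') \<odot>\<^bsub>E\<^esub>
        N (x \<otimes>\<^bsub>A\<^esub> x') (i + i') (j + j') (h + h') (\<alpha> \<otimes>\<^bsub>K\<^esub> \<alpha>') (\<beta> \<otimes>\<^bsub>K\<^esub> \<beta>')) f (u, v, w)"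
    proof (cases "j + j' \<le> v \<and> h + h' \<le> w")
      case True
      have v: "v - j = j' + (v - (j + j'))" "w - h = h' + (w - (h + h'))" using True by auto
      have p: "\<alpha> [^]\<^bsub>K\<^esub> (v - j) = \<alpha> [^]\<^bsub>K\<^esub> j' \<otimes>\<^bsub>K\<^esub> \<alpha> [^]\<^bsub>K\<^esub> (v - (j + j'))"
        "\<beta> [^]\<^bsub>K\<^esub> (w - h) = \<beta> [^]\<^bsub>K\<^esub> h' \<otimes>\<^bsub>K\<^esub> \<beta> [^]\<^bsub>K\<^esub> (w - (h + h'))"
        using comm assms v by metis+
      have fc: "f (u - (i + i'), v - (j + j'), w - (h + h')) \<in> carrier A" using f by simp
      have "(N x i j h \<alpha> \<beta> \<otimes>\<^bsub>E\<^esub> N x' i' j' h' \<alpha>' \<beta>') f (u, v, w) = N x i j h \<alpha> \<beta> ?g (u, v, w)"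
        using f by (simp add: end_alg_apply del: V_simps)
      also have "\<dots> = (\<alpha> [^]\<^bsub>K\<^esub> (v - j) \<otimes>\<^bsub>K\<^esub> \<beta> [^]\<^bsub>K\<^esub> (w - h)) \<odot>\<^bsub>A\<^esub> (x \<otimes>\<^bsub>A\<^esub>
        ((\<alpha>' [^]\<^bsub>K\<^esub> (v - (j + j')) \<otimes>\<^bsub>K\<^esub> \<beta>' [^]\<^bsub>K\<^esub> (w - (h + h'))) \<odot>\<^bsub>A\<^esub>
          (x' \<otimes>\<^bsub>A\<^esub> f (u - (i + i'), v - (j + j'), w - (h + h')))))"
        using True unfolding N_apply[OF g] N_apply[OF f] e by auto
      finally show ?thesis
        using True assms fc unfolding end_alg_apply(5)[OF f] V_simps N_apply[OF f] p
        by (simp add: smult_mult_right[symmetric] smult_assoc1[symmetric] distr m_assoc KS)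
    next
      case False
      have "(N x i j h \<alpha> \<beta> \<otimes>\<^bsub>E\<^esub> N x' i' j' h' \<alpha>' \<beta>') f (u, v, w) = N x i j h \<alpha> \<beta> ?g (u, v, w)"
        using f by (simp add: end_alg_apply del: V_simps)
      also have "\<dots> = \<zero>\<^bsub>A\<^esub>"
        using False assms unfolding N_apply[OF g] N_apply[OF f] by (auto simp: KS)
      finally show ?thesis
        using False assms unfolding end_alg_apply(5)[OF f] V_simps N_apply[OF f]
        by (auto simp: KS)
    qed
  qed (use assms in \<open>simp_all add: KS\<close>)
qed

lemma N_add:
  assumes "x \<in> carrier A" "y \<in> carrier A" "\<alpha> \<in> carrier K" "\<beta> \<in> carrier K"
  shows "N (x \<oplus>\<^bsub>A\<^esub> y) i j h \<alpha> \<beta> = N x i j h \<alpha> \<beta> \<oplus>\<^bsub>E\<^esub> N y i j h \<alpha> \<beta>"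
proof -
  interpret E: k_algebra K E by (rule E_algebra)
  show ?thesis
  proof (rule N_eqI)
    fix f u v w assume f: "f \<in> carrier V"
    then show "N (x \<oplus>\<^bsub>A\<^esub> y) i j h \<alpha> \<beta> f (u, v, w) = (N x i j h \<alpha> \<beta> \<oplus>\<^bsub>E\<^esub> N y i j h \<alpha> \<beta>) f (u, v, w)"
      unfolding end_alg_apply(4)[OF f] V_simps N_apply[OF f]
      using assms by (auto simp: l_distr smult_r_distr cring.cring_simprules(5)[OF cring_K])
  qed (use assms in simp_all)
qed

lemma N_smult:
  assumes "x \<in> carrier A" "c \<in> carrier K" "\<alpha> \<in> carrier K" "\<beta> \<in> carrier K"
  shows "N (c \<odot>\<^bsub>A\<^esub> x) i j h \<alpha> \<beta> = c \<odot>\<^bsub>E\<^esub> N x i j h \<alpha> \<beta>"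
proof -
  interpret E: k_algebra K E by (rule E_algebra)
  show ?thesis
  proof (rule N_eqI)
    fix f u v w assume f: "f \<in> carrier V"
    then show "N (c \<odot>\<^bsub>A\<^esub> x) i j h \<alpha> \<beta> f (u, v, w) = (c \<odot>\<^bsub>E\<^esub> N x i j h \<alpha> \<beta>) f (u, v, w)"
      unfolding end_alg_apply(5)[OF f] V_simps N_apply[OF f]
      using assms by (auto simp: smult_mult_left[symmetric] smult_left_commute
        cring.cring_simprules(5)[OF cring_K])
  qed (use assms in simp_all)
qed

lemma N_one: "N \<one>\<^bsub>A\<^esub> 0 0 0 \<one>\<^bsub>K\<^esub> \<one>\<^bsub>K\<^esub> = \<one>\<^bsub>E\<^esub>"
proof -
  interpret E: k_algebra K E by (rule E_algebra)
  have 1: "\<one>\<^bsub>K\<^esub> [^]\<^bsub>K\<^esub> (j::nat) = \<one>\<^bsub>K\<^esub>" for j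
    using cring_K by (simp add: cring.axioms(1) monoid.nat_pow_one ring.is_monoid)
  show ?thesis
  proof (rule N_eqI)
    fix f u v w assume f: "f \<in> carrier V"
    then show "N \<one>\<^bsub>A\<^esub> 0 0 0 \<one>\<^bsub>K\<^esub> \<one>\<^bsub>K\<^esub> f (u, v, w) = \<one>\<^bsub>E\<^esub> f (u, v, w)"
      unfolding end_alg_apply(2)[OF f] N_apply[OF f] 1
      by (simp add: cring.cring_simprules[OF cring_K])
  qed (simp_all add: cring.cring_simprules[OF cring_K])
qed

text \<open>The operator that represents 1 \<otimes> y: it multiplies every coefficient on the right
  and commutes with all weighted shifts.\<close>

definition rmul :: "'a \<Rightarrow> (int \<times> nat \<times> nat \<Rightarrow> 'a) \<Rightarrow> int \<times> nat \<times> nat \<Rightarrow> 'a" where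
  "rmul y = (\<lambda>f\<in>carrier V. \<lambda>i. f i \<otimes>\<^bsub>A\<^esub> y)"

lemma rmul_closed: "y \<in> carrier A \<Longrightarrow> rmul y \<in> carrier E"
  unfolding rmul_def
  by (rule end_algI[OF _ _ _ module_V]) (auto simp: l_distr smult_mult_left[symmetric])

lemma rmul_apply: "f \<in> carrier V \<Longrightarrow> rmul y f i = f i \<otimes>\<^bsub>A\<^esub> y"
  by (simp add: rmul_def)

lemma rmul_hom: "rmul \<in> alg_hom K (op_alg A) E"
proof -
  interpret E: k_algebra K E by (rule E_algebra)
  have ap: "rmul y f = (\<lambda>i. f i \<otimes>\<^bsub>A\<^esub> y)" if "f \<in> carrier V" for f y
    using that by (auto simp: rmul_apply simp del: V_simps)
  show ?thesis
    by (rule alg_homI; (intro end_alg_eqI[where K=K and V=V] E.m_closed E.a_closed E.smult_closed E.one_closed)?)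
      (auto simp: rmul_closed end_alg_apply ap m_assoc r_distr smult_mult_right[symmetric])
qed

lemma rmul_N:
  assumes "x \<in> carrier A" "\<alpha> \<in> carrier K" "\<beta> \<in> carrier K" "y \<in> carrier A"
  shows "rmul y \<otimes>\<^bsub>E\<^esub> N x i j h \<alpha> \<beta> = N x i j h \<alpha> \<beta> \<otimes>\<^bsub>E\<^esub> rmul y"
proof -
  interpret E: k_algebra K E by (rule E_algebra)
  show ?thesis
  proof (rule N_eqI)
    fix f u v w assume f: "f \<in> carrier V"
    have c: "N x i j h \<alpha> \<beta> f \<in> carrier V" "rmul y f \<in> carrier V"
      using end_algD(1)[OF N_closed f] end_algD(1)[OF rmul_closed f] assms by auto
    have fc: "f i \<in> carrier A" for i using f by (cases i) simp
    show "(rmul y \<otimes>\<^bsub>E\<^esub> N x i j h \<alpha> \<beta>) f (u, v, w) = (N x i j h \<alpha> \<beta> \<otimes>\<^bsub>E\<^esub> rmul y) f (u, v, w)"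
      unfolding end_alg_apply(1)[OF f] rmul_apply[OF c(1)] N_apply[OF c(2)] N_apply[OF f] rmul_apply[OF f]
      using assms fc by (auto simp: smult_mult_left[symmetric] m_assoc cring.cring_simprules(5)[OF cring_K])
  qed (use assms in \<open>simp_all add: rmul_closed\<close>)
qed

lemma unit_combs8:
  assumes "{e1,e2,e3,e4,e5,e6,e7,e8} \<subseteq> carrier A"
  shows "\<exists>es. set es \<subseteq> carrier A \<and> length es = 8 \<and>
    e1 = comb es [\<one>\<^bsub>K\<^esub>,\<zero>\<^bsub>K\<^esub>,\<zero>\<^bsub>K\<^esub>,\<zero>\<^bsub>K\<^esub>,\<zero>\<^bsub>K\<^esub>,\<zero>\<^bsub>K\<^esub>,\<zero>\<^bsub>K\<^esub>,\<zero>\<^bsub>K\<^esub>] \<and>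
    e2 = comb es [\<zero>\<^bsub>K\<^esub>,\<one>\<^bsub>K\<^esub>,\<zero>\<^bsub>K\<^esub>,\<zero>\<^bsub>K\<^esub>,\<zero>\<^bsub>K\<^esub>,\<zero>\<^bsub>K\<^esub>,\<zero>\<^bsub>K\<^esub>,\<zero>\<^bsub>K\<^esub>] \<and>
    e3 = comb es [\<zero>\<^bsub>K\<^esub>,\<zero>\<^bsub>K\<^esub>,\<one>\<^bsub>K\<^esub>,\<zero>\<^bsub>K\<^esub>,\<zero>\<^bsub>K\<^esub>,\<zero>\<^bsub>K\<^esub>,\<zero>\<^bsub>K\<^esub>,\<zero>\<^bsub>K\<^esub>] \<and>
    e4 = comb es [\<zero>\<^bsub>K\<^esub>,\<zero>\<^bsub>K\<^esub>,\<zero>\<^bsub>K\<^esub>,\<one>\<^bsub>K\<^esub>,\<zero>\<^bsub>K\<^esub>,\<zero>\<^bsub>K\<^esub>,\<zero>\<^bsub>K\<^esub>,\<zero>\<^bsub>K\<^esub>] \<and>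
    e5 = comb es [\<zero>\<^bsub>K\<^esub>,\<zero>\<^bsub>K\<^esub>,\<zero>\<^bsub>K\<^esub>,\<zero>\<^bsub>K\<^esub>,\<one>\<^bsub>K\<^esub>,\<zero>\<^bsub>K\<^esub>,\<zero>\<^bsub>K\<^esub>,\<zero>\<^bsub>K\<^esub>] \<and>
    e6 = comb es [\<zero>\<^bsub>K\<^esub>,\<zero>\<^bsub>K\<^esub>,\<zero>\<^bsub>K\<^esub>,\<zero>\<^bsub>K\<^esub>,\<zero>\<^bsub>K\<^esub>,\<one>\<^bsub>K\<^esub>,\<zero>\<^bsub>K\<^esub>,\<zero>\<^bsub>K\<^esub>] \<and>
    e7 = comb es [\<zero>\<^bsub>K\<^esub>,\<zero>\<^bsub>K\<^esub>,\<zero>\<^bsub>K\<^esub>,\<zero>\<^bsub>K\<^esub>,\<zero>\<^bsub>K\<^esub>,\<zero>\<^bsub>K\<^esub>,\<one>\<^bsub>K\<^esub>,\<zero>\<^bsub>K\<^esub>] \<and>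
    e8 = comb es [\<zero>\<^bsub>K\<^esub>,\<zero>\<^bsub>K\<^esub>,\<zero>\<^bsub>K\<^esub>,\<zero>\<^bsub>K\<^esub>,\<zero>\<^bsub>K\<^esub>,\<zero>\<^bsub>K\<^esub>,\<zero>\<^bsub>K\<^esub>,\<one>\<^bsub>K\<^esub>]"
  by (intro exI[of _ "[e1,e2,e3,e4,e5,e6,e7,e8]"]) (use assms in simp)

end

context sl2_letters
begin

sublocale E: k_algebra K E by (rule E_algebra)

text \<open>Read off from \<open>et_a\<close> to \<open>et_d\<close>. The weights come out for the
  order D_Z^w D_Y^v; the opposite order differs by powers of the unit k m. The index u counts powers
  of X as though X were invertible, so X is a pure shift in u, while W is the inverse shift plus the
  same one raised by one step in v and w. Hence a and b need two terms, c and d three.\<close>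

fun opr :: "sl2_gen \<Rightarrow> (int \<times> nat \<times> nat \<Rightarrow> 'a) \<Rightarrow> int \<times> nat \<times> nat \<Rightarrow> 'a" where
  "opr Ga = N a 1 0 0 n l \<oplus>\<^bsub>E\<^esub> N c 0 1 0 n l"
| "opr Gb = N b 1 0 0 l n \<oplus>\<^bsub>E\<^esub> N d 0 1 0 l n"
| "opr Gc = N a 0 0 1 n m \<oplus>\<^bsub>E\<^esub> (N c (-1) 0 0 k m \<oplus>\<^bsub>E\<^esub> N c (-1) 1 1 n m)"
| "opr Gd = N b 0 0 1 l k \<oplus>\<^bsub>E\<^esub> (N d (-1) 0 0 m k \<oplus>\<^bsub>E\<^esub> N d (-1) 1 1 l k)"

lemma opr_closed [simp]: "opr g \<in> carrier E"
  by (cases g) simp_all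

lemma K_pow_simps: "x \<in> carrier K \<Longrightarrow> x [^] (0::nat) = \<one>" "x \<in> carrier K \<Longrightarrow> x [^] (Suc i) = x [^] i \<otimes> x"
  "x \<in> carrier K \<Longrightarrow> x [^] (1::nat) = x"
  using cring_K by (simp_all add: cring.axioms(1) monoid.nat_pow_0 monoid.nat_pow_Suc ring.is_monoid KS)

lemma scalar_inverses: "l \<otimes> k = \<one>" "n \<otimes> m = \<one>"
  using kl mn KS(14) by auto

lemmas opr_simps = E.l_distr E.r_distr E.a_closed E.m_closed E.smult_closed N_mult N_closed N_add N_smult
  K_pow_simps letters scalars rels
  E.smult_mult_left[symmetric] E.smult_mult_right[symmetric] E.smult_assoc1[symmetric]

text \<open>In this and the next six relations \<open>N_mult\<close> expands all products into at
  most eight distinct weighted shifts, which are named as opaque unit vectors; what remains is a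
  comparison of scalars using k l = m n = 1.\<close>

lemma opr_ba: "opr Gb \<otimes>\<^bsub>E\<^esub> opr Ga = m \<odot>\<^bsub>E\<^esub> (opr Ga \<otimes>\<^bsub>E\<^esub> opr Gb)"
proof -
  obtain es where es: "set es \<subseteq> carrier E" "length es = 8"
    and u: "N (a \<otimes>\<^bsub>A\<^esub> b) (2) 0 0 (l \<otimes> n) (l \<otimes> n) = E.comb es [\<one>,\<zero>,\<zero>,\<zero>,\<zero>,\<zero>,\<zero>,\<zero>]"
      "N (b \<otimes>\<^bsub>A\<^esub> c) (1) (Suc 0) 0 (l \<otimes> n) (l \<otimes> n) = E.comb es [\<zero>,\<one>,\<zero>,\<zero>,\<zero>,\<zero>,\<zero>,\<zero>]"
      "N \<one>\<^bsub>A\<^esub> (1) (Suc 0) 0 (l \<otimes> n) (l \<otimes> n) = E.comb es [\<zero>,\<zero>,\<one>,\<zero>,\<zero>,\<zero>,\<zero>,\<zero>]"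
      "N (c \<otimes>\<^bsub>A\<^esub> d) (0) (Suc (Suc 0)) 0 (l \<otimes> n) (l \<otimes> n) = E.comb es [\<zero>,\<zero>,\<zero>,\<one>,\<zero>,\<zero>,\<zero>,\<zero>]"
    using E.unit_combs8[of "N (a \<otimes>\<^bsub>A\<^esub> b) (2) 0 0 (l \<otimes> n) (l \<otimes> n)" "N (b \<otimes>\<^bsub>A\<^esub> c) (1) (Suc 0) 0 (l \<otimes> n) (l \<otimes> n)" "N \<one>\<^bsub>A\<^esub> (1) (Suc 0) 0 (l \<otimes> n) (l \<otimes> n)" "N (c \<otimes>\<^bsub>A\<^esub> d) (0) (Suc (Suc 0)) 0 (l \<otimes> n) (l \<otimes> n)" "\<zero>\<^bsub>E\<^esub>" "\<zero>\<^bsub>E\<^esub>" "\<zero>\<^bsub>E\<^esub>" "\<zero>\<^bsub>E\<^esub>"] by (auto simp: KS)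
  show ?thesis
    by (simp add: opr_simps KS kl mn kl_cancel scalar_inverses, simp add: u E.comb_add E.comb_smult es KS, (simp add: scalar_simps)?)
qed

lemma opr_ca: "opr Gc \<otimes>\<^bsub>E\<^esub> opr Ga = k \<odot>\<^bsub>E\<^esub> (opr Ga \<otimes>\<^bsub>E\<^esub> opr Gc)"
proof -
  obtain es where es: "set es \<subseteq> carrier E" "length es = 8"
    and u: "N (a \<otimes>\<^bsub>A\<^esub> a) (1) 0 (Suc 0) (n \<otimes> n) (l \<otimes> m) = E.comb es [\<one>,\<zero>,\<zero>,\<zero>,\<zero>,\<zero>,\<zero>,\<zero>]"
      "N (a \<otimes>\<^bsub>A\<^esub> c) (0) (Suc 0) (Suc 0) (n \<otimes> n) (l \<otimes> m) = E.comb es [\<zero>,\<one>,\<zero>,\<zero>,\<zero>,\<zero>,\<zero>,\<zero>]"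
      "N (a \<otimes>\<^bsub>A\<^esub> c) (0) 0 0 (k \<otimes> n) (l \<otimes> m) = E.comb es [\<zero>,\<zero>,\<one>,\<zero>,\<zero>,\<zero>,\<zero>,\<zero>]"
      "N (c \<otimes>\<^bsub>A\<^esub> c) (-1) (Suc 0) 0 (k \<otimes> n) (l \<otimes> m) = E.comb es [\<zero>,\<zero>,\<zero>,\<one>,\<zero>,\<zero>,\<zero>,\<zero>]"
      "N (c \<otimes>\<^bsub>A\<^esub> c) (-1) (Suc (Suc 0)) (Suc 0) (n \<otimes> n) (l \<otimes> m) = E.comb es [\<zero>,\<zero>,\<zero>,\<zero>,\<one>,\<zero>,\<zero>,\<zero>]"
    using E.unit_combs8[of "N (a \<otimes>\<^bsub>A\<^esub> a) (1) 0 (Suc 0) (n \<otimes> n) (l \<otimes> m)" "N (a \<otimes>\<^bsub>A\<^esub> c) (0) (Suc 0) (Suc 0) (n \<otimes> n) (l \<otimes> m)" "N (a \<otimes>\<^bsub>A\<^esub> c) (0) 0 0 (k \<otimes> n) (l \<otimes> m)" "N (c \<otimes>\<^bsub>A\<^esub> c) (-1) (Suc 0) 0 (k \<otimes> n) (l \<otimes> m)" "N (c \<otimes>\<^bsub>A\<^esub> c) (-1) (Suc (Suc 0)) (Suc 0) (n \<otimes> n) (l \<otimes> m)" "\<zero>\<^bsub>E\<^esub>" "\<zero>\<^bsub>E\<^esub>" "\<zero>\<^bsub>E\<^esub>"] by (auto simp: KS)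
  show ?thesis
    by (simp add: opr_simps KS kl mn kl_cancel scalar_inverses, simp add: u E.comb_add E.comb_smult es KS, (simp add: scalar_simps)?)
qed

lemma opr_db: "opr Gd \<otimes>\<^bsub>E\<^esub> opr Gb = m \<odot>\<^bsub>E\<^esub> (opr Gb \<otimes>\<^bsub>E\<^esub> opr Gd)"
proof -
  obtain es where es: "set es \<subseteq> carrier E" "length es = 8"
    and u: "N (b \<otimes>\<^bsub>A\<^esub> b) (1) 0 (Suc 0) (l \<otimes> l) (k \<otimes> n) = E.comb es [\<one>,\<zero>,\<zero>,\<zero>,\<zero>,\<zero>,\<zero>,\<zero>]"
      "N (b \<otimes>\<^bsub>A\<^esub> d) (0) (Suc 0) (Suc 0) (l \<otimes> l) (k \<otimes> n) = E.comb es [\<zero>,\<one>,\<zero>,\<zero>,\<zero>,\<zero>,\<zero>,\<zero>]"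
      "N (b \<otimes>\<^bsub>A\<^esub> d) (0) 0 0 (l \<otimes> m) (k \<otimes> n) = E.comb es [\<zero>,\<zero>,\<one>,\<zero>,\<zero>,\<zero>,\<zero>,\<zero>]"
      "N (d \<otimes>\<^bsub>A\<^esub> d) (-1) (Suc 0) 0 (l \<otimes> m) (k \<otimes> n) = E.comb es [\<zero>,\<zero>,\<zero>,\<one>,\<zero>,\<zero>,\<zero>,\<zero>]"
      "N (d \<otimes>\<^bsub>A\<^esub> d) (-1) (Suc (Suc 0)) (Suc 0) (l \<otimes> l) (k \<otimes> n) = E.comb es [\<zero>,\<zero>,\<zero>,\<zero>,\<one>,\<zero>,\<zero>,\<zero>]"
    using E.unit_combs8[of "N (b \<otimes>\<^bsub>A\<^esub> b) (1) 0 (Suc 0) (l \<otimes> l) (k \<otimes> n)" "N (b \<otimes>\<^bsub>A\<^esub> d) (0) (Suc 0) (Suc 0) (l \<otimes> l) (k \<otimes> n)" "N (b \<otimes>\<^bsub>A\<^esub> d) (0) 0 0 (l \<otimes> m) (k \<otimes> n)" "N (d \<otimes>\<^bsub>A\<^esub> d) (-1) (Suc 0) 0 (l \<otimes> m) (k \<otimes> n)" "N (d \<otimes>\<^bsub>A\<^esub> d) (-1) (Suc (Suc 0)) (Suc 0) (l \<otimes> l) (k \<otimes> n)" "\<zero>\<^bsub>E\<^esub>" "\<zero>\<^bsub>E\<^esub>" "\<zero>\<^bsub>E\<^esub>"] by (auto simp: KS)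
  show ?thesis
    by (simp add: opr_simps KS kl mn kl_cancel scalar_inverses, simp add: u E.comb_add E.comb_smult es KS, (simp add: scalar_simps)?)
qed

lemma opr_dc: "opr Gd \<otimes>\<^bsub>E\<^esub> opr Gc = k \<odot>\<^bsub>E\<^esub> (opr Gc \<otimes>\<^bsub>E\<^esub> opr Gd)"
proof -
  obtain es where es: "set es \<subseteq> carrier E" "length es = 8"
    and u: "N (a \<otimes>\<^bsub>A\<^esub> b) (0) 0 (Suc (Suc 0)) (l \<otimes> n) (k \<otimes> m) = E.comb es [\<one>,\<zero>,\<zero>,\<zero>,\<zero>,\<zero>,\<zero>,\<zero>]"
      "N (b \<otimes>\<^bsub>A\<^esub> c) (-1) 0 (Suc 0) \<one> (k \<otimes> m) = E.comb es [\<zero>,\<one>,\<zero>,\<zero>,\<zero>,\<zero>,\<zero>,\<zero>]"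
      "N (b \<otimes>\<^bsub>A\<^esub> c) (-1) (Suc 0) (Suc (Suc 0)) (l \<otimes> n) (k \<otimes> m) = E.comb es [\<zero>,\<zero>,\<one>,\<zero>,\<zero>,\<zero>,\<zero>,\<zero>]"
      "N \<one>\<^bsub>A\<^esub> (-1) 0 (Suc 0) \<one> (k \<otimes> m) = E.comb es [\<zero>,\<zero>,\<zero>,\<one>,\<zero>,\<zero>,\<zero>,\<zero>]"
      "N (c \<otimes>\<^bsub>A\<^esub> d) (-2) 0 0 (k \<otimes> m) (k \<otimes> m) = E.comb es [\<zero>,\<zero>,\<zero>,\<zero>,\<one>,\<zero>,\<zero>,\<zero>]"
      "N (c \<otimes>\<^bsub>A\<^esub> d) (-2) (Suc 0) (Suc 0) \<one> (k \<otimes> m) = E.comb es [\<zero>,\<zero>,\<zero>,\<zero>,\<zero>,\<one>,\<zero>,\<zero>]"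
      "N \<one>\<^bsub>A\<^esub> (-1) (Suc 0) (Suc (Suc 0)) (l \<otimes> n) (k \<otimes> m) = E.comb es [\<zero>,\<zero>,\<zero>,\<zero>,\<zero>,\<zero>,\<one>,\<zero>]"
      "N (c \<otimes>\<^bsub>A\<^esub> d) (-2) (Suc (Suc 0)) (Suc (Suc 0)) (l \<otimes> n) (k \<otimes> m) = E.comb es [\<zero>,\<zero>,\<zero>,\<zero>,\<zero>,\<zero>,\<zero>,\<one>]"
    using E.unit_combs8[of "N (a \<otimes>\<^bsub>A\<^esub> b) (0) 0 (Suc (Suc 0)) (l \<otimes> n) (k \<otimes> m)" "N (b \<otimes>\<^bsub>A\<^esub> c) (-1) 0 (Suc 0) \<one> (k \<otimes> m)" "N (b \<otimes>\<^bsub>A\<^esub> c) (-1) (Suc 0) (Suc (Suc 0)) (l \<otimes> n) (k \<otimes> m)" "N \<one>\<^bsub>A\<^esub> (-1) 0 (Suc 0) \<one> (k \<otimes> m)" "N (c \<otimes>\<^bsub>A\<^esub> d) (-2) 0 0 (k \<otimes> m) (k \<otimes> m)" "N (c \<otimes>\<^bsub>A\<^esub> d) (-2) (Suc 0) (Suc 0) \<one> (k \<otimes> m)" "N \<one>\<^bsub>A\<^esub> (-1) (Suc 0) (Suc (Suc 0)) (l \<otimes> n) (k \<otimes> m)" "N (c \<otimes>\<^bsub>A\<^esub> d) (-2) (Suc (Suc 0)) (Suc (Suc 0)) (l \<otimes> n) (k \<otimes> m)"] by (auto simp: KS)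
  show ?thesis
    by (simp add: opr_simps KS kl mn kl_cancel scalar_inverses, simp add: u E.comb_add E.comb_smult es KS, (simp add: scalar_simps)?)
qed

lemma opr_cb: "opr Gc \<otimes>\<^bsub>E\<^esub> opr Gb = opr Gb \<otimes>\<^bsub>E\<^esub> opr Gc"
proof -
  obtain es where es: "set es \<subseteq> carrier E" "length es = 8"
    and u: "N (a \<otimes>\<^bsub>A\<^esub> b) (1) 0 (Suc 0) (l \<otimes> n) \<one> = E.comb es [\<one>,\<zero>,\<zero>,\<zero>,\<zero>,\<zero>,\<zero>,\<zero>]"
      "N \<one>\<^bsub>A\<^esub> (0) (Suc 0) (Suc 0) (l \<otimes> n) \<one> = E.comb es [\<zero>,\<one>,\<zero>,\<zero>,\<zero>,\<zero>,\<zero>,\<zero>]"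
      "N (b \<otimes>\<^bsub>A\<^esub> c) (0) (Suc 0) (Suc 0) (l \<otimes> n) \<one> = E.comb es [\<zero>,\<zero>,\<one>,\<zero>,\<zero>,\<zero>,\<zero>,\<zero>]"
      "N (b \<otimes>\<^bsub>A\<^esub> c) (0) 0 0 \<one> \<one> = E.comb es [\<zero>,\<zero>,\<zero>,\<one>,\<zero>,\<zero>,\<zero>,\<zero>]"
      "N (c \<otimes>\<^bsub>A\<^esub> d) (-1) (Suc 0) 0 \<one> \<one> = E.comb es [\<zero>,\<zero>,\<zero>,\<zero>,\<one>,\<zero>,\<zero>,\<zero>]"
      "N (c \<otimes>\<^bsub>A\<^esub> d) (-1) (Suc (Suc 0)) (Suc 0) (l \<otimes> n) \<one> = E.comb es [\<zero>,\<zero>,\<zero>,\<zero>,\<zero>,\<one>,\<zero>,\<zero>]"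
    using E.unit_combs8[of "N (a \<otimes>\<^bsub>A\<^esub> b) (1) 0 (Suc 0) (l \<otimes> n) \<one>" "N \<one>\<^bsub>A\<^esub> (0) (Suc 0) (Suc 0) (l \<otimes> n) \<one>" "N (b \<otimes>\<^bsub>A\<^esub> c) (0) (Suc 0) (Suc 0) (l \<otimes> n) \<one>" "N (b \<otimes>\<^bsub>A\<^esub> c) (0) 0 0 \<one> \<one>" "N (c \<otimes>\<^bsub>A\<^esub> d) (-1) (Suc 0) 0 \<one> \<one>" "N (c \<otimes>\<^bsub>A\<^esub> d) (-1) (Suc (Suc 0)) (Suc 0) (l \<otimes> n) \<one>" "\<zero>\<^bsub>E\<^esub>" "\<zero>\<^bsub>E\<^esub>"] by (auto simp: KS)
  show ?thesis
    by (simp add: opr_simps KS kl mn kl_cancel scalar_inverses, simp add: u E.comb_add E.comb_smult es KS, (simp add: scalar_simps)?)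
qed

lemma opr_ad: "opr Ga \<otimes>\<^bsub>E\<^esub> opr Gd = \<one>\<^bsub>E\<^esub> \<oplus>\<^bsub>E\<^esub> l \<odot>\<^bsub>E\<^esub> (opr Gb \<otimes>\<^bsub>E\<^esub> opr Gc)"
proof -
  obtain es where es: "set es \<subseteq> carrier E" "length es = 8"
    and u: "N \<one>\<^bsub>A\<^esub> (0) 0 0 \<one> \<one> = E.comb es [\<one>,\<zero>,\<zero>,\<zero>,\<zero>,\<zero>,\<zero>,\<zero>]"
      "N (a \<otimes>\<^bsub>A\<^esub> b) (1) 0 (Suc 0) (l \<otimes> n) \<one> = E.comb es [\<zero>,\<one>,\<zero>,\<zero>,\<zero>,\<zero>,\<zero>,\<zero>]"
      "N (b \<otimes>\<^bsub>A\<^esub> c) (0) 0 0 \<one> \<one> = E.comb es [\<zero>,\<zero>,\<one>,\<zero>,\<zero>,\<zero>,\<zero>,\<zero>]"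
      "N \<one>\<^bsub>A\<^esub> (0) (Suc 0) (Suc 0) (l \<otimes> n) \<one> = E.comb es [\<zero>,\<zero>,\<zero>,\<one>,\<zero>,\<zero>,\<zero>,\<zero>]"
      "N (b \<otimes>\<^bsub>A\<^esub> c) (0) (Suc 0) (Suc 0) (l \<otimes> n) \<one> = E.comb es [\<zero>,\<zero>,\<zero>,\<zero>,\<one>,\<zero>,\<zero>,\<zero>]"
      "N (c \<otimes>\<^bsub>A\<^esub> d) (-1) (Suc 0) 0 \<one> \<one> = E.comb es [\<zero>,\<zero>,\<zero>,\<zero>,\<zero>,\<one>,\<zero>,\<zero>]"
      "N (c \<otimes>\<^bsub>A\<^esub> d) (-1) (Suc (Suc 0)) (Suc 0) (l \<otimes> n) \<one> = E.comb es [\<zero>,\<zero>,\<zero>,\<zero>,\<zero>,\<zero>,\<one>,\<zero>]"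
    using E.unit_combs8[of "N \<one>\<^bsub>A\<^esub> (0) 0 0 \<one> \<one>" "N (a \<otimes>\<^bsub>A\<^esub> b) (1) 0 (Suc 0) (l \<otimes> n) \<one>" "N (b \<otimes>\<^bsub>A\<^esub> c) (0) 0 0 \<one> \<one>" "N \<one>\<^bsub>A\<^esub> (0) (Suc 0) (Suc 0) (l \<otimes> n) \<one>" "N (b \<otimes>\<^bsub>A\<^esub> c) (0) (Suc 0) (Suc 0) (l \<otimes> n) \<one>" "N (c \<otimes>\<^bsub>A\<^esub> d) (-1) (Suc 0) 0 \<one> \<one>" "N (c \<otimes>\<^bsub>A\<^esub> d) (-1) (Suc (Suc 0)) (Suc 0) (l \<otimes> n) \<one>" "\<zero>\<^bsub>E\<^esub>"] by (auto simp: KS)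
  show ?thesis
    unfolding N_one[symmetric]
    by (simp add: opr_simps KS kl mn kl_cancel scalar_inverses, simp add: u E.comb_add E.comb_smult es KS, (simp add: scalar_simps)?)
qed

lemma opr_da: "opr Gd \<otimes>\<^bsub>E\<^esub> opr Ga = \<one>\<^bsub>E\<^esub> \<oplus>\<^bsub>E\<^esub> m \<odot>\<^bsub>E\<^esub> (opr Gb \<otimes>\<^bsub>E\<^esub> opr Gc)"
proof -
  obtain es where es: "set es \<subseteq> carrier E" "length es = 8"
    and u: "N \<one>\<^bsub>A\<^esub> (0) 0 0 \<one> \<one> = E.comb es [\<one>,\<zero>,\<zero>,\<zero>,\<zero>,\<zero>,\<zero>,\<zero>]"
      "N (a \<otimes>\<^bsub>A\<^esub> b) (1) 0 (Suc 0) (l \<otimes> n) \<one> = E.comb es [\<zero>,\<one>,\<zero>,\<zero>,\<zero>,\<zero>,\<zero>,\<zero>]"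
      "N (b \<otimes>\<^bsub>A\<^esub> c) (0) (Suc 0) (Suc 0) (l \<otimes> n) \<one> = E.comb es [\<zero>,\<zero>,\<one>,\<zero>,\<zero>,\<zero>,\<zero>,\<zero>]"
      "N (b \<otimes>\<^bsub>A\<^esub> c) (0) 0 0 \<one> \<one> = E.comb es [\<zero>,\<zero>,\<zero>,\<one>,\<zero>,\<zero>,\<zero>,\<zero>]"
      "N (c \<otimes>\<^bsub>A\<^esub> d) (-1) (Suc 0) 0 \<one> \<one> = E.comb es [\<zero>,\<zero>,\<zero>,\<zero>,\<one>,\<zero>,\<zero>,\<zero>]"
      "N \<one>\<^bsub>A\<^esub> (0) (Suc 0) (Suc 0) (l \<otimes> n) \<one> = E.comb es [\<zero>,\<zero>,\<zero>,\<zero>,\<zero>,\<one>,\<zero>,\<zero>]"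
      "N (c \<otimes>\<^bsub>A\<^esub> d) (-1) (Suc (Suc 0)) (Suc 0) (l \<otimes> n) \<one> = E.comb es [\<zero>,\<zero>,\<zero>,\<zero>,\<zero>,\<zero>,\<one>,\<zero>]"
    using E.unit_combs8[of "N \<one>\<^bsub>A\<^esub> (0) 0 0 \<one> \<one>" "N (a \<otimes>\<^bsub>A\<^esub> b) (1) 0 (Suc 0) (l \<otimes> n) \<one>" "N (b \<otimes>\<^bsub>A\<^esub> c) (0) (Suc 0) (Suc 0) (l \<otimes> n) \<one>" "N (b \<otimes>\<^bsub>A\<^esub> c) (0) 0 0 \<one> \<one>" "N (c \<otimes>\<^bsub>A\<^esub> d) (-1) (Suc 0) 0 \<one> \<one>" "N \<one>\<^bsub>A\<^esub> (0) (Suc 0) (Suc 0) (l \<otimes> n) \<one>" "N (c \<otimes>\<^bsub>A\<^esub> d) (-1) (Suc (Suc 0)) (Suc 0) (l \<otimes> n) \<one>" "\<zero>\<^bsub>E\<^esub>"] by (auto simp: KS)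
  show ?thesis
    unfolding N_one[symmetric]
    by (simp add: opr_simps KS kl mn kl_cancel scalar_inverses, simp add: u E.comb_add E.comb_smult es KS, (simp add: scalar_simps)?)
qed

end

section \<open>Normal forms in the enveloping algebra\<close>

text \<open>The assumptions isolate what is used of the presentation: two consequences of its
  universal property and generation by the letters. They will hold for the parameters (p, q) and for
  (q^{-1}, p^{-1}), so that the normal form and its corollaries are available for both.\<close>

locale sl2_presented = sl2_letters K A k l m n a b c d
  for K :: "('k, 'x) ring_scheme" (structure) and A :: "('k, 'a) module"
    and k l m n :: 'k and a b c d :: 'a +
  assumes tor_ex: "\<lbrakk>s \<in> carrier K; s' \<in> carrier K; t \<in> carrier K; t' \<in> carrier K; s \<otimes> s' = \<one>; t \<otimes> t' = \<one>\<rbrakk>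
      \<Longrightarrow> \<exists>h\<in>alg_hom K A A. h a = s \<odot>\<^bsub>A\<^esub> a \<and> h d = s' \<odot>\<^bsub>A\<^esub> d \<and> h b = t \<odot>\<^bsub>A\<^esub> b \<and> h c = t' \<odot>\<^bsub>A\<^esub> c"
    and opr_ex: "\<exists>h\<in>alg_hom K A E. h a = opr Ga \<and> h b = opr Gb \<and> h c = opr Gc \<and> h d = opr Gd"
    and letter_induct: "\<lbrakk>x \<in> carrier A; P \<zero>\<^bsub>A\<^esub>; P \<one>\<^bsub>A\<^esub>;
       \<And>s x. s \<in> carrier K \<Longrightarrow> x \<in> carrier A \<Longrightarrow> P x \<Longrightarrow> P (s \<odot>\<^bsub>A\<^esub> x);
       \<And>x y. x \<in> carrier A \<Longrightarrow> y \<in> carrier A \<Longrightarrow> P x \<Longrightarrow> P y \<Longrightarrow> P (x \<oplus>\<^bsub>A\<^esub> y);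
       \<And>e x. e \<in> {a, b, c, d} \<Longrightarrow> x \<in> carrier A \<Longrightarrow> P x \<Longrightarrow> P (e \<otimes>\<^bsub>A\<^esub> x)\<rbrakk> \<Longrightarrow> P x"
begin

lemma letter_mem: "e \<in> {a, b, c, d} \<Longrightarrow> e \<in> carrier A" by auto

lemma A_hom_unique:
  assumes "assoc_algebra K B" "h \<in> alg_hom K A B" "h' \<in> alg_hom K A B" "x \<in> carrier A"
    and "h a = h' a" "h b = h' b" "h c = h' c" "h d = h' d"
  shows "h x = h' x"
  using assms(4)
proof (rule letter_induct)
  show "h \<zero>\<^bsub>A\<^esub> = h' \<zero>\<^bsub>A\<^esub>"
    using assms(1-3) ring_A assoc_algebra.ring_A alg_hom_zero by metis
next
  fix e x assume e: "e \<in> {a, b, c, d}" and x: "x \<in> carrier A" "h x = h' x"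
  have "h e = h' e" using e assms(5-) by auto
  then show "h (e \<otimes>\<^bsub>A\<^esub> x) = h' (e \<otimes>\<^bsub>A\<^esub> x)"
    using x letter_mem[OF e] by (simp add: alg_homD[OF assms(2)] alg_homD[OF assms(3)])
qed (simp_all add: alg_homD[OF assms(2)] alg_homD[OF assms(3)])

lemma R_hom_unique:
  assumes "assoc_algebra K B" "h \<in> alg_hom K R B" "h' \<in> alg_hom K R B" "r \<in> carrier R"
    and "\<And>x y. x \<in> carrier A \<Longrightarrow> y \<in> carrier A \<Longrightarrow> h (et x y) = h' (et x y)"
  shows "h r = h' r"
  using assms(4)
proof (induction r rule: R_induct)
  case zero
  then show ?case using assms(1-3) R.ring_A assoc_algebra.ring_A alg_hom_zero by metis
qed (simp add: alg_homD[OF assms(2)] alg_homD[OF assms(3)] assms(5))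

text \<open>The torus scaling the letters, acting on the left tensor factor of $A^e$. For $u = X, W$ one
  has $Y u = \phi(u) Y$ with \<open>\<phi> = py\<close>; the map \<open>Dy r = py r \<otimes> Y\<close> makes sense on all of $A^e$ and
  commutes with multiplication by $1 \otimes y$.\<close>

definition tor :: "'k \<Rightarrow> 'k \<Rightarrow> 'k \<Rightarrow> 'k \<Rightarrow> 'a \<Rightarrow> 'a" where
  "tor s s' t t' = (SOME h. h \<in> alg_hom K A A \<and> h a = s \<odot>\<^bsub>A\<^esub> a \<and> h d = s' \<odot>\<^bsub>A\<^esub> d \<and>
    h b = t \<odot>\<^bsub>A\<^esub> b \<and> h c = t' \<odot>\<^bsub>A\<^esub> c)"

definition torR :: "'k \<Rightarrow> 'k \<Rightarrow> 'k \<Rightarrow> 'k \<Rightarrow> ('k, 'a) env \<Rightarrow> ('k, 'a) env" where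
  "torR s s' t t' = (SOME h. h \<in> alg_hom K R R \<and>
    (\<forall>x\<in>carrier A. \<forall>y\<in>carrier A. h (et x y) = et (tor s s' t t' x) y))"

definition "weights s s' t t' \<longleftrightarrow> s \<in> carrier K \<and> s' \<in> carrier K \<and> t \<in> carrier K \<and> t' \<in> carrier K \<and>
  s \<otimes> s' = \<one> \<and> t \<otimes> t' = \<one>"

lemma weights_scalars [simp]: "weights k l m n" "weights m n k l" "weights l k n m" "weights n m l k"
  using kl mn scalar_inverses by (simp_all add: weights_def)

lemma tor:
  assumes "weights s s' t t'"
  shows "tor s s' t t' \<in> alg_hom K A A" "tor s s' t t' a = s \<odot>\<^bsub>A\<^esub> a" "tor s s' t t' d = s' \<odot>\<^bsub>A\<^esub> d"
    "tor s s' t t' b = t \<odot>\<^bsub>A\<^esub> b" "tor s s' t t' c = t' \<odot>\<^bsub>A\<^esub> c"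
proof -
  have "\<exists>h. h \<in> alg_hom K A A \<and> h a = s \<odot>\<^bsub>A\<^esub> a \<and> h d = s' \<odot>\<^bsub>A\<^esub> d \<and>
    h b = t \<odot>\<^bsub>A\<^esub> b \<and> h c = t' \<odot>\<^bsub>A\<^esub> c"
    using tor_ex[of s s' t t'] assms by (auto simp: weights_def)
  from someI_ex[OF this, folded tor_def]
  show "tor s s' t t' \<in> alg_hom K A A" "tor s s' t t' a = s \<odot>\<^bsub>A\<^esub> a" "tor s s' t t' d = s' \<odot>\<^bsub>A\<^esub> d"
    "tor s s' t t' b = t \<odot>\<^bsub>A\<^esub> b" "tor s s' t t' c = t' \<odot>\<^bsub>A\<^esub> c" by blast+
qed

lemma et_left_hom: "(\<lambda>x. et x \<one>\<^bsub>A\<^esub>) \<in> alg_hom K A R"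
  by (rule alg_homI) (simp_all add: et_mult et_add et_smult et_one)

lemma et_right_hom: "(\<lambda>x. et \<one>\<^bsub>A\<^esub> x) \<in> alg_hom K (op_alg A) R"
  by (rule alg_homI) (simp_all add: et_mult et_add et_smult et_one)

lemma torR:
  assumes "weights s s' t t'"
  shows "torR s s' t t' \<in> alg_hom K R R"
    "\<And>x y. x \<in> carrier A \<Longrightarrow> y \<in> carrier A \<Longrightarrow> torR s s' t t' (et x y) = et (tor s s' t t' x) y"
proof -
  note h = tor(1)[OF assms]
  have "\<exists>h\<in>alg_hom K R R. \<forall>x\<in>carrier A. \<forall>y\<in>carrier A. h (et x y) = et (tor s s' t t' x) \<one>\<^bsub>A\<^esub> \<otimes>\<^bsub>R\<^esub> et \<one>\<^bsub>A\<^esub> y"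
    by (rule R_lift[OF R.assoc_algebra_axioms alg_hom_comp[OF h et_left_hom] et_right_hom])
      (simp add: alg_homD(1)[OF h] et_mult)
  then have "\<exists>h. h \<in> alg_hom K R R \<and> (\<forall>x\<in>carrier A. \<forall>y\<in>carrier A. h (et x y) = et (tor s s' t t' x) y)"
    by (auto simp: alg_homD(1)[OF h] et_mult)
  from someI_ex[OF this, folded torR_def]
  show "torR s s' t t' \<in> alg_hom K R R"
    "\<And>x y. x \<in> carrier A \<Longrightarrow> y \<in> carrier A \<Longrightarrow> torR s s' t t' (et x y) = et (tor s s' t t' x) y" by blast+
qed

lemma tor_comp:
  assumes "weights s s' t t'" "weights u u' v v'" "x \<in> carrier A"
  shows "tor s s' t t' (tor u u' v v' x) = tor u u' v v' (tor s s' t t' x)"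
  by (rule A_hom_unique[OF assoc_algebra_axioms alg_hom_comp[OF tor(1)[OF assms(2)] tor(1)[OF assms(1)]]
        alg_hom_comp[OF tor(1)[OF assms(1)] tor(1)[OF assms(2)]] assms(3)])
    (use assms(1,2) in \<open>simp_all add: tor alg_homD(5)[OF tor(1)] weights_def smult_left_commute\<close>)

lemma torR_comp:
  assumes "weights s s' t t'" "weights u u' v v'" "r \<in> carrier R"
  shows "torR s s' t t' (torR u u' v v' r) = torR u u' v v' (torR s s' t t' r)"
  by (rule R_hom_unique[OF R.assoc_algebra_axioms alg_hom_comp[OF torR(1)[OF assms(2)] torR(1)[OF assms(1)]]
        alg_hom_comp[OF torR(1)[OF assms(1)] torR(1)[OF assms(2)]] assms(3)])
    (use assms(1,2) in \<open>simp add: torR alg_homD(1)[OF tor(1)] tor_comp\<close>)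

lemma tor_inv:
  assumes "weights s s' t t'" "weights s' s t' t" "x \<in> carrier A"
  shows "tor s s' t t' (tor s' s t' t x) = x"
  by (rule A_hom_unique[OF assoc_algebra_axioms alg_hom_comp[OF tor(1)[OF assms(2)] tor(1)[OF assms(1)]]
        alg_hom_id assms(3)])
    (use assms(1,2) in \<open>simp_all add: tor alg_homD(5)[OF tor(1)] weights_def smult_assoc1[symmetric]\<close>)

lemma torR_inv:
  assumes "weights s s' t t'" "weights s' s t' t" "r \<in> carrier R"
  shows "torR s s' t t' (torR s' s t' t r) = r"
  by (rule R_hom_unique[OF R.assoc_algebra_axioms alg_hom_comp[OF torR(1)[OF assms(2)] torR(1)[OF assms(1)]]
        alg_hom_id assms(3)])
    (use assms(1,2) in \<open>simp add: torR alg_homD(1)[OF tor(1)] tor_inv\<close>)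

abbreviation "py \<equiv> torR m n k l"
abbreviation "pz \<equiv> torR k l m n"
abbreviation "py' \<equiv> torR n m l k"
abbreviation "pz' \<equiv> torR l k n m"
abbreviation "X \<equiv> vX \<one> l"
abbreviation "Y \<equiv> vY m"
abbreviation "Z \<equiv> vZ l"
abbreviation "W \<equiv> vW \<one> m"

lemmas py = alg_homD[OF torR(1)[OF weights_scalars(2)]]
lemmas pz = alg_homD[OF torR(1)[OF weights_scalars(1)]]
lemmas py' = alg_homD[OF torR(1)[OF weights_scalars(4)]]
lemmas pz' = alg_homD[OF torR(1)[OF weights_scalars(3)]]

lemmas tor_vals = torR(2) tor et_smult R.smult_assoc1[symmetric] alg_homD[OF torR(1)]

text \<open>Rescaling turns Y and Z into unit multiples of elements of the same shape with another
  inner scalar; this is where \<open>vY k\<close> and \<open>vZ n\<close> come from.\<close>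

lemma twist_values:
  "py X = vX m \<one>" "py Z = l \<odot>\<^bsub>R\<^esub> vZ n" "py W = vW n (m \<otimes> l)"
  "pz X = vX k (m \<otimes> l)" "pz Y = m \<odot>\<^bsub>R\<^esub> vY k" "pz W = vW l \<one>"
  "pz' (vY k) = n \<odot>\<^bsub>R\<^esub> vY m"
  by (simp_all add: vX_def vY_def vZ_def vW_def tor_vals KS R.smult_r_distr)
    (simp_all add: scalar_simps scalar_inverses)

lemma XYZW_closed [simp]: "X \<in> carrier R" "Y \<in> carrier R" "Z \<in> carrier R" "W \<in> carrier R"
  by (simp_all add: KS)

definition "Dy r = py r \<otimes>\<^bsub>R\<^esub> Y"
definition "Dz r = pz r \<otimes>\<^bsub>R\<^esub> Z"

lemma D_closed [simp]: "r \<in> carrier R \<Longrightarrow> Dy r \<in> carrier R" "r \<in> carrier R \<Longrightarrow> Dz r \<in> carrier R"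
  by (simp_all add: Dy_def Dz_def py pz KS)

lemma D_add: "r \<in> carrier R \<Longrightarrow> s \<in> carrier R \<Longrightarrow> Dy (r \<oplus>\<^bsub>R\<^esub> s) = Dy r \<oplus>\<^bsub>R\<^esub> Dy s"
  "r \<in> carrier R \<Longrightarrow> s \<in> carrier R \<Longrightarrow> Dz (r \<oplus>\<^bsub>R\<^esub> s) = Dz r \<oplus>\<^bsub>R\<^esub> Dz s"
  by (simp_all add: Dy_def Dz_def py pz R.l_distr)

lemma D_smult: "r \<in> carrier R \<Longrightarrow> s \<in> carrier K \<Longrightarrow> Dy (s \<odot>\<^bsub>R\<^esub> r) = s \<odot>\<^bsub>R\<^esub> Dy r"
  "r \<in> carrier R \<Longrightarrow> s \<in> carrier K \<Longrightarrow> Dz (s \<odot>\<^bsub>R\<^esub> r) = s \<odot>\<^bsub>R\<^esub> Dz r"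
  by (simp_all add: Dy_def Dz_def py pz R.smult_mult_left[symmetric])

lemma D_zero [simp]: "Dy \<zero>\<^bsub>R\<^esub> = \<zero>\<^bsub>R\<^esub>" "Dz \<zero>\<^bsub>R\<^esub> = \<zero>\<^bsub>R\<^esub>"
  using D_smult[of "\<zero>\<^bsub>R\<^esub>" \<zero>] by (simp_all add: KS)

lemma tor_one: "weights s s' t t' \<Longrightarrow> tor s s' t t' \<one>\<^bsub>A\<^esub> = \<one>\<^bsub>A\<^esub>"
  using alg_homD(4)[OF tor(1)] .

lemma D_rmul:
  assumes "r \<in> carrier R" "y \<in> carrier A"
  shows "et \<one>\<^bsub>A\<^esub> y \<otimes>\<^bsub>R\<^esub> Dy r = Dy (et \<one>\<^bsub>A\<^esub> y \<otimes>\<^bsub>R\<^esub> r)" "et \<one>\<^bsub>A\<^esub> y \<otimes>\<^bsub>R\<^esub> Dz r = Dz (et \<one>\<^bsub>A\<^esub> y \<otimes>\<^bsub>R\<^esub> r)"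
  using assms by (simp_all add: Dy_def Dz_def py pz torR(2) tor_one R.m_assoc)

lemma D_mult:
  assumes "r \<in> carrier R" "s \<in> carrier R"
  shows "Dy (r \<otimes>\<^bsub>R\<^esub> s) = py r \<otimes>\<^bsub>R\<^esub> Dy s" "Dz (r \<otimes>\<^bsub>R\<^esub> s) = pz r \<otimes>\<^bsub>R\<^esub> Dz s"
  using assms by (simp_all add: Dy_def Dz_def py pz R.m_assoc)

text \<open>A torus element multiplies each letter by a unit, so a left letter passes through D_Y or
  D_Z at the cost of the inverse unit.\<close>

lemma D_letter:
  assumes "r \<in> carrier R" "e \<in> {a, b, c, d}"
  shows "\<exists>s\<in>carrier K. et e \<one>\<^bsub>A\<^esub> \<otimes>\<^bsub>R\<^esub> Dy r = s \<odot>\<^bsub>R\<^esub> Dy (et e \<one>\<^bsub>A\<^esub> \<otimes>\<^bsub>R\<^esub> r)"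
    "\<exists>s\<in>carrier K. et e \<one>\<^bsub>A\<^esub> \<otimes>\<^bsub>R\<^esub> Dz r = s \<odot>\<^bsub>R\<^esub> Dz (et e \<one>\<^bsub>A\<^esub> \<otimes>\<^bsub>R\<^esub> r)"
proof -
  have *: "\<exists>s\<in>carrier K. x = s \<odot>\<^bsub>R\<^esub> (t \<odot>\<^bsub>R\<^esub> x)" if "x \<in> carrier R" "t \<in> {k, l, m, n}" for x t
  proof -
    from that(2) obtain s where "s \<in> carrier K" "s \<otimes> t = \<one>"
      using kl mn scalar_inverses scalars by blast
    then show ?thesis using that by (intro bexI[of _ s]) (auto simp: R.smult_assoc1[symmetric])
  qed
  show "\<exists>s\<in>carrier K. et e \<one>\<^bsub>A\<^esub> \<otimes>\<^bsub>R\<^esub> Dy r = s \<odot>\<^bsub>R\<^esub> Dy (et e \<one>\<^bsub>A\<^esub> \<otimes>\<^bsub>R\<^esub> r)"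
    "\<exists>s\<in>carrier K. et e \<one>\<^bsub>A\<^esub> \<otimes>\<^bsub>R\<^esub> Dz r = s \<odot>\<^bsub>R\<^esub> Dz (et e \<one>\<^bsub>A\<^esub> \<otimes>\<^bsub>R\<^esub> r)"
    using assms by (auto simp: D_mult torR(2) tor et_smult R.smult_mult_left[symmetric] intro!: *)
qed

text \<open>By \<open>YZ\<close>, the operators D_Y and D_Z commute up to the unit k m, so their
  order in a normal form is immaterial.\<close>

lemma Dz_Dy:
  assumes "r \<in> carrier R"
  shows "Dz (Dy r) = (k \<otimes> m) \<odot>\<^bsub>R\<^esub> Dy (Dz r)"
proof -
  have r: "pz (py r) \<in> carrier R" using assms by (simp add: py pz)
  have "Dz (Dy r) = pz (py r) \<otimes>\<^bsub>R\<^esub> (pz Y \<otimes>\<^bsub>R\<^esub> Z)"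
    using assms by (simp add: Dy_def Dz_def py pz R.m_assoc)
  also have "pz Y \<otimes>\<^bsub>R\<^esub> Z = m \<odot>\<^bsub>R\<^esub> (vZ n \<otimes>\<^bsub>R\<^esub> Y)"
    by (simp add: twist_values R.smult_mult_left[symmetric] YZ)
  also have "\<dots> = (k \<otimes> m) \<odot>\<^bsub>R\<^esub> (py Z \<otimes>\<^bsub>R\<^esub> Y)"
    by (simp add: twist_values R.smult_mult_left[symmetric] R.smult_assoc1[symmetric] scalar_simps)
  also have "pz (py r) \<otimes>\<^bsub>R\<^esub> ((k \<otimes> m) \<odot>\<^bsub>R\<^esub> (py Z \<otimes>\<^bsub>R\<^esub> Y)) = (k \<otimes> m) \<odot>\<^bsub>R\<^esub> Dy (Dz r)"
    using assms r by (simp add: Dy_def Dz_def py pz R.m_assoc R.smult_mult_right[symmetric]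
      torR_comp[of k l m n m n k l] KS)
  finally show ?thesis .
qed

lemma XW_WX: "X \<otimes>\<^bsub>R\<^esub> W = \<one>\<^bsub>R\<^esub> \<oplus>\<^bsub>R\<^esub> Dy Z" "W \<otimes>\<^bsub>R\<^esub> X = \<one>\<^bsub>R\<^esub> \<oplus>\<^bsub>R\<^esub> Dz Y"
  by (simp_all add: XW WX Dy_def Dz_def twist_values R.smult_mult_left[symmetric])

section \<open>Powers of X and W and the action of X, Y, Z, W on them\<close>

primrec pw :: "('k, 'a) env \<Rightarrow> nat \<Rightarrow> ('k, 'a) env" where
  "pw x 0 = \<one>\<^bsub>R\<^esub>"
| "pw x (Suc i) = x \<otimes>\<^bsub>R\<^esub> pw x i"

definition T :: "int \<Rightarrow> ('k, 'a) env" where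
  "T i = (if 0 \<le> i then pw X (nat i) else pw W (nat (- i)))"

lemma pow_closed [simp]: "x \<in> carrier R \<Longrightarrow> pw x i \<in> carrier R"
  by (induction i) simp_all

lemma T_closed [simp]: "T i \<in> carrier R"
  by (simp add: T_def)

lemma Y_pow:
  assumes "x \<in> carrier R" "Y \<otimes>\<^bsub>R\<^esub> x = py x \<otimes>\<^bsub>R\<^esub> Y"
  shows "Y \<otimes>\<^bsub>R\<^esub> pw x (i) = Dy (pw x (i))"
proof (induction i)
  case 0
  then show ?case by (simp add: Dy_def py(4))
next
  case (Suc i)
  have "Y \<otimes>\<^bsub>R\<^esub> pw x (Suc i) = py x \<otimes>\<^bsub>R\<^esub> (Y \<otimes>\<^bsub>R\<^esub> pw x (i))"
    using assms py(1) by (simp add: R.m_assoc[symmetric])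
  then show ?case using Suc assms by (simp add: D_mult)
qed

lemma Z_pow:
  assumes "x \<in> carrier R" "Z \<otimes>\<^bsub>R\<^esub> x = pz x \<otimes>\<^bsub>R\<^esub> Z"
  shows "Z \<otimes>\<^bsub>R\<^esub> pw x (i) = Dz (pw x (i))"
proof (induction i)
  case 0
  then show ?case by (simp add: Dz_def pz(4))
next
  case (Suc i)
  have "Z \<otimes>\<^bsub>R\<^esub> pw x (Suc i) = pz x \<otimes>\<^bsub>R\<^esub> (Z \<otimes>\<^bsub>R\<^esub> pw x (i))"
    using assms pz(1) by (simp add: R.m_assoc[symmetric])
  then show ?case using Suc assms by (simp add: D_mult)
qed

lemma YZ_pow: "Y \<otimes>\<^bsub>R\<^esub> pw X (i) = Dy (pw X (i))" "Y \<otimes>\<^bsub>R\<^esub> pw W (i) = Dy (pw W (i))"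
  "Z \<otimes>\<^bsub>R\<^esub> pw X (i) = Dz (pw X (i))" "Z \<otimes>\<^bsub>R\<^esub> pw W (i) = Dz (pw W (i))"
  by (rule Y_pow Z_pow; simp add: twist_values YX YW ZX ZW)+

lemma YZ_T: "Y \<otimes>\<^bsub>R\<^esub> T i = Dy (T i)" "Z \<otimes>\<^bsub>R\<^esub> T i = Dz (T i)"
  by (auto simp: T_def YZ_pow)

text \<open>For negative i a factor X W is contracted to 1 + D_Y(Z). The second summand moves Z and
  Y through the remaining power of W and so lies in the image of D_Y D_Z.\<close>

lemma X_T: "X \<otimes>\<^bsub>R\<^esub> T i = T (i + 1) \<oplus>\<^bsub>R\<^esub> (if 0 \<le> i then \<zero>\<^bsub>R\<^esub> else Dy (Dz (T (i + 1))))"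
proof (cases "0 \<le> i")
  case True
  then show ?thesis by (simp add: T_def nat_add_distrib)
next
  case False
  \<comment> \<open>With this j one has T i = W W^j and T (i + 1) = W^j. The latter includes i = -1,
    where T 0 is formally a power of X but equals the empty power of W.\<close>
  define j where "j = nat (- i - 1)"
  have i: "nat (- i) = Suc j" using False by (simp add: j_def)
  have Ti: "T (i + 1) = pw W (j)"
  proof (cases "i = -1")
    case True then show ?thesis by (simp add: T_def j_def)
  next
    case f: False
    have "nat (- (i + 1)) = j" "\<not> 0 \<le> i + 1" using False f by (auto simp: j_def)
    then show ?thesis by (simp add: T_def)
  qed
  have "X \<otimes>\<^bsub>R\<^esub> T i = (X \<otimes>\<^bsub>R\<^esub> W) \<otimes>\<^bsub>R\<^esub> pw W (j)"
    using False by (simp add: T_def i R.m_assoc)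
  also have "\<dots> = pw W (j) \<oplus>\<^bsub>R\<^esub> py Z \<otimes>\<^bsub>R\<^esub> (Y \<otimes>\<^bsub>R\<^esub> pw W (j))"
    unfolding XW_WX by (simp add: R.l_distr Dy_def py(1) R.m_assoc)
  also have "py Z \<otimes>\<^bsub>R\<^esub> (Y \<otimes>\<^bsub>R\<^esub> pw W (j)) = Dy (Dz (pw W (j)))"
    by (simp add: YZ_pow(2) D_mult(1)[symmetric] YZ_pow(4))
  finally show ?thesis using False by (simp add: Ti)
qed

lemma W_T: "W \<otimes>\<^bsub>R\<^esub> T i = T (i - 1) \<oplus>\<^bsub>R\<^esub> (if i \<le> 0 then \<zero>\<^bsub>R\<^esub> else Dz (Dy (T (i - 1))))"
proof (cases "i \<le> 0")
  case True
  then show ?thesis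
  proof (cases "i = 0")
    case False
    then have "nat (- (i - 1)) = Suc (nat (- i))" "\<not> 0 \<le> i" "\<not> 1 \<le> i" using True by auto
    then show ?thesis using True by (simp add: T_def)
  qed (simp add: T_def)
next
  case False
  define j where "j = nat (i - 1)"
  have i: "nat i = Suc j" "T (i - 1) = pw X (j)" using False by (simp_all add: j_def T_def)
  have "W \<otimes>\<^bsub>R\<^esub> T i = (W \<otimes>\<^bsub>R\<^esub> X) \<otimes>\<^bsub>R\<^esub> pw X (j)"
    using False by (simp add: T_def i R.m_assoc)
  also have "\<dots> = pw X (j) \<oplus>\<^bsub>R\<^esub> pz Y \<otimes>\<^bsub>R\<^esub> (Z \<otimes>\<^bsub>R\<^esub> pw X (j))"
    unfolding XW_WX by (simp add: R.l_distr Dz_def pz(1) R.m_assoc)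
  also have "pz Y \<otimes>\<^bsub>R\<^esub> (Z \<otimes>\<^bsub>R\<^esub> pw X (j)) = Dz (Dy (pw X (j)))"
    by (simp add: YZ_pow(3) D_mult(2)[symmetric] YZ_pow(1))
  finally show ?thesis using False by (simp add: i)
qed

section \<open>Spanning: every element has a normal form\<close>

definition rec :: "int set \<Rightarrow> (int \<Rightarrow> 'a) \<Rightarrow> ('k, 'a) env" where
  "rec F y = (\<Oplus>\<^bsub>R\<^esub>i\<in>F. et \<one>\<^bsub>A\<^esub> (y i) \<otimes>\<^bsub>R\<^esub> T i)"

definition "S0 = {rec F y |F y. finite F \<and> (\<forall>i. y i \<in> carrier A)}"

text \<open>Normal forms are kept in Horner shape: \<open>S1\<close> is a polynomial in D_Z with
  coefficients in \<open>S0\<close>, and \<open>S\<close> a polynomial in D_Y with coefficients in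
  \<open>S1\<close>. Each step splits off the lowest coefficient, which fits both the closure proofs
  here and the later comparison of coordinates.\<close>

inductive_set S1 where
  zero: "\<zero>\<^bsub>R\<^esub> \<in> S1"
| step: "s \<in> S0 \<Longrightarrow> r \<in> S1 \<Longrightarrow> s \<oplus>\<^bsub>R\<^esub> Dz r \<in> S1"

inductive_set S where
  zero: "\<zero>\<^bsub>R\<^esub> \<in> S"
| step: "s \<in> S1 \<Longrightarrow> r \<in> S \<Longrightarrow> s \<oplus>\<^bsub>R\<^esub> Dy r \<in> S"

lemma rec_closed: "(\<And>i. y i \<in> carrier A) \<Longrightarrow> rec F y \<in> carrier R"
  unfolding rec_def by (rule R.finsum_closed) auto

lemma S0_closed: "s \<in> S0 \<Longrightarrow> s \<in> carrier R"
  by (auto simp: S0_def rec_closed)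

lemma S1_closed: "s \<in> S1 \<Longrightarrow> s \<in> carrier R"
  by (induction rule: S1.induct) (auto simp: S0_closed)

lemma S_closed: "s \<in> S \<Longrightarrow> s \<in> carrier R"
  by (induction rule: S.induct) (auto simp: S1_closed)

lemma et_right_zero: "et \<one>\<^bsub>A\<^esub> \<zero>\<^bsub>A\<^esub> = \<zero>\<^bsub>R\<^esub>"
  using et_smult(2)[of \<zero> "\<one>\<^bsub>A\<^esub>" "\<zero>\<^bsub>A\<^esub>"] by (simp add: KS)

lemma rec_superset:
  assumes "finite G" "F \<subseteq> G" "\<And>i. y i \<in> carrier A"
  shows "rec F y = rec G (\<lambda>i. if i \<in> F then y i else \<zero>\<^bsub>A\<^esub>)"
proof -
  have "rec F y = rec F (\<lambda>i. if i \<in> F then y i else \<zero>\<^bsub>A\<^esub>)"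
    unfolding rec_def using assms by (intro R.finsum_cong') auto
  also have "\<dots> = rec G (\<lambda>i. if i \<in> F then y i else \<zero>\<^bsub>A\<^esub>)"
    unfolding rec_def using assms by (intro R.finsum_superset) (auto simp: et_right_zero)
  finally show ?thesis .
qed

lemma S0_add:
  assumes "s \<in> S0" "r \<in> S0"
  shows "s \<oplus>\<^bsub>R\<^esub> r \<in> S0"
proof -
  obtain F y G z where s: "s = rec F y" "finite F" "\<And>i. y i \<in> carrier A"
    and r: "r = rec G z" "finite G" "\<And>i. z i \<in> carrier A"
    using assms by (auto simp: S0_def)
  define y' z' where "y' = (\<lambda>i. if i \<in> F then y i else \<zero>\<^bsub>A\<^esub>)" and "z' = (\<lambda>i. if i \<in> G then z i else \<zero>\<^bsub>A\<^esub>)"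
  have yz: "y' i \<in> carrier A" "z' i \<in> carrier A" for i using s r by (auto simp: y'_def z'_def)
  have "s \<oplus>\<^bsub>R\<^esub> r = rec (F \<union> G) y' \<oplus>\<^bsub>R\<^esub> rec (F \<union> G) z'"
    using rec_superset[of "F \<union> G" F y] rec_superset[of "F \<union> G" G z] s r by (simp add: y'_def z'_def)
  also have "\<dots> = rec (F \<union> G) (\<lambda>i. y' i \<oplus>\<^bsub>A\<^esub> z' i)"
    unfolding rec_def using yz
    by (subst R.finsum_addf[symmetric]) (auto intro!: R.finsum_cong' simp: et_add R.l_distr)
  finally show ?thesis unfolding S0_def using s r yz by blast
qed

lemma S0_rmul:
  assumes "s \<in> S0" "z \<in> carrier A"
  shows "et \<one>\<^bsub>A\<^esub> z \<otimes>\<^bsub>R\<^esub> s \<in> S0"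
proof -
  obtain F y where s: "s = rec F y" "finite F" "\<And>i. y i \<in> carrier A"
    using assms by (auto simp: S0_def)
  have "et \<one>\<^bsub>A\<^esub> z \<otimes>\<^bsub>R\<^esub> s = (\<Oplus>\<^bsub>R\<^esub>i\<in>F. et \<one>\<^bsub>A\<^esub> z \<otimes>\<^bsub>R\<^esub> (et \<one>\<^bsub>A\<^esub> (y i) \<otimes>\<^bsub>R\<^esub> T i))"
    unfolding s(1) rec_def using s assms by (intro R.finsum_rdistr) auto
  also have "\<dots> = rec F (\<lambda>i. y i \<otimes>\<^bsub>A\<^esub> z)"
    unfolding rec_def using s assms by (intro R.finsum_cong') (auto simp: R.m_assoc[symmetric] et_mult)
  finally show ?thesis unfolding S0_def using s assms by blast
qed

lemma S0_T: "T i \<in> S0"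
proof -
  have "T i = rec {i} (\<lambda>_. \<one>\<^bsub>A\<^esub>)"
    by (simp add: rec_def R.finsum_insert et_one)
  then show ?thesis unfolding S0_def by blast
qed

lemma S0_zero: "\<zero>\<^bsub>R\<^esub> \<in> S0"
proof -
  have "\<zero>\<^bsub>R\<^esub> = rec {} (\<lambda>_. \<zero>\<^bsub>A\<^esub>)" by (simp add: rec_def)
  then show ?thesis unfolding S0_def by blast
qed

lemma S1_S0: "s \<in> S0 \<Longrightarrow> s \<in> S1"
  using S1.step[OF _ S1.zero, of s] by (simp add: S0_closed)

lemma S_S1: "s \<in> S1 \<Longrightarrow> s \<in> S"
  using S.step[OF _ S.zero, of s] by (simp add: S1_closed)

lemma S1_add: "s \<in> S1 \<Longrightarrow> r \<in> S1 \<Longrightarrow> s \<oplus>\<^bsub>R\<^esub> r \<in> S1"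
proof (induction arbitrary: r rule: S1.induct)
  case zero
  then show ?case by (simp add: S1_closed)
next
  case (step s s')
  from step.prems show ?case
  proof cases
    case zero
    then show ?thesis using step S1.step by (simp add: S0_closed S1_closed)
  next
    case r: (step t t')
    have "s \<oplus>\<^bsub>R\<^esub> Dz s' \<oplus>\<^bsub>R\<^esub> r = (s \<oplus>\<^bsub>R\<^esub> t) \<oplus>\<^bsub>R\<^esub> Dz (s' \<oplus>\<^bsub>R\<^esub> t')"
      using step r by (simp add: D_add S0_closed S1_closed R.a_ac)
    then show ?thesis using step r S1.step[OF S0_add] by simp
  qed
qed

lemma S_add: "s \<in> S \<Longrightarrow> r \<in> S \<Longrightarrow> s \<oplus>\<^bsub>R\<^esub> r \<in> S"
proof (induction arbitrary: r rule: S.induct)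
  case zero
  then show ?case by (simp add: S_closed)
next
  case (step s s')
  from step.prems show ?case
  proof cases
    case zero
    then show ?thesis using step S.step by (simp add: S1_closed S_closed)
  next
    case r: (step t t')
    have "s \<oplus>\<^bsub>R\<^esub> Dy s' \<oplus>\<^bsub>R\<^esub> r = (s \<oplus>\<^bsub>R\<^esub> t) \<oplus>\<^bsub>R\<^esub> Dy (s' \<oplus>\<^bsub>R\<^esub> t')"
      using step r by (simp add: D_add S1_closed S_closed R.a_ac)
    then show ?thesis using step r S.step[OF S1_add] by simp
  qed
qed

lemma S1_rmul: "s \<in> S1 \<Longrightarrow> z \<in> carrier A \<Longrightarrow> et \<one>\<^bsub>A\<^esub> z \<otimes>\<^bsub>R\<^esub> s \<in> S1"
  by (induction rule: S1.induct) (simp_all add: S1.zero R.r_distr S0_closed S1_closed D_rmul S1.step S0_rmul)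

lemma S_rmul: "s \<in> S \<Longrightarrow> z \<in> carrier A \<Longrightarrow> et \<one>\<^bsub>A\<^esub> z \<otimes>\<^bsub>R\<^esub> s \<in> S"
  by (induction rule: S.induct) (simp_all add: S.zero R.r_distr S1_closed S_closed D_rmul S.step S1_rmul)

lemma smult_rmul: "s \<in> carrier K \<Longrightarrow> r \<in> carrier R \<Longrightarrow> s \<odot>\<^bsub>R\<^esub> r = et \<one>\<^bsub>A\<^esub> (s \<odot>\<^bsub>A\<^esub> \<one>\<^bsub>A\<^esub>) \<otimes>\<^bsub>R\<^esub> r"
  by (simp add: et_smult et_one R.smult_mult_left[symmetric])

lemma S_smult: "s \<in> carrier K \<Longrightarrow> r \<in> S \<Longrightarrow> s \<odot>\<^bsub>R\<^esub> r \<in> S"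
  by (simp add: smult_rmul S_closed S_rmul)

lemma S_Dy: "r \<in> S \<Longrightarrow> Dy r \<in> S"
  using S.step[OF S1.zero, of r] by (simp add: S_closed)

text \<open>On an \<open>S1\<close> element D_Z adds a zero lowest coefficient; under an outer D_Y
  it slips inside by \<open>Dz_Dy\<close>.\<close>

lemma S_Dz: "r \<in> S \<Longrightarrow> Dz r \<in> S"
proof (induction rule: S.induct)
  case (step s r)
  have "Dz s \<in> S" using S1.step[OF S0_zero step(1)] S_S1 by (simp add: S1_closed step)
  moreover have "Dz (Dy r) \<in> S" using step by (simp add: Dz_Dy S_closed S_Dy S_smult KS)
  ultimately show ?case using step by (simp add: D_add S1_closed S_closed S_add)
qed (simp add: S.zero)

lemma S_T: "T i \<in> S" by (intro S_S1 S1_S0 S0_T)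

text \<open>The only place where left letters are eliminated: \<open>et_a\<close> to
  \<open>et_d\<close> replace them by right letters and X, Y, Z, W, whose products with T i have
  been computed.\<close>

lemma S_letter_T: "e \<in> {a, b, c, d} \<Longrightarrow> et e \<one>\<^bsub>A\<^esub> \<otimes>\<^bsub>R\<^esub> T i \<in> S"
proof -
  have x: "X \<otimes>\<^bsub>R\<^esub> T i \<in> S" "W \<otimes>\<^bsub>R\<^esub> T i \<in> S" "Y \<otimes>\<^bsub>R\<^esub> T i \<in> S" "Z \<otimes>\<^bsub>R\<^esub> T i \<in> S"
    by (auto simp: X_T W_T YZ_T intro!: S_add S_T S_Dy S_Dz S.zero)
  have "(et \<one>\<^bsub>A\<^esub> y \<otimes>\<^bsub>R\<^esub> u \<oplus>\<^bsub>R\<^esub> et \<one>\<^bsub>A\<^esub> z \<otimes>\<^bsub>R\<^esub> v) \<otimes>\<^bsub>R\<^esub> T i \<in> S"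
    if "y \<in> carrier A" "z \<in> carrier A" "u \<in> {X, Z}" "v \<in> {Y, W}" for y z u v
  proof -
    have uv: "u \<in> carrier R" "v \<in> carrier R" "u \<otimes>\<^bsub>R\<^esub> T i \<in> S" "v \<otimes>\<^bsub>R\<^esub> T i \<in> S" using that x by (auto simp: KS)
    then show ?thesis using that by (simp add: R.l_distr R.m_assoc S_add S_rmul)
  qed
  then show "e \<in> {a, b, c, d} \<Longrightarrow> et e \<one>\<^bsub>A\<^esub> \<otimes>\<^bsub>R\<^esub> T i \<in> S"
    by (auto simp: et_a et_b et_c et_d)
qed

text \<open>A left letter commutes with right letters and passes D_Y and D_Z at the cost of a unit,
  so everything is reduced to its product with a single T i.\<close>

lemma S_letter: "s \<in> S \<Longrightarrow> e \<in> {a, b, c, d} \<Longrightarrow> et e \<one>\<^bsub>A\<^esub> \<otimes>\<^bsub>R\<^esub> s \<in> S"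
proof (induction rule: S.induct)
  case zero
  then show ?case using letter_mem[of e] by (simp add: S.zero)
next
  case (step s r)
  have e: "et e \<one>\<^bsub>A\<^esub> \<in> carrier R" using letter_mem[OF step.prems] by simp
  have 0: "et e \<one>\<^bsub>A\<^esub> \<otimes>\<^bsub>R\<^esub> s \<in> S" if "s \<in> S0" for s
  proof -
    obtain F y where s: "s = rec F y" "finite F" "\<And>i. y i \<in> carrier A"
      using \<open>s \<in> S0\<close> by (auto simp: S0_def)
    have "et e \<one>\<^bsub>A\<^esub> \<otimes>\<^bsub>R\<^esub> rec F y \<in> S" using s(2)
    proof (induction F rule: finite_induct)
      case empty
      then show ?case using e by (simp add: rec_def S.zero)
    next
      case (insert i F)
      have "rec (insert i F) y = et \<one>\<^bsub>A\<^esub> (y i) \<otimes>\<^bsub>R\<^esub> T i \<oplus>\<^bsub>R\<^esub> rec F y"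
        using insert s(3) by (simp add: rec_def R.finsum_insert)
      moreover have "et e \<one>\<^bsub>A\<^esub> \<otimes>\<^bsub>R\<^esub> (et \<one>\<^bsub>A\<^esub> (y i) \<otimes>\<^bsub>R\<^esub> T i) = et \<one>\<^bsub>A\<^esub> (y i) \<otimes>\<^bsub>R\<^esub> (et e \<one>\<^bsub>A\<^esub> \<otimes>\<^bsub>R\<^esub> T i)"
        using s(3) letter_mem[OF step.prems] by (simp add: R.m_assoc[symmetric] et_mult)
      ultimately show ?case using insert s(3) e S_letter_T[OF step.prems]
        by (simp add: R.r_distr rec_closed S_add S_rmul)
    qed
    then show ?thesis using s by simp
  qed
  have 1: "et e \<one>\<^bsub>A\<^esub> \<otimes>\<^bsub>R\<^esub> s \<in> S" if "s \<in> S1" for s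
    using that
  proof (induction rule: S1.induct)
    case (step s r)
    have "et e \<one>\<^bsub>A\<^esub> \<otimes>\<^bsub>R\<^esub> Dz r \<in> S"
      using D_letter(2)[OF S1_closed[OF step(2)] \<open>e \<in> _\<close>] step S_smult S_Dz by auto
    then show ?case using step 0 e by (simp add: R.r_distr S0_closed S1_closed S_add)
  qed (use e in \<open>simp add: S.zero\<close>)
  have "et e \<one>\<^bsub>A\<^esub> \<otimes>\<^bsub>R\<^esub> Dy r \<in> S"
    using D_letter(1)[OF S_closed[OF step(2)] \<open>e \<in> _\<close>] step S_smult S_Dy by auto
  then show ?case using step 1 e by (simp add: R.r_distr S_closed S1_closed S_add)
qed

lemma et_split: "x \<in> carrier A \<Longrightarrow> y \<in> carrier A \<Longrightarrow> et x y = et x \<one>\<^bsub>A\<^esub> \<otimes>\<^bsub>R\<^esub> et \<one>\<^bsub>A\<^esub> y"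
  by (simp add: et_mult)

text \<open>\<open>S\<close> contains 1 = T 0, is additive, and is stable under left multiplication
  by letters of both factors.\<close>

theorem normal_form: "r \<in> carrier R \<Longrightarrow> r \<in> S"
proof (induction r rule: R_induct)
  case zero
  then show ?case by (rule S.zero)
next
  case (step x y t)
  have "\<forall>s\<in>S. et x \<one>\<^bsub>A\<^esub> \<otimes>\<^bsub>R\<^esub> s \<in> S" using step(1)
  proof (rule letter_induct)
    fix e z assume e: "e \<in> {a, b, c, d}" and z: "z \<in> carrier A" "\<forall>s\<in>S. et z \<one>\<^bsub>A\<^esub> \<otimes>\<^bsub>R\<^esub> s \<in> S"
    have "et (e \<otimes>\<^bsub>A\<^esub> z) \<one>\<^bsub>A\<^esub> \<otimes>\<^bsub>R\<^esub> s = et e \<one>\<^bsub>A\<^esub> \<otimes>\<^bsub>R\<^esub> (et z \<one>\<^bsub>A\<^esub> \<otimes>\<^bsub>R\<^esub> s)" if "s \<in> S" for s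
      using letter_mem[OF e] z S_closed[OF that] by (simp add: R.m_assoc[symmetric] et_mult)
    then show "\<forall>s\<in>S. et (e \<otimes>\<^bsub>A\<^esub> z) \<one>\<^bsub>A\<^esub> \<otimes>\<^bsub>R\<^esub> s \<in> S" using z e S_letter by simp
  next
    have "et \<zero>\<^bsub>A\<^esub> \<one>\<^bsub>A\<^esub> = \<zero>\<^bsub>R\<^esub>"
      using et_smult(1)[of \<zero> "\<zero>\<^bsub>A\<^esub>" "\<one>\<^bsub>A\<^esub>"] by (simp add: KS)
    then show "\<forall>s\<in>S. et \<zero>\<^bsub>A\<^esub> \<one>\<^bsub>A\<^esub> \<otimes>\<^bsub>R\<^esub> s \<in> S" by (simp add: S_closed S.zero)
  qed (auto simp: et_one et_smult et_add R.l_distr R.smult_mult_left[symmetric] S_closed S_smult S_add)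
  moreover have "et \<one>\<^bsub>A\<^esub> y \<in> S"
    using S_rmul[OF S_T[of 0] step(2)] step(2) by (simp add: T_def)
  ultimately show ?case using step by (subst et_split) (simp_all add: S_add)
qed

section \<open>Independence: the representation by shifts and coordinates of normal forms\<close>

declare V_simps(1) [simp del]

definition opA :: "'a \<Rightarrow> (int \<times> nat \<times> nat \<Rightarrow> 'a) \<Rightarrow> int \<times> nat \<times> nat \<Rightarrow> 'a" where
  "opA = (SOME h. h \<in> alg_hom K A E \<and> h a = opr Ga \<and> h b = opr Gb \<and> h c = opr Gc \<and> h d = opr Gd)"

lemma opA: "opA \<in> alg_hom K A E" "opA a = opr Ga" "opA b = opr Gb" "opA c = opr Gc" "opA d = opr Gd"
  using someI_ex[of "\<lambda>h. h \<in> alg_hom K A E \<and> h a = opr Ga \<and> h b = opr Gb \<and> h c = opr Gc \<and> h d = opr Gd"]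
    opr_ex unfolding opA_def by blast+

lemma rmul_opA:
  assumes "x \<in> carrier A" "y \<in> carrier A"
  shows "rmul y \<otimes>\<^bsub>E\<^esub> opA x = opA x \<otimes>\<^bsub>E\<^esub> rmul y"
  using assms(1)
proof (rule letter_induct)
  note y = rmul_closed[OF assms(2)]
  note h = alg_homD[OF opA(1)]
  show "rmul y \<otimes>\<^bsub>E\<^esub> opA \<zero>\<^bsub>A\<^esub> = opA \<zero>\<^bsub>A\<^esub> \<otimes>\<^bsub>E\<^esub> rmul y"
    using y alg_hom_zero[OF ring_A E.ring_A opA(1)] by simp
  fix e x assume e: "e \<in> {a, b, c, d}" and x: "x \<in> carrier A" "rmul y \<otimes>\<^bsub>E\<^esub> opA x = opA x \<otimes>\<^bsub>E\<^esub> rmul y"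
  have "rmul y \<otimes>\<^bsub>E\<^esub> opA e = opA e \<otimes>\<^bsub>E\<^esub> rmul y"
    using e y assms(2) by (auto simp: opA E.l_distr E.r_distr rmul_N KS)
  then have "rmul y \<otimes>\<^bsub>E\<^esub> (opA e \<otimes>\<^bsub>E\<^esub> opA x) = (opA e \<otimes>\<^bsub>E\<^esub> opA x) \<otimes>\<^bsub>E\<^esub> rmul y"
    using x y h(1)[OF letter_mem[OF e]] h(1)[OF x(1)] by (metis E.m_assoc)
  then show "rmul y \<otimes>\<^bsub>E\<^esub> opA (e \<otimes>\<^bsub>A\<^esub> x) = opA (e \<otimes>\<^bsub>A\<^esub> x) \<otimes>\<^bsub>E\<^esub> rmul y"
    using x letter_mem[OF e] by (simp add: h)
qed (simp_all add: alg_homD[OF opA(1)] rmul_closed[OF assms(2)] E.l_distr E.r_distr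
    E.smult_mult_left[symmetric] E.smult_mult_right[symmetric])

definition opR :: "('k, 'a) env \<Rightarrow> (int \<times> nat \<times> nat \<Rightarrow> 'a) \<Rightarrow> int \<times> nat \<times> nat \<Rightarrow> 'a" where
  "opR = (SOME h. h \<in> alg_hom K R E \<and> (\<forall>x\<in>carrier A. \<forall>y\<in>carrier A. h (et x y) = opA x \<otimes>\<^bsub>E\<^esub> rmul y))"

lemma opR: "opR \<in> alg_hom K R E"
  "x \<in> carrier A \<Longrightarrow> y \<in> carrier A \<Longrightarrow> opR (et x y) = opA x \<otimes>\<^bsub>E\<^esub> rmul y"
proof -
  have "\<exists>h. h \<in> alg_hom K R E \<and> (\<forall>x\<in>carrier A. \<forall>y\<in>carrier A. h (et x y) = opA x \<otimes>\<^bsub>E\<^esub> rmul y)"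
    using R_lift[OF E.assoc_algebra_axioms opA(1) rmul_hom rmul_opA] by blast
  from someI_ex[OF this, folded opR_def]
  show "opR \<in> alg_hom K R E"
    "x \<in> carrier A \<Longrightarrow> y \<in> carrier A \<Longrightarrow> opR (et x y) = opA x \<otimes>\<^bsub>E\<^esub> rmul y" by blast+
qed

lemmas opRh = alg_homD[OF opR(1)]

text \<open>The twisted commutation with T' is inherited by sums and products, so it is enough to
  check letters. T' will be the operator that right multiplication by Y, Z or X induces on
  coordinates.\<close>

lemma twist_shift:
  assumes w: "weights s s' t t'" and T: "T' \<in> carrier E"
    and "\<And>e. e \<in> {a, b, c, d} \<Longrightarrow> opA (tor s s' t t' e) \<otimes>\<^bsub>E\<^esub> T' = T' \<otimes>\<^bsub>E\<^esub> opA e"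
    and "\<And>y. y \<in> carrier A \<Longrightarrow> rmul y \<otimes>\<^bsub>E\<^esub> T' = T' \<otimes>\<^bsub>E\<^esub> rmul y"
    and "r \<in> carrier R"
  shows "opR (torR s s' t t' r) \<otimes>\<^bsub>E\<^esub> T' = T' \<otimes>\<^bsub>E\<^esub> opR r"
proof -
  note h = alg_homD[OF opA(1)] and th = alg_homD[OF tor(1)[OF w]]
  have A: "opA (tor s s' t t' x) \<otimes>\<^bsub>E\<^esub> T' = T' \<otimes>\<^bsub>E\<^esub> opA x" if "x \<in> carrier A" for x
    using that
  proof (rule letter_induct)
    show "opA (tor s s' t t' \<zero>\<^bsub>A\<^esub>) \<otimes>\<^bsub>E\<^esub> T' = T' \<otimes>\<^bsub>E\<^esub> opA \<zero>\<^bsub>A\<^esub>"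
      using T alg_hom_zero[OF ring_A E.ring_A opA(1)] alg_hom_zero[OF ring_A ring_A tor(1)[OF w]] by simp
    fix e x assume e: "e \<in> {a, b, c, d}" and x: "x \<in> carrier A" "opA (tor s s' t t' x) \<otimes>\<^bsub>E\<^esub> T' = T' \<otimes>\<^bsub>E\<^esub> opA x"
    note c = letter_mem[OF e]
    have "opA (tor s s' t t' e) \<otimes>\<^bsub>E\<^esub> opA (tor s s' t t' x) \<otimes>\<^bsub>E\<^esub> T' = opA (tor s s' t t' e) \<otimes>\<^bsub>E\<^esub> T' \<otimes>\<^bsub>E\<^esub> opA x"
      using T c x by (simp add: h th E.m_assoc)
    also have "\<dots> = T' \<otimes>\<^bsub>E\<^esub> (opA e \<otimes>\<^bsub>E\<^esub> opA x)"
      using T c x assms(3)[OF e] by (simp add: h th E.m_assoc)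
    finally show "opA (tor s s' t t' (e \<otimes>\<^bsub>A\<^esub> x)) \<otimes>\<^bsub>E\<^esub> T' = T' \<otimes>\<^bsub>E\<^esub> opA (e \<otimes>\<^bsub>A\<^esub> x)"
      using c x by (simp add: h th)
  qed (use T in \<open>simp_all add: h th E.l_distr E.r_distr E.smult_mult_left[symmetric] E.smult_mult_right[symmetric]\<close>)
  show ?thesis
    using assms(5)
  proof (induction r rule: R_induct)
    case zero
    then show ?case
      using T alg_hom_zero[OF R.ring_A E.ring_A opR(1)] alg_hom_zero[OF R.ring_A R.ring_A torR(1)[OF w]] by simp
  next
    case (step x y r)
    have "opA (tor s s' t t' x) \<otimes>\<^bsub>E\<^esub> rmul y \<otimes>\<^bsub>E\<^esub> T' = opA (tor s s' t t' x) \<otimes>\<^bsub>E\<^esub> T' \<otimes>\<^bsub>E\<^esub> rmul y"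
      using T step assms(4) by (simp add: h th rmul_closed E.m_assoc)
    also have "\<dots> = T' \<otimes>\<^bsub>E\<^esub> (opA x \<otimes>\<^bsub>E\<^esub> rmul y)"
      using T step A by (simp add: h th rmul_closed E.m_assoc)
    finally show ?case using T step
      by (simp add: opRh opR(2) torR[OF w] alg_homD[OF torR(1)[OF w]] h th rmul_closed E.l_distr E.r_distr)
  qed
qed

definition single :: "int \<times> nat \<times> nat \<Rightarrow> 'a \<Rightarrow> int \<times> nat \<times> nat \<Rightarrow> 'a" where
  "single i x = (\<lambda>j. if j = i then x else \<zero>\<^bsub>A\<^esub>)"

abbreviation "\<delta> \<equiv> single (0, 0, 0) \<one>\<^bsub>A\<^esub>"

text \<open>The coordinates of r: \<delta> is the coordinate vector of 1, and r is applied to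
  it.\<close>

definition "ev r = opR r \<delta>"

lemma single_closed [simp]: "x \<in> carrier A \<Longrightarrow> single i x \<in> carrier V"
  by (simp add: single_def V_simps(1))

lemma N_single:
  assumes "x \<in> carrier A" "y \<in> carrier A" "\<alpha> \<in> carrier K" "\<beta> \<in> carrier K"
  shows "N x i j h \<alpha> \<beta> (single (0, 0, 0) y) = single (i, j, h) (x \<otimes>\<^bsub>A\<^esub> y)"
proof (rule ext, clarify)
  fix u v w
  show "N x i j h \<alpha> \<beta> (single (0, 0, 0) y) (u, v, w) = single (i, j, h) (x \<otimes>\<^bsub>A\<^esub> y) (u, v, w)"
    unfolding N_apply[OF single_closed[OF assms(2)]] using assms by (auto simp: single_def K_pow_simps KS)
qed

lemma rmul_single: "x \<in> carrier A \<Longrightarrow> y \<in> carrier A \<Longrightarrow> rmul y (single i x) = single i (x \<otimes>\<^bsub>A\<^esub> y)"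
  by (rule ext, simp only: rmul_apply[OF single_closed]) (simp add: single_def)

lemma et_delta: "x \<in> carrier A \<Longrightarrow> y \<in> carrier A \<Longrightarrow> opR (et x y) \<delta> = opA x (single (0, 0, 0) y)"
  by (simp add: opR end_alg_apply rmul_single del: V_simps)

lemmas letters_delta = et_delta opA end_alg_apply(4,5)[OF single_closed] N_single opr.simps

lemma ev_Y: "opR Y \<delta> = N \<one>\<^bsub>A\<^esub> 0 1 0 \<one> (l \<otimes> n) \<delta>"
  by (simp add: vY_def opRh letters_delta KS rels)
    (auto simp: single_def fun_eq_iff smult_r_distr smult_assoc1[symmetric] KS smult_l_minus M.r_neg M.a_assoc)

lemma ev_Z: "opR Z \<delta> = N \<one>\<^bsub>A\<^esub> 0 0 1 \<one> \<one> \<delta>"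
  by (simp add: vZ_def opRh letters_delta KS rels)
    (auto simp: single_def fun_eq_iff smult_r_distr smult_assoc1[symmetric] KS smult_l_minus M.r_neg M.a_assoc kl
      scalar_inverses)

lemma opR_V: "r \<in> carrier R \<Longrightarrow> f \<in> carrier V \<Longrightarrow> opR r f \<in> carrier V"
  using end_algD(1)[OF opRh(1)] .

lemma rmul_V: "y \<in> carrier A \<Longrightarrow> f \<in> carrier V \<Longrightarrow> rmul y f \<in> carrier V"
  using end_algD(1)[OF rmul_closed] .

lemma ev_V: "r \<in> carrier R \<Longrightarrow> ev r \<in> carrier V"
  unfolding ev_def by (rule opR_V) simp_all

lemma ev_closed [simp]: "r \<in> carrier R \<Longrightarrow> ev r i \<in> carrier A"
  using ev_V by (cases i) (simp add: V_simps(1))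

lemma ev_add: "r \<in> carrier R \<Longrightarrow> s \<in> carrier R \<Longrightarrow> ev (r \<oplus>\<^bsub>R\<^esub> s) i = ev r i \<oplus>\<^bsub>A\<^esub> ev s i"
  by (simp add: ev_def opRh end_alg_apply(4)[OF single_closed])

lemma ev_zero [simp]: "ev \<zero>\<^bsub>R\<^esub> i = \<zero>\<^bsub>A\<^esub>"
  using alg_hom_zero[OF R.ring_A E.ring_A opR(1)] by (simp add: ev_def end_alg_apply(3)[OF single_closed])

text \<open>The three shifts send \<delta> to the coordinates of Y, Z and X. Commuting them past the
  operator of r therefore expresses D_Y(r), D_Z(r) and r X in the coordinates of r; the case of X
  has trivial torus weights.\<close>

lemma shift_commutes:
  "opR (py r) \<otimes>\<^bsub>E\<^esub> N \<one>\<^bsub>A\<^esub> 0 1 0 \<one> (l \<otimes> n) = N \<one>\<^bsub>A\<^esub> 0 1 0 \<one> (l \<otimes> n) \<otimes>\<^bsub>E\<^esub> opR r"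
  "opR (pz r) \<otimes>\<^bsub>E\<^esub> N \<one>\<^bsub>A\<^esub> 0 0 1 \<one> \<one> = N \<one>\<^bsub>A\<^esub> 0 0 1 \<one> \<one> \<otimes>\<^bsub>E\<^esub> opR r"
  "opR r \<otimes>\<^bsub>E\<^esub> N \<one>\<^bsub>A\<^esub> 1 0 0 \<one> \<one> = N \<one>\<^bsub>A\<^esub> 1 0 0 \<one> \<one> \<otimes>\<^bsub>E\<^esub> opR r" if r: "r \<in> carrier R"
proof -
  have one: "\<one> [^] (i::nat) = \<one>" for i
    using cring_K by (simp add: cring.axioms(1) monoid.nat_pow_one ring.is_monoid)
  note h = alg_homD[OF opA(1)]
  note sm = E.smult_assoc1[symmetric] E.smult_mult_left[symmetric] E.smult_mult_right[symmetric] E.smult_r_distr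
  show "opR (py r) \<otimes>\<^bsub>E\<^esub> N \<one>\<^bsub>A\<^esub> 0 1 0 \<one> (l \<otimes> n) = N \<one>\<^bsub>A\<^esub> 0 1 0 \<one> (l \<otimes> n) \<otimes>\<^bsub>E\<^esub> opR r"
    by (rule twist_shift[OF weights_scalars(2) _ _ _ r])
      (auto simp: rmul_N KS tor h opA E.l_distr E.r_distr N_mult K_pow_simps sm kl mn scalar_inverses kl_cancel)
  show "opR (pz r) \<otimes>\<^bsub>E\<^esub> N \<one>\<^bsub>A\<^esub> 0 0 1 \<one> \<one> = N \<one>\<^bsub>A\<^esub> 0 0 1 \<one> \<one> \<otimes>\<^bsub>E\<^esub> opR r"
    by (rule twist_shift[OF weights_scalars(1) _ _ _ r])
      (auto simp: rmul_N KS tor h opA E.l_distr E.r_distr N_mult K_pow_simps sm kl mn scalar_inverses kl_cancel one)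
  have w: "weights \<one> \<one> \<one> \<one>" by (simp add: weights_def KS)
  have "opR (torR \<one> \<one> \<one> \<one> r) \<otimes>\<^bsub>E\<^esub> N \<one>\<^bsub>A\<^esub> 1 0 0 \<one> \<one> = N \<one>\<^bsub>A\<^esub> 1 0 0 \<one> \<one> \<otimes>\<^bsub>E\<^esub> opR r"
    by (rule twist_shift[OF w _ _ _ r])
      (auto simp: rmul_N KS tor[OF w] h opA E.l_distr E.r_distr N_mult K_pow_simps sm one)
  moreover have "torR \<one> \<one> \<one> \<one> (torR \<one> \<one> \<one> \<one> r) = r" by (rule torR_inv[OF w w r])
  moreover have "torR \<one> \<one> \<one> \<one> r = r"
  proof -
    have t: "tor \<one> \<one> \<one> \<one> x = x" if "x \<in> carrier A" for x
      by (rule A_hom_unique[OF assoc_algebra_axioms tor(1)[OF w] alg_hom_id that]) (simp_all add: tor[OF w])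
    show ?thesis
      by (rule R_hom_unique[OF R.assoc_algebra_axioms torR(1)[OF w] alg_hom_id r]) (simp add: torR[OF w] t)
  qed
  ultimately show "opR r \<otimes>\<^bsub>E\<^esub> N \<one>\<^bsub>A\<^esub> 1 0 0 \<one> \<one> = N \<one>\<^bsub>A\<^esub> 1 0 0 \<one> \<one> \<otimes>\<^bsub>E\<^esub> opR r" by simp
qed

text \<open>The unit (l n)^w is the price for moving the new D_Y inside past D_Z^w, the coordinates
  being taken in the order D_Z^w D_Y^v.\<close>

lemma ev_Dy: "r \<in> carrier R \<Longrightarrow> ev (Dy r) (u, v, w) = (if 1 \<le> v then ((l \<otimes> n) [^] w) \<odot>\<^bsub>A\<^esub> ev r (u, v - 1, w) else \<zero>\<^bsub>A\<^esub>)"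
proof -
  assume r: "r \<in> carrier R"
  have one: "\<one> [^] (i::nat) = \<one>" for i
    using cring_K by (simp add: cring.axioms(1) monoid.nat_pow_one ring.is_monoid)
  have "ev (Dy r) = opR (py r) (opR Y \<delta>)"
    using r by (simp add: ev_def Dy_def py opRh end_alg_apply(1)[OF single_closed])
  also have "\<dots> = (opR (py r) \<otimes>\<^bsub>E\<^esub> N \<one>\<^bsub>A\<^esub> 0 1 0 \<one> (l \<otimes> n)) \<delta>"
    by (simp only: ev_Y end_alg_apply(1)[OF single_closed] one_closed)
  also have "\<dots> = N \<one>\<^bsub>A\<^esub> 0 1 0 \<one> (l \<otimes> n) (ev r)"
    using r by (simp only: shift_commutes ev_def end_alg_apply(1)[OF single_closed] one_closed)
  finally show ?thesis unfolding N_apply[OF ev_V[OF r]]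
    using r by (simp add: N_apply[OF ev_V] one KS)
qed

lemma ev_Dz: "r \<in> carrier R \<Longrightarrow> ev (Dz r) (u, v, w) = (if 1 \<le> w then ev r (u, v, w - 1) else \<zero>\<^bsub>A\<^esub>)"
proof -
  assume r: "r \<in> carrier R"
  have one: "\<one> [^] (i::nat) = \<one>" for i
    using cring_K by (simp add: cring.axioms(1) monoid.nat_pow_one ring.is_monoid)
  have "ev (Dz r) = opR (pz r) (opR Z \<delta>)"
    using r by (simp add: ev_def Dz_def pz opRh end_alg_apply(1)[OF single_closed])
  also have "\<dots> = (opR (pz r) \<otimes>\<^bsub>E\<^esub> N \<one>\<^bsub>A\<^esub> 0 0 1 \<one> \<one>) \<delta>"
    by (simp only: ev_Z end_alg_apply(1)[OF single_closed] one_closed)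
  also have "\<dots> = N \<one>\<^bsub>A\<^esub> 0 0 1 \<one> \<one> (ev r)"
    using r by (simp only: shift_commutes ev_def end_alg_apply(1)[OF single_closed] one_closed)
  finally show ?thesis unfolding N_apply[OF ev_V[OF r]]
    using r by (simp add: N_apply[OF ev_V] one KS)
qed

lemma N_0: "f \<in> carrier V \<Longrightarrow> x \<in> carrier A \<Longrightarrow> \<alpha> \<in> carrier K \<Longrightarrow> \<beta> \<in> carrier K \<Longrightarrow>
    N x i j h \<alpha> \<beta> f (u, 0, 0) = (if j = 0 \<and> h = 0 then x \<otimes>\<^bsub>A\<^esub> f (u - i, 0, 0) else \<zero>\<^bsub>A\<^esub>)"
  unfolding N_apply by (auto simp: K_pow_simps KS V_simps(1))

lemma opA_0:
  assumes f: "f \<in> carrier V"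
  shows "opA a f (u, 0, 0) = a \<otimes>\<^bsub>A\<^esub> f (u - 1, 0, 0)" "opA b f (u, 0, 0) = b \<otimes>\<^bsub>A\<^esub> f (u - 1, 0, 0)"
    "opA c f (u, 0, 0) = c \<otimes>\<^bsub>A\<^esub> f (u + 1, 0, 0)" "opA d f (u, 0, 0) = d \<otimes>\<^bsub>A\<^esub> f (u + 1, 0, 0)"
proof -
  have "f i \<in> carrier A" for i using f by (cases i) (simp add: V_simps(1))
  then show "opA a f (u, 0, 0) = a \<otimes>\<^bsub>A\<^esub> f (u - 1, 0, 0)" "opA b f (u, 0, 0) = b \<otimes>\<^bsub>A\<^esub> f (u - 1, 0, 0)"
    "opA c f (u, 0, 0) = c \<otimes>\<^bsub>A\<^esub> f (u + 1, 0, 0)" "opA d f (u, 0, 0) = d \<otimes>\<^bsub>A\<^esub> f (u + 1, 0, 0)"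
    by (simp_all add: opA end_alg_apply(4)[OF f] N_0[OF f])
qed

text \<open>On the slice v = w = 0 the determinant relations collapse a d - l b c and d a - m c b to
  1, so X and W become opposite pure shifts. Values 0 and 1 are central, which lets the coefficient
  be pulled out from between the two letters.\<close>

lemma XW_0:
  assumes f: "f \<in> carrier V" and f01: "\<And>u. f (u, 0, 0) \<in> {\<zero>\<^bsub>A\<^esub>, \<one>\<^bsub>A\<^esub>}"
  shows "opR X f (u, 0, 0) = f (u - 1, 0, 0)" "opR W f (u, 0, 0) = f (u + 1, 0, 0)"
proof -
  have e: "opR (et x y) f = opA x (rmul y f)" if "x \<in> carrier A" "y \<in> carrier A" for x y
    using that f by (simp add: opR end_alg_apply del: V_simps)
  have a: "opR (s \<odot>\<^bsub>R\<^esub> et x y \<oplus>\<^bsub>R\<^esub> t \<odot>\<^bsub>R\<^esub> et z w) f (u, 0, 0)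
      = s \<odot>\<^bsub>A\<^esub> opA x (rmul y f) (u, 0, 0) \<oplus>\<^bsub>A\<^esub> t \<odot>\<^bsub>A\<^esub> opA z (rmul w f) (u, 0, 0)"
    if "x \<in> carrier A" "y \<in> carrier A" "z \<in> carrier A" "w \<in> carrier A" "s \<in> carrier K" "t \<in> carrier K"
    for s t x y z w
    using that by (simp add: opRh end_alg_apply(4,5)[OF f] e)
  have "opR X f (u, 0, 0) = \<one> \<odot>\<^bsub>A\<^esub> opA a (rmul d f) (u, 0, 0) \<oplus>\<^bsub>A\<^esub> (\<ominus> l) \<odot>\<^bsub>A\<^esub> opA b (rmul c f) (u, 0, 0)"
    "opR W f (u, 0, 0) = \<one> \<odot>\<^bsub>A\<^esub> opA d (rmul a f) (u, 0, 0) \<oplus>\<^bsub>A\<^esub> (\<ominus> m) \<odot>\<^bsub>A\<^esub> opA c (rmul b f) (u, 0, 0)"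
    unfolding vX_def vW_def by (rule a; simp add: KS)+
  then show "opR X f (u, 0, 0) = f (u - 1, 0, 0)" "opR W f (u, 0, 0) = f (u + 1, 0, 0)"
    using f01[of "u - 1"] f01[of "u + 1"]
    by (auto simp: KS opA_0[OF rmul_V[OF _ f]] rmul_apply[OF f] rels smult_l_minus M.r_neg M.a_assoc)
qed

text \<open>Only the leading slice is described: a negative T i is a power of W and may have further
  coordinates with v, w > 0. The triangular shape suffices for independence.\<close>

lemma ev_T: "ev (T i) (u, 0, 0) = (if u = i then \<one>\<^bsub>A\<^esub> else \<zero>\<^bsub>A\<^esub>)"
proof -
  have d: "opR (pw x j) \<delta> \<in> carrier V" if "x \<in> carrier R" for x j
    using that by (intro opR_V) simp_all
  have s: "opR (pw x (Suc j)) \<delta> = opR x (opR (pw x j) \<delta>)" if "x \<in> carrier R" for x j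
    using that by (simp add: opRh end_alg_apply(1)[OF single_closed])
  have 0: "opR (pw x 0) \<delta> = \<delta>" for x
    by (simp add: opRh(4) end_alg_apply(2)[OF single_closed])
  have X: "opR (pw X j) \<delta> (u, 0, 0) = (if u = int j then \<one>\<^bsub>A\<^esub> else \<zero>\<^bsub>A\<^esub>)" for j u
  proof (induction j arbitrary: u)
    case (Suc j)
    then show ?case unfolding s[OF XYZW_closed(1)] using XW_0(1)[OF d[OF XYZW_closed(1)], of j u] by auto
  qed (simp only: 0, simp add: single_def)
  have W: "opR (pw W j) \<delta> (u, 0, 0) = (if u = - int j then \<one>\<^bsub>A\<^esub> else \<zero>\<^bsub>A\<^esub>)" for j u
  proof (induction j arbitrary: u)
    case (Suc j)
    then show ?case unfolding s[OF XYZW_closed(4)] using XW_0(2)[OF d[OF XYZW_closed(4)], of j u] by auto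
  qed (simp only: 0, simp add: single_def)
  show ?thesis by (auto simp: ev_def T_def X W)
qed

lemma ev_rmul: "y \<in> carrier A \<Longrightarrow> r \<in> carrier R \<Longrightarrow> ev (et \<one>\<^bsub>A\<^esub> y \<otimes>\<^bsub>R\<^esub> r) i = ev r i \<otimes>\<^bsub>A\<^esub> y"
proof -
  assume y: "y \<in> carrier A" and r: "r \<in> carrier R"
  have "ev (et \<one>\<^bsub>A\<^esub> y \<otimes>\<^bsub>R\<^esub> r) = opR (et \<one>\<^bsub>A\<^esub> y) (ev r)"
    using y r by (simp add: ev_def opRh end_alg_apply(1)[OF single_closed])
  also have "\<dots> = rmul y (ev r)"
    using y r ev_V[OF r] rmul_V[OF y ev_V[OF r]] by (simp add: opR alg_homD(4)[OF opA(1)] end_alg_apply del: V_simps)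
  finally show ?thesis using ev_V[OF r] by (simp add: rmul_apply del: V_simps)
qed

lemma ev_rec:
  assumes "finite F" "\<And>i. y i \<in> carrier A"
  shows "ev (rec F y) (u, 0, 0) = (if u \<in> F then y u else \<zero>\<^bsub>A\<^esub>)"
  using assms(1)
proof (induction F rule: finite_induct)
  case empty
  then show ?case by (simp add: rec_def)
next
  case (insert i F)
  have "rec (insert i F) y = et \<one>\<^bsub>A\<^esub> (y i) \<otimes>\<^bsub>R\<^esub> T i \<oplus>\<^bsub>R\<^esub> rec F y"
    using insert assms(2) by (simp add: rec_def R.finsum_insert)
  then show ?case using insert assms(2) by (auto simp: ev_add ev_rmul ev_T rec_closed)
qed

lemma S0_ev:
  assumes "s \<in> S0" "\<And>u. ev s (u, 0, 0) = \<zero>\<^bsub>A\<^esub>"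
  shows "s = \<zero>\<^bsub>R\<^esub>"
proof -
  obtain F y where s: "s = rec F y" "finite F" "\<And>i. y i \<in> carrier A"
    using assms(1) by (auto simp: S0_def)
  then have "y u = \<zero>\<^bsub>A\<^esub>" if "u \<in> F" for u using assms(2)[of u] that by (simp add: ev_rec)
  then show ?thesis unfolding s(1) rec_def
    by (intro R.add.finprod_one_eqI) (simp add: et_right_zero)
qed

text \<open>Coefficients are read off in Horner order: D_Z(r) vanishes at w = 0, so that row
  determines the \<open>S0\<close> part, and once this is zero the remaining rows are those of r
  shifted by one. \<open>S_ev\<close> repeats the argument in v.\<close>

lemma S1_ev:
  assumes "s \<in> S1" "\<And>u w. ev s (u, 0, w) = \<zero>\<^bsub>A\<^esub>"
  shows "s = \<zero>\<^bsub>R\<^esub>"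
  using assms
proof (induction rule: S1.induct)
  case (step s r)
  have e: "ev (s \<oplus>\<^bsub>R\<^esub> Dz r) (u, v, w) = ev s (u, v, w) \<oplus>\<^bsub>A\<^esub> ev (Dz r) (u, v, w)" for u v w
    using step by (simp add: ev_add S0_closed S1_closed)
  have "ev s (u, 0, 0) = \<zero>\<^bsub>A\<^esub>" for u
    using step.prems[of u 0] step by (simp add: e ev_Dz S0_closed S1_closed)
  then have s: "s = \<zero>\<^bsub>R\<^esub>" using S0_ev step by blast
  have "ev r (u, 0, w) = \<zero>\<^bsub>A\<^esub>" for u w
    using step.prems[of u "Suc w"] step by (simp add: e s ev_Dz S1_closed)
  then have "r = \<zero>\<^bsub>R\<^esub>" by (rule step.IH)
  with s show ?case by simp
qed simp

text \<open>The weight (l n)^w is inverted by (k m)^w.\<close>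

lemma ev_Dy_zero:
  assumes "r \<in> carrier R" "ev (Dy r) (u, Suc v, w) = \<zero>\<^bsub>A\<^esub>"
  shows "ev r (u, v, w) = \<zero>\<^bsub>A\<^esub>"
proof -
  have "((k \<otimes> m) [^] w) \<otimes> ((l \<otimes> n) [^] w) = \<one>"
  proof -
    have "((k \<otimes> m) [^] w) \<otimes> ((l \<otimes> n) [^] w) = ((k \<otimes> m) \<otimes> (l \<otimes> n)) [^] w"
      using cring_K by (simp add: cring.axioms(2) comm_monoid.nat_pow_distrib KS)
    also have "(k \<otimes> m) \<otimes> (l \<otimes> n) = \<one>" by (simp add: scalar_simps scalar_inverses)
    finally show ?thesis using cring_K by (simp add: cring.axioms(1) monoid.nat_pow_one ring.is_monoid)
  qed
  then have "ev r (u, v, w) = ((k \<otimes> m) [^] w) \<odot>\<^bsub>A\<^esub> (((l \<otimes> n) [^] w) \<odot>\<^bsub>A\<^esub> ev r (u, v, w))"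
    using assms(1) by (simp add: smult_assoc1[symmetric] KS)
  also have "((l \<otimes> n) [^] w) \<odot>\<^bsub>A\<^esub> ev r (u, v, w) = \<zero>\<^bsub>A\<^esub>"
    using assms by (simp add: ev_Dy)
  finally show ?thesis by (simp add: KS)
qed

lemma S_ev:
  assumes "s \<in> S" "\<And>i. ev s i = \<zero>\<^bsub>A\<^esub>"
  shows "s = \<zero>\<^bsub>R\<^esub>"
  using assms
proof (induction rule: S.induct)
  case (step s r)
  have e: "ev (s \<oplus>\<^bsub>R\<^esub> Dy r) (u, v, w) = ev s (u, v, w) \<oplus>\<^bsub>A\<^esub> ev (Dy r) (u, v, w)" for u v w
    using step by (simp add: ev_add S_closed S1_closed)
  have "ev s (u, 0, w) = \<zero>\<^bsub>A\<^esub>" for u w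
    using step.prems[of "(u, 0, w)", unfolded e] step(1,2) by (simp add: ev_Dy S_closed S1_closed)
  then have s: "s = \<zero>\<^bsub>R\<^esub>" using S1_ev step by blast
  have "Dy r = s \<oplus>\<^bsub>R\<^esub> Dy r" using s step(2) by (simp add: S_closed)
  then have "ev (Dy r) i = \<zero>\<^bsub>A\<^esub>" for i using step.prems[of i] by simp
  then have "ev r (u, v, w) = \<zero>\<^bsub>A\<^esub>" for u v w
    by (rule ev_Dy_zero[OF S_closed[OF step(2)]])
  then have "ev r i = \<zero>\<^bsub>A\<^esub>" for i by (cases i) simp
  then have "r = \<zero>\<^bsub>R\<^esub>" by (rule step.IH)
  with s show ?case by simp
qed simp

lemma ev_eq_zero: "r \<in> carrier R \<Longrightarrow> (\<And>i. ev r i = \<zero>\<^bsub>A\<^esub>) \<Longrightarrow> r = \<zero>\<^bsub>R\<^esub>"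
  using S_ev normal_form by blast

section \<open>Regularity of Y, Z and X - 1 from coordinates\<close>

lemma ev_zero_Dy:
  assumes "r \<in> carrier R" "\<And>u w. ev r (u, 0, w) = \<zero>\<^bsub>A\<^esub>"
  shows "\<exists>t\<in>carrier R. r = Dy t"
  using normal_form[OF assms(1)]
proof cases
  case zero
  then show ?thesis by (intro bexI[of _ "\<zero>\<^bsub>R\<^esub>"]) auto
next
  case (step s t)
  have "ev s (u, 0, w) = \<zero>\<^bsub>A\<^esub>" for u w
    using assms(2)[of u w] step by (simp add: ev_add ev_Dy S_closed S1_closed)
  then have "s = \<zero>\<^bsub>R\<^esub>" using S1_ev step by blast
  then show ?thesis using step S_closed[OF step(3)] by (intro bexI[of _ t]) auto
qed

lemma ev_zero_Dy_Dz:
  assumes "r \<in> carrier R" "\<And>u. ev r (u, 0, 0) = \<zero>\<^bsub>A\<^esub>"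
  shows "\<exists>s\<in>carrier R. \<exists>t\<in>carrier R. r = Dy s \<oplus>\<^bsub>R\<^esub> Dz t"
  using normal_form[OF assms(1)]
proof cases
  case zero
  then show ?thesis by (intro bexI[of _ "\<zero>\<^bsub>R\<^esub>"]) auto
next
  case (step s t)
  note t = S_closed[OF step(3)]
  from step(2) show ?thesis
  proof cases
    case zero
    then show ?thesis using step t by (intro bexI[of _ t] bexI[of _ "\<zero>\<^bsub>R\<^esub>"]) auto
  next
    case s: (step s' s'')
    note s'' = S1_closed[OF s(3)] and s' = S0_closed[OF s(2)]
    have "ev s' (u, 0, 0) = \<zero>\<^bsub>A\<^esub>" for u
      using assms(2)[of u] step(1) s t s' s'' by (simp add: ev_add ev_Dy ev_Dz)
    then have "s' = \<zero>\<^bsub>R\<^esub>" using S0_ev s by blast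
    then show ?thesis using step s t s'' by (intro bexI[of _ t] bexI[of _ s'']) (auto simp: R.a_comm)
  qed
qed

text \<open>A normal form has finitely many T i in its lowest coefficient. This excludes a nonzero
  shift-invariant slice in \<open>regular_X\<close>.\<close>

lemma ev_finite: "r \<in> carrier R \<Longrightarrow> finite {u. ev r (u, 0, 0) \<noteq> \<zero>\<^bsub>A\<^esub>}"
proof -
  have 0: "finite {u. ev s (u, 0, 0) \<noteq> \<zero>\<^bsub>A\<^esub>}" if "s \<in> S0" for s
  proof -
    obtain F y where s: "s = rec F y" "finite F" "\<And>i. y i \<in> carrier A"
      using \<open>s \<in> S0\<close> by (auto simp: S0_def)
    then show ?thesis by (intro finite_subset[OF _ s(2)]) (auto simp: ev_rec)
  qed
  have 1: "finite {u. ev s (u, 0, 0) \<noteq> \<zero>\<^bsub>A\<^esub>}" if "s \<in> S1" for s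
    using that
  proof cases
    case (step s' s'')
    then have "ev s (u, 0, 0) = ev s' (u, 0, 0)" for u
      by (simp add: ev_add ev_Dz S0_closed S1_closed)
    then show ?thesis using 0[OF step(2)] by simp
  qed simp
  assume "r \<in> carrier R"
  from normal_form[OF this] show ?thesis
  proof cases
    case (step s t)
    then have "ev r (u, 0, 0) = ev s (u, 0, 0)" for u
      by (simp add: ev_add ev_Dy S1_closed S_closed)
    then show ?thesis using 1[OF step(2)] by simp
  qed simp
qed

text \<open>Right multiplication by X commutes with the left regular action, and on coordinates it
  is the shift that sends \<delta> to the coordinates of X.\<close>

lemma ev_mult_X:
  assumes "r \<in> carrier R"
  shows "ev (r \<otimes>\<^bsub>R\<^esub> X) (u, 0, 0) = ev r (u - 1, 0, 0)"
proof -
  have X: "opR X \<delta> = N \<one>\<^bsub>A\<^esub> 1 0 0 \<one> \<one> \<delta>"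
    by (simp add: vX_def opRh letters_delta KS rels)
      (auto simp: single_def fun_eq_iff smult_r_distr smult_assoc1[symmetric] KS smult_l_minus M.r_neg M.a_assoc kl
        scalar_inverses)
  have "ev (r \<otimes>\<^bsub>R\<^esub> X) = (opR r \<otimes>\<^bsub>E\<^esub> N \<one>\<^bsub>A\<^esub> 1 0 0 \<one> \<one>) \<delta>"
    using assms by (simp only: ev_def opRh XYZW_closed end_alg_apply(1)[OF single_closed] one_closed X)
  also have "\<dots> = N \<one>\<^bsub>A\<^esub> 1 0 0 \<one> \<one> (ev r)"
    using assms by (simp only: shift_commutes ev_def end_alg_apply(1)[OF single_closed] one_closed)
  finally show ?thesis using assms by (simp only: N_0[OF ev_V[OF assms]] KS one_closed) simp
qed

text \<open>Right multiplication by Y is the inverse of \<phi> followed by D_Y, and D_Y is injective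
  on coordinates.\<close>

theorem regular_Y:
  assumes "r \<in> carrier R" "r \<otimes>\<^bsub>R\<^esub> vY m = \<zero>\<^bsub>R\<^esub>"
  shows "r = \<zero>\<^bsub>R\<^esub>"
proof -
  have c: "py' r \<in> carrier R" and e: "py (py' r) = r"
    using assms torR_inv[OF weights_scalars(2,4)] by (simp_all add: py')
  have "Dy (py' r) = \<zero>\<^bsub>R\<^esub>" using assms by (simp add: Dy_def e)
  then have "ev (py' r) i = \<zero>\<^bsub>A\<^esub>" for i
    by (cases i) (simp add: ev_Dy_zero[OF c])
  then have "py' r = \<zero>\<^bsub>R\<^esub>" by (rule ev_eq_zero[OF c])
  then show ?thesis using e alg_hom_zero[OF R.ring_A R.ring_A torR(1)[OF weights_scalars(2)]] by simp
qed

text \<open>The inverse of \<psi> carries \<open>vY k\<close> to a unit multiple of Y.\<close>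

theorem regular_Y':
  assumes "r \<in> carrier R" "r \<otimes>\<^bsub>R\<^esub> vY k = \<zero>\<^bsub>R\<^esub>"
  shows "r = \<zero>\<^bsub>R\<^esub>"
proof -
  have c: "pz' r \<in> carrier R" and e: "pz (pz' r) = r"
    using assms torR_inv[OF weights_scalars(1,3)] by (simp_all add: pz')
  have z: "pz' \<zero>\<^bsub>R\<^esub> = \<zero>\<^bsub>R\<^esub>" "pz \<zero>\<^bsub>R\<^esub> = \<zero>\<^bsub>R\<^esub>"
    using alg_hom_zero[OF R.ring_A R.ring_A torR(1)[OF weights_scalars(3)]]
      alg_hom_zero[OF R.ring_A R.ring_A torR(1)[OF weights_scalars(1)]] .
  have "pz' r \<otimes>\<^bsub>R\<^esub> (n \<odot>\<^bsub>R\<^esub> Y) = \<zero>\<^bsub>R\<^esub>"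
    using assms pz'(2)[OF assms(1), of "vY k"] by (simp add: twist_values z)
  then have "(n \<odot>\<^bsub>R\<^esub> pz' r) \<otimes>\<^bsub>R\<^esub> Y = \<zero>\<^bsub>R\<^esub>"
    using c by (simp add: R.smult_mult_left[symmetric] R.smult_mult_right[symmetric])
  then have "n \<odot>\<^bsub>R\<^esub> pz' r = \<zero>\<^bsub>R\<^esub>" using c regular_Y[of "n \<odot>\<^bsub>R\<^esub> pz' r"] by simp
  then have "m \<odot>\<^bsub>R\<^esub> (n \<odot>\<^bsub>R\<^esub> pz' r) = \<zero>\<^bsub>R\<^esub>" by simp
  then have "pz' r = \<zero>\<^bsub>R\<^esub>" using c by (simp add: R.smult_assoc1[symmetric] mn)
  then show ?thesis using e z by simp
qed

text \<open>A multiple of Y has no coordinates at v = 0, and D_Z leaves v unchanged; so the preimage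
  of r under \<psi> is in the image of D_Y. Applying \<psi> again replaces Y by a multiple of
  \<open>vY k\<close>, which is why the conclusion has a different scalar from the
  hypothesis.\<close>

theorem regular_Z:
  assumes "r \<in> carrier R" "s \<in> carrier R" "r \<otimes>\<^bsub>R\<^esub> vZ l = s \<otimes>\<^bsub>R\<^esub> vY m"
  shows "\<exists>t\<in>carrier R. r = t \<otimes>\<^bsub>R\<^esub> vY k"
proof -
  have c: "pz' r \<in> carrier R" "py' s \<in> carrier R" and e: "pz (pz' r) = r" "py (py' s) = s"
    using assms torR_inv[OF weights_scalars(1,3)] torR_inv[OF weights_scalars(2,4)] by (simp_all add: pz' py')
  have "Dz (pz' r) = Dy (py' s)" using assms by (simp add: Dz_def Dy_def e)
  then have "ev (Dz (pz' r)) (u, 0, Suc w) = \<zero>\<^bsub>A\<^esub>" for u w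
    using c by (simp add: ev_Dy)
  then have "ev (pz' r) (u, 0, w) = \<zero>\<^bsub>A\<^esub>" for u w
    using c by (simp add: ev_Dz)
  then obtain t where t: "t \<in> carrier R" "pz' r = Dy t" using ev_zero_Dy[OF c(1)] by blast
  have "r = pz (py t \<otimes>\<^bsub>R\<^esub> Y)" using e t by (simp add: Dy_def)
  also have "\<dots> = (m \<odot>\<^bsub>R\<^esub> pz (py t)) \<otimes>\<^bsub>R\<^esub> vY k"
    using t by (simp add: pz py twist_values R.smult_mult_left[symmetric] R.smult_mult_right[symmetric])
  finally show ?thesis using t by (intro bexI[of _ "m \<odot>\<^bsub>R\<^esub> pz (py t)"]) (auto simp: pz py)
qed

lemma ev_mult_Y: "s \<in> carrier R \<Longrightarrow> ev (s \<otimes>\<^bsub>R\<^esub> Y) (u, 0, w) = \<zero>\<^bsub>A\<^esub>"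
proof -
  assume s: "s \<in> carrier R"
  then have "s \<otimes>\<^bsub>R\<^esub> Y = Dy (py' s)"
    using torR_inv[OF weights_scalars(2,4)] by (simp add: Dy_def)
  then show ?thesis using s by (simp add: ev_Dy py')
qed

lemma ev_mult_Z: "s \<in> carrier R \<Longrightarrow> ev (s \<otimes>\<^bsub>R\<^esub> Z) (u, v, 0) = \<zero>\<^bsub>A\<^esub>"
proof -
  assume s: "s \<in> carrier R"
  then have "s \<otimes>\<^bsub>R\<^esub> Z = Dz (pz' s)"
    using torR_inv[OF weights_scalars(1,3)] by (simp add: Dz_def)
  then show ?thesis using s by (simp add: ev_Dz pz')
qed

text \<open>Multiples of Y and Z vanish at v = w = 0, so there r X and r agree: the slice of r is
  invariant under u -> u - 1 on all integers. Being finitely supported it is zero, and r is in the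
  sum of the images of D_Y and D_Z.\<close>

theorem regular_X:
  assumes "r \<in> carrier R" "s \<in> carrier R" "t \<in> carrier R"
    and "r \<otimes>\<^bsub>R\<^esub> (vX \<one> l \<ominus>\<^bsub>R\<^esub> \<one>\<^bsub>R\<^esub>) = s \<otimes>\<^bsub>R\<^esub> vY m \<oplus>\<^bsub>R\<^esub> t \<otimes>\<^bsub>R\<^esub> vZ l"
  shows "\<exists>s'\<in>carrier R. \<exists>t'\<in>carrier R. r = s' \<otimes>\<^bsub>R\<^esub> vY m \<oplus>\<^bsub>R\<^esub> t' \<otimes>\<^bsub>R\<^esub> vZ l"
proof -
  have "r \<otimes>\<^bsub>R\<^esub> X = r \<oplus>\<^bsub>R\<^esub> r \<otimes>\<^bsub>R\<^esub> (X \<ominus>\<^bsub>R\<^esub> \<one>\<^bsub>R\<^esub>)"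
    using assms(1) R.M.a_lcomm[of r "r \<otimes>\<^bsub>R\<^esub> X" "\<ominus>\<^bsub>R\<^esub> r"]
    by (simp add: a_minus_def R.r_distr R.r_minus R.M.r_neg)
  then have e: "r \<otimes>\<^bsub>R\<^esub> X = r \<oplus>\<^bsub>R\<^esub> (s \<otimes>\<^bsub>R\<^esub> Y \<oplus>\<^bsub>R\<^esub> t \<otimes>\<^bsub>R\<^esub> Z)" using assms(4) by simp
  have shift: "ev r (u - 1, 0, 0) = ev r (u, 0, 0)" for u
    using arg_cong[OF e, of "\<lambda>x. ev x (u, 0, 0)"] assms(1-3)
    by (simp add: ev_mult_X ev_add ev_mult_Y ev_mult_Z)
  have const: "ev r (u - int i, 0, 0) = ev r (u, 0, 0)" for u i
  proof (induction i)
    case (Suc i)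
    have "u - int (Suc i) = u - int i - 1" by simp
    then show ?case using Suc shift by metis
  qed simp
  have "ev r (u, 0, 0) = \<zero>\<^bsub>A\<^esub>" for u
  proof (rule ccontr)
    assume n: "ev r (u, 0, 0) \<noteq> \<zero>\<^bsub>A\<^esub>"
    have "range (\<lambda>i. u - int i) \<subseteq> {u. ev r (u, 0, 0) \<noteq> \<zero>\<^bsub>A\<^esub>}"
      using const n by auto
    then have "finite (range (\<lambda>i. u - int i))" using ev_finite[OF assms(1)] finite_subset by blast
    moreover have "inj (\<lambda>i. u - int i)" by (auto simp: inj_def)
    ultimately show False using finite_imageD by blast
  qed
  then obtain x y where xy: "x \<in> carrier R" "y \<in> carrier R" "r = Dy x \<oplus>\<^bsub>R\<^esub> Dz y"
    using ev_zero_Dy_Dz[OF assms(1)] by blast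
  then show ?thesis
    by (intro bexI[of _ "py x"] bexI[of _ "pz y"]) (simp_all add: Dy_def Dz_def py pz)
qed

end

section \<open>An abstract Koszul-type complex\<close>

text \<open>A Koszul complex on three elements is a cube. Here the edges are twisted: x0, x1, x2, x3
  are the four parallel edges of one direction, y, y' and z, z' occur twice each in the other two.
  The equations \<open>comm\<close> say that the faces commute; the two yz-faces give the same
  equation.\<close>

locale koszul = ring R for R (structure) +
  fixes x0 x1 x2 x3 y y' z z'
  assumes el [simp]: "x0 \<in> carrier R" "x1 \<in> carrier R" "x2 \<in> carrier R" "x3 \<in> carrier R"
      "y \<in> carrier R" "y' \<in> carrier R" "z \<in> carrier R" "z' \<in> carrier R"
    and comm: "y \<otimes> x0 = x1 \<otimes> y" "z \<otimes> x0 = x2 \<otimes> z" "y' \<otimes> z = z' \<otimes> y"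
      "y' \<otimes> x2 = x3 \<otimes> y'" "z' \<otimes> x1 = x3 \<otimes> z'"
    and reg_y: "\<And>r. r \<in> carrier R \<Longrightarrow> r \<otimes> y = \<zero> \<Longrightarrow> r = \<zero>"
    and reg_y': "\<And>r. r \<in> carrier R \<Longrightarrow> r \<otimes> y' = \<zero> \<Longrightarrow> r = \<zero>"
    and reg_z: "\<And>r s. \<lbrakk>r \<in> carrier R; s \<in> carrier R; r \<otimes> z = s \<otimes> y\<rbrakk> \<Longrightarrow> \<exists>t\<in>carrier R. r = t \<otimes> y'"
    and reg_x: "\<And>r s t. \<lbrakk>r \<in> carrier R; s \<in> carrier R; t \<in> carrier R; r \<otimes> x0 = s \<otimes> y \<oplus> t \<otimes> z\<rbrakk>
      \<Longrightarrow> \<exists>s\<in>carrier R. \<exists>t\<in>carrier R. r = s \<otimes> y \<oplus> t \<otimes> z"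
begin

lemma eq_minusI: "r \<in> carrier R \<Longrightarrow> s \<in> carrier R \<Longrightarrow> r \<oplus> s = \<zero> \<Longrightarrow> r = \<ominus> s"
  using minus_equality[of r s] by simp

text \<open>\<open>reg_z\<close> gives s = t y'; by the face y' z = z' y the relation becomes (r + t
  z') y = 0, and y cancels.\<close>

lemma syzygy_yz:
  assumes "r \<in> carrier R" "s \<in> carrier R" "r \<otimes> y \<oplus> s \<otimes> z = \<zero>"
  shows "\<exists>t\<in>carrier R. r = \<ominus> (t \<otimes> z') \<and> s = t \<otimes> y'"
proof -
  have "s \<otimes> z = (\<ominus> r) \<otimes> y"
    using assms eq_minusI[of "s \<otimes> z" "r \<otimes> y"] by (simp add: a_comm l_minus)
  then obtain t where t: "t \<in> carrier R" "s = t \<otimes> y'"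
    using reg_z[of s "\<ominus> r"] assms by auto
  have "(r \<oplus> t \<otimes> z') \<otimes> y = r \<otimes> y \<oplus> t \<otimes> (y' \<otimes> z)"
    using t assms by (simp add: l_distr m_assoc comm)
  also have "\<dots> = \<zero>" using t assms by (simp add: m_assoc)
  finally have "r \<oplus> t \<otimes> z' = \<zero>" using t assms reg_y[of "r \<oplus> t \<otimes> z'"] by simp
  then have "r = \<ominus> (t \<otimes> z')" using t assms by (intro eq_minusI) auto
  with t show ?thesis by blast
qed

text \<open>Regularity of x0 modulo the left ideal of y and z writes r0 as s y + t z. Subtracting
  the boundary of (s, t, 0) removes r0 and leaves a syzygy of y and z alone.\<close>

theorem exact_1:
  assumes r: "r0 \<in> carrier R" "r1 \<in> carrier R" "r2 \<in> carrier R"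
    and 0: "r0 \<otimes> x0 \<oplus> (r1 \<otimes> y \<oplus> r2 \<otimes> z) = \<zero>"
  shows "\<exists>s01\<in>carrier R. \<exists>s02\<in>carrier R. \<exists>s12\<in>carrier R. r0 = s01 \<otimes> y \<oplus> s02 \<otimes> z \<and>
    r1 = \<ominus> (s01 \<otimes> x1) \<oplus> \<ominus> (s12 \<otimes> z') \<and> r2 = \<ominus> (s02 \<otimes> x2) \<oplus> s12 \<otimes> y'"
proof -
  have "r0 \<otimes> x0 = \<ominus> (r1 \<otimes> y \<oplus> r2 \<otimes> z)"
    using r 0 by (intro eq_minusI) auto
  also have "\<dots> = (\<ominus> r1) \<otimes> y \<oplus> (\<ominus> r2) \<otimes> z" using r by (simp add: minus_add l_minus)
  finally obtain s t where st: "s \<in> carrier R" "t \<in> carrier R" "r0 = s \<otimes> y \<oplus> t \<otimes> z"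
    using reg_x[of r0 "\<ominus> r1" "\<ominus> r2"] r by auto
  have "(s \<otimes> x1 \<oplus> r1) \<otimes> y \<oplus> (t \<otimes> x2 \<oplus> r2) \<otimes> z = r0 \<otimes> x0 \<oplus> (r1 \<otimes> y \<oplus> r2 \<otimes> z)"
    using r st by (simp add: l_distr m_assoc comm a_ac)
  then obtain u where u: "u \<in> carrier R" "s \<otimes> x1 \<oplus> r1 = \<ominus> (u \<otimes> z')" "t \<otimes> x2 \<oplus> r2 = u \<otimes> y'"
    using syzygy_yz[of "s \<otimes> x1 \<oplus> r1" "t \<otimes> x2 \<oplus> r2"] 0 r st by auto
  have "r1 = \<ominus> (s \<otimes> x1) \<oplus> (s \<otimes> x1 \<oplus> r1)" "r2 = \<ominus> (t \<otimes> x2) \<oplus> (t \<otimes> x2 \<oplus> r2)"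
    using r st by (simp_all add: r_neg1)
  then have "r0 = s \<otimes> y \<oplus> t \<otimes> z \<and> r1 = \<ominus> (s \<otimes> x1) \<oplus> \<ominus> (u \<otimes> z') \<and> r2 = \<ominus> (t \<otimes> x2) \<oplus> u \<otimes> y'"
    using u st by simp
  then show ?thesis using u st by blast
qed

text \<open>The first equation already produces the preimage up to sign; the second, multiplied
  through the face y' x2 = x3 y', fixes the last coordinate after y' is cancelled.\<close>

theorem exact_2:
  assumes s: "s01 \<in> carrier R" "s02 \<in> carrier R" "s12 \<in> carrier R"
    and 0: "s01 \<otimes> y \<oplus> s02 \<otimes> z = \<zero>" "\<ominus> (s02 \<otimes> x2) \<oplus> s12 \<otimes> y' = \<zero>"
  shows "\<exists>t\<in>carrier R. s01 = t \<otimes> z' \<and> s02 = \<ominus> (t \<otimes> y') \<and> s12 = \<ominus> (t \<otimes> x3)"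
proof -
  obtain u where u: "u \<in> carrier R" "s01 = \<ominus> (u \<otimes> z')" "s02 = u \<otimes> y'"
    using syzygy_yz[OF s(1,2) 0(1)] by blast
  have "(\<ominus> (u \<otimes> x3) \<oplus> s12) \<otimes> y' = \<ominus> (s02 \<otimes> x2) \<oplus> s12 \<otimes> y'"
    using u s by (simp add: l_distr l_minus m_assoc comm)
  then have "\<ominus> (u \<otimes> x3) \<oplus> s12 = \<zero>" using u s 0 reg_y'[of "\<ominus> (u \<otimes> x3) \<oplus> s12"] by simp
  then have "s12 = u \<otimes> x3" using u s eq_minusI[of s12 "\<ominus> (u \<otimes> x3)"] by (simp add: a_comm)
  then show ?thesis using u s by (intro bexI[of _ "\<ominus> u"]) (auto simp: l_minus)
qed

end

context sl2_presented
begin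

lemma minus_one_mult:
  assumes "u \<in> carrier R" "v \<in> carrier R" "w \<in> carrier R" "u \<otimes>\<^bsub>R\<^esub> v = w \<otimes>\<^bsub>R\<^esub> u"
  shows "u \<otimes>\<^bsub>R\<^esub> (v \<ominus>\<^bsub>R\<^esub> \<one>\<^bsub>R\<^esub>) = (w \<ominus>\<^bsub>R\<^esub> \<one>\<^bsub>R\<^esub>) \<otimes>\<^bsub>R\<^esub> u"
  using assms by (simp add: a_minus_def R.l_distr R.r_distr R.l_minus R.r_minus)

abbreviation "x0 \<equiv> X \<ominus>\<^bsub>R\<^esub> \<one>\<^bsub>R\<^esub>"
abbreviation "x1 \<equiv> vX m \<one> \<ominus>\<^bsub>R\<^esub> \<one>\<^bsub>R\<^esub>"
abbreviation "x2 \<equiv> vX k (m \<otimes> l) \<ominus>\<^bsub>R\<^esub> \<one>\<^bsub>R\<^esub>"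
abbreviation "x3 \<equiv> vX (k \<otimes> m) m \<ominus>\<^bsub>R\<^esub> \<one>\<^bsub>R\<^esub>"

lemma commutations:
  "Y \<otimes>\<^bsub>R\<^esub> x0 = x1 \<otimes>\<^bsub>R\<^esub> Y" "Z \<otimes>\<^bsub>R\<^esub> x0 = x2 \<otimes>\<^bsub>R\<^esub> Z" "vY k \<otimes>\<^bsub>R\<^esub> Z = vZ n \<otimes>\<^bsub>R\<^esub> Y"
  "vY k \<otimes>\<^bsub>R\<^esub> x2 = x3 \<otimes>\<^bsub>R\<^esub> vY k" "vZ n \<otimes>\<^bsub>R\<^esub> x1 = x3 \<otimes>\<^bsub>R\<^esub> vZ n"
  using YX ZX YZ YX' ZX' by (simp_all add: minus_one_mult KS)

sublocale koszul R x0 x1 x2 x3 Y "vY k" Z "vZ n"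
proof (rule koszul.intro[OF R.ring_A], rule koszul_axioms.intro)
  show "r = \<zero>\<^bsub>R\<^esub>" if "r \<in> carrier R" "r \<otimes>\<^bsub>R\<^esub> Y = \<zero>\<^bsub>R\<^esub>" for r using that by (rule regular_Y)
  show "r = \<zero>\<^bsub>R\<^esub>" if "r \<in> carrier R" "r \<otimes>\<^bsub>R\<^esub> vY k = \<zero>\<^bsub>R\<^esub>" for r using that by (rule regular_Y')
  show "\<exists>t\<in>carrier R. r = t \<otimes>\<^bsub>R\<^esub> vY k"
    if "r \<in> carrier R" "s \<in> carrier R" "r \<otimes>\<^bsub>R\<^esub> Z = s \<otimes>\<^bsub>R\<^esub> Y" for r s using that by (rule regular_Z)
  show "\<exists>s\<in>carrier R. \<exists>t\<in>carrier R. r = s \<otimes>\<^bsub>R\<^esub> Y \<oplus>\<^bsub>R\<^esub> t \<otimes>\<^bsub>R\<^esub> Z"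
    if "r \<in> carrier R" "s \<in> carrier R" "t \<in> carrier R" "r \<otimes>\<^bsub>R\<^esub> x0 = s \<otimes>\<^bsub>R\<^esub> Y \<oplus>\<^bsub>R\<^esub> t \<otimes>\<^bsub>R\<^esub> Z" for r s t
    using that by (rule regular_X)
qed (rule commutations | simp add: KS)+

section \<open>The annihilator of 1 as a left ideal of the enveloping algebra\<close>

definition "J = {x \<otimes>\<^bsub>R\<^esub> x0 \<oplus>\<^bsub>R\<^esub> (y \<otimes>\<^bsub>R\<^esub> Y \<oplus>\<^bsub>R\<^esub> z \<otimes>\<^bsub>R\<^esub> Z) |x y z.
  x \<in> carrier R \<and> y \<in> carrier R \<and> z \<in> carrier R}"

lemma J_I: "x \<in> carrier R \<Longrightarrow> y \<in> carrier R \<Longrightarrow> z \<in> carrier R \<Longrightarrow>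
    x \<otimes>\<^bsub>R\<^esub> x0 \<oplus>\<^bsub>R\<^esub> (y \<otimes>\<^bsub>R\<^esub> Y \<oplus>\<^bsub>R\<^esub> z \<otimes>\<^bsub>R\<^esub> Z) \<in> J"
  unfolding J_def by (rule CollectI, rule exI[of _ x], rule exI[of _ y], rule exI[of _ z]) simp

lemma J_E:
  assumes "j \<in> J"
  obtains x y z where "x \<in> carrier R" "y \<in> carrier R" "z \<in> carrier R"
    "j = x \<otimes>\<^bsub>R\<^esub> x0 \<oplus>\<^bsub>R\<^esub> (y \<otimes>\<^bsub>R\<^esub> Y \<oplus>\<^bsub>R\<^esub> z \<otimes>\<^bsub>R\<^esub> Z)"
  using assms unfolding J_def by (elim CollectE exE conjE) (rule that)

lemma J_add:
  assumes "i \<in> J" "j \<in> J"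
  shows "i \<oplus>\<^bsub>R\<^esub> j \<in> J"
proof -
  obtain x y z where i: "x \<in> carrier R" "y \<in> carrier R" "z \<in> carrier R"
    "i = x \<otimes>\<^bsub>R\<^esub> x0 \<oplus>\<^bsub>R\<^esub> (y \<otimes>\<^bsub>R\<^esub> Y \<oplus>\<^bsub>R\<^esub> z \<otimes>\<^bsub>R\<^esub> Z)" by (rule J_E[OF assms(1)])
  obtain u v w where j: "u \<in> carrier R" "v \<in> carrier R" "w \<in> carrier R"
    "j = u \<otimes>\<^bsub>R\<^esub> x0 \<oplus>\<^bsub>R\<^esub> (v \<otimes>\<^bsub>R\<^esub> Y \<oplus>\<^bsub>R\<^esub> w \<otimes>\<^bsub>R\<^esub> Z)" by (rule J_E[OF assms(2)])
  have "i \<oplus>\<^bsub>R\<^esub> j = (x \<oplus>\<^bsub>R\<^esub> u) \<otimes>\<^bsub>R\<^esub> x0 \<oplus>\<^bsub>R\<^esub> ((y \<oplus>\<^bsub>R\<^esub> v) \<otimes>\<^bsub>R\<^esub> Y \<oplus>\<^bsub>R\<^esub> (z \<oplus>\<^bsub>R\<^esub> w) \<otimes>\<^bsub>R\<^esub> Z)"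
    using i j by (simp add: R.l_distr R.M.a_ac)
  then show ?thesis using i(1-3) j(1-3) J_I by simp
qed

lemma J_mult:
  assumes r: "r \<in> carrier R" and "j \<in> J"
  shows "r \<otimes>\<^bsub>R\<^esub> j \<in> J"
proof -
  obtain x y z where e: "x \<in> carrier R" "y \<in> carrier R" "z \<in> carrier R"
    "j = x \<otimes>\<^bsub>R\<^esub> x0 \<oplus>\<^bsub>R\<^esub> (y \<otimes>\<^bsub>R\<^esub> Y \<oplus>\<^bsub>R\<^esub> z \<otimes>\<^bsub>R\<^esub> Z)" by (rule J_E[OF assms(2)])
  have "r \<otimes>\<^bsub>R\<^esub> j = (r \<otimes>\<^bsub>R\<^esub> x) \<otimes>\<^bsub>R\<^esub> x0 \<oplus>\<^bsub>R\<^esub> ((r \<otimes>\<^bsub>R\<^esub> y) \<otimes>\<^bsub>R\<^esub> Y \<oplus>\<^bsub>R\<^esub> (r \<otimes>\<^bsub>R\<^esub> z) \<otimes>\<^bsub>R\<^esub> Z)"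
    using e r by (simp add: R.r_distr R.m_assoc)
  then show ?thesis using e(1-3) r J_I[of "r \<otimes>\<^bsub>R\<^esub> x" "r \<otimes>\<^bsub>R\<^esub> y" "r \<otimes>\<^bsub>R\<^esub> z"] by simp
qed

lemma J_generators: "x0 \<in> J" "Y \<in> J" "Z \<in> J" "\<zero>\<^bsub>R\<^esub> \<in> J"
  using J_I[of "\<one>\<^bsub>R\<^esub>" "\<zero>\<^bsub>R\<^esub>" "\<zero>\<^bsub>R\<^esub>"] J_I[of "\<zero>\<^bsub>R\<^esub>" "\<one>\<^bsub>R\<^esub>" "\<zero>\<^bsub>R\<^esub>"] J_I[of "\<zero>\<^bsub>R\<^esub>" "\<zero>\<^bsub>R\<^esub>" "\<one>\<^bsub>R\<^esub>"]
    J_I[of "\<zero>\<^bsub>R\<^esub>" "\<zero>\<^bsub>R\<^esub>" "\<zero>\<^bsub>R\<^esub>"] by simp_all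

text \<open>By the determinant relation W (X - 1) equals 1 - W plus a left multiple of Z.\<close>

lemma J_W: "W \<ominus>\<^bsub>R\<^esub> \<one>\<^bsub>R\<^esub> \<in> J"
proof -
  have "W \<otimes>\<^bsub>R\<^esub> x0 = \<one>\<^bsub>R\<^esub> \<oplus>\<^bsub>R\<^esub> m \<odot>\<^bsub>R\<^esub> (vY k \<otimes>\<^bsub>R\<^esub> Z) \<oplus>\<^bsub>R\<^esub> \<ominus>\<^bsub>R\<^esub> W"
    by (simp add: a_minus_def R.r_distr R.r_minus WX)
  then have "W \<ominus>\<^bsub>R\<^esub> \<one>\<^bsub>R\<^esub> = (\<ominus>\<^bsub>R\<^esub> W) \<otimes>\<^bsub>R\<^esub> x0 \<oplus>\<^bsub>R\<^esub> (m \<odot>\<^bsub>R\<^esub> vY k) \<otimes>\<^bsub>R\<^esub> Z"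
    by (simp add: R.l_minus R.smult_mult_left[symmetric] a_minus_def R.minus_add R.M.a_ac R.M.r_neg R.M.r_neg1 R.M.r_neg2)
  then show ?thesis using J_add[OF J_mult[OF _ J_generators(1)] J_mult[OF _ J_generators(3)], of "\<ominus>\<^bsub>R\<^esub> W" "m \<odot>\<^bsub>R\<^esub> vY k"]
    by simp
qed

lemma J_letter:
  assumes "e \<in> {a, b, c, d}"
  shows "et e \<one>\<^bsub>A\<^esub> \<ominus>\<^bsub>R\<^esub> et \<one>\<^bsub>A\<^esub> e \<in> J"
proof -
  have 1: "(x \<otimes>\<^bsub>R\<^esub> u \<oplus>\<^bsub>R\<^esub> v) \<ominus>\<^bsub>R\<^esub> x = x \<otimes>\<^bsub>R\<^esub> (u \<ominus>\<^bsub>R\<^esub> \<one>\<^bsub>R\<^esub>) \<oplus>\<^bsub>R\<^esub> v"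
    if "x \<in> carrier R" "u \<in> carrier R" "v \<in> carrier R" for x u v
    using that by (simp add: a_minus_def R.r_distr R.r_minus R.M.a_ac)
  have 2: "(v \<oplus>\<^bsub>R\<^esub> x \<otimes>\<^bsub>R\<^esub> u) \<ominus>\<^bsub>R\<^esub> x = v \<oplus>\<^bsub>R\<^esub> x \<otimes>\<^bsub>R\<^esub> (u \<ominus>\<^bsub>R\<^esub> \<one>\<^bsub>R\<^esub>)"
    if "x \<in> carrier R" "u \<in> carrier R" "v \<in> carrier R" for x u v
    using that by (simp add: a_minus_def R.r_distr R.r_minus R.M.a_ac)
  show ?thesis using assms
    by (auto simp: et_a et_b et_c et_d 1 2 intro!: J_add J_mult J_generators J_W)
qed

text \<open>Write D(x) = x \<otimes> 1 - 1 \<otimes> x. Then D(e x) = (e \<otimes> 1) D(x) + (1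
  \<otimes> x) D(e), so membership in the left ideal spreads from the letters to all of A.\<close>

lemma et_minus: "x \<in> carrier A \<Longrightarrow> et x \<one>\<^bsub>A\<^esub> \<ominus>\<^bsub>R\<^esub> et \<one>\<^bsub>A\<^esub> x \<in> J"
proof (rule letter_induct, assumption)
  have z: "et \<zero>\<^bsub>A\<^esub> \<one>\<^bsub>A\<^esub> = \<zero>\<^bsub>R\<^esub>"
    using et_smult(1)[of \<zero> "\<zero>\<^bsub>A\<^esub>" "\<one>\<^bsub>A\<^esub>"] by (simp add: KS)
  show "et \<zero>\<^bsub>A\<^esub> \<one>\<^bsub>A\<^esub> \<ominus>\<^bsub>R\<^esub> et \<one>\<^bsub>A\<^esub> \<zero>\<^bsub>A\<^esub> \<in> J" "et \<one>\<^bsub>A\<^esub> \<one>\<^bsub>A\<^esub> \<ominus>\<^bsub>R\<^esub> et \<one>\<^bsub>A\<^esub> \<one>\<^bsub>A\<^esub> \<in> J"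
    using J_generators(4) by (simp_all add: z et_right_zero a_minus_def R.M.r_neg)
next
  fix s x assume s: "s \<in> carrier K" and x: "x \<in> carrier A" "et x \<one>\<^bsub>A\<^esub> \<ominus>\<^bsub>R\<^esub> et \<one>\<^bsub>A\<^esub> x \<in> J"
  have "et (s \<odot>\<^bsub>A\<^esub> x) \<one>\<^bsub>A\<^esub> \<ominus>\<^bsub>R\<^esub> et \<one>\<^bsub>A\<^esub> (s \<odot>\<^bsub>A\<^esub> x) = (s \<odot>\<^bsub>R\<^esub> \<one>\<^bsub>R\<^esub>) \<otimes>\<^bsub>R\<^esub> (et x \<one>\<^bsub>A\<^esub> \<ominus>\<^bsub>R\<^esub> et \<one>\<^bsub>A\<^esub> x)"
    using s x by (simp add: et_smult R.smult_mult_left[symmetric] a_minus_def R.smult_r_distr R.smult_r_minus)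
  then show "et (s \<odot>\<^bsub>A\<^esub> x) \<one>\<^bsub>A\<^esub> \<ominus>\<^bsub>R\<^esub> et \<one>\<^bsub>A\<^esub> (s \<odot>\<^bsub>A\<^esub> x) \<in> J" using s x J_mult by simp
next
  fix x y assume x: "x \<in> carrier A" "et x \<one>\<^bsub>A\<^esub> \<ominus>\<^bsub>R\<^esub> et \<one>\<^bsub>A\<^esub> x \<in> J"
    and y: "y \<in> carrier A" "et y \<one>\<^bsub>A\<^esub> \<ominus>\<^bsub>R\<^esub> et \<one>\<^bsub>A\<^esub> y \<in> J"
  have "et (x \<oplus>\<^bsub>A\<^esub> y) \<one>\<^bsub>A\<^esub> \<ominus>\<^bsub>R\<^esub> et \<one>\<^bsub>A\<^esub> (x \<oplus>\<^bsub>A\<^esub> y)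
    = (et x \<one>\<^bsub>A\<^esub> \<ominus>\<^bsub>R\<^esub> et \<one>\<^bsub>A\<^esub> x) \<oplus>\<^bsub>R\<^esub> (et y \<one>\<^bsub>A\<^esub> \<ominus>\<^bsub>R\<^esub> et \<one>\<^bsub>A\<^esub> y)"
    using x(1) y(1) by (simp add: et_add a_minus_def R.minus_add R.M.a_ac)
  then show "et (x \<oplus>\<^bsub>A\<^esub> y) \<one>\<^bsub>A\<^esub> \<ominus>\<^bsub>R\<^esub> et \<one>\<^bsub>A\<^esub> (x \<oplus>\<^bsub>A\<^esub> y) \<in> J" using x y J_add by simp
next
  fix e x assume e: "e \<in> {a, b, c, d}" and x: "x \<in> carrier A" "et x \<one>\<^bsub>A\<^esub> \<ominus>\<^bsub>R\<^esub> et \<one>\<^bsub>A\<^esub> x \<in> J"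
  note ec = letter_mem[OF e]
  have "et e \<one>\<^bsub>A\<^esub> \<otimes>\<^bsub>R\<^esub> (et x \<one>\<^bsub>A\<^esub> \<ominus>\<^bsub>R\<^esub> et \<one>\<^bsub>A\<^esub> x) \<oplus>\<^bsub>R\<^esub> et \<one>\<^bsub>A\<^esub> x \<otimes>\<^bsub>R\<^esub> (et e \<one>\<^bsub>A\<^esub> \<ominus>\<^bsub>R\<^esub> et \<one>\<^bsub>A\<^esub> e)
    = et (e \<otimes>\<^bsub>A\<^esub> x) \<one>\<^bsub>A\<^esub> \<oplus>\<^bsub>R\<^esub> \<ominus>\<^bsub>R\<^esub> et e x \<oplus>\<^bsub>R\<^esub> (et e x \<oplus>\<^bsub>R\<^esub> \<ominus>\<^bsub>R\<^esub> et \<one>\<^bsub>A\<^esub> (e \<otimes>\<^bsub>A\<^esub> x))"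
    using ec x by (simp add: a_minus_def R.r_distr R.r_minus et_mult)
  also have "\<dots> = et (e \<otimes>\<^bsub>A\<^esub> x) \<one>\<^bsub>A\<^esub> \<ominus>\<^bsub>R\<^esub> et \<one>\<^bsub>A\<^esub> (e \<otimes>\<^bsub>A\<^esub> x)"
    using ec x by (simp add: a_minus_def R.M.a_assoc R.M.r_neg1)
  finally show "et (e \<otimes>\<^bsub>A\<^esub> x) \<one>\<^bsub>A\<^esub> \<ominus>\<^bsub>R\<^esub> et \<one>\<^bsub>A\<^esub> (e \<otimes>\<^bsub>A\<^esub> x) \<in> J"
    using J_add[OF J_mult[OF _ x(2)] J_mult[OF _ J_letter[OF e]], of "et e \<one>\<^bsub>A\<^esub>" "et \<one>\<^bsub>A\<^esub> x"] ec x by simp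
qed

lemma action_left_module:
  "r \<in> carrier R \<Longrightarrow> s \<in> carrier R \<Longrightarrow> x \<in> carrier A \<Longrightarrow>
    env_action K A (r \<oplus>\<^bsub>R\<^esub> s) x = env_action K A r x \<oplus>\<^bsub>A\<^esub> env_action K A s x"
  "r \<in> carrier R \<Longrightarrow> s \<in> carrier R \<Longrightarrow> x \<in> carrier A \<Longrightarrow>
    env_action K A (r \<otimes>\<^bsub>R\<^esub> s) x = env_action K A r (env_action K A s x)"
  "r \<in> carrier R \<Longrightarrow> x \<in> carrier A \<Longrightarrow> y \<in> carrier A \<Longrightarrow>
    env_action K A r (x \<oplus>\<^bsub>A\<^esub> y) = env_action K A r x \<oplus>\<^bsub>A\<^esub> env_action K A r y"
  using left_module.smult_l_distr[OF left_module_env] left_module.smult_assoc[OF left_module_env]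
    left_module.smult_r_distr[OF left_module_env] by (simp_all add: env_module_def)

lemma action_smult:
  assumes "r \<in> carrier R" "x \<in> carrier A" "s \<in> carrier K"
  shows "env_action K A (s \<odot>\<^bsub>R\<^esub> r) x = s \<odot>\<^bsub>A\<^esub> env_action K A r x"
proof -
  have "s \<odot>\<^bsub>R\<^esub> r = et (s \<odot>\<^bsub>A\<^esub> \<one>\<^bsub>A\<^esub>) \<one>\<^bsub>A\<^esub> \<otimes>\<^bsub>R\<^esub> r"
    using assms by (simp add: et_smult et_one R.smult_mult_left[symmetric])
  then show ?thesis using assms
    by (simp add: action_left_module env_action_et env_action_closed smult_mult_left[symmetric])
qed

lemma action_zero: "x \<in> carrier A \<Longrightarrow> env_action K A \<zero>\<^bsub>R\<^esub> x = \<zero>\<^bsub>A\<^esub>"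
  using action_smult[of "\<zero>\<^bsub>R\<^esub>" x \<zero>] by (simp add: KS env_action_closed)

lemma action_one: "x \<in> carrier A \<Longrightarrow> env_action K A \<one>\<^bsub>R\<^esub> x = x"
  using env_action_et[of "\<one>\<^bsub>A\<^esub>" "\<one>\<^bsub>A\<^esub>" x] by (simp add: et_one)

text \<open>Every r is congruent modulo \<open>J\<close> to 1 \<otimes> (r acting on 1), because x
  \<otimes> y = (1 \<otimes> y)(x \<otimes> 1). The second term vanishes by hypothesis.\<close>

lemma action_kernel_J: 
  assumes "r \<in> carrier R" "env_action K A r \<one>\<^bsub>A\<^esub> = \<zero>\<^bsub>A\<^esub>"
  shows "r \<in> J"
proof -
  have "r \<ominus>\<^bsub>R\<^esub> et \<one>\<^bsub>A\<^esub> (env_action K A r \<one>\<^bsub>A\<^esub>) \<in> J"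
    using assms(1)
  proof (induction r rule: R_induct)
    case zero
    then show ?case using J_generators(4) by (simp add: action_zero et_right_zero a_minus_def)
  next
    case (step x y t)
    let ?t = "env_action K A t \<one>\<^bsub>A\<^esub>"
    have t: "?t \<in> carrier A" using step by (simp add: env_action_closed)
    have "et x y \<oplus>\<^bsub>R\<^esub> t \<ominus>\<^bsub>R\<^esub> et \<one>\<^bsub>A\<^esub> (env_action K A (et x y \<oplus>\<^bsub>R\<^esub> t) \<one>\<^bsub>A\<^esub>)
      = et x y \<oplus>\<^bsub>R\<^esub> t \<ominus>\<^bsub>R\<^esub> et \<one>\<^bsub>A\<^esub> (x \<otimes>\<^bsub>A\<^esub> y \<oplus>\<^bsub>A\<^esub> ?t)"
      using step by (simp add: action_left_module env_action_et)
    also have "\<dots> = (et x y \<ominus>\<^bsub>R\<^esub> et \<one>\<^bsub>A\<^esub> (x \<otimes>\<^bsub>A\<^esub> y)) \<oplus>\<^bsub>R\<^esub> (t \<ominus>\<^bsub>R\<^esub> et \<one>\<^bsub>A\<^esub> ?t)"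
      using step t by (simp add: et_add a_minus_def R.minus_add R.M.a_ac)
    also have "et x y \<ominus>\<^bsub>R\<^esub> et \<one>\<^bsub>A\<^esub> (x \<otimes>\<^bsub>A\<^esub> y) = et \<one>\<^bsub>A\<^esub> y \<otimes>\<^bsub>R\<^esub> (et x \<one>\<^bsub>A\<^esub> \<ominus>\<^bsub>R\<^esub> et \<one>\<^bsub>A\<^esub> x)"
      using step by (simp add: a_minus_def R.r_distr R.r_minus et_mult)
    finally show ?case using step J_add[OF J_mult[OF _ et_minus]] by simp
  qed
  then show ?thesis using assms by (simp add: et_right_zero a_minus_def)
qed

lemma generators_action:
  "env_action K A x0 \<one>\<^bsub>A\<^esub> = \<zero>\<^bsub>A\<^esub>" "env_action K A Y \<one>\<^bsub>A\<^esub> = \<zero>\<^bsub>A\<^esub>" "env_action K A Z \<one>\<^bsub>A\<^esub> = \<zero>\<^bsub>A\<^esub>"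
proof -
  have neg: "env_action K A (\<ominus>\<^bsub>R\<^esub> \<one>\<^bsub>R\<^esub>) \<one>\<^bsub>A\<^esub> = \<ominus>\<^bsub>A\<^esub> \<one>\<^bsub>A\<^esub>"
    using action_smult[of "\<one>\<^bsub>R\<^esub>" "\<one>\<^bsub>A\<^esub>" "\<ominus> \<one>"]
    by (simp add: action_one KS R.smult_l_minus smult_l_minus)
  have X: "env_action K A X \<one>\<^bsub>A\<^esub> = \<one>\<^bsub>A\<^esub>"
    by (simp add: vX_def action_left_module action_smult env_action_et KS rels smult_l_minus M.r_neg M.a_assoc)
  show "env_action K A x0 \<one>\<^bsub>A\<^esub> = \<zero>\<^bsub>A\<^esub>"
    by (simp add: a_minus_def action_left_module X neg M.r_neg KS)
  show "env_action K A Y \<one>\<^bsub>A\<^esub> = \<zero>\<^bsub>A\<^esub>"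
    by (simp add: vY_def action_left_module action_smult env_action_et KS rels smult_l_minus M.r_neg M.a_assoc)
  show "env_action K A Z \<one>\<^bsub>A\<^esub> = \<zero>\<^bsub>A\<^esub>"
    by (simp add: vZ_def action_left_module action_smult env_action_et KS rels smult_l_minus M.r_neg M.a_assoc
      smult_assoc1[symmetric] kl scalar_inverses)
qed

end

section \<open>The presented algebra and its dual parameters\<close>

text \<open>The inverses are separate parameters so that the instance at (q', p') has exactly q and
  p as its inverses, rather than inverses of inverses.\<close>

locale qsl2 = quantum_sl2 K p q for K :: "('k, 'x) ring_scheme" (structure) and p q :: 'k +
  fixes p' q' :: 'k
  assumes p': "p' = inv p" and q': "q' = inv q"
begin

lemma scal [simp]: "p \<in> carrier K" "q \<in> carrier K" "p' \<in> carrier K" "q' \<in> carrier K"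
  by (simp_all add: p' q')

lemma A_rels:
  "gen Gb \<otimes>\<^bsub>A\<^esub> gen Ga = q \<odot>\<^bsub>A\<^esub> (gen Ga \<otimes>\<^bsub>A\<^esub> gen Gb)"
  "gen Gc \<otimes>\<^bsub>A\<^esub> gen Ga = p \<odot>\<^bsub>A\<^esub> (gen Ga \<otimes>\<^bsub>A\<^esub> gen Gc)"
  "gen Gd \<otimes>\<^bsub>A\<^esub> gen Gb = q \<odot>\<^bsub>A\<^esub> (gen Gb \<otimes>\<^bsub>A\<^esub> gen Gd)"
  "gen Gd \<otimes>\<^bsub>A\<^esub> gen Gc = p \<odot>\<^bsub>A\<^esub> (gen Gc \<otimes>\<^bsub>A\<^esub> gen Gd)"
  "gen Gc \<otimes>\<^bsub>A\<^esub> gen Gb = gen Gb \<otimes>\<^bsub>A\<^esub> gen Gc"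
  "gen Ga \<otimes>\<^bsub>A\<^esub> gen Gd = \<one>\<^bsub>A\<^esub> \<oplus>\<^bsub>A\<^esub> p' \<odot>\<^bsub>A\<^esub> (gen Gb \<otimes>\<^bsub>A\<^esub> gen Gc)"
  "gen Gd \<otimes>\<^bsub>A\<^esub> gen Ga = \<one>\<^bsub>A\<^esub> \<oplus>\<^bsub>A\<^esub> q \<odot>\<^bsub>A\<^esub> (gen Gb \<otimes>\<^bsub>A\<^esub> gen Gc)"
  using sl2_tuple_gen by (simp_all add: sl2_tuple_def p')

sublocale L: sl2_letters K A p p' q q' "gen Ga" "gen Gb" "gen Gc" "gen Gd"
proof -
  have "enveloping K A" by (simp add: enveloping_def A.k_algebra_axioms)
  then show "sl2_letters K A p p' q q' (gen Ga) (gen Gb) (gen Gc) (gen Gd)"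
    by (rule sl2_letters.intro, unfold_locales) (simp_all add: A_rels, simp_all add: p' q' pq_inv)
qed

lemma tupleI:
  assumes "\<And>g. w g \<in> carrier B"
    "w Gb \<otimes>\<^bsub>B\<^esub> w Ga = q \<odot>\<^bsub>B\<^esub> (w Ga \<otimes>\<^bsub>B\<^esub> w Gb)"
    "w Gc \<otimes>\<^bsub>B\<^esub> w Ga = p \<odot>\<^bsub>B\<^esub> (w Ga \<otimes>\<^bsub>B\<^esub> w Gc)"
    "w Gd \<otimes>\<^bsub>B\<^esub> w Gb = q \<odot>\<^bsub>B\<^esub> (w Gb \<otimes>\<^bsub>B\<^esub> w Gd)"
    "w Gd \<otimes>\<^bsub>B\<^esub> w Gc = p \<odot>\<^bsub>B\<^esub> (w Gc \<otimes>\<^bsub>B\<^esub> w Gd)"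
    "w Gc \<otimes>\<^bsub>B\<^esub> w Gb = w Gb \<otimes>\<^bsub>B\<^esub> w Gc"
    "w Ga \<otimes>\<^bsub>B\<^esub> w Gd = \<one>\<^bsub>B\<^esub> \<oplus>\<^bsub>B\<^esub> p' \<odot>\<^bsub>B\<^esub> (w Gb \<otimes>\<^bsub>B\<^esub> w Gc)"
    "w Gd \<otimes>\<^bsub>B\<^esub> w Ga = \<one>\<^bsub>B\<^esub> \<oplus>\<^bsub>B\<^esub> q \<odot>\<^bsub>B\<^esub> (w Gb \<otimes>\<^bsub>B\<^esub> w Gc)"
  shows "sl2_tuple K p q B w"
  using assms by (simp add: sl2_tuple_def p')

sublocale L: sl2_presented K A p p' q q' "gen Ga" "gen Gb" "gen Gc" "gen Gd"
proof (rule sl2_presented.intro[OF L.sl2_letters_axioms], rule sl2_presented_axioms.intro)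
  fix s s' t t'
  assume s: "s \<in> carrier K" "s' \<in> carrier K" "t \<in> carrier K" "t' \<in> carrier K" "s \<otimes> s' = \<one>" "t \<otimes> t' = \<one>"
  define w where "w = (\<lambda>g. (case g of Ga \<Rightarrow> s | Gb \<Rightarrow> t | Gc \<Rightarrow> t' | Gd \<Rightarrow> s') \<odot>\<^bsub>A\<^esub> gen g)"
  have c: "s' \<otimes> s = \<one>" using s K.m_comm by simp
  have pull: "(x \<odot>\<^bsub>A\<^esub> u) \<otimes>\<^bsub>A\<^esub> (y \<odot>\<^bsub>A\<^esub> v) = (x \<otimes> y) \<odot>\<^bsub>A\<^esub> (u \<otimes>\<^bsub>A\<^esub> v)"
    if "x \<in> carrier K" "y \<in> carrier K" "u \<in> carrier A" "v \<in> carrier A" for x y u v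
    using that by (simp add: A.smult_mult_left[symmetric] A.smult_mult_right[symmetric] A.smult_assoc1 A.smult_left_commute)
  have "sl2_tuple K p q A w"
  proof (rule tupleI)
    show "w g \<in> carrier A" for g using s by (cases g) (simp_all add: w_def)
  qed (use s in \<open>simp_all add: w_def pull A_rels A.smult_assoc1[symmetric] K.m_ac A.smult_r_distr c\<close>)
  then obtain h where "h \<in> alg_hom K A A" "\<And>g. h (gen g) = w g"
    using A_lift[OF A.assoc_algebra_axioms] by blast
  then show "\<exists>h\<in>alg_hom K A A. h (gen Ga) = s \<odot>\<^bsub>A\<^esub> gen Ga \<and> h (gen Gd) = s' \<odot>\<^bsub>A\<^esub> gen Gd \<and>
      h (gen Gb) = t \<odot>\<^bsub>A\<^esub> gen Gb \<and> h (gen Gc) = t' \<odot>\<^bsub>A\<^esub> gen Gc"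
    by (intro bexI[of _ h]) (simp_all add: w_def)
next
  have "sl2_tuple K p q (end_alg K (grid_module A)) L.opr"
    by (rule tupleI) (simp_all only: L.opr_closed L.opr_ba L.opr_ca L.opr_db L.opr_dc L.opr_cb L.opr_ad L.opr_da)
  then obtain h where "h \<in> alg_hom K A (end_alg K (grid_module A))" "\<And>g. h (gen g) = L.opr g"
    using A_lift[OF L.E.assoc_algebra_axioms] by blast
  then show "\<exists>h\<in>alg_hom K A (end_alg K (grid_module A)). h (gen Ga) = L.opr Ga \<and> h (gen Gb) = L.opr Gb \<and>
      h (gen Gc) = L.opr Gc \<and> h (gen Gd) = L.opr Gd" by blast
next
  fix x and P :: "(sl2_gen list \<Rightarrow> 'k) set \<Rightarrow> bool"
  assume x: "x \<in> carrier A" "P \<zero>\<^bsub>A\<^esub>" "P \<one>\<^bsub>A\<^esub>"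
    "\<And>s x. s \<in> carrier K \<Longrightarrow> x \<in> carrier A \<Longrightarrow> P x \<Longrightarrow> P (s \<odot>\<^bsub>A\<^esub> x)"
    "\<And>x y. x \<in> carrier A \<Longrightarrow> y \<in> carrier A \<Longrightarrow> P x \<Longrightarrow> P y \<Longrightarrow> P (x \<oplus>\<^bsub>A\<^esub> y)"
    and g: "\<And>e x. e \<in> {gen Ga, gen Gb, gen Gc, gen Gd} \<Longrightarrow> x \<in> carrier A \<Longrightarrow> P x \<Longrightarrow> P (e \<otimes>\<^bsub>A\<^esub> x)"
  show "P x"
    using x(1-3)
  proof (induction x rule: A_induct)
    case (gen g x)
    have "gen g \<in> {gen Ga, gen Gb, gen Gc, gen Gd}" by (cases g) auto
    then show ?case using gen g by blast
  qed (use x in blast)+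
qed

end

locale qsl2_dual = qsl2 K p q p' q' + D: qsl2 K q' p' q p
  for K :: "('k, 'x) ring_scheme" (structure) and p q p' q' :: 'k
begin

abbreviation "A' \<equiv> D.A"
abbreviation "R \<equiv> env_alg K A"
abbreviation "R' \<equiv> env_alg K A'"

text \<open>Exchanging a with d and b with c turns b a = q a b into c d = q d c, so the first
  parameter of the target must be q^{-1}; in the same way c a = p a c forces the second one to be
  p^{-1}.\<close>

definition iota :: "(sl2_gen list \<Rightarrow> 'k) set \<Rightarrow> (sl2_gen list \<Rightarrow> 'k) set" where
  "iota = (SOME h. h \<in> alg_hom K A A' \<and> h (gen Ga) = D.gen Gd \<and> h (gen Gb) = D.gen Gc \<and>
    h (gen Gc) = D.gen Gb \<and> h (gen Gd) = D.gen Ga)"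

definition iota' :: "(sl2_gen list \<Rightarrow> 'k) set \<Rightarrow> (sl2_gen list \<Rightarrow> 'k) set" where
  "iota' = (SOME h. h \<in> alg_hom K A' A \<and> h (D.gen Ga) = gen Gd \<and> h (D.gen Gb) = gen Gc \<and>
    h (D.gen Gc) = gen Gb \<and> h (D.gen Gd) = gen Ga)"

lemma swap_simps: "q \<otimes> q' = \<one>" "p \<otimes> p' = \<one>" "q' \<otimes> q = \<one>" "p' \<otimes> p = \<one>"
  by (simp_all add: p' q' pq_inv)

lemma iota: "iota \<in> alg_hom K A A'" "iota (gen Ga) = D.gen Gd" "iota (gen Gb) = D.gen Gc"
  "iota (gen Gc) = D.gen Gb" "iota (gen Gd) = D.gen Ga"
proof -
  have "sl2_tuple K p q A' (\<lambda>g. D.gen (case g of Ga \<Rightarrow> Gd | Gb \<Rightarrow> Gc | Gc \<Rightarrow> Gb | Gd \<Rightarrow> Ga))"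
    by (rule tupleI) (simp_all add: D.A_rels D.A.smult_assoc1[symmetric] swap_simps)
  from A_lift[OF D.A.assoc_algebra_axioms this]
  have "\<exists>h. h \<in> alg_hom K A A' \<and> h (gen Ga) = D.gen Gd \<and> h (gen Gb) = D.gen Gc \<and>
    h (gen Gc) = D.gen Gb \<and> h (gen Gd) = D.gen Ga" by auto
  from someI_ex[OF this, folded iota_def]
  show "iota \<in> alg_hom K A A'" "iota (gen Ga) = D.gen Gd" "iota (gen Gb) = D.gen Gc"
    "iota (gen Gc) = D.gen Gb" "iota (gen Gd) = D.gen Ga" by blast+
qed

lemma iota': "iota' \<in> alg_hom K A' A" "iota' (D.gen Ga) = gen Gd" "iota' (D.gen Gb) = gen Gc"
  "iota' (D.gen Gc) = gen Gb" "iota' (D.gen Gd) = gen Ga"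
proof -
  have "sl2_tuple K q' p' A (\<lambda>g. gen (case g of Ga \<Rightarrow> Gd | Gb \<Rightarrow> Gc | Gc \<Rightarrow> Gb | Gd \<Rightarrow> Ga))"
    by (rule D.tupleI) (simp_all add: A_rels A.smult_assoc1[symmetric] swap_simps)
  from D.A_lift[OF A.assoc_algebra_axioms this]
  have "\<exists>h. h \<in> alg_hom K A' A \<and> h (D.gen Ga) = gen Gd \<and> h (D.gen Gb) = gen Gc \<and>
    h (D.gen Gc) = gen Gb \<and> h (D.gen Gd) = gen Ga" by auto
  from someI_ex[OF this, folded iota'_def]
  show "iota' \<in> alg_hom K A' A" "iota' (D.gen Ga) = gen Gd" "iota' (D.gen Gb) = gen Gc"
    "iota' (D.gen Gc) = gen Gb" "iota' (D.gen Gd) = gen Ga" by blast+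
qed

lemma iota_inv: "x \<in> carrier A \<Longrightarrow> iota' (iota x) = x" "y \<in> carrier A' \<Longrightarrow> iota (iota' y) = y"
  by (rule L.A_hom_unique[OF A.assoc_algebra_axioms alg_hom_comp[OF iota(1) iota'(1)] alg_hom_id];
      simp add: iota iota')
    (rule D.L.A_hom_unique[OF D.A.assoc_algebra_axioms alg_hom_comp[OF iota'(1) iota(1)] alg_hom_id];
      simp add: iota iota')

section \<open>The torus twist and the anti-isomorphism of enveloping algebras\<close>

definition "nak = L.tor (p' \<otimes> q') (p \<otimes> q) \<one> \<one>"
definition "nak' = L.tor (p \<otimes> q) (p' \<otimes> q') \<one> \<one>"
text \<open>The twist by \<open>nak'\<close> is forced. The last edge \<open>x3\<close> involves p q
  a \<otimes> d, which should become a \<otimes> d, with coefficient 1, in the annihilator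
  generators for the dual parameters; \<open>kap\<close> sends d to (p q)^{-1} times the dual a and
  cancels the factor.\<close>

definition "kap x = iota (nak' x)"
definition "kap' y = nak (iota' y)"

lemma weights_nak: "L.weights (p' \<otimes> q') (p \<otimes> q) \<one> \<one>" "L.weights (p \<otimes> q) (p' \<otimes> q') \<one> \<one>"
proof -
  have "(p \<otimes> q) \<otimes> (p' \<otimes> q') = (p \<otimes> p') \<otimes> (q \<otimes> q')" by (simp add: K.m_ac)
  then have 1: "(p \<otimes> q) \<otimes> (p' \<otimes> q') = \<one>" by (simp add: swap_simps)
  then have "(p' \<otimes> q') \<otimes> (p \<otimes> q) = \<one>" using K.m_comm by simp
  with 1 show "L.weights (p' \<otimes> q') (p \<otimes> q) \<one> \<one>" "L.weights (p \<otimes> q) (p' \<otimes> q') \<one> \<one>"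
    by (simp_all add: L.weights_def)
qed

lemmas nak = L.tor[OF weights_nak(1), folded nak_def]
lemmas nak' = L.tor[OF weights_nak(2), folded nak'_def]

lemma nak_inv: "x \<in> carrier A \<Longrightarrow> nak (nak' x) = x" "x \<in> carrier A \<Longrightarrow> nak' (nak x) = x"
  using L.tor_inv weights_nak by (auto simp: nak_def nak'_def)

lemma kap: "kap \<in> alg_hom K A A'" "kap' \<in> alg_hom K A' A"
  unfolding kap_def[abs_def] kap'_def[abs_def]
  by (rule alg_hom_comp[OF nak'(1) iota(1)] alg_hom_comp[OF iota'(1) nak(1)])+

lemmas iotah = alg_homD[OF iota(1)]
lemmas iotah' = alg_homD[OF iota'(1)]
lemmas kaph = alg_homD[OF kap(1)]
lemmas kaph' = alg_homD[OF kap(2)]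

lemma kap_inv: "x \<in> carrier A \<Longrightarrow> kap' (kap x) = x" "y \<in> carrier A' \<Longrightarrow> kap (kap' y) = y"
  by (simp_all add: kap_def kap'_def iota_inv nak_inv alg_homD(1)[OF nak'(1)] alg_homD(1)[OF iota'(1)])

lemma kap_iota: "x \<in> carrier A \<Longrightarrow> kap' (iota x) = nak x"
  by (simp add: kap'_def iota_inv)

lemma kap_vals: "kap (gen Ga) = (p \<otimes> q) \<odot>\<^bsub>A'\<^esub> D.gen Gd" "kap (gen Gb) = D.gen Gc"
  "kap (gen Gc) = D.gen Gb" "kap (gen Gd) = (p' \<otimes> q') \<odot>\<^bsub>A'\<^esub> D.gen Ga"
  by (simp_all add: kap_def nak' iotah iota)

text \<open>\<open>Th\<close> is an anti-isomorphism from $A^e$ to the enveloping algebra for the parameters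
  $q^{-1}, p^{-1}$. It turns the transposed complex into the complex \<open>koszul\<close> for these parameters,
  up to units.\<close>

definition Th :: "('k, (sl2_gen list \<Rightarrow> 'k) set) env \<Rightarrow> ('k, (sl2_gen list \<Rightarrow> 'k) set) env" where
  "Th = (SOME h. h \<in> alg_hom K R (op_alg R') \<and>
    (\<forall>x\<in>carrier A. \<forall>y\<in>carrier A. h (L.et x y) = D.L.et (kap y) (iota x)))"

definition Th' :: "('k, (sl2_gen list \<Rightarrow> 'k) set) env \<Rightarrow> ('k, (sl2_gen list \<Rightarrow> 'k) set) env" where
  "Th' = (SOME h. h \<in> alg_hom K R' (op_alg R) \<and>
    (\<forall>x\<in>carrier A'. \<forall>y\<in>carrier A'. h (D.L.et x y) = L.et (iota' y) (kap' x)))"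

lemma op_hom: "h \<in> alg_hom K B C \<Longrightarrow> h \<in> alg_hom K (op_alg B) (op_alg C)"
  by (auto simp: alg_hom_def ring_hom_def)

lemma op_hom': "h \<in> alg_hom K B (op_alg C) \<Longrightarrow> h \<in> alg_hom K (op_alg B) C"
  by (auto simp: alg_hom_def ring_hom_def)

lemma op_op: "h \<in> alg_hom K (op_alg B) C \<Longrightarrow> h \<in> alg_hom K B (op_alg C)"
  by (auto simp: alg_hom_def ring_hom_def)

lemma Th: "Th \<in> alg_hom K R (op_alg R')"
  "\<And>x y. x \<in> carrier A \<Longrightarrow> y \<in> carrier A \<Longrightarrow> Th (L.et x y) = D.L.et (kap y) (iota x)"
proof -
  have f: "(\<lambda>x. D.L.et \<one>\<^bsub>A'\<^esub> (iota x)) \<in> alg_hom K A (op_alg R')"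
    by (rule op_op, rule alg_hom_comp[OF op_hom[OF iota(1)] D.L.et_right_hom])
  have g: "(\<lambda>y. D.L.et (kap y) \<one>\<^bsub>A'\<^esub>) \<in> alg_hom K (op_alg A) (op_alg R')"
    by (rule op_hom, rule alg_hom_comp[OF kap(1) D.L.et_left_hom])
  have "\<exists>h\<in>alg_hom K R (op_alg R'). \<forall>x\<in>carrier A. \<forall>y\<in>carrier A.
      h (L.et x y) = D.L.et \<one>\<^bsub>A'\<^esub> (iota x) \<otimes>\<^bsub>op_alg R'\<^esub> D.L.et (kap y) \<one>\<^bsub>A'\<^esub>"
    by (rule L.R_lift[OF assoc_algebra_op[OF D.L.R.assoc_algebra_axioms] f g])
      (simp add: D.L.et_mult iotah kaph)
  then have "\<exists>h. h \<in> alg_hom K R (op_alg R') \<and>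
    (\<forall>x\<in>carrier A. \<forall>y\<in>carrier A. h (L.et x y) = D.L.et (kap y) (iota x))"
    by (auto simp: D.L.et_mult iotah kaph)
  from someI_ex[OF this, folded Th_def]
  show "Th \<in> alg_hom K R (op_alg R')"
    "\<And>x y. x \<in> carrier A \<Longrightarrow> y \<in> carrier A \<Longrightarrow> Th (L.et x y) = D.L.et (kap y) (iota x)" by blast+
qed

lemma Th': "Th' \<in> alg_hom K R' (op_alg R)"
  "\<And>x y. x \<in> carrier A' \<Longrightarrow> y \<in> carrier A' \<Longrightarrow> Th' (D.L.et x y) = L.et (iota' y) (kap' x)"
proof -
  have f: "(\<lambda>x. L.et \<one>\<^bsub>A\<^esub> (kap' x)) \<in> alg_hom K A' (op_alg R)"
    by (rule op_op, rule alg_hom_comp[OF op_hom[OF kap(2)] L.et_right_hom])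
  have g: "(\<lambda>y. L.et (iota' y) \<one>\<^bsub>A\<^esub>) \<in> alg_hom K (op_alg A') (op_alg R)"
    by (rule op_hom, rule alg_hom_comp[OF iota'(1) L.et_left_hom])
  have "\<exists>h\<in>alg_hom K R' (op_alg R). \<forall>x\<in>carrier A'. \<forall>y\<in>carrier A'.
      h (D.L.et x y) = L.et \<one>\<^bsub>A\<^esub> (kap' x) \<otimes>\<^bsub>op_alg R\<^esub> L.et (iota' y) \<one>\<^bsub>A\<^esub>"
    by (rule D.L.R_lift[OF assoc_algebra_op[OF L.R.assoc_algebra_axioms] f g])
      (simp add: L.et_mult iotah' kaph')
  then have "\<exists>h. h \<in> alg_hom K R' (op_alg R) \<and>
    (\<forall>x\<in>carrier A'. \<forall>y\<in>carrier A'. h (D.L.et x y) = L.et (iota' y) (kap' x))"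
    by (auto simp: L.et_mult iotah' kaph')
  from someI_ex[OF this, folded Th'_def]
  show "Th' \<in> alg_hom K R' (op_alg R)"
    "\<And>x y. x \<in> carrier A' \<Longrightarrow> y \<in> carrier A' \<Longrightarrow> Th' (D.L.et x y) = L.et (iota' y) (kap' x)" by blast+
qed

lemma Th_props:
  "r \<in> carrier R \<Longrightarrow> Th r \<in> carrier R'"
  "r \<in> carrier R \<Longrightarrow> s \<in> carrier R \<Longrightarrow> Th (r \<otimes>\<^bsub>R\<^esub> s) = Th s \<otimes>\<^bsub>R'\<^esub> Th r"
  "r \<in> carrier R \<Longrightarrow> s \<in> carrier R \<Longrightarrow> Th (r \<oplus>\<^bsub>R\<^esub> s) = Th r \<oplus>\<^bsub>R'\<^esub> Th s"
  "Th \<one>\<^bsub>R\<^esub> = \<one>\<^bsub>R'\<^esub>"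
  "c \<in> carrier K \<Longrightarrow> r \<in> carrier R \<Longrightarrow> Th (c \<odot>\<^bsub>R\<^esub> r) = c \<odot>\<^bsub>R'\<^esub> Th r"
  "Th \<zero>\<^bsub>R\<^esub> = \<zero>\<^bsub>R'\<^esub>"
  "r \<in> carrier R \<Longrightarrow> s \<in> carrier R \<Longrightarrow> Th (r \<ominus>\<^bsub>R\<^esub> s) = Th r \<ominus>\<^bsub>R'\<^esub> Th s"
proof -
  interpret O: assoc_algebra K "op_alg R'" by (rule assoc_algebra_op[OF D.L.R.assoc_algebra_axioms])
  show Z: "Th \<zero>\<^bsub>R\<^esub> = \<zero>\<^bsub>R'\<^esub>"
    using alg_hom_zero[OF L.R.ring_A O.ring_A Th(1)] by simp
  show c: "\<And>r. r \<in> carrier R \<Longrightarrow> Th r \<in> carrier R'" using alg_homD(1)[OF Th(1)] by simp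
  show add: "\<And>r s. r \<in> carrier R \<Longrightarrow> s \<in> carrier R \<Longrightarrow> Th (r \<oplus>\<^bsub>R\<^esub> s) = Th r \<oplus>\<^bsub>R'\<^esub> Th s"
    using alg_homD(3)[OF Th(1)] by simp
  show "Th (r \<ominus>\<^bsub>R\<^esub> s) = Th r \<ominus>\<^bsub>R'\<^esub> Th s" if "r \<in> carrier R" "s \<in> carrier R"
  proof -
    have "Th (\<ominus>\<^bsub>R\<^esub> s) \<oplus>\<^bsub>R'\<^esub> Th s = \<zero>\<^bsub>R'\<^esub>"
      using that add[of "\<ominus>\<^bsub>R\<^esub> s" s] Z by (simp add: L.R.M.l_neg)
    then have "Th (\<ominus>\<^bsub>R\<^esub> s) = \<ominus>\<^bsub>R'\<^esub> Th s"
      using that c D.L.R.minus_equality[of "Th (\<ominus>\<^bsub>R\<^esub> s)" "Th s"] by simp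
    then show ?thesis using that add by (simp add: a_minus_def)
  qed
qed (use alg_homD[OF Th(1)] in auto)

lemma Th'_props:
  "r \<in> carrier R' \<Longrightarrow> Th' r \<in> carrier R"
  "r \<in> carrier R' \<Longrightarrow> s \<in> carrier R' \<Longrightarrow> Th' (r \<otimes>\<^bsub>R'\<^esub> s) = Th' s \<otimes>\<^bsub>R\<^esub> Th' r"
  "r \<in> carrier R' \<Longrightarrow> s \<in> carrier R' \<Longrightarrow> Th' (r \<oplus>\<^bsub>R'\<^esub> s) = Th' r \<oplus>\<^bsub>R\<^esub> Th' s"
  "Th' \<zero>\<^bsub>R'\<^esub> = \<zero>\<^bsub>R\<^esub>"
proof -
  interpret O: assoc_algebra K "op_alg R" by (rule assoc_algebra_op[OF L.R.assoc_algebra_axioms])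
  show "Th' \<zero>\<^bsub>R'\<^esub> = \<zero>\<^bsub>R\<^esub>"
    using alg_hom_zero[OF D.L.R.ring_A O.ring_A Th'(1)] by simp
qed (use alg_homD[OF Th'(1)] in auto)

lemma Th_inv: "r \<in> carrier R \<Longrightarrow> Th' (Th r) = r" "s \<in> carrier R' \<Longrightarrow> Th (Th' s) = s"
proof -
  show "r \<in> carrier R \<Longrightarrow> Th' (Th r) = r"
    by (rule L.R_hom_unique[OF L.R.assoc_algebra_axioms alg_hom_comp[OF Th(1) op_hom'[OF Th'(1)]] alg_hom_id])
      (simp_all add: Th Th' iotah kaph iota_inv kap_inv)
  show "s \<in> carrier R' \<Longrightarrow> Th (Th' s) = s"
    by (rule D.L.R_hom_unique[OF D.L.R.assoc_algebra_axioms alg_hom_comp[OF Th'(1) op_hom'[OF Th(1)]] alg_hom_id])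
      (simp_all add: Th Th' iotah' kaph' iota_inv kap_inv)
qed

lemma K_cancel:
  "x \<in> carrier K \<Longrightarrow> p' \<otimes> (p \<otimes> x) = x"
  "x \<in> carrier K \<Longrightarrow> q \<otimes> (q' \<otimes> x) = x" "x \<in> carrier K \<Longrightarrow> q' \<otimes> (q \<otimes> x) = x"
  by (simp_all add: K.m_assoc[symmetric] swap_simps)

text \<open>Exchanging the tensor factors interchanges elements of type Y and Z. The weight of
  \<open>kap\<close> at d gives the inner scalar p', which is that of Y for the dual
  parameters.\<close>

lemma Th_Zn: "Th (L.vZ q') = (\<ominus> q') \<odot>\<^bsub>R'\<^esub> D.L.vY p'"
  by (simp add: L.vZ_def D.L.vY_def Th_props Th iotah iota kap_vals D.L.et_smult D.L.R.smult_r_distr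
      D.L.R.smult_assoc1[symmetric] K.l_minus K.r_minus K.m_ac swap_simps K_cancel D.L.R.M.a_ac)

lemma Th_Zl: "Th (L.vZ p') = (\<ominus> p') \<odot>\<^bsub>R'\<^esub> D.L.vY q'"
  by (simp add: L.vZ_def D.L.vY_def Th_props Th iotah iota kap_vals D.L.et_smult D.L.R.smult_r_distr
      D.L.R.smult_assoc1[symmetric] K.l_minus K.r_minus K.m_ac swap_simps K_cancel D.L.R.M.a_ac)

lemma Th_Yk: "Th (L.vY p) = (\<ominus> p) \<odot>\<^bsub>R'\<^esub> D.L.vZ q"
  by (simp add: L.vY_def D.L.vZ_def Th_props Th iotah iota kap_vals D.L.et_smult D.L.R.smult_r_distr
      D.L.R.smult_assoc1[symmetric] K.l_minus K.r_minus K.m_ac swap_simps K_cancel D.L.R.M.a_ac)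

lemma Th_X3: "Th (L.vX (p \<otimes> q) q) = D.L.vX \<one> q"
  by (simp add: L.vX_def D.L.vX_def Th_props Th iotah iota kap_vals D.L.et_smult D.L.R.smult_r_distr
      D.L.R.smult_assoc1[symmetric] K.l_minus K.r_minus K.m_ac swap_simps K_cancel D.L.R.M.a_ac)

lemma pull_Th: "u \<in> carrier R' \<Longrightarrow> v \<in> carrier R \<Longrightarrow> u \<otimes>\<^bsub>R'\<^esub> Th v = Th (v \<otimes>\<^bsub>R\<^esub> Th' u)"
  by (simp add: Th_props Th'_props Th_inv)

lemma Th_eq_iff: "r \<in> carrier R \<Longrightarrow> s \<in> carrier R \<Longrightarrow> Th r = Th s \<longleftrightarrow> r = s"
  using Th_inv(1) by metis

lemma unit_pull:
  assumes "c \<in> carrier K" "c' \<in> carrier K" "c' \<otimes> c = \<one>" "u \<in> carrier R'" "v \<in> carrier R'" "w \<in> carrier R'"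
    and "w = c \<odot>\<^bsub>R'\<^esub> v"
  shows "u \<otimes>\<^bsub>R'\<^esub> w = (c \<odot>\<^bsub>R'\<^esub> u) \<otimes>\<^bsub>R'\<^esub> v" "u \<otimes>\<^bsub>R'\<^esub> v = (c' \<odot>\<^bsub>R'\<^esub> u) \<otimes>\<^bsub>R'\<^esub> w"
    "c \<odot>\<^bsub>R'\<^esub> u = \<zero>\<^bsub>R'\<^esub> \<Longrightarrow> u = \<zero>\<^bsub>R'\<^esub>" "c' \<odot>\<^bsub>R'\<^esub> (c \<odot>\<^bsub>R'\<^esub> u) = u"
proof -
  have "c \<otimes> c' = \<one>" using assms(1-3) K.m_comm by simp
  then show "u \<otimes>\<^bsub>R'\<^esub> w = (c \<odot>\<^bsub>R'\<^esub> u) \<otimes>\<^bsub>R'\<^esub> v" "u \<otimes>\<^bsub>R'\<^esub> v = (c' \<odot>\<^bsub>R'\<^esub> u) \<otimes>\<^bsub>R'\<^esub> w"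
    using assms by (simp_all add: D.L.R.smult_mult_left[symmetric] D.L.R.smult_mult_right[symmetric]
      D.L.R.smult_assoc1[symmetric])
  show 1: "c' \<odot>\<^bsub>R'\<^esub> (c \<odot>\<^bsub>R'\<^esub> u) = u" using assms by (simp add: D.L.R.smult_assoc1[symmetric])
  show "u = \<zero>\<^bsub>R'\<^esub>" if "c \<odot>\<^bsub>R'\<^esub> u = \<zero>\<^bsub>R'\<^esub>" using 1 that assms by simp
qed

lemma neg_units: "(\<ominus> q) \<otimes> (\<ominus> q') = \<one>" "(\<ominus> p) \<otimes> (\<ominus> p') = \<one>" "(\<ominus> p') \<otimes> (\<ominus> p) = \<one>"
  by (simp_all add: K.l_minus K.r_minus swap_simps)

lemma Zn_zero: "u \<in> carrier R' \<Longrightarrow> u \<otimes>\<^bsub>R'\<^esub> Th (L.vZ q') = \<zero>\<^bsub>R'\<^esub> \<Longrightarrow> u = \<zero>\<^bsub>R'\<^esub>"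
  using unit_pull[OF _ _ neg_units(1) _ _ _ Th_Zn, of u] D.L.regular_Y[of "(\<ominus> q') \<odot>\<^bsub>R'\<^esub> u"]
  by (simp add: Th_props)

lemma Zl_zero: "u \<in> carrier R' \<Longrightarrow> u \<otimes>\<^bsub>R'\<^esub> Th (L.vZ p') = \<zero>\<^bsub>R'\<^esub> \<Longrightarrow> u = \<zero>\<^bsub>R'\<^esub>"
  using unit_pull[OF _ _ neg_units(2) _ _ _ Th_Zl, of u] D.L.regular_Y'[of "(\<ominus> p') \<odot>\<^bsub>R'\<^esub> u"]
  by (simp add: Th_props)

text \<open>Through \<open>Th\<close> this is \<open>regular_Z\<close> for the dual parameters:
  \<open>vY p\<close> becomes the dual Z, \<open>vZ q'\<close> the dual Y and \<open>vZ p'\<close>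
  the dual of \<open>vY k\<close>, each up to a unit.\<close>

lemma dual_reg_z:
  assumes "u \<in> carrier R'" "v \<in> carrier R'" "u \<otimes>\<^bsub>R'\<^esub> Th (L.vY p) = v \<otimes>\<^bsub>R'\<^esub> Th (L.vZ q')"
  shows "\<exists>t\<in>carrier R'. u = t \<otimes>\<^bsub>R'\<^esub> Th (L.vZ p')"
proof -
  have "((\<ominus> p) \<odot>\<^bsub>R'\<^esub> u) \<otimes>\<^bsub>R'\<^esub> D.L.vZ q = ((\<ominus> q') \<odot>\<^bsub>R'\<^esub> v) \<otimes>\<^bsub>R'\<^esub> D.L.vY p'"
    using assms unit_pull(1)[OF _ _ neg_units(3) _ _ _ Th_Yk, of u] unit_pull(1)[OF _ _ neg_units(1) _ _ _ Th_Zn, of v]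
    by (simp add: Th_props)
  then obtain t where t: "t \<in> carrier R'" "(\<ominus> p) \<odot>\<^bsub>R'\<^esub> u = t \<otimes>\<^bsub>R'\<^esub> D.L.vY q'"
    using D.L.regular_Z[of "(\<ominus> p) \<odot>\<^bsub>R'\<^esub> u" "(\<ominus> q') \<odot>\<^bsub>R'\<^esub> v"] assms by auto
  have "u = (\<ominus> p') \<odot>\<^bsub>R'\<^esub> ((\<ominus> p) \<odot>\<^bsub>R'\<^esub> u)"
    using assms by (simp add: D.L.R.smult_assoc1[symmetric] neg_units)
  also have "\<dots> = (\<ominus> p') \<odot>\<^bsub>R'\<^esub> (((\<ominus> p) \<odot>\<^bsub>R'\<^esub> t) \<otimes>\<^bsub>R'\<^esub> Th (L.vZ p'))"
    using t unit_pull(2)[OF _ _ neg_units(2) _ _ _ Th_Zl, of t] by (simp add: Th_props)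
  also have "\<dots> = t \<otimes>\<^bsub>R'\<^esub> Th (L.vZ p')"
    using t by (simp add: D.L.R.smult_mult_left D.L.R.smult_assoc1[symmetric] neg_units Th_props)
  finally show ?thesis using t by blast
qed

lemma dual_reg_x:
  assumes "u \<in> carrier R'" "v \<in> carrier R'" "w \<in> carrier R'"
    and "u \<otimes>\<^bsub>R'\<^esub> Th L.x3 = v \<otimes>\<^bsub>R'\<^esub> Th (L.vZ q') \<oplus>\<^bsub>R'\<^esub> w \<otimes>\<^bsub>R'\<^esub> Th (L.vY p)"
  shows "\<exists>v\<in>carrier R'. \<exists>w\<in>carrier R'. u = v \<otimes>\<^bsub>R'\<^esub> Th (L.vZ q') \<oplus>\<^bsub>R'\<^esub> w \<otimes>\<^bsub>R'\<^esub> Th (L.vY p)"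
proof -
  have "u \<otimes>\<^bsub>R'\<^esub> D.L.x0 = ((\<ominus> q') \<odot>\<^bsub>R'\<^esub> v) \<otimes>\<^bsub>R'\<^esub> D.L.vY p' \<oplus>\<^bsub>R'\<^esub> ((\<ominus> p) \<odot>\<^bsub>R'\<^esub> w) \<otimes>\<^bsub>R'\<^esub> D.L.vZ q"
    using assms unit_pull(1)[OF _ _ neg_units(3) _ _ _ Th_Yk, of w] unit_pull(1)[OF _ _ neg_units(1) _ _ _ Th_Zn, of v]
    by (simp add: Th_props Th_X3)
  then obtain s t where st: "s \<in> carrier R'" "t \<in> carrier R'"
    "u = s \<otimes>\<^bsub>R'\<^esub> D.L.vY p' \<oplus>\<^bsub>R'\<^esub> t \<otimes>\<^bsub>R'\<^esub> D.L.vZ q"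
    using D.L.regular_X[of u "(\<ominus> q') \<odot>\<^bsub>R'\<^esub> v" "(\<ominus> p) \<odot>\<^bsub>R'\<^esub> w"] assms(1-3) by auto
  then have "u = ((\<ominus> q) \<odot>\<^bsub>R'\<^esub> s) \<otimes>\<^bsub>R'\<^esub> Th (L.vZ q') \<oplus>\<^bsub>R'\<^esub> ((\<ominus> p') \<odot>\<^bsub>R'\<^esub> t) \<otimes>\<^bsub>R'\<^esub> Th (L.vY p)"
    using unit_pull(2)[OF _ _ neg_units(3) _ _ _ Th_Yk, of t] unit_pull(2)[OF _ _ neg_units(1) _ _ _ Th_Zn, of s]
    by (simp add: Th_props)
  moreover have "(\<ominus> q) \<odot>\<^bsub>R'\<^esub> s \<in> carrier R'" "(\<ominus> p') \<odot>\<^bsub>R'\<^esub> t \<in> carrier R'" using st by simp_all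
  ultimately show ?thesis by blast
qed

text \<open>Dualising reads the cube from its far corner over the opposite ring: \<open>x3\<close>
  and \<open>x0\<close> change places, and the edges of type Z take over the role of those of type
  Y. The faces are the old ones reversed; the regularity conditions are those of the dual parameters
  pulled back by \<open>Th\<close>.\<close>

sublocale Op: koszul "op_alg R" L.x3 L.x1 L.x2 L.x0 "L.vZ q'" "L.vZ p'" "L.vY p" "L.vY q"
proof (rule koszul.intro, rule assoc_algebra.ring_A[OF assoc_algebra_op[OF L.R.assoc_algebra_axioms]],
    rule koszul_axioms.intro)
  fix r s t assume "r \<in> carrier (op_alg R)"
  then have r: "r \<in> carrier R" by simp
  show "r = \<zero>\<^bsub>op_alg R\<^esub>" if e: "r \<otimes>\<^bsub>op_alg R\<^esub> L.vZ q' = \<zero>\<^bsub>op_alg R\<^esub>"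
    using r arg_cong[OF e, of Th] Zn_zero[of "Th r"] Th_eq_iff[of r "\<zero>\<^bsub>R\<^esub>"] by (simp add: Th_props)
  show "r = \<zero>\<^bsub>op_alg R\<^esub>" if e: "r \<otimes>\<^bsub>op_alg R\<^esub> L.vZ p' = \<zero>\<^bsub>op_alg R\<^esub>"
    using r arg_cong[OF e, of Th] Zl_zero[of "Th r"] Th_eq_iff[of r "\<zero>\<^bsub>R\<^esub>"] by (simp add: Th_props)
  assume "s \<in> carrier (op_alg R)"
  then have s: "s \<in> carrier R" by simp
  show "\<exists>t\<in>carrier (op_alg R). r = t \<otimes>\<^bsub>op_alg R\<^esub> L.vZ p'"
    if e: "r \<otimes>\<^bsub>op_alg R\<^esub> L.vY p = s \<otimes>\<^bsub>op_alg R\<^esub> L.vZ q'"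
  proof -
    obtain t where t: "t \<in> carrier R'" "Th r = t \<otimes>\<^bsub>R'\<^esub> Th (L.vZ p')"
      using dual_reg_z[of "Th r" "Th s"] arg_cong[OF e, of Th] r s by (auto simp: Th_props)
    then have "r = L.vZ p' \<otimes>\<^bsub>R\<^esub> Th' t"
      using r by (simp add: pull_Th Th_eq_iff Th'_props)
    then show ?thesis using t by (intro bexI[of _ "Th' t"]) (auto simp: Th'_props)
  qed
  assume "t \<in> carrier (op_alg R)"
  then have t: "t \<in> carrier R" by simp
  show "\<exists>s\<in>carrier (op_alg R). \<exists>t\<in>carrier (op_alg R).
      r = s \<otimes>\<^bsub>op_alg R\<^esub> L.vZ q' \<oplus>\<^bsub>op_alg R\<^esub> t \<otimes>\<^bsub>op_alg R\<^esub> L.vY p"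
    if e: "r \<otimes>\<^bsub>op_alg R\<^esub> L.x3 = s \<otimes>\<^bsub>op_alg R\<^esub> L.vZ q' \<oplus>\<^bsub>op_alg R\<^esub> t \<otimes>\<^bsub>op_alg R\<^esub> L.vY p"
  proof -
    have x3: "L.x3 \<in> carrier R" by simp
    obtain v w where vw: "v \<in> carrier R'" "w \<in> carrier R'"
      "Th r = v \<otimes>\<^bsub>R'\<^esub> Th (L.vZ q') \<oplus>\<^bsub>R'\<^esub> w \<otimes>\<^bsub>R'\<^esub> Th (L.vY p)"
      using dual_reg_x[of "Th r" "Th s" "Th t"] arg_cong[OF e, of Th] r s t x3
      by (auto simp: Th_props(1-3) simp del: L.el)
    then have "Th r = Th (L.vZ q' \<otimes>\<^bsub>R\<^esub> Th' v \<oplus>\<^bsub>R\<^esub> L.vY p \<otimes>\<^bsub>R\<^esub> Th' w)"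
      by (simp add: pull_Th Th_props(3) Th'_props)
    then have "r = L.vZ q' \<otimes>\<^bsub>R\<^esub> Th' v \<oplus>\<^bsub>R\<^esub> L.vY p \<otimes>\<^bsub>R\<^esub> Th' w"
      using r vw by (simp add: Th_eq_iff Th'_props)
    then show ?thesis using vw by (intro bexI[of _ "Th' v"] bexI[of _ "Th' w"]) (auto simp: Th'_props)
  qed
qed (use L.commutations in simp_all)

text \<open>The top cohomology of the dual complex: the quotient of $A^e$ by the right ideal generated by
  \<open>x3\<close>, \<open>vZ q'\<close> and \<open>vY p\<close>, identified with \<open>A\<close>.\<close>

definition nu :: "('k, (sl2_gen list \<Rightarrow> 'k) set) env \<Rightarrow> (sl2_gen list \<Rightarrow> 'k) set" where
  "nu r = kap' (env_action K A' (Th r) \<one>\<^bsub>A'\<^esub>)"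

lemma nu_closed: "r \<in> carrier R \<Longrightarrow> nu r \<in> carrier A"
  by (simp add: nu_def kaph' Th_props D.L.env_action_closed)

lemma nu_add: "r \<in> carrier R \<Longrightarrow> s \<in> carrier R \<Longrightarrow> nu (r \<oplus>\<^bsub>R\<^esub> s) = nu r \<oplus>\<^bsub>A\<^esub> nu s"
  by (simp add: nu_def kaph' Th_props D.L.env_action_closed D.L.action_left_module)

text \<open>The origin of the Nakayama twist: the right letter y enters \<open>Th\<close> through
  \<open>kap\<close> and is restored by \<open>kap'\<close>, whereas the left letter x enters
  through \<open>iota\<close> and returns as \<open>nak x\<close>.\<close>

lemma nu_mult:
  assumes "r \<in> carrier R" "x \<in> carrier A" "y \<in> carrier A"
  shows "nu (r \<otimes>\<^bsub>R\<^esub> L.et x y) = y \<otimes>\<^bsub>A\<^esub> nu r \<otimes>\<^bsub>A\<^esub> nak x"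
  using assms by (simp add: nu_def kaph' Th_props D.L.env_action_closed D.L.action_left_module Th
      D.L.env_action_et iotah kaph kap_inv kap_iota)

lemma nu_one: "nu \<one>\<^bsub>R\<^esub> = \<one>\<^bsub>A\<^esub>"
  by (simp add: nu_def Th_props D.L.action_one kaph')

text \<open>\<open>Th\<close> reverses products, so it carries the right ideal generated by
  \<open>x3\<close>, \<open>vZ q'\<close> and \<open>vY p\<close> to the left ideal \<open>J\<close>
  of the dual parameters, which is the annihilator of 1 there.\<close>

lemma nu_kernel:
  assumes "r \<in> carrier R"
  shows "nu r = \<zero>\<^bsub>A\<^esub> \<longleftrightarrow> (\<exists>s\<in>carrier R. \<exists>t\<in>carrier R. \<exists>u\<in>carrier R.
    r = L.x3 \<otimes>\<^bsub>R\<^esub> s \<oplus>\<^bsub>R\<^esub> (L.vZ q' \<otimes>\<^bsub>R\<^esub> t \<oplus>\<^bsub>R\<^esub> L.vY p \<otimes>\<^bsub>R\<^esub> u))"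
proof
  assume "nu r = \<zero>\<^bsub>A\<^esub>"
  then have "kap (nu r) = \<zero>\<^bsub>A'\<^esub>" using alg_hom_zero[OF A.ring_A D.A.ring_A kap(1)] by simp
  then have "env_action K A' (Th r) \<one>\<^bsub>A'\<^esub> = \<zero>\<^bsub>A'\<^esub>"
    using assms by (simp add: nu_def kap_inv D.L.env_action_closed Th_props)
  then have "Th r \<in> D.L.J" using assms by (intro D.L.action_kernel_J) (simp_all add: Th_props)
  then obtain x y z where e: "x \<in> carrier R'" "y \<in> carrier R'" "z \<in> carrier R'"
    "Th r = x \<otimes>\<^bsub>R'\<^esub> D.L.x0 \<oplus>\<^bsub>R'\<^esub> (y \<otimes>\<^bsub>R'\<^esub> D.L.vY p' \<oplus>\<^bsub>R'\<^esub> z \<otimes>\<^bsub>R'\<^esub> D.L.vZ q)"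
    by (rule D.L.J_E)
  have "Th r = x \<otimes>\<^bsub>R'\<^esub> Th L.x3 \<oplus>\<^bsub>R'\<^esub> (((\<ominus> q) \<odot>\<^bsub>R'\<^esub> y) \<otimes>\<^bsub>R'\<^esub> Th (L.vZ q') \<oplus>\<^bsub>R'\<^esub>
      ((\<ominus> p') \<odot>\<^bsub>R'\<^esub> z) \<otimes>\<^bsub>R'\<^esub> Th (L.vY p))"
    using e unit_pull(2)[OF _ _ neg_units(3) _ _ _ Th_Yk, of z] unit_pull(2)[OF _ _ neg_units(1) _ _ _ Th_Zn, of y]
    by (simp add: Th_props Th_X3)
  also have "\<dots> = Th (L.x3 \<otimes>\<^bsub>R\<^esub> Th' x \<oplus>\<^bsub>R\<^esub> (L.vZ q' \<otimes>\<^bsub>R\<^esub> Th' ((\<ominus> q) \<odot>\<^bsub>R'\<^esub> y) \<oplus>\<^bsub>R\<^esub>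
      L.vY p \<otimes>\<^bsub>R\<^esub> Th' ((\<ominus> p') \<odot>\<^bsub>R'\<^esub> z)))"
    using e by (simp add: pull_Th Th_props(3) Th'_props)
  finally have "r = L.x3 \<otimes>\<^bsub>R\<^esub> Th' x \<oplus>\<^bsub>R\<^esub> (L.vZ q' \<otimes>\<^bsub>R\<^esub> Th' ((\<ominus> q) \<odot>\<^bsub>R'\<^esub> y) \<oplus>\<^bsub>R\<^esub>
      L.vY p \<otimes>\<^bsub>R\<^esub> Th' ((\<ominus> p') \<odot>\<^bsub>R'\<^esub> z))"
    using assms e by (simp add: Th_eq_iff Th'_props)
  moreover have "Th' x \<in> carrier R" "Th' ((\<ominus> q) \<odot>\<^bsub>R'\<^esub> y) \<in> carrier R" "Th' ((\<ominus> p') \<odot>\<^bsub>R'\<^esub> z) \<in> carrier R"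
    using e by (simp_all add: Th'_props)
  ultimately show "\<exists>s\<in>carrier R. \<exists>t\<in>carrier R. \<exists>u\<in>carrier R.
    r = L.x3 \<otimes>\<^bsub>R\<^esub> s \<oplus>\<^bsub>R\<^esub> (L.vZ q' \<otimes>\<^bsub>R\<^esub> t \<oplus>\<^bsub>R\<^esub> L.vY p \<otimes>\<^bsub>R\<^esub> u)" by blast
next
  assume "\<exists>s\<in>carrier R. \<exists>t\<in>carrier R. \<exists>u\<in>carrier R.
    r = L.x3 \<otimes>\<^bsub>R\<^esub> s \<oplus>\<^bsub>R\<^esub> (L.vZ q' \<otimes>\<^bsub>R\<^esub> t \<oplus>\<^bsub>R\<^esub> L.vY p \<otimes>\<^bsub>R\<^esub> u)"
  then obtain s t u where e: "s \<in> carrier R" "t \<in> carrier R" "u \<in> carrier R"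
    "r = L.x3 \<otimes>\<^bsub>R\<^esub> s \<oplus>\<^bsub>R\<^esub> (L.vZ q' \<otimes>\<^bsub>R\<^esub> t \<oplus>\<^bsub>R\<^esub> L.vY p \<otimes>\<^bsub>R\<^esub> u)" by blast
  have z: "env_action K A' w \<zero>\<^bsub>A'\<^esub> = \<zero>\<^bsub>A'\<^esub>" if "w \<in> carrier R'" for w
    using D.L.action_left_module(2)[OF that _ D.A.one_closed, of "\<zero>\<^bsub>R'\<^esub>"] that by (simp add: D.L.action_zero)
  have "env_action K A' (Th r) \<one>\<^bsub>A'\<^esub> = \<zero>\<^bsub>A'\<^esub>"
    using e D.L.generators_action by (simp add: Th_props Th_X3 Th_Zn Th_Yk D.L.action_left_module D.L.action_smult z)
  then show "nu r = \<zero>\<^bsub>A\<^esub>"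
    using alg_hom_zero[OF D.A.ring_A A.ring_A kap(2)] by (simp add: nu_def)
qed

end

section \<open>Projective modules and comparison of resolutions\<close>

lemma mod_homI:
  assumes "\<And>x. x \<in> carrier M \<Longrightarrow> f x \<in> carrier N"
    and "\<And>x y. x \<in> carrier M \<Longrightarrow> y \<in> carrier M \<Longrightarrow> f (x \<oplus>\<^bsub>M\<^esub> y) = f x \<oplus>\<^bsub>N\<^esub> f y"
    and "\<And>r x. r \<in> carrier R \<Longrightarrow> x \<in> carrier M \<Longrightarrow> f (r \<odot>\<^bsub>M\<^esub> x) = r \<odot>\<^bsub>N\<^esub> f x"
  shows "f \<in> mod_hom R M N"
  using assms by (auto simp: mod_hom_def hom_def)

lemma mod_homD:
  assumes "f \<in> mod_hom R M N"
  shows "\<And>x. x \<in> carrier M \<Longrightarrow> f x \<in> carrier N"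
    and "\<And>x y. x \<in> carrier M \<Longrightarrow> y \<in> carrier M \<Longrightarrow> f (x \<oplus>\<^bsub>M\<^esub> y) = f x \<oplus>\<^bsub>N\<^esub> f y"
    and "\<And>r x. r \<in> carrier R \<Longrightarrow> x \<in> carrier M \<Longrightarrow> f (r \<odot>\<^bsub>M\<^esub> x) = r \<odot>\<^bsub>N\<^esub> f x"
  using assms by (auto simp: mod_hom_def hom_def)

lemma mod_hom_zero:
  assumes "left_module R M" "left_module R N" "f \<in> mod_hom R M N"
  shows "f \<zero>\<^bsub>M\<^esub> = \<zero>\<^bsub>N\<^esub>"
proof -
  interpret M: left_module R M by fact
  interpret N: left_module R N by fact
  note h = mod_homD[OF assms(3)]
  have "f \<zero>\<^bsub>M\<^esub> \<oplus>\<^bsub>N\<^esub> f \<zero>\<^bsub>M\<^esub> = f \<zero>\<^bsub>M\<^esub>" using h(2)[of "\<zero>\<^bsub>M\<^esub>" "\<zero>\<^bsub>M\<^esub>"] by simp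
  then show ?thesis using h(1)[of "\<zero>\<^bsub>M\<^esub>"] N.M.add.r_cancel_one by simp
qed

lemma mod_hom_minus:
  assumes "left_module R M" "left_module R N" "f \<in> mod_hom R M N" "x \<in> carrier M"
  shows "f (\<ominus>\<^bsub>M\<^esub> x) = \<ominus>\<^bsub>N\<^esub> f x"
proof -
  interpret M: left_module R M by fact
  interpret N: left_module R N by fact
  note h = mod_homD[OF assms(3)]
  have "f (\<ominus>\<^bsub>M\<^esub> x) \<oplus>\<^bsub>N\<^esub> f x = \<zero>\<^bsub>N\<^esub>"
    using h(2)[of "\<ominus>\<^bsub>M\<^esub> x" x] assms mod_hom_zero[OF assms(1-3)] by (simp add: M.M.l_neg)
  then show ?thesis using h(1) assms(4) by (intro N.M.minus_equality[symmetric]) auto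
qed

lemma mod_hom_diff_apply:
  assumes "left_module R M" "left_module R N" "f \<in> mod_hom R M N" "x \<in> carrier M" "y \<in> carrier M"
  shows "f (x \<ominus>\<^bsub>M\<^esub> y) = f x \<ominus>\<^bsub>N\<^esub> f y"
proof -
  interpret M: left_module R M by fact
  show ?thesis using assms mod_homD[OF assms(3)] mod_hom_minus[OF assms(1-3)] by (simp add: a_minus_def)
qed

lemma mod_hom_comp:
  assumes "f \<in> mod_hom R M N" "g \<in> mod_hom R N L"
  shows "(\<lambda>x. g (f x)) \<in> mod_hom R M L"
  by (rule mod_homI) (simp_all add: mod_homD[OF assms(1)] mod_homD[OF assms(2)])

lemma mod_hom_diff:
  assumes "left_module R M" "left_module R N" "f \<in> mod_hom R M N" "g \<in> mod_hom R M N"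
  shows "(\<lambda>x. f x \<ominus>\<^bsub>N\<^esub> g x) \<in> mod_hom R M N"
proof -
  interpret M: left_module R M by fact
  interpret N: left_module R N by fact
  note f = mod_homD[OF assms(3)] and g = mod_homD[OF assms(4)]
  have sm: "r \<odot>\<^bsub>N\<^esub> (x \<ominus>\<^bsub>N\<^esub> y) = r \<odot>\<^bsub>N\<^esub> x \<ominus>\<^bsub>N\<^esub> r \<odot>\<^bsub>N\<^esub> y"
    if "r \<in> carrier R" "x \<in> carrier N" "y \<in> carrier N" for r x y
  proof -
    have m: "(\<lambda>x. r \<odot>\<^bsub>N\<^esub> x) \<in> hom (add_monoid N) (add_monoid N)"
      using that by (auto simp: hom_def N.smult_closed N.smult_r_distr)
    interpret h: abelian_group_hom N N "\<lambda>x. r \<odot>\<^bsub>N\<^esub> x"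
      by (rule abelian_group_homI[OF N.M.abelian_group_axioms N.M.abelian_group_axioms])
        (rule group_hom.intro[OF N.M.a_group N.M.a_group], simp add: group_hom_axioms_def m)
    show ?thesis using that by (simp add: a_minus_def)
  qed
  show ?thesis
    by (rule mod_homI) (simp_all add: f g sm, simp add: a_minus_def f g N.M.minus_add N.M.a_ac)
qed

lemma mod_hom_id: "(\<lambda>x. x) \<in> mod_hom R M M"
  by (rule mod_homI) auto

context ring
begin

abbreviation "Fm \<equiv> free_module R"

lemma free_carrier: "f \<in> carrier (Fm X) \<longleftrightarrow> (\<forall>i. f i \<in> carrier R) \<and> (\<forall>i. i \<notin> X \<longrightarrow> f i = \<zero>)
    \<and> finite {i. f i \<noteq> \<zero>}"
  by (simp add: free_module_def)

lemma free_simps [simp]: "\<zero>\<^bsub>Fm X\<^esub> = (\<lambda>i. \<zero>)" "f \<oplus>\<^bsub>Fm X\<^esub> g = (\<lambda>i. f i \<oplus> g i)" "r \<odot>\<^bsub>Fm X\<^esub> f = (\<lambda>i. r \<otimes> f i)"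
  by (simp_all add: free_module_def)

lemma free_add_closed: "f \<in> carrier (Fm X) \<Longrightarrow> g \<in> carrier (Fm X) \<Longrightarrow> (\<lambda>i. f i \<oplus> g i) \<in> carrier (Fm X)"
  by (auto simp: free_carrier intro: rev_finite_subset[of "{i. f i \<noteq> \<zero>} \<union> {i. g i \<noteq> \<zero>}"])

lemma free_smult_closed: "r \<in> carrier R \<Longrightarrow> f \<in> carrier (Fm X) \<Longrightarrow> (\<lambda>i. r \<otimes> f i) \<in> carrier (Fm X)"
  by (auto simp: free_carrier intro: rev_finite_subset)

lemma left_module_free: "left_module R (Fm X)"
proof -
  have "abelian_group (Fm X)"
  proof (rule abelian_groupI)
    show "\<exists>y\<in>carrier (Fm X). y \<oplus>\<^bsub>Fm X\<^esub> x = \<zero>\<^bsub>Fm X\<^esub>" if "x \<in> carrier (Fm X)" for x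
    proof (intro bexI[of _ "\<lambda>i. \<ominus> x i"])
      show "(\<lambda>i. \<ominus> x i) \<in> carrier (Fm X)" using that
        by (auto simp: free_carrier intro: rev_finite_subset)
    qed (use that in \<open>auto simp: free_carrier l_neg\<close>)
  qed (auto simp: free_add_closed, auto simp: free_carrier a_ac)
  then show ?thesis
    unfolding left_module_def left_module_axioms_def using ring_axioms
    by (auto simp: free_smult_closed) (auto simp: free_carrier l_distr r_distr m_assoc)
qed

lemma delta_free [simp]: "x \<in> X \<Longrightarrow> delta R x \<in> carrier (Fm X)"
  by (auto simp: free_carrier delta_def)

end

definition free_lin :: "('r, 'x) ring_scheme \<Rightarrow> ('r, 'n) module \<Rightarrow> ('i \<Rightarrow> 'n) \<Rightarrow> ('i \<Rightarrow> 'r) \<Rightarrow> 'n" where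
  "free_lin R N b f = (\<Oplus>\<^bsub>N\<^esub>i\<in>{i. f i \<noteq> \<zero>\<^bsub>R\<^esub>}. f i \<odot>\<^bsub>N\<^esub> b i)"

lemma left_module_zero_smult:
  assumes "left_module R N" "x \<in> carrier N"
  shows "\<zero>\<^bsub>R\<^esub> \<odot>\<^bsub>N\<^esub> x = \<zero>\<^bsub>N\<^esub>"
proof -
  interpret left_module R N by fact
  have "\<zero>\<^bsub>R\<^esub> \<odot>\<^bsub>N\<^esub> x \<oplus>\<^bsub>N\<^esub> \<zero>\<^bsub>R\<^esub> \<odot>\<^bsub>N\<^esub> x = \<zero>\<^bsub>R\<^esub> \<odot>\<^bsub>N\<^esub> x"
    using smult_l_distr[of "\<zero>\<^bsub>R\<^esub>" "\<zero>\<^bsub>R\<^esub>" x] assms by simp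
  moreover have "\<zero>\<^bsub>R\<^esub> \<odot>\<^bsub>N\<^esub> x \<in> carrier N" using assms by (simp add: smult_closed)
  ultimately show ?thesis by simp
qed

context ring
begin

lemma free_lin_superset:
  assumes "left_module R N" "f \<in> carrier (Fm X)" "b \<in> X \<rightarrow> carrier N"
    and "finite T" "{i. f i \<noteq> \<zero>} \<subseteq> T" "T \<subseteq> X"
  shows "free_lin R N b f = (\<Oplus>\<^bsub>N\<^esub>i\<in>T. f i \<odot>\<^bsub>N\<^esub> b i)"
proof -
  interpret N: left_module R N by fact
  have "b i \<in> carrier N" if "i \<in> T" for i using that assms by auto
  moreover have "f i \<in> carrier R" for i using assms(2) by (simp add: free_carrier)
  ultimately show ?thesis unfolding free_lin_def using assms(4,5)
    by (intro N.M.finsum_superset) (auto simp: N.smult_closed left_module_zero_smult[OF assms(1)])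
qed

lemma free_lin_hom:
  assumes N: "left_module R N" and b: "b \<in> X \<rightarrow> carrier N"
  shows "free_lin R N b \<in> mod_hom R (Fm X) N"
proof (rule mod_homI)
  interpret N: left_module R N by fact
  fix f g r assume f: "f \<in> carrier (Fm X)"
  have supp: "{i. f i \<noteq> \<zero>} \<subseteq> X" "finite {i. f i \<noteq> \<zero>}" if "f \<in> carrier (Fm X)" for f
    using that by (auto simp: free_carrier)
  have c: "f i \<in> carrier R" if "f \<in> carrier (Fm X)" for f i using that by (simp add: free_carrier)
  show "free_lin R N b f \<in> carrier N"
  proof -
    have "b i \<in> carrier N" if "f i \<noteq> \<zero>" for i using that b supp[OF f] by auto
    then show ?thesis
      unfolding free_lin_def using c[OF f] by (intro N.M.finsum_closed) (auto simp: N.smult_closed)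
  qed
  {
    assume g: "g \<in> carrier (Fm X)"
    define T where "T = {i. f i \<noteq> \<zero>} \<union> {i. g i \<noteq> \<zero>}"
    have T: "finite T" "T \<subseteq> X" "{i. f i \<noteq> \<zero>} \<subseteq> T" "{i. g i \<noteq> \<zero>} \<subseteq> T" "{i. f i \<oplus> g i \<noteq> \<zero>} \<subseteq> T"
      using supp f g by (auto simp: T_def)
    have bT: "b i \<in> carrier N" if "i \<in> T" for i using that b T by auto
    have "free_lin R N b (\<lambda>i. f i \<oplus> g i) = (\<Oplus>\<^bsub>N\<^esub>i\<in>T. (f i \<oplus> g i) \<odot>\<^bsub>N\<^esub> b i)"
      using T by (intro free_lin_superset[OF N free_add_closed[OF f g] b]) auto
    also have "\<dots> = (\<Oplus>\<^bsub>N\<^esub>i\<in>T. f i \<odot>\<^bsub>N\<^esub> b i \<oplus>\<^bsub>N\<^esub> g i \<odot>\<^bsub>N\<^esub> b i)"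
      using bT c f g by (intro N.M.finsum_cong') (auto simp: N.smult_l_distr N.smult_closed)
    also have "\<dots> = (\<Oplus>\<^bsub>N\<^esub>i\<in>T. f i \<odot>\<^bsub>N\<^esub> b i) \<oplus>\<^bsub>N\<^esub> (\<Oplus>\<^bsub>N\<^esub>i\<in>T. g i \<odot>\<^bsub>N\<^esub> b i)"
      using bT c f g by (intro N.M.finsum_addf) (auto simp: N.smult_closed)
    finally show "free_lin R N b (f \<oplus>\<^bsub>Fm X\<^esub> g) = free_lin R N b f \<oplus>\<^bsub>N\<^esub> free_lin R N b g"
      using T by (simp add: free_lin_superset[OF N f b, of T] free_lin_superset[OF N g b, of T])
  }
  assume r: "r \<in> carrier R"
  let ?T = "{i. f i \<noteq> \<zero>}"
  have bT: "b i \<in> carrier N" if "i \<in> ?T" for i using that b supp[OF f] by auto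
  have sum: "finite S \<Longrightarrow> S \<subseteq> ?T \<Longrightarrow> (\<Oplus>\<^bsub>N\<^esub>i\<in>S. (r \<otimes> f i) \<odot>\<^bsub>N\<^esub> b i) = r \<odot>\<^bsub>N\<^esub> (\<Oplus>\<^bsub>N\<^esub>i\<in>S. f i \<odot>\<^bsub>N\<^esub> b i)" for S
  proof (induction S rule: finite_induct)
    case empty
    have "r \<odot>\<^bsub>N\<^esub> \<zero>\<^bsub>N\<^esub> \<oplus>\<^bsub>N\<^esub> r \<odot>\<^bsub>N\<^esub> \<zero>\<^bsub>N\<^esub> = r \<odot>\<^bsub>N\<^esub> \<zero>\<^bsub>N\<^esub>"
      using N.smult_r_distr[of r "\<zero>\<^bsub>N\<^esub>" "\<zero>\<^bsub>N\<^esub>"] r by simp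
    moreover have "r \<odot>\<^bsub>N\<^esub> \<zero>\<^bsub>N\<^esub> \<in> carrier N" using r by (simp add: N.smult_closed)
    ultimately show ?case by simp
  next
    case (insert j S)
    then have "b j \<in> carrier N" "\<And>i. i \<in> S \<Longrightarrow> b i \<in> carrier N" using bT by auto
    moreover have "(\<Oplus>\<^bsub>N\<^esub>i\<in>S. f i \<odot>\<^bsub>N\<^esub> b i) \<in> carrier N"
      using calculation c[OF f] by (intro N.M.finsum_closed) (auto simp: N.smult_closed)
    ultimately show ?case using insert r c[OF f]
      by (simp add: N.M.finsum_insert Pi_iff N.smult_closed N.smult_r_distr N.smult_assoc)
  qed
  have "free_lin R N b (\<lambda>i. r \<otimes> f i) = (\<Oplus>\<^bsub>N\<^esub>i\<in>?T. (r \<otimes> f i) \<odot>\<^bsub>N\<^esub> b i)"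
    using supp[OF f] r by (intro free_lin_superset[OF N free_smult_closed[OF r f] b]) auto
  then show "free_lin R N b (r \<odot>\<^bsub>Fm X\<^esub> f) = r \<odot>\<^bsub>N\<^esub> free_lin R N b f"
    using sum[of ?T] supp[OF f] by (simp add: free_lin_def)
qed

lemma free_hom_eq:
  assumes N: "left_module R N" and h: "h \<in> mod_hom R (Fm X) N" and f: "f \<in> carrier (Fm X)"
    and b: "\<And>x. x \<in> X \<Longrightarrow> h (delta R x) = b x"
  shows "h f = free_lin R N b f"
proof -
  interpret N: left_module R N by fact
  note hh = mod_homD[OF h]
  have bc: "b x \<in> carrier N" if "x \<in> X" for x using hh(1)[OF delta_free[OF that]] b that by simp
  have "\<And>f. f \<in> carrier (Fm X) \<Longrightarrow> {i. f i \<noteq> \<zero>} \<subseteq> S \<Longrightarrow> h f = (\<Oplus>\<^bsub>N\<^esub>i\<in>S. f i \<odot>\<^bsub>N\<^esub> b i)"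
    if "finite S" "S \<subseteq> X" for S
    using that
  proof (induction S rule: finite_induct)
    case empty
    then have "f = \<zero>\<^bsub>Fm X\<^esub>" by auto
    then show ?case using mod_hom_zero[OF left_module_free N h] by simp
  next
    case (insert x S)
    define f' where "f' = f(x := \<zero>)"
    have fc: "f i \<in> carrier R" for i using insert.prems by (simp add: free_carrier)
    have f': "f' \<in> carrier (Fm X)"
      using insert.prems by (auto simp: free_carrier f'_def intro: rev_finite_subset)
    have "f = (f x \<odot>\<^bsub>Fm X\<^esub> delta R x) \<oplus>\<^bsub>Fm X\<^esub> f'"
      using fc by (auto simp: f'_def delta_def fun_eq_iff)
    moreover have "f x \<odot>\<^bsub>Fm X\<^esub> delta R x \<in> carrier (Fm X)"
      using fc insert.prems free_smult_closed[OF _ delta_free, of "f x" x X] by simp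
    ultimately have "h f = f x \<odot>\<^bsub>N\<^esub> b x \<oplus>\<^bsub>N\<^esub> h f'"
      using hh(2)[of "f x \<odot>\<^bsub>Fm X\<^esub> delta R x" f'] hh(3)[of "f x" "delta R x"] f' fc insert.prems b
      by (metis delta_free insert_subset)
    also have "h f' = (\<Oplus>\<^bsub>N\<^esub>i\<in>S. f' i \<odot>\<^bsub>N\<^esub> b i)"
    proof -
      have "{i. f' i \<noteq> \<zero>} \<subseteq> S" using insert.prems by (auto simp: f'_def)
      then show ?thesis using insert.IH[of f'] f' insert.prems by auto
    qed
    also have "\<dots> = (\<Oplus>\<^bsub>N\<^esub>i\<in>S. f i \<odot>\<^bsub>N\<^esub> b i)"
      using insert bc fc by (intro N.M.finsum_cong') (auto simp: f'_def N.smult_closed)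
    finally show ?case using insert bc fc
      by (subst N.M.finsum_insert) (auto simp: N.smult_closed)
  qed
  from this[of "{i. f i \<noteq> \<zero>}" f] show ?thesis
    using f by (auto simp: free_lin_def free_carrier)
qed

lemma free_lin_delta:
  assumes N: "left_module R N" and b: "b \<in> X \<rightarrow> carrier N" and x: "x \<in> X"
  shows "free_lin R N b (delta R x) = b x"
proof -
  interpret N: left_module R N by fact
  have "free_lin R N b (delta R x) = (\<Oplus>\<^bsub>N\<^esub>i\<in>{x}. delta R x i \<odot>\<^bsub>N\<^esub> b i)"
    by (rule free_lin_superset[OF N delta_free[OF x] b]) (use x in \<open>auto simp: delta_def\<close>)
  moreover have "b x \<in> carrier N" using b x by auto
  ultimately show ?thesis by (simp add: delta_def N.M.finsum_insert N.smult_one)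
qed

end

text \<open>Instead of surjectivity of g only the inclusion of the image of f in that of g is
  required; this is the form in which exactness of a resolution is used. Preimages are chosen on a
  basis of the free module of which P is a summand.\<close>

lemma projective_lift:
  fixes P :: "('r, 'p) module"
  assumes P: "projective_module R P" and B: "left_module R B" and C: "left_module R C"
    and g: "g \<in> mod_hom R B C" and f: "f \<in> mod_hom R P C"
    and im: "\<And>x. x \<in> carrier P \<Longrightarrow> f x \<in> g ` carrier B"
  shows "\<exists>h\<in>mod_hom R P B. \<forall>x\<in>carrier P. g (h x) = f x"
proof -
  from P obtain X :: "'p set" and s t where s: "s \<in> mod_hom R P (free_module R X)" and t: "t \<in> mod_hom R (free_module R X) P"
    and ts: "\<And>m. m \<in> carrier P \<Longrightarrow> t (s m) = m" and LP: "left_module R P"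
    unfolding projective_module_def by blast
  interpret B: left_module R B by fact
  define b where "b x = (SOME y. y \<in> carrier B \<and> g y = f (t (delta R x)))" for x
  have b: "b x \<in> carrier B" "g (b x) = f (t (delta R x))" if "x \<in> X" for x
  proof -
    have "\<exists>y. y \<in> carrier B \<and> g y = f (t (delta R x))"
      using im[OF mod_homD(1)[OF t B.R.delta_free[OF that]]] by (auto simp: image_iff eq_commute)
    from someI_ex[OF this] show "b x \<in> carrier B" "g (b x) = f (t (delta R x))" by (auto simp: b_def)
  qed
  have bl: "free_lin R B b \<in> mod_hom R (free_module R X) B"
    by (rule B.R.free_lin_hom[OF B]) (use b in auto)
  let ?c = "\<lambda>x. f (t (delta R x))"
  have "g (free_lin R B b (s x)) = f x" if x: "x \<in> carrier P" for x
  proof -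
    note sx = mod_homD(1)[OF s x]
    have "g (free_lin R B b (s x)) = free_lin R C ?c (s x)"
      by (rule B.R.free_hom_eq[OF C mod_hom_comp[OF bl g] sx])
        (use b in \<open>simp add: B.R.free_lin_delta[OF B, of b X] Pi_iff\<close>)
    also have "\<dots> = f (t (s x))"
      by (rule B.R.free_hom_eq[OF C mod_hom_comp[OF t f] sx, symmetric]) simp
    finally show ?thesis by (simp add: ts x)
  qed
  then show ?thesis
    by (intro bexI[of _ "\<lambda>x. free_lin R B b (s x)"] ballI mod_hom_comp[OF s bl]) simp
qed

section \<open>Comparison maps and homotopies between projective resolutions\<close>

locale resolution =
  fixes R :: "('r, 'x) ring_scheme" and M :: "('r, 'm) module"
    and P :: "nat \<Rightarrow> ('r, 'p) module" and d :: "nat \<Rightarrow> 'p \<Rightarrow> 'p" and e :: "'p \<Rightarrow> 'm"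
  assumes res: "projective_resolution R M (P, d, e)" and M: "left_module R M"
begin

lemma proj: "projective_module R (P i)" using res by (simp add: projective_resolution_def)
lemma lm: "left_module R (P i)" using proj by (simp add: projective_module_def)
lemma d: "d i \<in> mod_hom R (P (Suc i)) (P i)" using res by (simp add: projective_resolution_def)
lemma e: "e \<in> mod_hom R (P 0) M" using res by (simp add: projective_resolution_def)
lemma surj: "e ` carrier (P 0) = carrier M" using res by (simp add: projective_resolution_def)
lemma ex0: "d 0 ` carrier (P (Suc 0)) = {x \<in> carrier (P 0). e x = \<zero>\<^bsub>M\<^esub>}"
  using res by (simp add: projective_resolution_def)
lemma ex: "d (Suc i) ` carrier (P (Suc (Suc i))) = {x \<in> carrier (P (Suc i)). d i x = \<zero>\<^bsub>P i\<^esub>}"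
  using res by (simp add: projective_resolution_def)

lemma d_closed: "x \<in> carrier (P (Suc i)) \<Longrightarrow> d i x \<in> carrier (P i)" by (rule mod_homD(1)[OF d])
lemma dd: "x \<in> carrier (P (Suc (Suc i))) \<Longrightarrow> d i (d (Suc i) x) = \<zero>\<^bsub>P i\<^esub>" using ex by blast
lemma ed: "x \<in> carrier (P (Suc 0)) \<Longrightarrow> e (d 0 x) = \<zero>\<^bsub>M\<^esub>" using ex0 by blast

lemma ag: "abelian_group (P i)" using lm by (simp add: left_module_def)

end

text \<open>The recursion carries in \<open>?G\<close> the condition under which the next lift
  exists: the current map composed with the differential lands in the image of the next differential
  of Q, which exactness provides.\<close>

lemma comparison:
  assumes "resolution R M P d e" "resolution R M Q d' e'"
  shows "\<exists>f. (\<forall>i. f i \<in> mod_hom R (P i) (Q i)) \<and> (\<forall>x\<in>carrier (P 0). e' (f 0 x) = e x) \<and>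
    (\<forall>i. \<forall>x\<in>carrier (P (Suc i)). d' i (f (Suc i) x) = f i (d i x))"
proof -
  interpret P: resolution R M P d e by fact
  interpret Q: resolution R M Q d' e' by fact
  let ?G = "\<lambda>n \<phi>. \<phi> \<in> mod_hom R (P n) (Q n) \<and> (n = 0 \<longrightarrow> (\<forall>x\<in>carrier (P 0). e' (\<phi> x) = e x)) \<and>
    (\<forall>x\<in>carrier (P (Suc n)). \<phi> (d n x) \<in> d' n ` carrier (Q (Suc n)))"
  have "\<exists>f. \<forall>n. ?G n (f n) \<and> (\<forall>x\<in>carrier (P (Suc n)). d' n (f (Suc n) x) = f n (d n x))"
  proof (rule dependent_nat_choice)
    obtain \<phi> where \<phi>: "\<phi> \<in> mod_hom R (P 0) (Q 0)" "\<And>x. x \<in> carrier (P 0) \<Longrightarrow> e' (\<phi> x) = e x"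
      using projective_lift[OF P.proj Q.lm P.M Q.e P.e] mod_homD(1)[OF P.e] by (auto simp: Q.surj)
    have "\<phi> (d 0 x) \<in> d' 0 ` carrier (Q (Suc 0))" if "x \<in> carrier (P (Suc 0))" for x
      unfolding Q.ex0 using \<phi>(2)[OF P.d_closed[OF that]] mod_homD(1)[OF \<phi>(1) P.d_closed[OF that]]
      by (simp add: P.ed[OF that])
    with \<phi> show "\<exists>\<phi>. ?G 0 \<phi>" by blast
  next
    fix \<phi> n assume \<phi>: "?G n \<phi>"
    obtain \<psi> where \<psi>: "\<psi> \<in> mod_hom R (P (Suc n)) (Q (Suc n))"
      "\<And>x. x \<in> carrier (P (Suc n)) \<Longrightarrow> d' n (\<psi> x) = \<phi> (d n x)"
      using projective_lift[OF P.proj Q.lm Q.lm Q.d mod_hom_comp[OF P.d]] \<phi> by blast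
    have "\<psi> (d (Suc n) x) \<in> d' (Suc n) ` carrier (Q (Suc (Suc n)))" if "x \<in> carrier (P (Suc (Suc n)))" for x
      unfolding Q.ex using \<psi>(2)[OF P.d_closed[OF that]] mod_homD(1)[OF \<psi>(1) P.d_closed[OF that]]
        mod_hom_zero[OF P.lm Q.lm, of \<phi> n n] \<phi> by (simp add: P.dd[OF that])
    with \<psi> show "\<exists>\<psi>. ?G (Suc n) \<psi> \<and> (\<forall>x\<in>carrier (P (Suc n)). d' n (\<psi> x) = \<phi> (d n x))" by auto
  qed
  then show ?thesis by metis
qed

text \<open>A chain endomorphism u over the identity of M is compared with the identity: w = id - u
  is a chain map over zero, and at each stage w - h d is killed by d, hence lifts through the next
  differential.\<close>

lemma homotopy:
  assumes "resolution R M P d e" and u: "\<And>i. u i \<in> mod_hom R (P i) (P i)"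
    and u0: "\<And>x. x \<in> carrier (P 0) \<Longrightarrow> e (u 0 x) = e x"
    and ud: "\<And>i x. x \<in> carrier (P (Suc i)) \<Longrightarrow> d i (u (Suc i) x) = u i (d i x)"
  shows "\<exists>h. (\<forall>i. h i \<in> mod_hom R (P i) (P (Suc i))) \<and>
    (\<forall>x\<in>carrier (P 0). x \<ominus>\<^bsub>P 0\<^esub> u 0 x = d 0 (h 0 x)) \<and>
    (\<forall>i. \<forall>x\<in>carrier (P (Suc i)). x \<ominus>\<^bsub>P (Suc i)\<^esub> u (Suc i) x \<ominus>\<^bsub>P (Suc i)\<^esub> h i (d i x) = d (Suc i) (h (Suc i) x))"
proof -
  interpret P: resolution R M P d e by fact
  interpret G: abelian_group "P i" for i by (rule P.ag)
  note uc = mod_homD(1)[OF u]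
  define w where "w i x = x \<ominus>\<^bsub>P i\<^esub> u i x" for i x
  have w: "w i \<in> mod_hom R (P i) (P i)" for i
    unfolding w_def by (rule mod_hom_diff[OF P.lm P.lm mod_hom_id u])
  have wd: "d i (w (Suc i) x) = w i (d i x)" if "x \<in> carrier (P (Suc i))" for i x
    using that by (simp add: w_def mod_hom_diff_apply[OF P.lm P.lm P.d] uc ud)
  let ?G = "\<lambda>n \<phi>. \<phi> \<in> mod_hom R (P n) (P (Suc n)) \<and> (n = 0 \<longrightarrow> (\<forall>x\<in>carrier (P 0). w 0 x = d 0 (\<phi> x))) \<and>
    (\<forall>x\<in>carrier (P (Suc n)). w (Suc n) x \<ominus>\<^bsub>P (Suc n)\<^esub> \<phi> (d n x) \<in> d (Suc n) ` carrier (P (Suc (Suc n))))"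
  have "\<exists>f. \<forall>n. ?G n (f n) \<and>
    (\<forall>x\<in>carrier (P (Suc n)). w (Suc n) x \<ominus>\<^bsub>P (Suc n)\<^esub> f n (d n x) = d (Suc n) (f (Suc n) x))"
  proof (rule dependent_nat_choice)
    have "w 0 x \<in> d 0 ` carrier (P (Suc 0))" if "x \<in> carrier (P 0)" for x
    proof -
      interpret M: left_module R M by (rule P.M)
      have "e (w 0 x) = \<zero>\<^bsub>M\<^esub>"
        using that mod_homD(1)[OF P.e that]
        by (simp add: w_def mod_hom_diff_apply[OF P.lm P.M P.e] uc u0) (simp add: a_minus_def M.M.r_neg)
      then show ?thesis unfolding P.ex0 using mod_homD(1)[OF w that] by simp
    qed
    then obtain \<phi> where \<phi>: "\<phi> \<in> mod_hom R (P 0) (P (Suc 0))" "\<And>x. x \<in> carrier (P 0) \<Longrightarrow> d 0 (\<phi> x) = w 0 x"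
      using projective_lift[OF P.proj P.lm P.lm P.d w] by blast
    have "w (Suc 0) x \<ominus>\<^bsub>P (Suc 0)\<^esub> \<phi> (d 0 x) \<in> d (Suc 0) ` carrier (P (Suc (Suc 0)))"
      if x: "x \<in> carrier (P (Suc 0))" for x
      unfolding P.ex
      using mod_homD(1)[OF w x] mod_homD(1)[OF \<phi>(1) P.d_closed[OF x]] mod_homD(1)[OF w P.d_closed[OF x]]
      by (simp add: mod_hom_diff_apply[OF P.lm P.lm P.d] wd[OF x] \<phi>(2)[OF P.d_closed[OF x]])
        (simp add: a_minus_def G.r_neg)
    with \<phi> show "\<exists>\<phi>. ?G 0 \<phi>" by (intro exI[of _ \<phi>]) simp
  next
    fix \<phi> n assume \<phi>: "?G n \<phi>"
    define v where "v x = w (Suc n) x \<ominus>\<^bsub>P (Suc n)\<^esub> \<phi> (d n x)" for x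
    have v: "v \<in> mod_hom R (P (Suc n)) (P (Suc n))"
      unfolding v_def using \<phi> by (intro mod_hom_diff[OF P.lm P.lm w mod_hom_comp[OF P.d]]) simp
    obtain \<psi> where \<psi>: "\<psi> \<in> mod_hom R (P (Suc n)) (P (Suc (Suc n)))"
      "\<And>x. x \<in> carrier (P (Suc n)) \<Longrightarrow> d (Suc n) (\<psi> x) = v x"
      using projective_lift[OF P.proj P.lm P.lm P.d v] \<phi> by (auto simp: v_def)
    have "w (Suc (Suc n)) x \<ominus>\<^bsub>P (Suc (Suc n))\<^esub> \<psi> (d (Suc n) x) \<in> d (Suc (Suc n)) ` carrier (P (Suc (Suc (Suc n))))"
      if x: "x \<in> carrier (P (Suc (Suc n)))" for x
    proof -
      note dx = P.d_closed[OF x]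
      have "\<phi> (d n (d (Suc n) x)) = \<zero>\<^bsub>P (Suc n)\<^esub>"
        using P.dd[OF x] mod_hom_zero[OF P.lm P.lm, of \<phi> n "Suc n"] \<phi> by simp
      then have "v (d (Suc n) x) = w (Suc n) (d (Suc n) x)"
        using mod_homD(1)[OF w dx] by (simp add: v_def a_minus_def)
      then show ?thesis
        unfolding P.ex
        using mod_homD(1)[OF w x] mod_homD(1)[OF \<psi>(1) dx] mod_homD(1)[OF w dx]
        by (simp add: mod_hom_diff_apply[OF P.lm P.lm P.d] wd[OF x] \<psi>(2)[OF dx])
          (simp add: a_minus_def G.r_neg)
    qed
    with \<psi> show "\<exists>\<psi>. ?G (Suc n) \<psi> \<and>
        (\<forall>x\<in>carrier (P (Suc n)). w (Suc n) x \<ominus>\<^bsub>P (Suc n)\<^esub> \<phi> (d n x) = d (Suc n) (\<psi> x))"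
      by (intro exI[of _ \<psi>]) (auto simp: v_def)
  qed
  then show ?thesis unfolding w_def by metis
qed

section \<open>Independence of the resolution\<close>

lemma left_module_regular: "ring R \<Longrightarrow> left_module R (regular_module R)"
proof -
  assume "ring R"
  then interpret ring R .
  show ?thesis
    unfolding left_module_def left_module_axioms_def
    using ring_axioms abelian_group_regular[OF ring_axioms]
    by (auto simp: regular_module_def l_distr r_distr m_assoc)
qed

lemma regular_simps [simp]:
  "carrier (regular_module R) = carrier R" "add (regular_module R) = add R"
  "smult (regular_module R) = mult R" "zero (regular_module R) = zero R"
  by (simp_all add: regular_module_def)

lemma regular_minus: "x \<ominus>\<^bsub>regular_module R\<^esub> y = x \<ominus>\<^bsub>R\<^esub> y"
  by (simp add: a_minus_def a_inv_def m_inv_def)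

lemma dual_carrier: "f \<in> carrier (dual_module R P) \<longleftrightarrow>
    f \<in> mod_hom R P (regular_module R) \<and> f \<in> extensional (carrier P)"
  by (simp add: dual_module_def)

lemma mod_hom_restrict:
  assumes "left_module R P" "f \<in> mod_hom R P N"
  shows "restrict f (carrier P) \<in> mod_hom R P N"
proof -
  interpret left_module R P by fact
  show ?thesis
    by (rule mod_homI) (simp_all add: mod_homD[OF assms(2)] smult_closed)
qed

lemma dual_restrict:
  assumes "left_module R P" "f \<in> mod_hom R P (regular_module R)"
  shows "restrict f (carrier P) \<in> carrier (dual_module R P)"
  using mod_hom_restrict[OF assms] by (simp add: dual_carrier)

lemma dual_eqI:
  assumes "f \<in> extensional (carrier P)" "g \<in> extensional (carrier P)" "\<And>x. x \<in> carrier P \<Longrightarrow> f x = g x"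
  shows "f = g"
  using assms by (rule extensionalityI)

lemma mod_hom_add:
  assumes "left_module R P" "f \<in> mod_hom R P (regular_module R)" "g \<in> mod_hom R P (regular_module R)"
  shows "(\<lambda>x. f x \<oplus>\<^bsub>R\<^esub> g x) \<in> mod_hom R P (regular_module R)"
proof -
  interpret left_module R P by fact
  note f = mod_homD[OF assms(2), simplified] and g = mod_homD[OF assms(3), simplified]
  show ?thesis by (rule mod_homI) (simp_all add: f g R.r_distr R.a_ac)
qed

lemma mod_hom_rmult:
  assumes "left_module R P" "f \<in> mod_hom R P (regular_module R)" "r \<in> carrier R"
  shows "(\<lambda>x. f x \<otimes>\<^bsub>R\<^esub> r) \<in> mod_hom R P (regular_module R)"
proof -
  interpret left_module R P by fact
  note f = mod_homD[OF assms(2), simplified]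
  show ?thesis by (rule mod_homI) (simp_all add: f assms(3) R.l_distr R.m_assoc)
qed

lemma mod_hom_zero_map:
  assumes "left_module R P"
  shows "(\<lambda>x. \<zero>\<^bsub>R\<^esub>) \<in> mod_hom R P (regular_module R)"
proof -
  interpret left_module R P by fact
  show ?thesis by (rule mod_homI) simp_all
qed

section \<open>Cocycles and coboundaries of the dual complex\<close>

context resolution
begin

abbreviation "Z i \<equiv> dual_cocycles R (P, d, e) i"
abbreviation "B i \<equiv> dual_coboundaries R (P, d, e) i"
abbreviation "Dm i \<equiv> dual_module R (P i)"

lemma ring_R: "ring R" using M by (simp add: left_module_def)

lemma Z_iff: "c \<in> Z i \<longleftrightarrow> c \<in> carrier (Dm i) \<and> (\<forall>x\<in>carrier (P (Suc i)). c (d i x) = \<zero>\<^bsub>R\<^esub>)"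
proof -
  have "compose (carrier (P (Suc i))) c (d i) = (\<lambda>x\<in>carrier (P (Suc i)). \<zero>\<^bsub>R\<^esub>)
      \<longleftrightarrow> (\<forall>x\<in>carrier (P (Suc i)). c (d i x) = \<zero>\<^bsub>R\<^esub>)"
    by (auto simp: compose_def fun_eq_iff restrict_def)
  then show ?thesis by (simp add: dual_cocycles_def dual_module_def)
qed

lemma B_0: "c \<in> B 0 \<longleftrightarrow> c \<in> extensional (carrier (P 0)) \<and> (\<forall>x\<in>carrier (P 0). c x = \<zero>\<^bsub>R\<^esub>)"
proof -
  have "c = (\<lambda>x\<in>carrier (P 0). \<zero>\<^bsub>R\<^esub>) \<longleftrightarrow> c \<in> extensional (carrier (P 0)) \<and> (\<forall>x\<in>carrier (P 0). c x = \<zero>\<^bsub>R\<^esub>)"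
    by (auto simp: fun_eq_iff restrict_def extensional_def)
  then show ?thesis by (simp add: dual_coboundaries_def dual_module_def)
qed

lemma B_Suc: "c \<in> B (Suc i) \<longleftrightarrow> c \<in> extensional (carrier (P (Suc i))) \<and>
    (\<exists>g\<in>mod_hom R (P i) (regular_module R). \<forall>x\<in>carrier (P (Suc i)). c x = g (d i x))"
proof
  assume "c \<in> B (Suc i)"
  then show "c \<in> extensional (carrier (P (Suc i))) \<and>
    (\<exists>g\<in>mod_hom R (P i) (regular_module R). \<forall>x\<in>carrier (P (Suc i)). c x = g (d i x))"
    by (auto simp: dual_coboundaries_def dual_module_def compose_def)
next
  assume "c \<in> extensional (carrier (P (Suc i))) \<and>
    (\<exists>g\<in>mod_hom R (P i) (regular_module R). \<forall>x\<in>carrier (P (Suc i)). c x = g (d i x))"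
  then obtain g where c: "c \<in> extensional (carrier (P (Suc i)))" and
    g: "g \<in> mod_hom R (P i) (regular_module R)" "\<And>x. x \<in> carrier (P (Suc i)) \<Longrightarrow> c x = g (d i x)" by blast
  have "c = compose (carrier (P (Suc i))) (restrict g (carrier (P i))) (d i)"
    by (rule extensionalityI[OF c compose_extensional]) (simp add: g compose_def d_closed)
  then show "c \<in> B (Suc i)"
    using dual_restrict[OF lm g(1)] by (auto simp: dual_coboundaries_def)
qed

lemma Z_hom: "c \<in> Z i \<Longrightarrow> c \<in> mod_hom R (P i) (regular_module R)"
  by (simp add: Z_iff dual_carrier)

lemma Z_ext: "c \<in> Z i \<Longrightarrow> c \<in> extensional (carrier (P i))"
  by (simp add: Z_iff dual_carrier)

lemma Z_restrict:
  assumes "f \<in> mod_hom R (P i) (regular_module R)" "\<And>x. x \<in> carrier (P (Suc i)) \<Longrightarrow> f (d i x) = \<zero>\<^bsub>R\<^esub>"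
  shows "restrict f (carrier (P i)) \<in> Z i"
  using assms dual_restrict[OF lm] by (simp add: Z_iff d_closed)

lemma regular: "left_module R (regular_module R)" by (rule left_module_regular[OF ring_R])

lemma B_subset_Z: "B i \<subseteq> Z i"
proof
  fix c assume c: "c \<in> B i"
  show "c \<in> Z i"
  proof (cases i)
    case 0
    have "restrict (\<lambda>x. \<zero>\<^bsub>R\<^esub>) (carrier (P 0)) \<in> Z 0"
      by (rule Z_restrict[OF mod_hom_zero_map[OF lm]]) simp
    moreover have "c = restrict (\<lambda>x. \<zero>\<^bsub>R\<^esub>) (carrier (P 0))"
      using c 0 by (intro extensionalityI[of c "carrier (P 0)"]) (auto simp: B_0)
    ultimately show ?thesis using 0 by simp
  next
    case (Suc j)
    then obtain g where g: "g \<in> mod_hom R (P j) (regular_module R)" "c \<in> extensional (carrier (P i))"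
      "\<And>x. x \<in> carrier (P i) \<Longrightarrow> c x = g (d j x)"
      using c by (auto simp: B_Suc)
    have "restrict (\<lambda>x. g (d j x)) (carrier (P i)) \<in> Z i"
      unfolding Suc
      by (rule Z_restrict[OF mod_hom_comp[OF d g(1)]])
        (simp add: dd mod_hom_zero[OF lm regular g(1), simplified])
    moreover have "c = restrict (\<lambda>x. g (d j x)) (carrier (P i))"
      using g by (intro extensionalityI[of c "carrier (P i)"]) auto
    ultimately show ?thesis by simp
  qed
qed

lemma dual_add_apply: "x \<in> carrier (P i) \<Longrightarrow> (c \<oplus>\<^bsub>Dm i\<^esub> c') x = c x \<oplus>\<^bsub>R\<^esub> c' x"
  "x \<in> carrier (P i) \<Longrightarrow> (r \<odot>\<^bsub>Dm i\<^esub> c) x = c x \<otimes>\<^bsub>R\<^esub> r" "x \<in> carrier (P i) \<Longrightarrow> \<zero>\<^bsub>Dm i\<^esub> x = \<zero>\<^bsub>R\<^esub>"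
  by (simp_all add: dual_module_def)

lemma dual_ext: "c \<oplus>\<^bsub>Dm i\<^esub> c' \<in> extensional (carrier (P i))" "r \<odot>\<^bsub>Dm i\<^esub> c \<in> extensional (carrier (P i))"
  "\<zero>\<^bsub>Dm i\<^esub> \<in> extensional (carrier (P i))"
  by (simp_all add: dual_module_def)

lemma Z_add: "c \<in> Z i \<Longrightarrow> c' \<in> Z i \<Longrightarrow> c \<oplus>\<^bsub>Dm i\<^esub> c' \<in> Z i"
proof -
  assume c: "c \<in> Z i" "c' \<in> Z i"
  interpret ring R by (rule ring_R)
  have "restrict (\<lambda>x. c x \<oplus>\<^bsub>R\<^esub> c' x) (carrier (P i)) \<in> Z i"
    by (rule Z_restrict[OF mod_hom_add[OF lm Z_hom[OF c(1)] Z_hom[OF c(2)]]]) (use c in \<open>simp add: Z_iff\<close>)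
  then show ?thesis by (simp add: dual_module_def)
qed

lemma Z_rmult: "c \<in> Z i \<Longrightarrow> r \<in> carrier R \<Longrightarrow> r \<odot>\<^bsub>Dm i\<^esub> c \<in> Z i"
proof -
  assume c: "c \<in> Z i" "r \<in> carrier R"
  interpret ring R by (rule ring_R)
  have "restrict (\<lambda>x. c x \<otimes>\<^bsub>R\<^esub> r) (carrier (P i)) \<in> Z i"
    by (rule Z_restrict[OF mod_hom_rmult[OF lm Z_hom[OF c(1)] c(2)]]) (use c in \<open>simp add: Z_iff\<close>)
  then show ?thesis by (simp add: dual_module_def)
qed

lemma Z_zero: "\<zero>\<^bsub>Dm i\<^esub> \<in> Z i"
proof -
  have "restrict (\<lambda>x. \<zero>\<^bsub>R\<^esub>) (carrier (P i)) \<in> Z i"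
    by (rule Z_restrict[OF mod_hom_zero_map[OF lm]]) simp
  then show ?thesis by (simp add: dual_module_def)
qed

abbreviation "ZM i \<equiv> (Dm i)\<lparr>carrier := Z i\<rparr>"

lemma abelian_group_Z: "abelian_group (ZM i)"
proof -
  interpret ring R by (rule ring_R)
  have c: "c x \<in> carrier R" if "c \<in> Z i" "x \<in> carrier (P i)" for c x
    using mod_homD(1)[OF Z_hom[OF that(1)] that(2)] by simp
  show ?thesis
  proof (rule abelian_groupI)
    fix x y z assume x: "x \<in> carrier (ZM i)"
    then have xZ: "x \<in> Z i" by simp
    show "\<exists>y\<in>carrier (ZM i). y \<oplus>\<^bsub>ZM i\<^esub> x = \<zero>\<^bsub>ZM i\<^esub>"
    proof (intro bexI[of _ "(\<ominus>\<^bsub>R\<^esub> \<one>\<^bsub>R\<^esub>) \<odot>\<^bsub>Dm i\<^esub> x"])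
      show "(\<ominus>\<^bsub>R\<^esub> \<one>\<^bsub>R\<^esub>) \<odot>\<^bsub>Dm i\<^esub> x \<in> carrier (ZM i)" using xZ Z_rmult by simp
      show "(\<ominus>\<^bsub>R\<^esub> \<one>\<^bsub>R\<^esub>) \<odot>\<^bsub>Dm i\<^esub> x \<oplus>\<^bsub>ZM i\<^esub> x = \<zero>\<^bsub>ZM i\<^esub>"
        using xZ by (auto intro!: dual_eqI[of _ "P i"] simp: dual_ext dual_add_apply c r_minus l_neg)
    qed
    show "\<zero>\<^bsub>ZM i\<^esub> \<oplus>\<^bsub>ZM i\<^esub> x = x"
      using xZ by (auto intro!: dual_eqI[of _ "P i"] simp: dual_ext dual_add_apply c Z_ext)
    assume "y \<in> carrier (ZM i)"
    then have y: "y \<in> Z i" by simp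
    show "x \<oplus>\<^bsub>ZM i\<^esub> y \<in> carrier (ZM i)" using xZ y Z_add by simp
    show "x \<oplus>\<^bsub>ZM i\<^esub> y = y \<oplus>\<^bsub>ZM i\<^esub> x"
      using xZ y by (auto intro!: dual_eqI[of _ "P i"] simp: dual_ext dual_add_apply c a_comm)
    assume "z \<in> carrier (ZM i)"
    then have z: "z \<in> Z i" by simp
    show "x \<oplus>\<^bsub>ZM i\<^esub> y \<oplus>\<^bsub>ZM i\<^esub> z = x \<oplus>\<^bsub>ZM i\<^esub> (y \<oplus>\<^bsub>ZM i\<^esub> z)"
      using xZ y z by (auto intro!: dual_eqI[of _ "P i"] simp: dual_ext dual_add_apply c a_assoc)
  qed (simp add: Z_zero)
qed

lemma B_add: "c \<in> B i \<Longrightarrow> c' \<in> B i \<Longrightarrow> c \<oplus>\<^bsub>Dm i\<^esub> c' \<in> B i"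
proof (cases i)
  case 0
  interpret ring R by (rule ring_R)
  assume "c \<in> B i" "c' \<in> B i"
  then show ?thesis using 0 by (simp add: B_0 dual_ext dual_add_apply)
next
  case (Suc j)
  assume "c \<in> B i" "c' \<in> B i"
  then obtain g g' where g: "g \<in> mod_hom R (P j) (regular_module R)" "\<And>x. x \<in> carrier (P i) \<Longrightarrow> c x = g (d j x)"
    "g' \<in> mod_hom R (P j) (regular_module R)" "\<And>x. x \<in> carrier (P i) \<Longrightarrow> c' x = g' (d j x)"
    using Suc by (auto simp: B_Suc)
  have "(c \<oplus>\<^bsub>Dm (Suc j)\<^esub> c') x = g (d j x) \<oplus>\<^bsub>R\<^esub> g' (d j x)" if "x \<in> carrier (P (Suc j))" for x
    using that g Suc by (simp add: dual_add_apply)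
  then show ?thesis unfolding Suc B_Suc
    by (intro conjI dual_ext(1) bexI[OF _ mod_hom_add[OF lm g(1,3)]]) simp
qed

text \<open>Apply c to id - u = d h + h d. The term c d h vanishes for a cocycle and c h d is a
  coboundary; in degree zero the second term is absent.\<close>

lemma homotopic_mod_B:
  assumes u: "\<And>i. u i \<in> mod_hom R (P i) (P i)"
    and u0: "\<And>x. x \<in> carrier (P 0) \<Longrightarrow> e (u 0 x) = e x"
    and ud: "\<And>i x. x \<in> carrier (P (Suc i)) \<Longrightarrow> d i (u (Suc i) x) = u i (d i x)"
    and c: "c \<in> Z i"
  shows "\<exists>b\<in>B i. c = restrict (\<lambda>x. c (u i x)) (carrier (P i)) \<oplus>\<^bsub>Dm i\<^esub> b"
proof -
  interpret ring R by (rule ring_R)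
  obtain h where h: "\<And>i. h i \<in> mod_hom R (P i) (P (Suc i))"
    "\<And>x. x \<in> carrier (P 0) \<Longrightarrow> x \<ominus>\<^bsub>P 0\<^esub> u 0 x = d 0 (h 0 x)"
    "\<And>i x. x \<in> carrier (P (Suc i)) \<Longrightarrow>
      x \<ominus>\<^bsub>P (Suc i)\<^esub> u (Suc i) x \<ominus>\<^bsub>P (Suc i)\<^esub> h i (d i x) = d (Suc i) (h (Suc i) x)"
    using homotopy[OF resolution_axioms u u0 ud] by blast
  note uc = mod_homD(1)[OF u] and hc = mod_homD(1)[OF h(1)]
  note cc = mod_homD(1)[OF Z_hom[OF c], simplified]
  have cd: "c (x \<ominus>\<^bsub>P i\<^esub> y) = c x \<ominus>\<^bsub>R\<^esub> c y" if "x \<in> carrier (P i)" "y \<in> carrier (P i)" for x y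
    using mod_hom_diff_apply[OF lm regular Z_hom[OF c] that] by (simp only: regular_minus)
  have split: "x = y \<oplus>\<^bsub>R\<^esub> z" if "x \<ominus>\<^bsub>R\<^esub> y = z" "x \<in> carrier R" "y \<in> carrier R" for x y z
    using that by (auto simp: a_minus_def a_comm r_neg2 a_lcomm r_neg)
  show ?thesis
  proof (cases i)
    case 0
    have b: "restrict (\<lambda>x. \<zero>\<^bsub>R\<^esub>) (carrier (P 0)) \<in> B 0" by (simp add: B_0)
    have "c x = c (u 0 x)" if x: "x \<in> carrier (P 0)" for x
    proof -
      have "c x \<ominus>\<^bsub>R\<^esub> c (u 0 x) = c (d 0 (h 0 x))"
        using cd[of x "u 0 x"] x uc h(2)[OF x] 0 by simp
      also have "\<dots> = \<zero>\<^bsub>R\<^esub>" using c 0 hc[OF x] by (simp add: Z_iff)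
      finally show ?thesis using split[of "c x" "c (u 0 x)" "\<zero>\<^bsub>R\<^esub>"] cc 0 x uc by simp
    qed
    then show ?thesis using 0 b Z_ext[OF c] cc uc
      by (intro bexI[of _ "restrict (\<lambda>x. \<zero>\<^bsub>R\<^esub>) (carrier (P 0))"])
        (auto intro!: dual_eqI[of _ "P 0"] simp: dual_ext dual_add_apply)
  next
    case (Suc j)
    define b where "b = restrict (\<lambda>x. c (h j (d j x))) (carrier (P i))"
    have cZ: "c \<in> mod_hom R (P (Suc j)) (regular_module R)" using Z_hom[OF c] Suc by simp
    have "b \<in> B i"
      unfolding Suc B_Suc b_def using mod_hom_comp[OF h(1)[of j] cZ]
      by (intro conjI bexI[of _ "\<lambda>x. c (h j x)"]) auto
    moreover have "c = restrict (\<lambda>x. c (u i x)) (carrier (P i)) \<oplus>\<^bsub>Dm i\<^esub> b"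
    proof (rule dual_eqI[of _ "P i"])
      fix x assume x: "x \<in> carrier (P i)"
      interpret G: abelian_group "P i" by (rule ag)
      have hx: "h j (d j x) \<in> carrier (P i)" using x Suc hc d_closed by simp
      have "c x \<ominus>\<^bsub>R\<^esub> c (u i x) \<ominus>\<^bsub>R\<^esub> c (h j (d j x)) = c (x \<ominus>\<^bsub>P i\<^esub> u i x \<ominus>\<^bsub>P i\<^esub> h j (d j x))"
        using x uc hx by (simp add: cd)
      also have "\<dots> = c (d i (h i x))" using h(3)[of x j] x Suc by simp
      also have "\<dots> = \<zero>\<^bsub>R\<^esub>" using c hc[of x i] x by (simp add: Z_iff)
      finally have "c x \<ominus>\<^bsub>R\<^esub> c (u i x) = c (h j (d j x))"
        using split[of "c x \<ominus>\<^bsub>R\<^esub> c (u i x)" "c (h j (d j x))" "\<zero>\<^bsub>R\<^esub>"] cc x uc hx by simp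
      then have "c x = c (u i x) \<oplus>\<^bsub>R\<^esub> c (h j (d j x))"
        by (rule split[OF _ cc[OF x] cc[OF uc[OF x]]])
      then show "c x = (restrict (\<lambda>x. c (u i x)) (carrier (P i)) \<oplus>\<^bsub>Dm i\<^esub> b) x"
        using x by (simp add: dual_add_apply b_def)
    qed (use Z_ext[OF c] dual_ext in auto)
    ultimately show ?thesis by blast
  qed
qed

end

section \<open>Pulling cocycles back along a comparison map\<close>

locale two_resolutions = P: resolution R M P d e + Q: resolution R M Q d' e'
  for R :: "('r, 'x) ring_scheme" and M :: "('r, 'm) module"
    and P :: "nat \<Rightarrow> ('r, 'p) module" and d e and Q :: "nat \<Rightarrow> ('r, 'q) module" and d' e' +
  fixes f
  assumes f: "\<And>i. f i \<in> mod_hom R (P i) (Q i)" "\<And>x. x \<in> carrier (P 0) \<Longrightarrow> e' (f 0 x) = e x"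
    "\<And>i x. x \<in> carrier (P (Suc i)) \<Longrightarrow> d' i (f (Suc i) x) = f i (d i x)"
begin

definition "pull i c = restrict (\<lambda>x. c (f i x)) (carrier (P i))"

lemma fc: "x \<in> carrier (P i) \<Longrightarrow> f i x \<in> carrier (Q i)" by (rule mod_homD(1)[OF f(1)])

lemma pull_Z: "c \<in> Q.Z i \<Longrightarrow> pull i c \<in> P.Z i"
  unfolding pull_def
  by (rule P.Z_restrict[OF mod_hom_comp[OF f(1) Q.Z_hom]])
    (auto simp: f(3)[symmetric] Q.Z_iff fc)

lemma pull_B: "c \<in> Q.B i \<Longrightarrow> pull i c \<in> P.B i"
proof (cases i)
  case 0
  assume "c \<in> Q.B i"
  then show ?thesis using 0 by (simp add: pull_def P.B_0 Q.B_0 fc)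
next
  case (Suc j)
  assume "c \<in> Q.B i"
  then obtain g where g: "g \<in> mod_hom R (Q j) (regular_module R)" "\<And>x. x \<in> carrier (Q (Suc j)) \<Longrightarrow> c x = g (d' j x)"
    using Suc by (auto simp: Q.B_Suc)
  show ?thesis unfolding Suc P.B_Suc
    using mod_hom_comp[OF f(1) g(1)] g(2) by (auto simp: pull_def f(3) fc intro!: bexI[of _ "\<lambda>x. g (f j x)"])
qed

lemma pull_add: "pull i (c \<oplus>\<^bsub>Q.Dm i\<^esub> c') = pull i c \<oplus>\<^bsub>P.Dm i\<^esub> pull i c'"
  by (rule dual_eqI[of _ "P i"]) (simp_all add: pull_def P.dual_ext, simp add: P.dual_add_apply Q.dual_add_apply fc)

lemma pull_rmult: "pull i (r \<odot>\<^bsub>Q.Dm i\<^esub> c) = r \<odot>\<^bsub>P.Dm i\<^esub> pull i c"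
  by (rule dual_eqI[of _ "P i"]) (simp_all add: pull_def P.dual_ext, simp add: P.dual_add_apply Q.dual_add_apply fc)

end

lemma two_resolutions_exist:
  assumes "resolution R M P d e" "resolution R M Q d' e'"
  shows "\<exists>f. two_resolutions R M P d e Q d' e' f"
proof -
  obtain f where "\<And>i. f i \<in> mod_hom R (P i) (Q i)" "\<And>x. x \<in> carrier (P 0) \<Longrightarrow> e' (f 0 x) = e x"
    "\<And>i x. x \<in> carrier (P (Suc i)) \<Longrightarrow> d' i (f (Suc i) x) = f i (d i x)"
    using comparison[OF assms] by meson
  then show ?thesis
    by (intro exI[of _ f] two_resolutions.intro two_resolutions_axioms.intro assms)
qed

text \<open>The composite of the two comparison maps covers the identity of M, so pulling back along
  it changes a cocycle only by a coboundary.\<close>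

lemma pull_pull:
  assumes "two_resolutions R M P d e Q d' e' f" "two_resolutions R M Q d' e' P d e g" "c \<in> dual_cocycles R (P, d, e) i"
  shows "\<exists>b\<in>dual_coboundaries R (P, d, e) i.
    c = two_resolutions.pull P f i (two_resolutions.pull Q g i c) \<oplus>\<^bsub>dual_module R (P i)\<^esub> b"
proof -
  interpret F: two_resolutions R M P d e Q d' e' f by fact
  interpret G: two_resolutions R M Q d' e' P d e g by fact
  have "\<exists>b\<in>F.P.B i. c = restrict (\<lambda>x. c (g i (f i x))) (carrier (P i)) \<oplus>\<^bsub>F.P.Dm i\<^esub> b"
    by (rule F.P.homotopic_mod_B[OF mod_hom_comp[OF F.f(1) G.f(1)] _ _ assms(3)])
      (simp_all add: F.f G.f F.fc)
  moreover have "restrict (\<lambda>x. c (g i (f i x))) (carrier (P i)) = F.pull i (G.pull i c)"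
    by (auto simp: F.pull_def G.pull_def F.fc)
  ultimately show ?thesis by simp
qed

text \<open>A cocycle over Q differs by a coboundary from the pull-back of its pull-back to P, and
  over P it is a coboundary already.\<close>

lemma exact_transfer:
  assumes P: "resolution R M P d e" and Q: "resolution R M Q d' e'"
    and ZB: "dual_cocycles R (P, d, e) i \<subseteq> dual_coboundaries R (P, d, e) i"
  shows "dual_cocycles R (Q, d', e') i \<subseteq> dual_coboundaries R (Q, d', e') i"
proof
  interpret P: resolution R M P d e by fact
  interpret Q: resolution R M Q d' e' by fact
  obtain f where "two_resolutions R M P d e Q d' e' f"
    using two_resolutions_exist[OF P Q] by blast
  then interpret F: two_resolutions R M P d e Q d' e' f .
  obtain g where "two_resolutions R M Q d' e' P d e g"
    using two_resolutions_exist[OF Q P] by blast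
  then interpret G: two_resolutions R M Q d' e' P d e g .
  fix c assume c: "c \<in> Q.Z i"
  have "F.pull i c \<in> P.B i" using F.pull_Z[OF c] ZB by blast
  then have "G.pull i (F.pull i c) \<in> Q.B i" by (rule G.pull_B)
  moreover obtain b where "b \<in> Q.B i" "c = G.pull i (F.pull i c) \<oplus>\<^bsub>Q.Dm i\<^esub> b"
    using pull_pull[OF G.two_resolutions_axioms F.two_resolutions_axioms c] by blast
  ultimately show "c \<in> Q.B i" using Q.B_add by metis
qed

text \<open>The identification of the cohomology with N is stated on cocycles, as a surjective
  additive map whose kernel is the coboundaries, so no quotients have to be compared.
  \<open>act\<close> is an arbitrary family of maps on N, and linearity is carried over with
  it.\<close>

lemma cohomology_transfer:
  assumes P: "resolution R M P d e" and Q: "resolution R M Q d' e'" and N: "abelian_group N"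
    and h: "\<And>c. c \<in> dual_cocycles R (P, d, e) i \<Longrightarrow> h c \<in> carrier N"
      "\<And>c c'. c \<in> dual_cocycles R (P, d, e) i \<Longrightarrow> c' \<in> dual_cocycles R (P, d, e) i \<Longrightarrow>
        h (c \<oplus>\<^bsub>dual_module R (P i)\<^esub> c') = h c \<oplus>\<^bsub>N\<^esub> h c'"
      "\<And>c. c \<in> dual_cocycles R (P, d, e) i \<Longrightarrow> h c = \<zero>\<^bsub>N\<^esub> \<longleftrightarrow> c \<in> dual_coboundaries R (P, d, e) i"
      "\<And>n. n \<in> carrier N \<Longrightarrow> \<exists>c\<in>dual_cocycles R (P, d, e) i. h c = n"
      "\<And>c r. c \<in> dual_cocycles R (P, d, e) i \<Longrightarrow> r \<in> carrier R \<Longrightarrow> h (r \<odot>\<^bsub>dual_module R (P i)\<^esub> c) = act r (h c)"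
  shows "\<exists>h'. (\<forall>c\<in>dual_cocycles R (Q, d', e') i. h' c \<in> carrier N) \<and>
    (\<forall>c\<in>dual_cocycles R (Q, d', e') i. \<forall>c'\<in>dual_cocycles R (Q, d', e') i.
      h' (c \<oplus>\<^bsub>dual_module R (Q i)\<^esub> c') = h' c \<oplus>\<^bsub>N\<^esub> h' c') \<and>
    (\<forall>c\<in>dual_cocycles R (Q, d', e') i. h' c = \<zero>\<^bsub>N\<^esub> \<longleftrightarrow> c \<in> dual_coboundaries R (Q, d', e') i) \<and>
    (\<forall>n\<in>carrier N. \<exists>c\<in>dual_cocycles R (Q, d', e') i. h' c = n) \<and>
    (\<forall>c\<in>dual_cocycles R (Q, d', e') i. \<forall>r\<in>carrier R. h' (r \<odot>\<^bsub>dual_module R (Q i)\<^esub> c) = act r (h' c))"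
proof -
  interpret P: resolution R M P d e by fact
  interpret Q: resolution R M Q d' e' by fact
  interpret N: abelian_group N by fact
  obtain f where "two_resolutions R M P d e Q d' e' f"
    using two_resolutions_exist[OF P Q] by blast
  then interpret F: two_resolutions R M P d e Q d' e' f .
  obtain g where "two_resolutions R M Q d' e' P d e g"
    using two_resolutions_exist[OF Q P] by blast
  then interpret G: two_resolutions R M Q d' e' P d e g .
  define h' where "h' c = h (F.pull i c)" for c
  have ker: "h' c = \<zero>\<^bsub>N\<^esub> \<longleftrightarrow> c \<in> Q.B i" if c: "c \<in> Q.Z i" for c
  proof
    assume "h' c = \<zero>\<^bsub>N\<^esub>"
    then have "F.pull i c \<in> P.B i" using h(3)[OF F.pull_Z[OF c]] by (simp add: h'_def)
    then have "G.pull i (F.pull i c) \<in> Q.B i" by (rule G.pull_B)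
    moreover obtain b where "b \<in> Q.B i" "c = G.pull i (F.pull i c) \<oplus>\<^bsub>Q.Dm i\<^esub> b"
      using pull_pull[OF G.two_resolutions_axioms F.two_resolutions_axioms c] by blast
    ultimately show "c \<in> Q.B i" using Q.B_add by metis
  next
    assume "c \<in> Q.B i"
    then show "h' c = \<zero>\<^bsub>N\<^esub>" using h(3)[OF F.pull_Z[OF c]] F.pull_B by (simp add: h'_def)
  qed
  have sur: "\<exists>c\<in>Q.Z i. h' c = n" if n: "n \<in> carrier N" for n
  proof -
    obtain c where c: "c \<in> P.Z i" "h c = n" using h(4)[OF n] by blast
    obtain b where b: "b \<in> P.B i" "c = F.pull i (G.pull i c) \<oplus>\<^bsub>P.Dm i\<^esub> b"
      using pull_pull[OF F.two_resolutions_axioms G.two_resolutions_axioms c(1)] by blast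
    have bZ: "b \<in> P.Z i" using b P.B_subset_Z by blast
    have pZ: "F.pull i (G.pull i c) \<in> P.Z i" using c F.pull_Z G.pull_Z by blast
    have "h c = h (F.pull i (G.pull i c)) \<oplus>\<^bsub>N\<^esub> h b"
      by (subst b(2)) (rule h(2)[OF pZ bZ])
    also have "h b = \<zero>\<^bsub>N\<^esub>" using h(3)[OF bZ] b by simp
    finally have "h' (G.pull i c) = n" using h(1)[OF pZ] c by (simp add: h'_def)
    then show ?thesis using G.pull_Z[OF c(1)] by blast
  qed
  show ?thesis
    by (intro exI[of _ h'] conjI ballI ker sur)
      (simp_all add: h'_def h F.pull_Z F.pull_add F.pull_rmult)
qed

section \<open>Quotients of abelian groups as bimodules\<close>

lemma quot_mod_trivial:
  assumes "abelian_group M" "I = carrier M"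
  shows "carrier (quot_mod M I) = {\<zero>\<^bsub>quot_mod M I\<^esub>}"
proof -
  interpret abelian_group M by fact
  have "subgroup I (add_monoid M)" using assms add.subgroup_self by simp
  then have "I +>\<^bsub>M\<^esub> x = I" if "x \<in> carrier M" for x
    using that assms by (intro a_coset_join2) auto
  moreover have "\<zero>\<^bsub>M\<^esub> \<in> carrier M" by simp
  ultimately show ?thesis
    by (auto simp: quot_mod_simps FactRing_def A_RCOSETS_def')
qed

text \<open>The first isomorphism theorem with operators. Elements of \<open>S\<close> act on M
  compatibly with h, hence they preserve the fibres of h, and the union of cosets in
  \<open>quot_mod\<close> is a single coset.\<close>

lemma quot_mod_iso:
  assumes M: "abelian_group M" and N: "abelian_group N"
    and h: "\<And>x. x \<in> carrier M \<Longrightarrow> h x \<in> carrier N"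
      "\<And>x y. x \<in> carrier M \<Longrightarrow> y \<in> carrier M \<Longrightarrow> h (x \<oplus>\<^bsub>M\<^esub> y) = h x \<oplus>\<^bsub>N\<^esub> h y"
      "\<And>n. n \<in> carrier N \<Longrightarrow> \<exists>x\<in>carrier M. h x = n"
    and I: "I = {x \<in> carrier M. h x = \<zero>\<^bsub>N\<^esub>}"
    and r: "\<And>r x. r \<in> S \<Longrightarrow> x \<in> carrier M \<Longrightarrow> r \<odot>\<^bsub>M\<^esub> x \<in> carrier M"
      "\<And>r x. r \<in> S \<Longrightarrow> x \<in> carrier M \<Longrightarrow> h (r \<odot>\<^bsub>M\<^esub> x) = act r (h x)"
  shows "\<exists>F\<in>iso (add_monoid (quot_mod M I)) (add_monoid N).
    \<forall>r\<in>S. \<forall>X\<in>carrier (quot_mod M I). F (r \<odot>\<^bsub>quot_mod M I\<^esub> X) = act r (F X)"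
proof -
  interpret M: abelian_group M by fact
  interpret N: abelian_group N by fact
  interpret h: group_hom "add_monoid M" "add_monoid N" h
    by (rule group_hom.intro[OF M.a_group N.a_group]) (auto simp: group_hom_axioms_def hom_def h)
  have k: "I = kernel (add_monoid M) (add_monoid N) h"
    by (auto simp: I kernel_def)
  define F where "F X = the_elem (h ` X)" for X
  have coset: "I +>\<^bsub>M\<^esub> x = I #>\<^bsub>add_monoid M\<^esub> x" for x by (simp add: a_r_coset_def)
  have mem: "y \<in> I +>\<^bsub>M\<^esub> x \<Longrightarrow> y \<in> carrier M \<and> h y = h x" if "x \<in> carrier M" for x y
    using that h by (auto simp: a_r_coset_def' I)
  have self: "x \<in> I +>\<^bsub>M\<^esub> x" if "x \<in> carrier M" for x
  proof -
    have "\<zero>\<^bsub>M\<^esub> \<in> I" using h.hom_one by (simp add: I)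
    then show ?thesis using that by (auto simp: a_r_coset_def' intro!: bexI[of _ "\<zero>\<^bsub>M\<^esub>"])
  qed
  have F: "F (I +>\<^bsub>M\<^esub> x) = h x" if x: "x \<in> carrier M" for x
  proof -
    have "h ` C = {h x}" if "x \<in> C" "\<And>y. y \<in> C \<Longrightarrow> h y = h x" for C using that by blast
    from this[OF self[OF x]] have "h ` (I +>\<^bsub>M\<^esub> x) = {h x}" using mem[OF x] by blast
    then show ?thesis by (simp add: F_def)
  qed
  have eq: "I +>\<^bsub>M\<^esub> x = I +>\<^bsub>M\<^esub> y" if "x \<in> carrier M" "y \<in> carrier M" "h x = h y" for x y
  proof -
    have "x \<in> I +>\<^bsub>M\<^esub> y"
    proof -
      have "h (x \<ominus>\<^bsub>M\<^esub> y) = \<zero>\<^bsub>N\<^esub>"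
        using that h h.hom_inv[of y] N.r_neg by (simp add: a_minus_def a_inv_def[symmetric])
      then have "x \<ominus>\<^bsub>M\<^esub> y \<in> I" using that by (simp add: I)
      moreover have "x = (x \<ominus>\<^bsub>M\<^esub> y) \<oplus>\<^bsub>M\<^esub> y" using that by (simp add: a_minus_def M.a_assoc M.l_neg)
      ultimately show ?thesis by (auto simp: a_r_coset_def')
    qed
    then show ?thesis using that h.subgroup_kernel unfolding k
      by (intro M.a_repr_independence[symmetric])
  qed
  have fact: "carrier (quot_mod M I) = carrier (add_monoid M Mod I)"
    "X \<oplus>\<^bsub>quot_mod M I\<^esub> Y = X \<otimes>\<^bsub>add_monoid M Mod I\<^esub> Y" for X Y
    by (simp_all add: quot_mod_def FactRing_def FactGroup_def A_RCOSETS_def set_add_def)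
  have "F \<in> iso (add_monoid M Mod I) (add_monoid N)"
    unfolding k F_def[abs_def]
  proof (rule h.FactGroup_iso_set)
    have "n \<in> h ` carrier M" if "n \<in> carrier N" for n using h(3)[OF that] by blast
    then show "h ` carrier (add_monoid M) = carrier (add_monoid N)" using h(1) by auto
  qed
  then have "F \<in> iso (add_monoid (quot_mod M I)) (add_monoid N)" by (simp add: iso_def hom_def fact)
  moreover have "F (r \<odot>\<^bsub>quot_mod M I\<^esub> X) = act r (F X)" if rS: "r \<in> S" and "X \<in> carrier (quot_mod M I)" for r X
  proof -
    obtain x where x: "x \<in> carrier M" "X = I +>\<^bsub>M\<^esub> x"
      using \<open>X \<in> _\<close> by (auto simp: quot_mod_simps FactRing_def A_RCOSETS_def')
    have "I +>\<^bsub>M\<^esub> (r \<odot>\<^bsub>M\<^esub> y) = I +>\<^bsub>M\<^esub> (r \<odot>\<^bsub>M\<^esub> x)" if "y \<in> X" for y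
      using mem[OF x(1)] that x rS by (intro eq) (auto simp: r)
    then have "(\<Union>y\<in>X. I +>\<^bsub>M\<^esub> (r \<odot>\<^bsub>M\<^esub> y)) = I +>\<^bsub>M\<^esub> (r \<odot>\<^bsub>M\<^esub> x)"
      using self[OF x(1)] x(2) by blast
    then have "r \<odot>\<^bsub>quot_mod M I\<^esub> X = I +>\<^bsub>M\<^esub> (r \<odot>\<^bsub>M\<^esub> x)" by (simp only: quot_mod_def module.simps)
    then show ?thesis using x rS by (simp add: F r)
  qed
  ultimately show ?thesis by blast
qed

section \<open>The length-three resolution and its dual\<close>

context ring
begin

text \<open>The definition asks for a basis inside the type of the elements of the module, so the
  index set X is replaced by the set of its basis vectors and the identity factors through the new
  free module.\<close>

lemma projective_free:
  fixes X :: "'i set"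
  shows "projective_module R (Fm X)"
proof -
  define X' where "X' = delta R ` X"
  define s where "s = free_lin R (Fm X') (\<lambda>x. delta R (delta R x))"
  define t where "t = free_lin R (Fm X) (\<lambda>g. g)"
  have s: "s \<in> mod_hom R (Fm X) (Fm X')" unfolding s_def
    by (rule free_lin_hom[OF left_module_free]) (auto simp: X'_def)
  have t: "t \<in> mod_hom R (Fm X') (Fm X)" unfolding t_def
    by (rule free_lin_hom[OF left_module_free]) (auto simp: X'_def)
  have ts: "t (s (delta R x)) = delta R x" if "x \<in> X" for x
  proof -
    have "s (delta R x) = delta R (delta R x)"
      unfolding s_def using that by (intro free_lin_delta[OF left_module_free, of _ X X']) (auto simp: X'_def)
    moreover have "t (delta R (delta R x)) = delta R x"
      unfolding t_def using that by (intro free_lin_delta[OF left_module_free, of _ X' X]) (auto simp: X'_def)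
    ultimately show ?thesis by simp
  qed
  have "t (s m) = m" if m: "m \<in> carrier (Fm X)" for m
  proof -
    have "t (s m) = free_lin R (Fm X) (delta R) m"
      using free_hom_eq[where h = "\<lambda>x. t (s x)" and b = "delta R", OF left_module_free mod_hom_comp[OF s t] m]
      ts by blast
    moreover have "m = free_lin R (Fm X) (delta R) m"
      using free_hom_eq[where h = "\<lambda>x. x" and b = "delta R", OF left_module_free mod_hom_id m] by blast
    ultimately show ?thesis by (rule trans[OF _ sym])
  qed
  then show ?thesis unfolding projective_module_def
    by (intro conjI left_module_free exI[of _ X'] bexI[OF _ s] bexI[OF _ t] ballI)
qed

lemma fg_free:
  assumes "finite X"
  shows "fg_module R (Fm X)"
proof -
  interpret F: left_module R "Fm X" by (rule left_module_free)
  show ?thesis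
  proof (cases "\<one> = \<zero>")
    \<comment> \<open>Over the zero ring all basis vectors coincide, and the reindexing used below
      would fail; there the module is zero and the empty set generates.\<close>
    case True
    then have "carrier R = {\<zero>}" by (simp add: carrier_one_zero)
    have "\<exists>c\<in>{} \<rightarrow> carrier R. m = (\<Oplus>\<^bsub>Fm X\<^esub>s\<in>{}. c s \<odot>\<^bsub>Fm X\<^esub> s)" if "m \<in> carrier (Fm X)" for m
    proof -
      have "m = (\<lambda>i. \<zero>)" using that \<open>carrier R = {\<zero>}\<close> by (simp add: free_carrier fun_eq_iff)
      then show ?thesis by (intro bexI[of _ "\<lambda>_. \<zero>"]) simp_all
    qed
    then show ?thesis unfolding fg_module_def by (intro exI[of _ "{}"] conjI) blast+
  next
    case False
    have inj: "inj_on (delta R) X" using False by (auto simp: inj_on_def delta_def fun_eq_iff)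
    have "\<exists>c\<in>delta R ` X \<rightarrow> carrier R. m = (\<Oplus>\<^bsub>Fm X\<^esub>s\<in>delta R ` X. c s \<odot>\<^bsub>Fm X\<^esub> s)"
      if m: "m \<in> carrier (Fm X)" for m
    proof (intro bexI)
      let ?c = "\<lambda>s. m (the_inv_into X (delta R) s)"
      show c: "?c \<in> delta R ` X \<rightarrow> carrier R" using m by (simp add: free_carrier)
      have cl: "?c s \<odot>\<^bsub>Fm X\<^esub> s \<in> carrier (Fm X)" if "s \<in> delta R ` X" for s
        using c that by (intro F.smult_closed) auto
      have "m = free_lin R (Fm X) (delta R) m"
        by (rule free_hom_eq[OF left_module_free mod_hom_id m refl])
      also have "\<dots> = (\<Oplus>\<^bsub>Fm X\<^esub>x\<in>X. m x \<odot>\<^bsub>Fm X\<^esub> delta R x)"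
      proof (rule free_lin_superset[OF left_module_free m _ assms])
        show "{i. m i \<noteq> \<zero>} \<subseteq> X" using m by (auto simp: free_carrier)
      qed simp_all
      also have "\<dots> = (\<Oplus>\<^bsub>Fm X\<^esub>x\<in>X. ?c (delta R x) \<odot>\<^bsub>Fm X\<^esub> delta R x)"
        by (rule F.M.finsum_cong'[OF refl]) (use cl in \<open>auto simp: the_inv_into_f_f[OF inj] simp del: free_simps\<close>)
      also have "\<dots> = (\<Oplus>\<^bsub>Fm X\<^esub>s\<in>delta R ` X. ?c s \<odot>\<^bsub>Fm X\<^esub> s)"
        by (rule F.M.finsum_reindex[OF _ inj, symmetric]) (use cl in \<open>auto simp del: free_simps\<close>)
      finally show "m = (\<Oplus>\<^bsub>Fm X\<^esub>s\<in>delta R ` X. ?c s \<odot>\<^bsub>Fm X\<^esub> s)" .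
    qed
    then show ?thesis using assms unfolding fg_module_def by (intro exI[of _ "delta R ` X"]) auto
  qed
qed

end

text \<open>The cube is assumed regular from both ends: over R it resolves the cyclic module M, and
  over the opposite ring it makes the dual complex exact below the top degree. The points w0, w1, w2
  label coordinates in the index type prescribed for resolutions.\<close>

locale koszul_module = koszul R x0 x1 x2 x3 y y' z z' + Op: koszul "op_alg R" x3 x1 x2 x0 z' z y' y +
    M: left_module R M
  for R :: "('k, 'r) module" (structure) and x0 x1 x2 x3 y y' z z' and M :: "('r, 'm) module" +
  fixes m0 and w0 w1 w2 :: 'i
  assumes m0: "m0 \<in> carrier M"
    and generates: "\<And>m. m \<in> carrier M \<Longrightarrow> \<exists>r\<in>carrier R. m = r \<odot>\<^bsub>M\<^esub> m0"
    and annihilator: "\<And>r. r \<in> carrier R \<Longrightarrow> r \<odot>\<^bsub>M\<^esub> m0 = \<zero>\<^bsub>M\<^esub> \<longleftrightarrow>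
      (\<exists>s\<in>carrier R. \<exists>t\<in>carrier R. \<exists>u\<in>carrier R. r = s \<otimes> x0 \<oplus> (t \<otimes> y \<oplus> u \<otimes> z))"
    and w: "w0 \<noteq> w1" "w0 \<noteq> w2" "w1 \<noteq> w2"
begin

abbreviation "reg \<equiv> regular_module R"

definition index :: "nat \<Rightarrow> 'i set" where
  "index n = (if n = 0 \<or> n = 3 then {w0} else if n = 1 \<or> n = 2 then {w0, w1, w2} else {})"

definition "KP n = Fm (index n)"

definition vec :: "'r \<Rightarrow> 'r \<Rightarrow> 'r \<Rightarrow> 'i \<Rightarrow> 'r" where
  "vec r s t = (\<lambda>i. if i = w0 then r else if i = w1 then s else if i = w2 then t else \<zero>)"

text \<open>In degree one the coordinates w0, w1, w2 belong to x, y, z; in degree two to the pairs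
  (x, y), (x, z), (y, z), matching s01, s02, s12 in \<open>exact_1\<close>.\<close>

definition Kd :: "nat \<Rightarrow> ('i \<Rightarrow> 'r) \<Rightarrow> 'i \<Rightarrow> 'r" where
  "Kd n v =
    (if n = 0 then vec (v w0 \<otimes> x0 \<oplus> (v w1 \<otimes> y \<oplus> v w2 \<otimes> z)) \<zero> \<zero>
     else if n = 1 then vec (v w0 \<otimes> y \<oplus> v w1 \<otimes> z) (\<ominus> (v w0 \<otimes> x1) \<oplus> \<ominus> (v w2 \<otimes> z'))
       (\<ominus> (v w1 \<otimes> x2) \<oplus> v w2 \<otimes> y')
     else if n = 2 then vec (v w0 \<otimes> z') (\<ominus> (v w0 \<otimes> y')) (\<ominus> (v w0 \<otimes> x3))
     else (\<lambda>i. \<zero>))"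

definition "Ke v = v w0 \<odot>\<^bsub>M\<^esub> m0"

lemma vec_simps [simp]: "vec r s t w0 = r" "vec r s t w1 = s" "vec r s t w2 = t"
  using w by (simp_all add: vec_def)

lemma vec_eq_iff: "vec r s t = vec r' s' t' \<longleftrightarrow> r = r' \<and> s = s' \<and> t = t'"
proof
  assume e: "vec r s t = vec r' s' t'"
  show "r = r' \<and> s = s' \<and> t = t'"
    using fun_cong[OF e, of w0] fun_cong[OF e, of w1] fun_cong[OF e, of w2] by simp
qed simp

lemma vec_zero: "(\<lambda>i. \<zero>) = vec \<zero> \<zero> \<zero>"
  by (simp add: vec_def fun_eq_iff)

lemma KP_zero: "\<zero>\<^bsub>KP n\<^esub> = vec \<zero> \<zero> \<zero>"
  by (simp add: KP_def vec_zero)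

lemma vec_finite: "finite {i. vec r s t i \<noteq> \<zero>}"
  by (rule finite_subset[of _ "{w0, w1, w2}"]) (auto simp: vec_def)

lemma vec_carrier:
  "r \<in> carrier R \<Longrightarrow> s \<in> carrier R \<Longrightarrow> t \<in> carrier R \<Longrightarrow> n = 1 \<or> n = 2 \<Longrightarrow> vec r s t \<in> carrier (KP n)"
  "r \<in> carrier R \<Longrightarrow> n = 0 \<or> n = 3 \<Longrightarrow> vec r \<zero> \<zero> \<in> carrier (KP n)"
proof -
  assume r: "r \<in> carrier R" and n: "n = 0 \<or> n = 3"
  have "index n = {w0}" using n by (simp add: index_def)
  then show "vec r \<zero> \<zero> \<in> carrier (KP n)"
    unfolding KP_def free_carrier using r by (intro conjI allI impI vec_finite) (simp_all add: vec_def)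
next
  assume r: "r \<in> carrier R" "s \<in> carrier R" "t \<in> carrier R" and n: "n = 1 \<or> n = 2"
  have "index n = {w0, w1, w2}" using n by (auto simp: index_def)
  then show "vec r s t \<in> carrier (KP n)"
    unfolding KP_def free_carrier using r by (intro conjI allI impI vec_finite) (simp_all add: vec_def)
qed

lemma KP_cases:
  assumes "v \<in> carrier (KP n)"
  shows "n = 1 \<or> n = 2 \<Longrightarrow> v = vec (v w0) (v w1) (v w2)"
    and "n = 0 \<or> n = 3 \<Longrightarrow> v = vec (v w0) \<zero> \<zero>"
    and "n > 3 \<Longrightarrow> v = vec \<zero> \<zero> \<zero>"
proof -
  have v: "v i = \<zero>" if "i \<notin> index n" for i using assms that by (simp add: KP_def free_carrier)
  show "v = vec (v w0) (v w1) (v w2)" if n: "n = 1 \<or> n = 2"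
  proof
    fix i
    have "index n = {w0, w1, w2}" using n by (auto simp: index_def)
    then show "v i = vec (v w0) (v w1) (v w2) i" using v[of i] by (simp add: vec_def)
  qed
  show "v = vec (v w0) \<zero> \<zero>" if n: "n = 0 \<or> n = 3"
  proof
    fix i
    have "index n = {w0}" using n by (simp add: index_def)
    then show "v i = vec (v w0) \<zero> \<zero> i" using v[of i] by (simp add: vec_def)
  qed
  show "v = vec \<zero> \<zero> \<zero>" if n: "n > 3"
  proof
    fix i
    have "index n = {}" using n by (simp add: index_def)
    then show "v i = vec \<zero> \<zero> \<zero> i" using v[of i] by (simp add: vec_def)
  qed
qed

lemma KP_closed: "v \<in> carrier (KP n) \<Longrightarrow> v i \<in> carrier R"
  by (simp add: KP_def free_carrier)

lemma left_module_KP: "left_module R (KP n)" by (simp add: KP_def left_module_free)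

lemma KP_zero_closed: "\<zero>\<^bsub>KP n\<^esub> \<in> carrier (KP n)"
proof -
  interpret left_module R "KP n" by (rule left_module_KP)
  show ?thesis by (rule M.zero_closed)
qed

lemma Kd_hom: "Kd n \<in> mod_hom R (KP (Suc n)) (KP n)"
proof (rule mod_homI)
  fix v r assume v: "v \<in> carrier (KP (Suc n))"
  note vc = KP_closed[OF v]
  show "Kd n v \<in> carrier (KP n)"
    using vc vec_carrier(1)[of _ _ _ n] vec_carrier(2)[of _ n] KP_zero_closed[of n]
    by (cases "n = 0 \<or> n = 1 \<or> n = 2") (auto simp: Kd_def vec_zero KP_zero)
  show "Kd n (v \<oplus>\<^bsub>KP (Suc n)\<^esub> u) = Kd n v \<oplus>\<^bsub>KP n\<^esub> Kd n u" if u: "u \<in> carrier (KP (Suc n))" for u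
    using vc KP_closed[OF u]
    by (auto simp: Kd_def KP_def vec_def fun_eq_iff l_distr minus_add a_ac)
  show "Kd n (r \<odot>\<^bsub>KP (Suc n)\<^esub> v) = r \<odot>\<^bsub>KP n\<^esub> Kd n v" if "r \<in> carrier R"
    using vc that by (auto simp: Kd_def KP_def vec_def fun_eq_iff r_distr r_minus m_assoc)
qed

lemma Ke_hom: "Ke \<in> mod_hom R (KP 0) M"
  by (rule mod_homI)
    (simp_all add: Ke_def KP_closed m0 M.smult_closed, simp_all add: KP_def free_carrier m0 M.smult_l_distr M.smult_assoc)

lemma cancel3:
  assumes "r \<in> carrier R" "s \<in> carrier R" "t \<in> carrier R"
  shows "(r \<oplus> s) \<oplus> ((\<ominus> r \<oplus> \<ominus> t) \<oplus> (\<ominus> s \<oplus> t)) = \<zero>"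
proof -
  have "(r \<oplus> s) \<oplus> ((\<ominus> r \<oplus> \<ominus> t) \<oplus> (\<ominus> s \<oplus> t)) = (r \<oplus> \<ominus> r) \<oplus> ((s \<oplus> \<ominus> s) \<oplus> (t \<oplus> \<ominus> t))"
    using assms by (simp only: a_ac a_inv_closed a_closed)
  then show ?thesis using assms by (simp add: r_neg)
qed

lemma Kd_Kd:
  assumes v: "v \<in> carrier (KP (Suc (Suc n)))"
  shows "Kd n (Kd (Suc n) v) = vec \<zero> \<zero> \<zero>"
proof -
  note vc = KP_closed[OF v]
  consider "n = 0" | "n = 1" | "n \<ge> 2" by linarith
  then show ?thesis
  proof cases
    case 1
    have "(v w0 \<otimes> y \<oplus> v w1 \<otimes> z) \<otimes> x0 \<oplus> ((\<ominus> (v w0 \<otimes> x1) \<oplus> \<ominus> (v w2 \<otimes> z')) \<otimes> y \<oplus> (\<ominus> (v w1 \<otimes> x2) \<oplus> v w2 \<otimes> y') \<otimes> z)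
      = \<zero>"
      using vc cancel3[of "v w0 \<otimes> (x1 \<otimes> y)" "v w1 \<otimes> (x2 \<otimes> z)" "v w2 \<otimes> (z' \<otimes> y)"]
      by (simp add: l_distr l_minus m_assoc comm)
    then show ?thesis using 1 by (simp add: Kd_def vec_eq_iff)
  next
    case 2
    then show ?thesis using vc by (simp add: Kd_def vec_eq_iff l_minus m_assoc comm r_neg l_neg)
  next
    case 3
    then show ?thesis using vc by (auto simp: Kd_def vec_zero)
  qed
qed

lemma Ke_surj: "Ke ` carrier (KP 0) = carrier M"
proof
  show "Ke ` carrier (KP 0) \<subseteq> carrier M" using mod_homD(1)[OF Ke_hom] by blast
  show "carrier M \<subseteq> Ke ` carrier (KP 0)"
  proof
    fix m assume "m \<in> carrier M"
    then obtain r where r: "r \<in> carrier R" "m = r \<odot>\<^bsub>M\<^esub> m0" using generates by blast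
    then show "m \<in> Ke ` carrier (KP 0)"
      by (intro image_eqI[of _ _ "vec r \<zero> \<zero>"]) (simp_all add: Ke_def vec_carrier)
  qed
qed

lemma exact_Ke: "Kd 0 ` carrier (KP (Suc 0)) = {v \<in> carrier (KP 0). Ke v = \<zero>\<^bsub>M\<^esub>}"
proof (rule Set.set_eqI, rule iffI)
  fix v assume "v \<in> Kd 0 ` carrier (KP (Suc 0))"
  then obtain u where u: "u \<in> carrier (KP (Suc 0))" "v = Kd 0 u" by blast
  note uc = KP_closed[OF u(1)]
  have "u w0 \<otimes> x0 \<oplus> (u w1 \<otimes> y \<oplus> u w2 \<otimes> z) \<in> carrier R" using uc by simp
  then have "(u w0 \<otimes> x0 \<oplus> (u w1 \<otimes> y \<oplus> u w2 \<otimes> z)) \<odot>\<^bsub>M\<^esub> m0 = \<zero>\<^bsub>M\<^esub>"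
    using annihilator uc by blast
  then show "v \<in> {v \<in> carrier (KP 0). Ke v = \<zero>\<^bsub>M\<^esub>}"
    using u mod_homD(1)[OF Kd_hom[of 0] u(1)] by (simp add: Ke_def Kd_def)
next
  fix v assume "v \<in> {v \<in> carrier (KP 0). Ke v = \<zero>\<^bsub>M\<^esub>}"
  then have v: "v \<in> carrier (KP 0)" "v w0 \<odot>\<^bsub>M\<^esub> m0 = \<zero>\<^bsub>M\<^esub>" by (simp_all add: Ke_def)
  then obtain s t u where e: "s \<in> carrier R" "t \<in> carrier R" "u \<in> carrier R" "v w0 = s \<otimes> x0 \<oplus> (t \<otimes> y \<oplus> u \<otimes> z)"
    using annihilator[OF KP_closed[OF v(1)]] by blast
  have "v = vec (v w0) \<zero> \<zero>" using KP_cases(2)[OF v(1)] by simp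
  then have "v = Kd 0 (vec s t u)" by (simp add: Kd_def e(4))
  then show "v \<in> Kd 0 ` carrier (KP (Suc 0))" using e vec_carrier(1) by (intro image_eqI) auto
qed

lemma exact_Kd: "Kd (Suc n) ` carrier (KP (Suc (Suc n))) = {v \<in> carrier (KP (Suc n)). Kd n v = \<zero>\<^bsub>KP n\<^esub>}"
proof (rule Set.set_eqI, rule iffI)
  fix v assume "v \<in> Kd (Suc n) ` carrier (KP (Suc (Suc n)))"
  then show "v \<in> {v \<in> carrier (KP (Suc n)). Kd n v = \<zero>\<^bsub>KP n\<^esub>}"
    using mod_homD(1)[OF Kd_hom] Kd_Kd by (auto simp: KP_zero)
next
  fix v assume "v \<in> {v \<in> carrier (KP (Suc n)). Kd n v = \<zero>\<^bsub>KP n\<^esub>}"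
  then have v: "v \<in> carrier (KP (Suc n))" "Kd n v = vec \<zero> \<zero> \<zero>" by (simp_all add: KP_zero)
  note vc = KP_closed[OF v(1)]
  have "\<exists>u\<in>carrier (KP (Suc (Suc n))). v = Kd (Suc n) u"
  proof -
    consider "n = 0" | "n = 1" | "n = 2" | "n > 2" by linarith
    then show ?thesis
    proof cases
      case 1
      then have "v w0 \<otimes> x0 \<oplus> (v w1 \<otimes> y \<oplus> v w2 \<otimes> z) = \<zero>" using v(2) by (simp add: Kd_def vec_eq_iff)
      from exact_1[OF vc vc vc this] obtain s t u where e: "s \<in> carrier R" "t \<in> carrier R" "u \<in> carrier R"
        "v w0 = s \<otimes> y \<oplus> t \<otimes> z" "v w1 = \<ominus> (s \<otimes> x1) \<oplus> \<ominus> (u \<otimes> z')" "v w2 = \<ominus> (t \<otimes> x2) \<oplus> u \<otimes> y'" by blast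
      have "v = vec (v w0) (v w1) (v w2)" using KP_cases(1)[OF v(1)] 1 by simp
      also have "\<dots> = Kd (Suc n) (vec s t u)" unfolding e(4-6) 1 by (simp add: Kd_def)
      finally show ?thesis by (intro bexI[of _ "vec s t u"]) (simp_all add: 1 vec_carrier(1)[OF e(1-3)])
    next
      case 2
      then have "v w0 \<otimes> y \<oplus> v w1 \<otimes> z = \<zero>" "\<ominus> (v w1 \<otimes> x2) \<oplus> v w2 \<otimes> y' = \<zero>"
        using v(2) by (simp_all add: Kd_def vec_eq_iff)
      from exact_2[OF vc vc vc this] obtain t where e: "t \<in> carrier R"
        "v w0 = t \<otimes> z'" "v w1 = \<ominus> (t \<otimes> y')" "v w2 = \<ominus> (t \<otimes> x3)" by blast
      have "v = vec (v w0) (v w1) (v w2)" using KP_cases(1)[OF v(1)] 2 by simp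
      also have "\<dots> = Kd (Suc n) (vec t \<zero> \<zero>)" unfolding e(2-4) 2 by (simp add: Kd_def)
      finally show ?thesis by (intro bexI[of _ "vec t \<zero> \<zero>"]) (simp_all add: 2 vec_carrier(2)[OF e(1)])
    next
      case 3
      \<comment> \<open>Injectivity of the last differential: its second coordinate alone allows y'
        to be cancelled.\<close>
      then have "\<ominus> (v w0 \<otimes> y') = \<zero>" using v(2) by (simp add: Kd_def vec_eq_iff)
      then have "v w0 \<otimes> y' = \<zero>" using vc minus_minus[of "v w0 \<otimes> y'"] by simp
      then have "v w0 = \<zero>" by (rule reg_y'[OF vc])
      then have "v = vec \<zero> \<zero> \<zero>" using KP_cases(2)[OF v(1)] 3 by simp
      then have "v = Kd (Suc n) (\<zero>\<^bsub>KP (Suc (Suc n))\<^esub>)" using 3 by (simp add: Kd_def vec_zero)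
      then show ?thesis using KP_zero_closed by (intro bexI)
    next
      case 4
      then have "v = vec \<zero> \<zero> \<zero>" using KP_cases(3)[OF v(1)] by simp
      then have "v = Kd (Suc n) (\<zero>\<^bsub>KP (Suc (Suc n))\<^esub>)" using 4 by (simp add: Kd_def vec_zero)
      then show ?thesis using KP_zero_closed by (intro bexI)
    qed
  qed
  then show "v \<in> Kd (Suc n) ` carrier (KP (Suc (Suc n)))" by blast
qed

lemma projective_resolution_K: "projective_resolution R M (KP, Kd, Ke)"
  using Kd_hom Ke_hom Ke_surj exact_Ke exact_Kd projective_free[of "index _", folded KP_def]
  by (simp add: projective_resolution_def)

lemma fg_KP: "fg_module R (KP n)"
  unfolding KP_def by (rule fg_free) (simp add: index_def)

lemma KP_trivial: "n > 3 \<Longrightarrow> carrier (KP n) = {\<zero>\<^bsub>KP n\<^esub>}"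
  using KP_cases(3)[of _ n] KP_zero_closed[of n] unfolding KP_zero by blast

sublocale K: resolution R M KP Kd Ke
  by (rule resolution.intro[OF projective_resolution_K M.left_module_axioms])

end

lemma op_alg_minus: "a_inv (op_alg R) = a_inv R"
  by (simp add: a_inv_def m_inv_def fun_eq_iff)

section \<open>Exactness of the dual complex below the top and its top cohomology\<close>

context koszul_module
begin

abbreviation "E0 \<equiv> vec \<one> \<zero> \<zero>"
abbreviation "E1 \<equiv> vec \<zero> \<one> \<zero>"
abbreviation "E2 \<equiv> vec \<zero> \<zero> \<one>"

lemma hom_value:
  assumes f: "f \<in> mod_hom R (KP n) reg" and v: "v \<in> carrier (KP n)"
  shows "n = 0 \<or> n = 3 \<Longrightarrow> f v = v w0 \<otimes> f E0"
    and "n = 1 \<or> n = 2 \<Longrightarrow> f v = v w0 \<otimes> f E0 \<oplus> (v w1 \<otimes> f E1 \<oplus> v w2 \<otimes> f E2)"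
proof -
  note vc = KP_closed[OF v] and fh = mod_homD[OF f, simplified]
  interpret KP: left_module R "KP n" by (rule left_module_KP)
  {
    assume n: "n = 0 \<or> n = 3"
    have "v = vec (v w0) \<zero> \<zero>" using KP_cases(2)[OF v n] .
    also have "\<dots> = v w0 \<odot>\<^bsub>KP n\<^esub> E0" using vc by (auto simp: KP_def vec_def)
    finally have "f v = f (v w0 \<odot>\<^bsub>KP n\<^esub> E0)" by (rule arg_cong)
    also have "\<dots> = v w0 \<otimes> f E0" using n vc by (intro fh(3) vec_carrier(2)) auto
    finally show "f v = v w0 \<otimes> f E0" .
  next
    assume n: "n = 1 \<or> n = 2"
    have E: "E0 \<in> carrier (KP n)" "E1 \<in> carrier (KP n)" "E2 \<in> carrier (KP n)"
      by (rule vec_carrier(1)[OF _ _ _ n]; simp)+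
    have "v = vec (v w0) (v w1) (v w2)" using KP_cases(1)[OF v n] .
    also have "\<dots> = v w0 \<odot>\<^bsub>KP n\<^esub> E0 \<oplus>\<^bsub>KP n\<^esub> (v w1 \<odot>\<^bsub>KP n\<^esub> E1 \<oplus>\<^bsub>KP n\<^esub> v w2 \<odot>\<^bsub>KP n\<^esub> E2)"
      using vc by (auto simp: KP_def vec_def)
    finally have "f v = f (v w0 \<odot>\<^bsub>KP n\<^esub> E0 \<oplus>\<^bsub>KP n\<^esub> (v w1 \<odot>\<^bsub>KP n\<^esub> E1 \<oplus>\<^bsub>KP n\<^esub> v w2 \<odot>\<^bsub>KP n\<^esub> E2))"
      by (rule arg_cong)
    also have "\<dots> = v w0 \<otimes> f E0 \<oplus> (v w1 \<otimes> f E1 \<oplus> v w2 \<otimes> f E2)"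
      using vc E by (simp only: fh(2,3) KP.smult_closed KP.M.a_closed)
    finally show "f v = v w0 \<otimes> f E0 \<oplus> (v w1 \<otimes> f E1 \<oplus> v w2 \<otimes> f E2)" .
  }
qed

lemma coordinate_hom:
  assumes "g0 \<in> carrier R"
  shows "(\<lambda>v. v w0 \<otimes> g0) \<in> mod_hom R (KP n) reg"
  by (rule mod_homI) (simp_all add: KP_closed assms, simp_all add: KP_def free_carrier assms l_distr m_assoc)

lemma coordinates_hom:
  assumes "g0 \<in> carrier R" "g1 \<in> carrier R" "g2 \<in> carrier R"
  shows "(\<lambda>v. v w0 \<otimes> g0 \<oplus> (v w1 \<otimes> g1 \<oplus> v w2 \<otimes> g2)) \<in> mod_hom R (KP n) reg"
  by (rule mod_homI)
    (simp_all add: KP_closed assms, simp_all add: KP_def free_carrier assms l_distr r_distr m_assoc a_ac)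

lemma Z_value: "c \<in> K.Z n \<Longrightarrow> v \<in> carrier (KP (Suc n)) \<Longrightarrow> c (Kd n v) = \<zero>"
  by (simp add: K.Z_iff)

lemma Z_closed: "c \<in> K.Z n \<Longrightarrow> v \<in> carrier (KP n) \<Longrightarrow> c v \<in> carrier R"
  using mod_homD(1)[OF K.Z_hom] by simp

text \<open>Evaluating the coboundary of c at the third basis vector gives z times c(E0), and z
  cancels on the left by \<open>Op.reg_y'\<close>.\<close>

lemma dual_exact_0: "K.Z 0 \<subseteq> K.B 0"
proof
  fix c assume c: "c \<in> K.Z 0"
  have cE: "c E0 \<in> carrier R" by (rule Z_closed[OF c]) (simp add: vec_carrier)
  have e: "E2 \<in> carrier (KP (Suc 0))" by (rule vec_carrier) simp_all
  have "z \<otimes> c E0 = \<zero>"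
    using Z_value[OF c e] hom_value(1)[OF K.Z_hom[OF c] mod_homD(1)[OF Kd_hom e]] by (simp add: Kd_def)
  then have "c E0 = \<zero>" using Op.reg_y'[of "c E0"] cE by simp
  then show "c \<in> K.B 0"
    using K.Z_ext[OF c] hom_value(1)[OF K.Z_hom[OF c]] KP_closed by (simp add: K.B_0)
qed

text \<open>The transposed differentials agree with those of the cube over the opposite ring only
  after sign changes: the triple (c E1, - c E2, - c E0) satisfies the hypotheses of
  \<open>Op.exact_2\<close>, and its preimage t is the value at E0 of a cochain bounding c.\<close>

lemma dual_exact_1: "K.Z (Suc 0) \<subseteq> K.B (Suc 0)"
proof
  fix c assume c: "c \<in> K.Z (Suc 0)"
  have E: "E0 \<in> carrier (KP n)" "E1 \<in> carrier (KP n)" "E2 \<in> carrier (KP n)" if "n = 1 \<or> n = 2" for n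
    by (rule vec_carrier(1)[OF _ _ _ that]; simp)+
  have cE: "c E0 \<in> carrier R" "c E1 \<in> carrier R" "c E2 \<in> carrier R"
    by (rule Z_closed[OF c], rule E, simp)+
  have val: "Kd (Suc 0) v w0 \<otimes> c E0 \<oplus> (Kd (Suc 0) v w1 \<otimes> c E1 \<oplus> Kd (Suc 0) v w2 \<otimes> c E2) = \<zero>"
    if v: "v \<in> carrier (KP (Suc (Suc 0)))" for v
    using Z_value[OF c v] hom_value(2)[OF K.Z_hom[OF c] mod_homD(1)[OF Kd_hom v]] by simp
  have 1: "\<ominus> (z' \<otimes> c E1) \<oplus> y' \<otimes> c E2 = \<zero>" and 2: "z \<otimes> c E0 \<oplus> \<ominus> (x2 \<otimes> c E2) = \<zero>"
    using val[of E2] val[of E1] E[of "Suc (Suc 0)"] cE by (simp_all add: Kd_def l_minus)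
  have 1: "z' \<otimes> c E1 \<oplus> y' \<otimes> \<ominus> (c E2) = \<zero>"
    using arg_cong[OF 1, of "\<lambda>u. \<ominus> u"] cE by (simp add: r_minus minus_add)
  have 2: "\<ominus> (x2 \<otimes> \<ominus> (c E2)) \<oplus> z \<otimes> \<ominus> (c E0) = \<zero>"
    using 2 eq_minusI[of "z \<otimes> c E0" "\<ominus> (x2 \<otimes> c E2)"] cE by (simp add: r_minus r_neg)
  obtain t where t: "t \<in> carrier R" "c E1 = y \<otimes> t" "\<ominus> (c E2) = \<ominus> (z \<otimes> t)" "\<ominus> (c E0) = \<ominus> (x0 \<otimes> t)"
    using Op.exact_2[of "c E1" "\<ominus> (c E2)" "\<ominus> (c E0)"] cE 1 2 by (auto simp: op_alg_minus)
  have t': "c E2 = z \<otimes> t" "c E0 = x0 \<otimes> t"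
    using t cE minus_minus[of "c E2"] minus_minus[of "c E0"] by simp_all
  show "c \<in> K.B (Suc 0)"
    unfolding K.B_Suc
  proof (intro conjI K.Z_ext[OF c] bexI[OF _ coordinate_hom[OF t(1)]] ballI)
    fix v assume v: "v \<in> carrier (KP (Suc 0))"
    have "c v = v w0 \<otimes> c E0 \<oplus> (v w1 \<otimes> c E1 \<oplus> v w2 \<otimes> c E2)"
      by (rule hom_value(2)[OF K.Z_hom[OF c] v]) simp
    then show "c v = Kd 0 v w0 \<otimes> t"
      unfolding t(2) t' using KP_closed[OF v] t(1) by (simp add: Kd_def l_distr m_assoc)
  qed
qed

text \<open>Again up to signs: (- c E2, c E0, - c E1) is a syzygy of x3, z', y' over the opposite
  ring, and \<open>Op.exact_1\<close> gives s, t, u, from which the bounding functional has values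
  -u, s, -t.\<close>

lemma dual_exact_2: "K.Z (Suc (Suc 0)) \<subseteq> K.B (Suc (Suc 0))"
proof
  fix c assume c: "c \<in> K.Z (Suc (Suc 0))"
  have cE: "c E0 \<in> carrier R" "c E1 \<in> carrier R" "c E2 \<in> carrier R"
    by (rule Z_closed[OF c], rule vec_carrier; simp)+
  have e: "E0 \<in> carrier (KP (Suc (Suc (Suc 0))))" by (rule vec_carrier) simp_all
  have "z' \<otimes> c E0 \<oplus> (\<ominus> (y' \<otimes> c E1) \<oplus> \<ominus> (x3 \<otimes> c E2)) = \<zero>"
    using Z_value[OF c e] hom_value(2)[OF K.Z_hom[OF c] mod_homD(1)[OF Kd_hom e]] cE
    by (simp add: Kd_def l_minus)
  then have "x3 \<otimes> \<ominus> (c E2) \<oplus> (z' \<otimes> c E0 \<oplus> y' \<otimes> \<ominus> (c E1)) = \<zero>"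
    using cE by (simp add: r_minus a_ac)
  then obtain s t u where e: "s \<in> carrier R" "t \<in> carrier R" "u \<in> carrier R"
    "\<ominus> (c E2) = z' \<otimes> s \<oplus> y' \<otimes> t" "c E0 = \<ominus> (x1 \<otimes> s) \<oplus> \<ominus> (y \<otimes> u)"
    "\<ominus> (c E1) = \<ominus> (x2 \<otimes> t) \<oplus> z \<otimes> u"
    using Op.exact_1[of "\<ominus> (c E2)" "c E0" "\<ominus> (c E1)"] cE by (auto simp: op_alg_minus)
  have e': "c E2 = \<ominus> (z' \<otimes> s \<oplus> y' \<otimes> t)" "c E1 = \<ominus> (\<ominus> (x2 \<otimes> t) \<oplus> z \<otimes> u)"
    using cE minus_minus[of "c E2"] minus_minus[of "c E1"] by (simp_all add: e(4,6))
  have m: "\<ominus> u \<in> carrier R" "s \<in> carrier R" "\<ominus> t \<in> carrier R" using e by simp_all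
  show "c \<in> K.B (Suc (Suc 0))"
    unfolding K.B_Suc
  proof (intro conjI K.Z_ext[OF c] bexI[OF _ coordinates_hom[OF m]] ballI)
    fix v assume v: "v \<in> carrier (KP (Suc (Suc 0)))"
    have "c v = v w0 \<otimes> c E0 \<oplus> (v w1 \<otimes> c E1 \<oplus> v w2 \<otimes> c E2)"
      by (rule hom_value(2)[OF K.Z_hom[OF c] v]) simp
    then show "c v = Kd (Suc 0) v w0 \<otimes> \<ominus> u \<oplus> (Kd (Suc 0) v w1 \<otimes> s \<oplus> Kd (Suc 0) v w2 \<otimes> \<ominus> t)"
      unfolding e(5) e' using KP_closed[OF v] e(1-3)
      by (simp add: Kd_def l_distr r_distr l_minus r_minus m_assoc minus_add a_ac)
  qed
qed

lemma dual_exact_high: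
  assumes "n > 3"
  shows "K.Z n \<subseteq> K.B n"
proof
  fix c assume c: "c \<in> K.Z n"
  obtain m where m: "n = Suc m" using assms by (cases n) auto
  have "c v = \<zero>" if v: "v \<in> carrier (KP n)" for v
    using v KP_trivial[OF assms] mod_hom_zero[OF left_module_KP K.regular K.Z_hom[OF c]] by auto
  then show "c \<in> K.B n"
    using K.Z_ext[OF c] unfolding m K.B_Suc
    by (intro conjI bexI[OF _ mod_hom_zero_map[OF left_module_KP]]) simp_all
qed

lemma dual_exact: "n \<noteq> 3 \<Longrightarrow> K.Z n \<subseteq> K.B n"
  using dual_exact_0 dual_exact_1 dual_exact_2 dual_exact_high[of n]
  by (cases "n > 3") (auto simp: numeral_3_eq_3 less_Suc_eq not_less_eq)

lemma dual_cocycle_3: 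
  assumes "f \<in> mod_hom R (KP 3) reg"
  shows "restrict f (carrier (KP 3)) \<in> K.Z 3"
proof (rule K.Z_restrict[OF assms])
  show "f (Kd 3 v) = \<zero>" for v
    using mod_hom_zero[OF left_module_KP K.regular assms] by (simp add: Kd_def KP_zero vec_zero)
qed

text \<open>A functional on the last module is determined by its value at E0, and the coboundaries
  fill the right ideal generated by x3, z' and y'. This is the ideal that \<open>nu_kernel\<close>
  describes as a kernel.\<close>

lemma dual_coboundary_3:
  assumes c: "c \<in> K.Z 3"
  shows "c \<in> K.B 3 \<longleftrightarrow> (\<exists>s\<in>carrier R. \<exists>t\<in>carrier R. \<exists>u\<in>carrier R. c E0 = x3 \<otimes> s \<oplus> (z' \<otimes> t \<oplus> y' \<otimes> u))"
proof -
  have 3: "3 = Suc (Suc (Suc 0))" by simp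
  have e: "E0 \<in> carrier (KP 3)" by (rule vec_carrier) simp_all
  show ?thesis
  proof
    assume "c \<in> K.B 3"
    then obtain g where g: "g \<in> mod_hom R (KP (Suc (Suc 0))) reg" "\<And>v. v \<in> carrier (KP 3) \<Longrightarrow> c v = g (Kd (Suc (Suc 0)) v)"
      unfolding 3 K.B_Suc by blast
    have gE: "g E0 \<in> carrier R" "g E1 \<in> carrier R" "g E2 \<in> carrier R"
      using mod_homD(1)[OF g(1)] vec_carrier(1)[of _ _ _ "Suc (Suc 0)"] by simp_all
    have "c E0 = z' \<otimes> g E0 \<oplus> (\<ominus> y' \<otimes> g E1 \<oplus> \<ominus> x3 \<otimes> g E2)"
      using g(2)[OF e] hom_value(2)[OF g(1) mod_homD(1)[OF Kd_hom e[unfolded 3]]] by (simp add: Kd_def)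
    also have "\<dots> = x3 \<otimes> \<ominus> (g E2) \<oplus> (z' \<otimes> g E0 \<oplus> y' \<otimes> \<ominus> (g E1))"
      using gE by (simp add: l_minus r_minus a_ac)
    finally show "\<exists>s\<in>carrier R. \<exists>t\<in>carrier R. \<exists>u\<in>carrier R. c E0 = x3 \<otimes> s \<oplus> (z' \<otimes> t \<oplus> y' \<otimes> u)"
      using gE a_inv_closed by blast
  next
    assume "\<exists>s\<in>carrier R. \<exists>t\<in>carrier R. \<exists>u\<in>carrier R. c E0 = x3 \<otimes> s \<oplus> (z' \<otimes> t \<oplus> y' \<otimes> u)"
    then obtain s t u where s: "s \<in> carrier R" "t \<in> carrier R" "u \<in> carrier R"
      "c E0 = x3 \<otimes> s \<oplus> (z' \<otimes> t \<oplus> y' \<otimes> u)" by blast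
    then have m: "t \<in> carrier R" "\<ominus> u \<in> carrier R" "\<ominus> s \<in> carrier R" by simp_all
    show "c \<in> K.B 3"
      unfolding 3 K.B_Suc
    proof (intro conjI K.Z_ext[OF c[unfolded 3]] bexI[OF _ coordinates_hom[OF m]] ballI)
      fix v assume v: "v \<in> carrier (KP (Suc (Suc (Suc 0))))"
      have "c v = v w0 \<otimes> c E0" by (rule hom_value(1)[OF K.Z_hom[OF c[unfolded 3]] v]) simp
      then show "c v = Kd (Suc (Suc 0)) v w0 \<otimes> t \<oplus>
          (Kd (Suc (Suc 0)) v w1 \<otimes> \<ominus> u \<oplus> Kd (Suc (Suc 0)) v w2 \<otimes> \<ominus> s)"
        unfolding s(4) using KP_closed[OF v] s(1-3)
        by (simp add: Kd_def l_minus r_minus r_distr m_assoc a_ac)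
    qed
  qed
qed

end

section \<open>The Calabi-Yau property\<close>

text \<open>\<open>Ext_ring\<close> uses some resolution about which nothing else is known. Any
  resolution of the right type shows that the choice succeeds, and results are then transferred to
  the chosen one by comparison.\<close>

lemma Ext_ring_resolution:
  fixes R :: "('r, 'x) ring_scheme" and M :: "('r, 'm) module"
    and P :: "nat \<Rightarrow> ('r, ('m, 'r) res_carrier) module"
  assumes "projective_resolution R M (P, d, e)" "left_module R M"
  obtains Q :: "nat \<Rightarrow> ('r, ('m, 'r) res_carrier) module" and d' e' where "resolution R M Q d' e'"
    "\<And>i. Ext_ring R M i =
      quot_mod ((dual_module R (Q i))\<lparr>carrier := dual_cocycles R (Q, d', e') i\<rparr>) (dual_coboundaries R (Q, d', e') i)"
proof -
  define X :: "('r, 'm, ('m, 'r) res_carrier) resolution" where "X = (SOME X. projective_resolution R M X)"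
  have "projective_resolution R M X" unfolding X_def by (rule someI) (rule assms(1))
  moreover obtain Q d' e' where "X = (Q, d', e')" by (cases X) auto
  ultimately show ?thesis
    using that[of Q d' e'] assms(2)
    by (simp add: resolution_def Ext_ring_def dual_cohomology_def X_def[symmetric])
qed

context qsl2_dual
begin

text \<open>Members of the resolutions in \<open>smooth_algebra\<close> and \<open>Ext_ring\<close>
  are functions on lists, so the three coordinates are labelled by lists of length 0, 1 and 2, which
  differ whatever the element type is.\<close>

lemma koszul_module_env:
  "koszul_module R L.x0 L.x1 L.x2 L.x3 (L.vY q) (L.vY p) (L.vZ p') (L.vZ q') (env_module K A) \<one>\<^bsub>A\<^esub>
    [] [undefined] [undefined, undefined]"
proof (intro koszul_module.intro koszul_module_axioms.intro)
  show "koszul R L.x0 L.x1 L.x2 L.x3 (L.vY q) (L.vY p) (L.vZ p') (L.vZ q')" by (rule L.koszul_axioms)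
  show "koszul (op_alg R) L.x3 L.x1 L.x2 L.x0 (L.vZ q') (L.vZ p') (L.vY p) (L.vY q)" by (rule Op.koszul_axioms)
  show "left_module R (env_module K A)" by (rule L.left_module_env)
  show "\<one>\<^bsub>A\<^esub> \<in> carrier (env_module K A)" by (simp add: env_module_def)
  show "\<exists>r\<in>carrier R. m = r \<odot>\<^bsub>env_module K A\<^esub> \<one>\<^bsub>A\<^esub>" if "m \<in> carrier (env_module K A)" for m
    using that by (intro bexI[of _ "L.et m \<one>\<^bsub>A\<^esub>"]) (simp_all add: env_module_def L.env_action_et)
  show "r \<odot>\<^bsub>env_module K A\<^esub> \<one>\<^bsub>A\<^esub> = \<zero>\<^bsub>env_module K A\<^esub> \<longleftrightarrow> (\<exists>s\<in>carrier R. \<exists>t\<in>carrier R. \<exists>u\<in>carrier R.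
      r = s \<otimes>\<^bsub>R\<^esub> L.x0 \<oplus>\<^bsub>R\<^esub> (t \<otimes>\<^bsub>R\<^esub> L.vY q \<oplus>\<^bsub>R\<^esub> u \<otimes>\<^bsub>R\<^esub> L.vZ p'))" if r: "r \<in> carrier R" for r
  proof
    assume "r \<odot>\<^bsub>env_module K A\<^esub> \<one>\<^bsub>A\<^esub> = \<zero>\<^bsub>env_module K A\<^esub>"
    then have "r \<in> L.J" using r by (intro L.action_kernel_J) (simp_all add: env_module_def)
    then show "\<exists>s\<in>carrier R. \<exists>t\<in>carrier R. \<exists>u\<in>carrier R.
      r = s \<otimes>\<^bsub>R\<^esub> L.x0 \<oplus>\<^bsub>R\<^esub> (t \<otimes>\<^bsub>R\<^esub> L.vY q \<oplus>\<^bsub>R\<^esub> u \<otimes>\<^bsub>R\<^esub> L.vZ p')" by (rule L.J_E) blast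
  next
    assume "\<exists>s\<in>carrier R. \<exists>t\<in>carrier R. \<exists>u\<in>carrier R.
      r = s \<otimes>\<^bsub>R\<^esub> L.x0 \<oplus>\<^bsub>R\<^esub> (t \<otimes>\<^bsub>R\<^esub> L.vY q \<oplus>\<^bsub>R\<^esub> u \<otimes>\<^bsub>R\<^esub> L.vZ p')"
    then obtain s t u where e: "s \<in> carrier R" "t \<in> carrier R" "u \<in> carrier R"
      "r = s \<otimes>\<^bsub>R\<^esub> L.x0 \<oplus>\<^bsub>R\<^esub> (t \<otimes>\<^bsub>R\<^esub> L.vY q \<oplus>\<^bsub>R\<^esub> u \<otimes>\<^bsub>R\<^esub> L.vZ p')" by blast
    have z: "env_action K A v \<zero>\<^bsub>A\<^esub> = \<zero>\<^bsub>A\<^esub>" if "v \<in> carrier R" for v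
      using L.action_left_module(2)[OF that _ A.one_closed, of "\<zero>\<^bsub>R\<^esub>"] that by (simp add: L.action_zero)
    have "env_action K A r \<one>\<^bsub>A\<^esub> = \<zero>\<^bsub>A\<^esub>"
      using e(1-3) L.generators_action by (simp add: e(4) L.action_left_module z)
    then show "r \<odot>\<^bsub>env_module K A\<^esub> \<one>\<^bsub>A\<^esub> = \<zero>\<^bsub>env_module K A\<^esub>" by (simp add: env_module_def)
  qed
qed simp_all

sublocale KM: koszul_module R L.x0 L.x1 L.x2 L.x3 "L.vY q" "L.vY p" "L.vZ p'" "L.vZ q'" "env_module K A" "\<one>\<^bsub>A\<^esub>"
    "[]" "[undefined]" "[undefined, undefined]"
  by (rule koszul_module_env)

lemma smooth_A: "smooth_algebra K A"
  unfolding smooth_algebra_def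
  using KM.projective_resolution_K KM.fg_KP KM.KP_trivial by blast

lemma hochschild_trivial:
  assumes "i \<noteq> 3"
  shows "carrier (hochschild_env K A i) = {\<zero>\<^bsub>hochschild_env K A i\<^esub>}"
proof -
  obtain Q d' e' where Q: "resolution R (env_module K A) Q d' e'"
    and ext: "Ext_ring R (env_module K A) i =
      quot_mod ((dual_module R (Q i))\<lparr>carrier := dual_cocycles R (Q, d', e') i\<rparr>) (dual_coboundaries R (Q, d', e') i)"
    using Ext_ring_resolution[OF KM.projective_resolution_K L.left_module_env] by metis
  interpret Q: resolution R "env_module K A" Q d' e' by (rule Q)
  have "Q.Z i \<subseteq> Q.B i"
    by (rule exact_transfer[OF KM.K.resolution_axioms Q KM.dual_exact[OF assms]])
  then have "Q.B i = carrier (Q.ZM i)" using Q.B_subset_Z by auto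
  from quot_mod_trivial[OF Q.abelian_group_Z this] show ?thesis
    by (simp add: hochschild_env_def bimodule_of_right_env_def ext)
qed

text \<open>The right $A^e$-action on \<open>A\<close> for which \<open>nu\<close> is linear; on pure tensors it is the bimodule
  structure of $A_\mu$.\<close>

definition "right_act r n = kap' (env_action K A' (Th r) (kap n))"

lemma nu_right_act: "r \<in> carrier R \<Longrightarrow> s \<in> carrier R \<Longrightarrow> nu (s \<otimes>\<^bsub>R\<^esub> r) = right_act r (nu s)"
  by (simp add: nu_def right_act_def Th_props D.L.action_left_module D.L.env_action_closed kap_inv)

lemma nu_et: "n \<in> carrier A \<Longrightarrow> nu (L.et \<one>\<^bsub>A\<^esub> n) = n"
  using nu_mult[of "\<one>\<^bsub>R\<^esub>" "\<one>\<^bsub>A\<^esub>" n] alg_homD(4)[OF nak(1)] by (simp add: nu_one)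

lemma right_act_et:
  assumes "n \<in> carrier A" "x \<in> carrier A" "y \<in> carrier A"
  shows "right_act (L.et x y) n = y \<otimes>\<^bsub>A\<^esub> n \<otimes>\<^bsub>A\<^esub> nak x"
  using assms nu_right_act[of "L.et x y" "L.et \<one>\<^bsub>A\<^esub> n"] nu_mult[of "L.et \<one>\<^bsub>A\<^esub> n" x y] by (simp add: nu_et)

text \<open>A top cocycle of the Koszul resolution is its value at E0, and \<open>nu\<close> of this
  value gives an element of A, with the coboundaries as kernel. On 1 \<otimes> y and x \<otimes> 1
  the transported action is left multiplication by y and right multiplication by
  \<open>nak x\<close>.\<close>

lemma hochschild_3:
  "bimodule_iso A (hochschild_env K A 3) (twisted_bimodule A (restrict nak (carrier A))) \<noteq> {}"
proof -
  obtain Q d' e' where Q: "resolution R (env_module K A) Q d' e'"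
    and ext: "Ext_ring R (env_module K A) 3 =
      quot_mod ((dual_module R (Q 3))\<lparr>carrier := dual_cocycles R (Q, d', e') 3\<rparr>) (dual_coboundaries R (Q, d', e') 3)"
    using Ext_ring_resolution[OF KM.projective_resolution_K L.left_module_env] by metis
  interpret Q: resolution R "env_module K A" Q d' e' by (rule Q)
  have E: "KM.E0 \<in> carrier (KM.KP 3)" by (rule KM.vec_carrier(2)) simp_all
  note ZE = KM.Z_closed[OF _ E]
  obtain h where h: "\<forall>c\<in>Q.Z 3. h c \<in> carrier A" "\<forall>c\<in>Q.Z 3. \<forall>c'\<in>Q.Z 3. h (c \<oplus>\<^bsub>Q.Dm 3\<^esub> c') = h c \<oplus>\<^bsub>A\<^esub> h c'"
    "\<forall>c\<in>Q.Z 3. h c = \<zero>\<^bsub>A\<^esub> \<longleftrightarrow> c \<in> Q.B 3" "\<forall>n\<in>carrier A. \<exists>c\<in>Q.Z 3. h c = n"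
    "\<forall>c\<in>Q.Z 3. \<forall>r\<in>carrier R. h (r \<odot>\<^bsub>Q.Dm 3\<^esub> c) = right_act r (h c)"
  proof (atomize_elim, rule cohomology_transfer[OF KM.K.resolution_axioms Q A.M.abelian_group_axioms,
        where h = "\<lambda>c. nu (c KM.E0)" and act = right_act])
    show "nu (c KM.E0) \<in> carrier A" if "c \<in> KM.K.Z 3" for c
      using ZE[OF that] by (rule nu_closed)
    show "nu ((c \<oplus>\<^bsub>KM.K.Dm 3\<^esub> c') KM.E0) = nu (c KM.E0) \<oplus>\<^bsub>A\<^esub> nu (c' KM.E0)"
      if "c \<in> KM.K.Z 3" "c' \<in> KM.K.Z 3" for c c'
      unfolding KM.K.dual_add_apply[OF E] by (rule nu_add[OF ZE[OF that(1)] ZE[OF that(2)]])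
    show "nu (c KM.E0) = \<zero>\<^bsub>A\<^esub> \<longleftrightarrow> c \<in> KM.K.B 3" if "c \<in> KM.K.Z 3" for c
      using KM.dual_coboundary_3[OF that] nu_kernel[OF ZE[OF that]] by simp
    show "\<exists>c\<in>KM.K.Z 3. nu (c KM.E0) = n" if n: "n \<in> carrier A" for n
    proof (intro bexI)
      \<comment> \<open>The index [] is w0, so this functional takes the value 1 \<otimes> n at E0,
        which \<open>nu\<close> sends to n.\<close>
      show "restrict (\<lambda>v. v [] \<otimes>\<^bsub>R\<^esub> L.et \<one>\<^bsub>A\<^esub> n) (carrier (KM.KP 3)) \<in> KM.K.Z 3"
        using n by (intro KM.dual_cocycle_3 KM.coordinate_hom) simp
      show "nu (restrict (\<lambda>v. v [] \<otimes>\<^bsub>R\<^esub> L.et \<one>\<^bsub>A\<^esub> n) (carrier (KM.KP 3)) KM.E0) = n"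
        unfolding restrict_apply'[OF E] using n by (simp add: nu_et)
    qed
    show "nu ((r \<odot>\<^bsub>KM.K.Dm 3\<^esub> c) KM.E0) = right_act r (nu (c KM.E0))"
      if "c \<in> KM.K.Z 3" "r \<in> carrier R" for c r
      unfolding KM.K.dual_add_apply[OF E] by (rule nu_right_act[OF that(2) ZE[OF that(1)]])
  qed
  let ?H = "quot_mod (Q.ZM 3) (Q.B 3)"
  have "\<exists>F\<in>iso (add_monoid ?H) (add_monoid A). \<forall>r\<in>carrier R. \<forall>X\<in>carrier ?H. F (r \<odot>\<^bsub>?H\<^esub> X) = right_act r (F X)"
  proof (rule quot_mod_iso[OF Q.abelian_group_Z A.M.abelian_group_axioms, where h = h])
    show "Q.B 3 = {c \<in> carrier (Q.ZM 3). h c = \<zero>\<^bsub>A\<^esub>}" using h(3) Q.B_subset_Z by auto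
  qed (use h Q.Z_rmult in simp_all)
  then obtain F where F: "F \<in> iso (add_monoid ?H) (add_monoid A)"
    "\<And>r X. r \<in> carrier R \<Longrightarrow> X \<in> carrier ?H \<Longrightarrow> F (r \<odot>\<^bsub>?H\<^esub> X) = right_act r (F X)" by blast
  have Fc: "F X \<in> carrier A" if "X \<in> carrier ?H" for X using F(1) that by (auto simp: iso_def hom_def)
  have "F \<in> bimodule_iso A (hochschild_env K A 3) (twisted_bimodule A (restrict nak (carrier A)))"
    using F(1) alg_homD(1,4)[OF nak(1)]
    by (simp add: bimodule_iso_def hochschild_env_def bimodule_of_right_env_def twisted_bimodule_def ext
        iso_def hom_def F(2) Fc right_act_et)
  then show ?thesis by blast
qed

text \<open>The torus element with inverse weights is the inverse map; the restriction is needed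
  because automorphisms are extensional.\<close>

lemma nakayama_auto: "restrict nak (carrier A) \<in> alg_auto K A"
proof -
  note h = alg_homD[OF nak(1)]
  have "bij_betw nak (carrier A) (carrier A)"
    by (rule bij_betwI[where g = nak']) (auto simp: h nak_inv alg_homD(1)[OF nak'(1)])
  then have "bij_betw (restrict nak (carrier A)) (carrier A) (carrier A)"
    by (simp cong: bij_betw_cong)
  then show ?thesis
    by (simp add: alg_auto_def ring_iso_def ring_hom_def h Pi_iff)
qed

lemma twisted_CY: "twisted_calabi_yau K A 3 (restrict nak (carrier A))"
  unfolding twisted_calabi_yau_def
  using A.assoc_algebra_axioms nakayama_auto smooth_A hochschild_trivial hochschild_3 by blast

end

theorem theorem6p13:
  fixes K :: "('k, 'x) ring_scheme" and p q :: 'k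
  assumes "field K" and "p \<in> Units K" and "q \<in> Units K"
  defines "A \<equiv> O_SL2 K p q" and "gen \<equiv> O_SL2_gen K p q"
  shows "\<exists>\<mu>. \<mu> (gen Ga) = inv\<^bsub>K\<^esub> (p \<otimes>\<^bsub>K\<^esub> q) \<odot>\<^bsub>A\<^esub> gen Ga \<and>
             \<mu> (gen Gb) = gen Gb \<and>
             \<mu> (gen Gc) = gen Gc \<and>
             \<mu> (gen Gd) = (p \<otimes>\<^bsub>K\<^esub> q) \<odot>\<^bsub>A\<^esub> gen Gd \<and>
             twisted_calabi_yau K A 3 \<mu>"
proof -
  interpret K: field K by fact
  have "qsl2_dual K p q (inv\<^bsub>K\<^esub> p) (inv\<^bsub>K\<^esub> q)"
    using assms(1-3)
    by (simp add: qsl2_dual_def qsl2_def qsl2_axioms_def quantum_sl2_def quantum_sl2_axioms_def)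
  then interpret qsl2_dual K p q "inv\<^bsub>K\<^esub> p" "inv\<^bsub>K\<^esub> q" .
  have "inv\<^bsub>K\<^esub> (p \<otimes>\<^bsub>K\<^esub> q) = inv\<^bsub>K\<^esub> p \<otimes>\<^bsub>K\<^esub> inv\<^bsub>K\<^esub> q"
    using weights_nak(1) by (intro K.comm_inv_char) (auto simp: L.weights_def K.m_comm)
  then show ?thesis
    unfolding A_def gen_def using twisted_CY
    by (intro exI[of _ "restrict nak (carrier (O_SL2 K p q))"]) (simp add: nak)
qed

end
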